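(* Let $\lambda>1$ and $\kappa>0$. For any $p\ge1$, $\chi>0$ and $L>0$, there exists a pair $(\nu,\theta)$, with $\nu>0$ and $\theta\in\ell^2$, $\|\theta\|_{\ell^2}=1$, satisfying the following property: for any $X(0)\in\ell^2$ with $\|X(0)\|_{\ell^2}\le L$, there exists a random constant $C>0$ with finite $p$-th moment such that for the solution $X(t)$ of $$dX=B(X)\,dt+\kappa SX\,dt+\sqrt{2\nu}\sum_i\lambda^i\sum_{j=1}^\infty\theta_jA_{i,i+j}X\circ dW_{i,j}$$ with initial condition $X(0)$, one has, $\mathbb P$-a.s., for any $t\ge0$, $$\|X(t)\|_{\ell^2}\le C\,e^{-\chi t}\|X(0)\|_{\ell^2}.$$
   Context: $\ell^2$ is the space of square summable real sequences $x=(x_n)_{n\ge1}$, with the convention $x_0=0$; $\|x\|_{H^1}=(\sum_n\lambda^{2n}x_n^2)^{1/2}$. $B(X)=B(X,X)$ with $B(X,Y)_n=\lambda^{n-1}X_{n-1}Y_{n-1}-\lambda^nX_nY_{n+1}$. $S=-\mathrm{diag}(\lambda^2,\lambda^4,\ldots)$. For $1\le i<k$, $A_{i,k}$ is the infinite skew-symmetric matrix whose only nonzero entries are $-1$ at $(i,k)$ and $1$ at $(k,i)$. $\{W_{i,j}\}_{i,j\ge1}$ are independent real Brownian motions on a filtered probability space $(\Omega,\mathcal F,\mathcal F_t,\mathbb P)$ and $\circ\,dW$ denotes Stratonovich differential. In It\^o form the equation is $$dX=B(X)\,dt+\kappa SX\,dt+\sqrt{2\nu}\sum_i\lambda^i\sum_{j=1}^\infty\theta_jA_{i,i+j}X\,dW_{i,j}+\nu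 S_\theta X\,dt,$$ where $S_\theta$ is the diagonal matrix with $n$-th entry $-\big(\lambda^{2n}+\sum_{j=1}^{n-1}\theta_j^2\lambda^{2(n-j)}\big)$. "The solution" is the pathwise unique, probabilistically strong, Leray--Hopf type solution: an adapted $\ell^2$-valued process with paths in $L^\infty(0,T;\ell^2)\cap L^2(0,T;H^1)$ for all $T>0$, satisfying the It\^o equation componentwise and the energy equality: $\mathbb P$-a.s., for all $0\le s<t$, $\|X(t)\|_{\ell^2}^2+2\kappa\int_s^t\|X(r)\|_{H^1}^2\,dr=\|X(s)\|_{\ell^2}^2$. *)

theory Defs
  imports "HOL-Probability.Probability"
begin

section \<open>Sequence spaces\<close>

text \<open>
  A real sequence $(x_n)_{n \ge 1}$ is a function on \<^typ>\<open>nat\<close> with \<open>x 0 = 0\<close>,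
  which is the convention $x_0 = 0$; hence sums over all of \<^typ>\<open>nat\<close> are sums over $n \ge 1$.
\<close>

definition ell2 :: "(nat \<Rightarrow> real) set" where
  "ell2 = {x. x 0 = 0 \<and> summable (\<lambda>n. (x n)\<^sup>2)}"

definition ell2_norm :: "(nat \<Rightarrow> real) \<Rightarrow> real" where
  "ell2_norm x = sqrt (\<Sum>n. (x n)\<^sup>2)"

definition h1 :: "real \<Rightarrow> (nat \<Rightarrow> real) set" where
  "h1 lam = {x. x 0 = 0 \<and> summable (\<lambda>n. lam ^ (2 * n) * (x n)\<^sup>2)}"

definition h1_norm :: "real \<Rightarrow> (nat \<Rightarrow> real) \<Rightarrow> real" where
  "h1_norm lam x = sqrt (\<Sum>n. lam ^ (2 * n) * (x n)\<^sup>2)"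

text \<open>
  Measurability of sequence-valued maps is componentwise, here and for adaptedness below: the
  coordinates generate the Borel sets of the separable space $\ell^2$.
\<close>

definition path_measurable :: "real \<Rightarrow> (real \<Rightarrow> nat \<Rightarrow> real) \<Rightarrow> bool" where
  "path_measurable T x \<longleftrightarrow> (\<forall>n. set_borel_measurable lborel {0..T} (\<lambda>t. x t n))"

definition Linf_ell2 :: "real \<Rightarrow> (real \<Rightarrow> nat \<Rightarrow> real) set" where
  "Linf_ell2 T = {x. path_measurable T x \<and>
     (\<exists>K. AE t in lborel. t \<in> {0..T} \<longrightarrow> x t \<in> ell2 \<and> ell2_norm (x t) \<le> K)}"

definition L2_H1 :: "real \<Rightarrow> real \<Rightarrow> (real \<Rightarrow> nat \<Rightarrow> real) set" where
  "L2_H1 lam T = {x. path_measurable T x \<and>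
     (AE t in lborel. t \<in> {0..T} \<longrightarrow> x t \<in> h1 lam) \<and>
     set_integrable lborel {0..T} (\<lambda>t. (h1_norm lam (x t))\<^sup>2)}"

section \<open>Coefficients of the equation\<close>

definition B_op :: "real \<Rightarrow> (nat \<Rightarrow> real) \<Rightarrow> (nat \<Rightarrow> real) \<Rightarrow> nat \<Rightarrow> real" where
  "B_op lam x y n = lam ^ (n - 1) * x (n - 1) * y (n - 1) - lam ^ n * x n * y (n + 1)"

definition S_op :: "real \<Rightarrow> (nat \<Rightarrow> real) \<Rightarrow> nat \<Rightarrow> real" where
  "S_op lam x n = - (lam ^ (2 * n)) * x n"

definition S_theta :: "real \<Rightarrow> (nat \<Rightarrow> real) \<Rightarrow> (nat \<Rightarrow> real) \<Rightarrow> nat \<Rightarrow> real" where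
  "S_theta lam \<theta> x n =
     - (lam ^ (2 * n) + (\<Sum>j = 1..<n. (\<theta> j)\<^sup>2 * lam ^ (2 * (n - j)))) * x n"

definition A_mat :: "nat \<Rightarrow> nat \<Rightarrow> nat \<Rightarrow> nat \<Rightarrow> real" where
  "A_mat i k m l = (if m = i \<and> l = k then - 1 else if m = k \<and> l = i then 1 else 0)"

definition mat_app :: "(nat \<Rightarrow> nat \<Rightarrow> real) \<Rightarrow> (nat \<Rightarrow> real) \<Rightarrow> nat \<Rightarrow> real" where
  "mat_app Q x m = (\<Sum>l. Q m l * x l)"

section \<open>Brownian motions\<close>

text \<open>
  Time is \<^typ>\<open>real\<close>; only $t \ge 0$ is used. The values of \<open>F\<close> at negative times are
  immaterial sub-\<open>\<sigma>\<close>-algebras of \<open>F 0\<close>.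
\<close>

locale filtered_prob_space = prob_space M + filtration "space M" F
  for M :: "'a measure" and F :: "real \<Rightarrow> 'a measure" +
  assumes subalgebra_F: "\<And>t. 0 \<le> t \<Longrightarrow> subalgebra M (F t)"

definition brownian_motion ::
  "'a measure \<Rightarrow> (real \<Rightarrow> 'a measure) \<Rightarrow> (real \<Rightarrow> 'a \<Rightarrow> real) \<Rightarrow> bool" where
  "brownian_motion M F W \<longleftrightarrow>
     (\<forall>t\<ge>0. W t \<in> borel_measurable (F t)) \<and>
     (AE \<omega> in M. W 0 \<omega> = 0) \<and>
     (AE \<omega> in M. continuous_on {0..} (\<lambda>t. W t \<omega>)) \<and>
     (\<forall>s t. 0 \<le> s \<and> s < t \<longrightarrow>
        distributed M lborel (\<lambda>\<omega>. W t \<omega> - W s \<omega>) (normal_density 0 (sqrt (t - s))) \<and>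
        prob_space.indep_set M (sets (F s))
          (sets (vimage_algebra (space M) (\<lambda>\<omega>. W t \<omega> - W s \<omega>) borel)))"

definition independent_brownian_motions ::
  "'a measure \<Rightarrow> (real \<Rightarrow> 'a measure) \<Rightarrow> (nat \<Rightarrow> nat \<Rightarrow> real \<Rightarrow> 'a \<Rightarrow> real) \<Rightarrow> bool" where
  "independent_brownian_motions M F W \<longleftrightarrow>
     (\<forall>i\<ge>1. \<forall>j\<ge>1. brownian_motion M F (W i j)) \<and>
     prob_space.indep_vars M (\<lambda>_. PiM {0..} (\<lambda>_. borel))
       (\<lambda>(i, j) \<omega>. \<lambda>t\<in>{0..}. W i j t \<omega>) ({1..} \<times> {1..})"

section \<open>The Ito integral\<close>

text \<open>
  Convergence to zero in probability. It is phrased through measurable supersets because the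
  filtration is not assumed to be complete, so that the sets in question may be measurable only up
  to null sets, and \<^const>\<open>measure\<close> vanishes on non-measurable sets.
\<close>

definition vanishes_in_prob :: "'a measure \<Rightarrow> (nat \<Rightarrow> 'a \<Rightarrow> ennreal) \<Rightarrow> bool" where
  "vanishes_in_prob M Z \<longleftrightarrow>
     (\<forall>\<epsilon>>0. \<forall>\<delta>>0. \<forall>\<^sub>F m in sequentially.
        \<exists>E\<in>sets M. measure M E < \<delta> \<and> {\<omega> \<in> space M. ennreal \<epsilon> \<le> Z m \<omega>} \<subseteq> E)"

definition tendsto_in_prob ::
  "'a measure \<Rightarrow> (nat \<Rightarrow> 'a \<Rightarrow> real) \<Rightarrow> ('a \<Rightarrow> real) \<Rightarrow> bool" where
  "tendsto_in_prob M f g \<longleftrightarrow> vanishes_in_prob M (\<lambda>m \<omega>. ennreal \<bar>f m \<omega> - g \<omega>\<bar>)"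

definition sums_in_prob ::
  "'a measure \<Rightarrow> (nat \<Rightarrow> 'a \<Rightarrow> real) \<Rightarrow> ('a \<Rightarrow> real) \<Rightarrow> bool" where
  "sums_in_prob M f g \<longleftrightarrow> tendsto_in_prob M (\<lambda>m \<omega>. \<Sum>k = 1..m. f k \<omega>) g"

text \<open>
  \<open>(m, \<tau>, \<xi>)\<close> encodes the simple process
  $\sum_{k<m} \xi_k 1_{(\tau_k, \tau_{k+1}]}$ with bounded, $F_{\tau_k}$-measurable $\xi_k$.
\<close>

type_synonym 'a simple_proc = "nat \<times> (nat \<Rightarrow> real) \<times> (nat \<Rightarrow> 'a \<Rightarrow> real)"

definition simple_proc ::
  "'a measure \<Rightarrow> (real \<Rightarrow> 'a measure) \<Rightarrow> 'a simple_proc \<Rightarrow> bool" where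
  "simple_proc M F = (\<lambda>(m, \<tau>, \<xi>). 0 \<le> \<tau> 0 \<and>
     (\<forall>k<m. \<tau> k < \<tau> (Suc k) \<and> \<xi> k \<in> borel_measurable (F (\<tau> k)) \<and>
        (\<exists>K. \<forall>\<omega>\<in>space M. \<bar>\<xi> k \<omega>\<bar> \<le> K)))"

definition simple_val :: "'a simple_proc \<Rightarrow> real \<Rightarrow> 'a \<Rightarrow> real" where
  "simple_val = (\<lambda>(m, \<tau>, \<xi>) t \<omega>. \<Sum>k<m. \<xi> k \<omega> * indicator {\<tau> k<..\<tau> (Suc k)} t)"

definition simple_integral ::
  "(real \<Rightarrow> 'a \<Rightarrow> real) \<Rightarrow> 'a simple_proc \<Rightarrow> real \<Rightarrow> 'a \<Rightarrow> real" where
  "simple_integral W = (\<lambda>(m, \<tau>, \<xi>) t \<omega>.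
     \<Sum>k<m. \<xi> k \<omega> * (W (min t (\<tau> (Suc k))) \<omega> - W (min t (\<tau> k)) \<omega>))"

text \<open>
  \<open>ito_integral M F W H I\<close>: the process \<open>I\<close> is a continuous version of
  $\int_0^\cdot H\,dW$, by the usual extension from simple processes. The relation determines
  \<open>I\<close> up to indistinguishability and does not depend on the approximating sequence.
\<close>

definition ito_integral ::
  "'a measure \<Rightarrow> (real \<Rightarrow> 'a measure) \<Rightarrow> (real \<Rightarrow> 'a \<Rightarrow> real) \<Rightarrow>
   (real \<Rightarrow> 'a \<Rightarrow> real) \<Rightarrow> (real \<Rightarrow> 'a \<Rightarrow> real) \<Rightarrow> bool" where
  "ito_integral M F W H I \<longleftrightarrow>
     (AE \<omega> in M. \<forall>T>0. set_borel_measurable lborel {0..T} (\<lambda>s. H s \<omega>)) \<and>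
     (\<forall>t\<ge>0. I t \<in> borel_measurable M) \<and>
     (AE \<omega> in M. continuous_on {0..} (\<lambda>t. I t \<omega>)) \<and>
     (\<exists>P. (\<forall>k. simple_proc M F (P k)) \<and>
        (\<forall>T>0. vanishes_in_prob M
           (\<lambda>k \<omega>. \<integral>\<^sup>+s\<in>{0..T}. ennreal ((simple_val (P k) s \<omega> - H s \<omega>)\<^sup>2) \<partial>lborel)) \<and>
        (\<forall>t\<ge>0. tendsto_in_prob M (\<lambda>k. simple_integral W (P k) t) (I t)))"

section \<open>Solutions\<close>

text \<open>
  \<open>N\<close> is a continuous version of the \<open>n\<close>-th component
  $\sum_i \lambda^i \sum_j \theta_j \int_0^\cdot (A_{i,i+j} X)_n\,dW_{i,j}$ of the noise, without the
  factor $\sqrt{2\nu}$. The series converge in probability at each time. For fixed \<open>n\<close> only the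
  terms with $i = n$ or $i + j = n$ are nonzero.
\<close>

definition noise_component ::
  "real \<Rightarrow> (nat \<Rightarrow> real) \<Rightarrow> 'a measure \<Rightarrow> (real \<Rightarrow> 'a measure) \<Rightarrow>
   (nat \<Rightarrow> nat \<Rightarrow> real \<Rightarrow> 'a \<Rightarrow> real) \<Rightarrow> (real \<Rightarrow> 'a \<Rightarrow> nat \<Rightarrow> real) \<Rightarrow> nat \<Rightarrow>
   (real \<Rightarrow> 'a \<Rightarrow> real) \<Rightarrow> bool" where
  "noise_component lam \<theta> M F W X n N \<longleftrightarrow>
     (AE \<omega> in M. continuous_on {0..} (\<lambda>t. N t \<omega>)) \<and>
     (\<exists>I J.
        (\<forall>i\<ge>1. \<forall>j\<ge>1.
           ito_integral M F (W i j) (\<lambda>t \<omega>. mat_app (A_mat i (i + j)) (X t \<omega>) n) (I i j)) \<and>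
        (\<forall>i\<ge>1. \<forall>t\<ge>0. sums_in_prob M (\<lambda>j \<omega>. \<theta> j * I i j t \<omega>) (J i t)) \<and>
        (\<forall>t\<ge>0. sums_in_prob M (\<lambda>i \<omega>. lam ^ i * J i t \<omega>) (N t)))"

text \<open>
  The Stratonovich equation is understood through its Ito form, whose correction term is
  $\nu S_\theta X\,dt$.
\<close>

definition leray_hopf_solution ::
  "real \<Rightarrow> real \<Rightarrow> real \<Rightarrow> (nat \<Rightarrow> real) \<Rightarrow> 'a measure \<Rightarrow> (real \<Rightarrow> 'a measure) \<Rightarrow>
   (nat \<Rightarrow> nat \<Rightarrow> real \<Rightarrow> 'a \<Rightarrow> real) \<Rightarrow> (nat \<Rightarrow> real) \<Rightarrow>
   (real \<Rightarrow> 'a \<Rightarrow> nat \<Rightarrow> real) \<Rightarrow> bool" where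
  "leray_hopf_solution lam \<kappa> \<nu> \<theta> M F W x0 X \<longleftrightarrow>
     (\<forall>t\<ge>0. \<forall>\<omega>\<in>space M. X t \<omega> \<in> ell2) \<and>
     (\<forall>t\<ge>0. \<forall>n. (\<lambda>\<omega>. X t \<omega> n) \<in> borel_measurable (F t)) \<and>
     (AE \<omega> in M. X 0 \<omega> = x0) \<and>
     (AE \<omega> in M. \<forall>T>0. (\<lambda>t. X t \<omega>) \<in> Linf_ell2 T \<inter> L2_H1 lam T) \<and>
     (\<forall>n\<ge>1. \<exists>N. noise_component lam \<theta> M F W X n N \<and>
        (AE \<omega> in M. \<forall>t\<ge>0. X t \<omega> n = X 0 \<omega> n +
           (LBINT r:{0..t}. B_op lam (X r \<omega>) (X r \<omega>) n + \<kappa> * S_op lam (X r \<omega>) n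
              + \<nu> * S_theta lam \<theta> (X r \<omega>) n) +
           sqrt (2 * \<nu>) * N t \<omega>)) \<and>
     (AE \<omega> in M. \<forall>s t. 0 \<le> s \<and> s < t \<longrightarrow>
        (ell2_norm (X t \<omega>))\<^sup>2 + 2 * \<kappa> * (LBINT r:{s..t}. (h1_norm lam (X r \<omega>))\<^sup>2)
          = (ell2_norm (X s \<omega>))\<^sup>2)"

end

theory Submission
  imports Defs
begin

text \<open>
  Take $\theta_j^2 = 1/N$ for $1 \le j \le N$. The noise moves energy out of the modes $n \le m$ at
  a rate proportional to $\nu$ and spreads it over about $N$ modes, where the viscosity dissipates it
  before it can return. Hence, for suitable \<open>m\<close>, then $\nu$, then \<open>N\<close>, the quantity
  $G(t) = E[\|X(t)\|^2 + \sum_{n \le m} X_n(t)^2]$ satisfies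
  $G(t) \le G(s) - K \int_s^t G$, and $E\|X(k)\|^2$ decays geometrically with any prescribed ratio.
  The energy equality makes $\|X\|$ decreasing, so a sum over integer times bounds the supremum of
  $e^{\chi t} \|X(t)\|$ and has finite moments. The constant obtained in this way is
  attached to one solution; pathwise uniqueness, from a Gronwall estimate for
  $\sum_n \lambda^{-2n} E[(X_n - Y_n)^2]$, transfers it to all of them. The only stochastic calculus needed
  is the evolution of $E[X_n Y_n]$, which follows from the Ito isometry.
\<close>

section \<open>Brownian increments\<close>

text \<open>The full norm enters \<open>G\<close> through the pathwise energy equality, which
  contains no noise; only finitely many modes enter through moment identities, so no infinite sum of
  stochastic integrals is ever estimated. Each motion has increments independent of the past, but
  this is not known for several motions at once. Orthogonality of integrals against different
  motions therefore has to be recovered from vanishing covariation before any isometry is available.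
  The integral is defined by convergence in probability, so integrands are truncated first; this is
  possible because the energy equality keeps solutions in the ball of radius \<open>L\<close>.
  Second moments give every \<open>p\<close>: the norm divided by its initial value is at most 1,
  hence its power \<open>q = max p 2\<close> is bounded by its square. With
  \<open>K = 2 * exp (q * chi)\<close> the ratio \<open>1 / (1 + K)\<close> beats the weight
  \<open>exp (q * chi)\<close> by a factor below 1/2, which makes the weighted series summable. The
  choice of \<open>N\<close> serves twice: it weakens the return of energy to the low modes, and it
  makes part of the noise small in the uniqueness estimate.\<close>

lemma (in prob_space) indep_set_imp_indep_var:
  fixes X :: "'a \<Rightarrow> real" and Y :: "'a \<Rightarrow> real"
  assumes sub: "subalgebra M G" and X: "X \<in> borel_measurable G" and Y: "Y \<in> borel_measurable M"
    and ind: "indep_set (sets G) (sets (vimage_algebra (space M) Y borel))"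
  shows "indep_var borel X borel Y"
proof -
  have spG: "space G = space M" using sub by (simp add: subalgebra_def)
  have XM: "X \<in> borel_measurable M" by (rule measurable_from_subalg[OF sub X])
  have 1: "sigma_sets (space M) {X -` A \<inter> space M |A. A \<in> sets borel} \<subseteq> sets G"
    unfolding spG[symmetric] by (rule sets.sigma_sets_subset) (auto intro: measurable_sets[OF X])
  have 2: "sigma_sets (space M) {Y -` A \<inter> space M |A. A \<in> sets borel}
      = sets (vimage_algebra (space M) Y borel)"
    by (simp add: sets_vimage_algebra)
  have "indep_set (sigma_sets (space M) {X -` A \<inter> space M |A. A \<in> sets borel})
     (sigma_sets (space M) {Y -` A \<inter> space M |A. A \<in> sets borel})"
    using ind 1 unfolding 2 indep_set_def
    by (elim indep_sets_mono) (auto split: bool.split)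
  then show ?thesis unfolding indep_var_eq using XM Y by simp
qed

lemma (in prob_space) integrable_mult_squares:
  fixes f g :: "'a \<Rightarrow> real"
  assumes [measurable]: "f \<in> borel_measurable M" "g \<in> borel_measurable M"
    and "integrable M (\<lambda>\<omega>. (f \<omega>)\<^sup>2)" "integrable M (\<lambda>\<omega>. (g \<omega>)\<^sup>2)"
  shows "integrable M (\<lambda>\<omega>. f \<omega> * g \<omega>)"
proof (rule Bochner_Integration.integrable_bound)
  show "integrable M (\<lambda>\<omega>. (f \<omega>)\<^sup>2 + (g \<omega>)\<^sup>2)" using assms by simp
  have "norm (f \<omega> * g \<omega>) \<le> norm ((f \<omega>)\<^sup>2 + (g \<omega>)\<^sup>2)" for \<omega>
  proof -
    have "2 * \<bar>f \<omega>\<bar> * \<bar>g \<omega>\<bar> \<le> (f \<omega>)\<^sup>2 + (g \<omega>)\<^sup>2"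
      using sum_squares_bound[of "\<bar>f \<omega>\<bar>" "\<bar>g \<omega>\<bar>"] by simp
    moreover have "0 \<le> \<bar>f \<omega>\<bar> * \<bar>g \<omega>\<bar>" by simp
    ultimately have "\<bar>f \<omega>\<bar> * \<bar>g \<omega>\<bar> \<le> (f \<omega>)\<^sup>2 + (g \<omega>)\<^sup>2" by linarith
    then show ?thesis by (simp add: abs_mult)
  qed
  then show "AE \<omega> in M. norm (f \<omega> * g \<omega>) \<le> norm ((f \<omega>)\<^sup>2 + (g \<omega>)\<^sup>2)" by simp
qed measurable

lemma (in prob_space) integrable_bounded_mult:
  fixes f g :: "'a \<Rightarrow> real"
  assumes [measurable]: "f \<in> borel_measurable M" and g: "integrable M g"
    and f: "AE \<omega> in M. \<bar>f \<omega>\<bar> \<le> K"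
  shows "integrable M (\<lambda>\<omega>. f \<omega> * g \<omega>)"
proof (rule Bochner_Integration.integrable_bound)
  show "integrable M (\<lambda>\<omega>. K * g \<omega>)" using g by simp
  show "AE \<omega> in M. norm (f \<omega> * g \<omega>) \<le> norm (K * g \<omega>)"
    using f by eventually_elim (auto simp: abs_mult intro!: mult_right_mono)
  show "(\<lambda>\<omega>. f \<omega> * g \<omega>) \<in> borel_measurable M" using g by measurable
qed

locale driven_space = filtered_prob_space M F
  for M :: "'a measure" and F :: "real \<Rightarrow> 'a measure" +
  fixes W :: "nat \<Rightarrow> nat \<Rightarrow> real \<Rightarrow> 'a \<Rightarrow> real"
  assumes BMs: "independent_brownian_motions M F W"
begin

text \<open>Pairs start at 1 because the motions are given for positive indices only; nothing is
  assumed about \<open>W 0 j\<close> or \<open>W i 0\<close>.\<close>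

definition labels :: "(nat \<times> nat) set" where "labels = {1..} \<times> {1..}"

abbreviation V :: "nat \<times> nat \<Rightarrow> real \<Rightarrow> 'a \<Rightarrow> real" where "V c \<equiv> W (fst c) (snd c)"

lemma borel_measurable_mono_F:
  assumes "f \<in> borel_measurable (F s)" "s \<le> t" shows "f \<in> borel_measurable (F t)"
  by (rule measurable_from_subalg[OF _ assms(1)])
     (simp add: subalgebra_def space_F sets_F_mono[OF assms(2)])

lemma borel_measurable_F_M:
  assumes "f \<in> borel_measurable (F s)" "0 \<le> s" shows "f \<in> borel_measurable M"
  using measurable_from_subalg[OF subalgebra_F] assms by blast

lemma brownian: "c \<in> labels \<Longrightarrow> brownian_motion M F (V c)"
  using BMs by (auto simp: independent_brownian_motions_def labels_def)

lemma V_measurable_F: "c \<in> labels \<Longrightarrow> 0 \<le> s \<Longrightarrow> s \<le> t \<Longrightarrow> V c s \<in> borel_measurable (F t)"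
  using brownian[of c] borel_measurable_mono_F unfolding brownian_motion_def by blast

lemma V_measurable: "c \<in> labels \<Longrightarrow> 0 \<le> t \<Longrightarrow> V c t \<in> borel_measurable M"
  using V_measurable_F[of c t t] borel_measurable_F_M by blast

section \<open>Increments of one motion: moments and independence of the past\<close>

definition incr :: "nat \<times> nat \<Rightarrow> real \<Rightarrow> real \<Rightarrow> 'a \<Rightarrow> real" where
  "incr c s t \<omega> = V c t \<omega> - V c s \<omega>"

lemma incr_self [simp]: "incr c s s \<omega> = 0" by (simp add: incr_def)

lemma incr_measurable: "c \<in> labels \<Longrightarrow> 0 \<le> s \<Longrightarrow> 0 \<le> t \<Longrightarrow> incr c s t \<in> borel_measurable M"
  unfolding incr_def[abs_def] by (intro borel_measurable_diff V_measurable)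

lemma incr_measurable_F:
  "c \<in> labels \<Longrightarrow> 0 \<le> s \<Longrightarrow> s \<le> t \<Longrightarrow> t \<le> u \<Longrightarrow> incr c s t \<in> borel_measurable (F u)"
  unfolding incr_def[abs_def] by (intro borel_measurable_diff V_measurable_F) auto

lemma incr_distributed:
  "c \<in> labels \<Longrightarrow> 0 \<le> s \<Longrightarrow> s < t \<Longrightarrow> distributed M lborel (incr c s t) (normal_density 0 (sqrt (t - s)))"
  using brownian[of c] unfolding brownian_motion_def incr_def[abs_def] by blast

lemma incr_moments:
  assumes c: "c \<in> labels" and st: "0 \<le> s" "s \<le> t"
  shows integrable_incr: "integrable M (incr c s t)"
    and integrable_incr_sq: "integrable M (\<lambda>\<omega>. (incr c s t \<omega>)\<^sup>2)"
    and expectation_incr: "expectation (incr c s t) = 0"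
    and expectation_incr_sq: "expectation (\<lambda>\<omega>. (incr c s t \<omega>)\<^sup>2) = t - s"
proof -
  have *: "integrable M (incr c s t) \<and> integrable M (\<lambda>\<omega>. (incr c s t \<omega>)\<^sup>2) \<and>
     expectation (incr c s t) = 0 \<and> expectation (\<lambda>\<omega>. (incr c s t \<omega>)\<^sup>2) = t - s"
  \<comment> \<open>The law is prescribed for \<open>s < t\<close> only; the zero increment has no
    density and is treated by hand.\<close>
  proof (cases "s = t")
    case False
    then have lt: "s < t" using st by simp
    note D = incr_distributed[OF c st(1) lt]
    have pos: "0 < sqrt (t - s)" using lt by simp
    have E: "expectation (incr c s t) = 0" by (rule normal_distributed_expectation[OF pos D])
    moreover have "expectation (\<lambda>\<omega>. (incr c s t \<omega>)\<^sup>2) = t - s"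
      using normal_distributed_variance[OF pos D] E lt by simp
    moreover have "integrable M (incr c s t)"
      using distributed_integrable[OF D, of "\<lambda>x. x"] integrable_normal_moment[OF pos, of 0 1] by simp
    moreover have "integrable M (\<lambda>\<omega>. (incr c s t \<omega>)\<^sup>2)"
      using distributed_integrable[OF D, of "\<lambda>x. x\<^sup>2"] integrable_normal_moment[OF pos, of 0 2] by simp
    ultimately show ?thesis by simp
  qed (simp add: incr_def[abs_def])
  then show "integrable M (incr c s t)" "integrable M (\<lambda>\<omega>. (incr c s t \<omega>)\<^sup>2)"
     "expectation (incr c s t) = 0" "expectation (\<lambda>\<omega>. (incr c s t \<omega>)\<^sup>2) = t - s" by auto
qed

lemma incr_indep_past:
  assumes c: "c \<in> labels" and st: "0 \<le> s" "s < t" and \<eta>: "\<eta> \<in> borel_measurable (F s)"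
  shows "indep_var borel \<eta> borel (incr c s t)"
proof (rule indep_set_imp_indep_var[OF subalgebra_F[OF st(1)] \<eta> incr_measurable[OF c]])
  show "indep_set (sets (F s)) (sets (vimage_algebra (space M) (incr c s t) borel))"
    using brownian[OF c] st unfolding brownian_motion_def incr_def[abs_def] by blast
qed (use st in auto)

text \<open>Independence factorises the expectation, so the martingale identities are stated with a
  factor \<eta> from the past instead of a conditional expectation.\<close>

lemma past_mult_incr:
  assumes c: "c \<in> labels" and st: "0 \<le> s" "s \<le> t" and \<eta>: "\<eta> \<in> borel_measurable (F s)"
    and i: "integrable M \<eta>"
  shows expectation_past_incr: "expectation (\<lambda>\<omega>. \<eta> \<omega> * incr c s t \<omega>) = 0"
    and expectation_past_incr_sq: "expectation (\<lambda>\<omega>. \<eta> \<omega> * (incr c s t \<omega>)\<^sup>2) = expectation \<eta> * (t - s)"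
proof -
  have "expectation (\<lambda>\<omega>. \<eta> \<omega> * incr c s t \<omega>) = 0 \<and>
    expectation (\<lambda>\<omega>. \<eta> \<omega> * (incr c s t \<omega>)\<^sup>2) = expectation \<eta> * (t - s)"
  proof (cases "s = t")
    case False
    then have lt: "s < t" using st by simp
    note I = incr_indep_past[OF c st(1) lt \<eta>]
    have I2: "indep_var borel \<eta> borel (\<lambda>\<omega>. (incr c s t \<omega>)\<^sup>2)"
      using indep_var_compose[OF I, of "\<lambda>x. x" borel "\<lambda>x. x\<^sup>2" borel] by (simp add: comp_def)
    show ?thesis
      using indep_var_lebesgue_integral[OF I i integrable_incr[OF c st]]
        indep_var_lebesgue_integral[OF I2 i integrable_incr_sq[OF c st]]
      by (simp add: expectation_incr[OF c st] expectation_incr_sq[OF c st])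
  qed simp
  then show "expectation (\<lambda>\<omega>. \<eta> \<omega> * incr c s t \<omega>) = 0"
    "expectation (\<lambda>\<omega>. \<eta> \<omega> * (incr c s t \<omega>)\<^sup>2) = expectation \<eta> * (t - s)" by auto
qed

lemma integrable_incr_mult:
  "c \<in> labels \<Longrightarrow> c' \<in> labels \<Longrightarrow> 0 \<le> s \<Longrightarrow> s \<le> t \<Longrightarrow> 0 \<le> u \<Longrightarrow> u \<le> v \<Longrightarrow>
   integrable M (\<lambda>\<omega>. incr c s t \<omega> * incr c' u v \<omega>)"
  by (intro integrable_mult_squares integrable_incr_sq incr_measurable) auto

text \<open>The earlier increment is known at time \<open>u\<close> and joins \<eta> as past factor
  for the later one. Only the motion \<open>c'\<close> has to be independent of the past here, so
  the two labels may agree or differ.\<close>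

lemma expectation_incr_disjoint:
  assumes c: "c \<in> labels" "c' \<in> labels" and st: "0 \<le> s" "s \<le> t" "t \<le> u" "u \<le> v"
    and \<eta>: "\<eta> \<in> borel_measurable (F u)" "\<And>\<omega>. \<omega> \<in> space M \<Longrightarrow> \<bar>\<eta> \<omega>\<bar> \<le> K"
  shows "expectation (\<lambda>\<omega>. \<eta> \<omega> * (incr c s t \<omega> * incr c' u v \<omega>)) = 0"
proof -
  have "integrable M (\<lambda>\<omega>. \<eta> \<omega> * incr c s t \<omega>)"
    using \<eta> st c by (intro integrable_bounded_mult[where K=K] integrable_incr borel_measurable_F_M[OF \<eta>(1)]) auto
  moreover have "(\<lambda>\<omega>. \<eta> \<omega> * incr c s t \<omega>) \<in> borel_measurable (F u)"
    using \<eta> st c by (intro borel_measurable_times incr_measurable_F) auto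
  ultimately show ?thesis
    using expectation_past_incr[OF c(2), of u v "\<lambda>\<omega>. \<eta> \<omega> * incr c s t \<omega>"] st by (simp add: mult.assoc)
qed

text \<open>This is the only point where the joint independence of the family of motions enters. It
  is kept at the level of whole paths, so that measurable functions of two different paths are
  independent.\<close>

lemma indep_var_paths:
  assumes "c \<in> labels" "c' \<in> labels" "c \<noteq> c'"
  shows "indep_var (PiM {0..} (\<lambda>_. borel)) (\<lambda>\<omega>. \<lambda>t\<in>{0..}. V c t \<omega>)
                   (PiM {0..} (\<lambda>_. borel)) (\<lambda>\<omega>. \<lambda>t\<in>{0..}. V c' t \<omega>)"
proof -
  let ?X = "\<lambda>(i, j) \<omega>. \<lambda>t\<in>{0..}. W i j t \<omega>"
  let ?P = "PiM {0::real..} (\<lambda>_. borel::real measure)"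
  have I: "indep_vars (\<lambda>_. ?P) ?X labels"
    using BMs unfolding independent_brownian_motions_def labels_def by blast
  let ?S = "\<lambda>c. sigma_sets (space M) {(\<lambda>\<omega>. \<lambda>t\<in>{0..}. V c t \<omega>) -` A \<inter> space M |A. A \<in> sets ?P}"
  have eq: "?X d = (\<lambda>\<omega>. \<lambda>t\<in>{0..}. V d t \<omega>)" for d by (simp add: case_prod_unfold)
  have rv: "(\<lambda>\<omega>. \<lambda>t\<in>{0..}. V d t \<omega>) \<in> measurable M ?P" if "d \<in> labels" for d
    using I that unfolding indep_vars_def eq by auto
  have S: "indep_sets ?S labels" using I unfolding indep_vars_def eq by auto
  have "indep_set (?S c) (?S c')"
  proof (rule indep_setI)
    show "?S c \<subseteq> events" "?S c' \<subseteq> events" using S assms unfolding indep_sets_def by auto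
    fix a b assume ab: "a \<in> ?S c" "b \<in> ?S c'"
    have "prob (\<Inter>j\<in>{c,c'}. (if j = c then a else b)) = (\<Prod>j\<in>{c,c'}. prob (if j = c then a else b))"
      by (rule indep_setsD[OF S]) (use assms ab in auto)
    then show "prob (a \<inter> b) = prob a * prob b" using assms(3) by (simp add: Int_commute)
  qed
  then show ?thesis unfolding indep_var_eq using rv assms by simp
qed

lemma indep_incr_mult:
  assumes c: "c \<in> labels" "c' \<in> labels" "c \<noteq> c'" and t: "0 \<le> s" "0 \<le> t" "0 \<le> u" "0 \<le> v"
  shows "indep_var borel (\<lambda>\<omega>. incr c s t \<omega> * incr c u v \<omega>) borel (\<lambda>\<omega>. incr c' s t \<omega> * incr c' u v \<omega>)"
proof -
  let ?P = "PiM {0::real..} (\<lambda>_. borel::real measure)"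
  let ?g = "\<lambda>w::real\<Rightarrow>real. (w t - w s) * (w v - w u)"
  have g: "?g \<in> borel_measurable ?P"
    using t by (intro borel_measurable_times borel_measurable_diff measurable_component_singleton) auto
  show ?thesis
    using indep_var_compose[OF indep_var_paths[OF c] g g] t by (simp add: comp_def incr_def)
qed

lemma expectation_incr_mult:
  assumes c: "c \<in> labels" and t: "0 \<le> s" "s \<le> t" "t \<le> u" "u \<le> v"
  shows "expectation (\<lambda>\<omega>. incr c s t \<omega> * incr c u v \<omega>) = 0"
  using expectation_incr_disjoint[OF c c t, of "\<lambda>_. 1" 1] by simp

text \<open>
  The increments of each motion are independent of the past, but the past need not be independent
  of the two motions jointly. What is used instead is that the quadratic covariation of two
  independent Brownian motions vanishes.
\<close>

lemma cross_variation_sq: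
  assumes c: "c \<in> labels" "c' \<in> labels" "c \<noteq> c'" and s: "0 \<le> s" "0 \<le> h"
  defines "D \<equiv> \<lambda>i. incr c (s + real i * h) (s + real (Suc i) * h)"
    and "D' \<equiv> \<lambda>i. incr c' (s + real i * h) (s + real (Suc i) * h)"
  shows "integrable M (\<lambda>\<omega>. (\<Sum>i<n. D i \<omega> * D' i \<omega>)\<^sup>2)"
    and "expectation (\<lambda>\<omega>. (\<Sum>i<n. D i \<omega> * D' i \<omega>)\<^sup>2) = real n * h\<^sup>2"
proof -
  have p: "0 \<le> s + real i * h" "s + real i * h \<le> s + real (Suc i) * h" "0 \<le> s + real (Suc i) * h" for i
    using s by (auto simp: algebra_simps add_nonneg_nonneg)
  have q: "s + real (Suc i) * h \<le> s + real j * h" if "i < j" for i j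
    using that s by (intro add_left_mono mult_right_mono) auto
  \<comment> \<open>The four factors are grouped by motion: the two groups are functions of
    different paths, hence independent, and off the diagonal each group has mean 0.\<close>
  let ?T = "\<lambda>i j \<omega>. (D i \<omega> * D j \<omega>) * (D' i \<omega> * D' j \<omega>)"
  have ind: "indep_var borel (\<lambda>\<omega>. D i \<omega> * D j \<omega>) borel (\<lambda>\<omega>. D' i \<omega> * D' j \<omega>)" for i j
    unfolding D_def D'_def by (rule indep_incr_mult[OF c]) (use p in auto)
  have int: "integrable M (\<lambda>\<omega>. D i \<omega> * D j \<omega>)" "integrable M (\<lambda>\<omega>. D' i \<omega> * D' j \<omega>)" for i j
    unfolding D_def D'_def by (rule integrable_incr_mult; use p c in auto)+
  have intT: "integrable M (?T i j)" for i j
    by (rule indep_var_integrable[OF ind int])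
  have E: "expectation (\<lambda>\<omega>. D i \<omega> * D j \<omega>) = (if i = j then h else 0)" for i j
  proof (cases i j rule: linorder_cases)
    case less then show ?thesis unfolding D_def using expectation_incr_mult[OF c(1) p(1,2) q p(2)] by simp
  next
    case equal then show ?thesis unfolding D_def
      using expectation_incr_sq[OF c(1) p(1,2)] by (simp add: power2_eq_square algebra_simps)
  next
    case greater then show ?thesis unfolding D_def
      using expectation_incr_mult[OF c(1) p(1,2)[of j] q[OF greater] p(2)[of i]]
      by (simp add: mult.commute[of "incr c (s + real j * h) _ _"])
  qed
  have E': "expectation (\<lambda>\<omega>. D' i \<omega> * D' j \<omega>) = (if i = j then h else 0)" for i j
  proof (cases i j rule: linorder_cases)
    case less then show ?thesis unfolding D'_def using expectation_incr_mult[OF c(2) p(1,2) q p(2)] by simp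
  next
    case equal then show ?thesis unfolding D'_def
      using expectation_incr_sq[OF c(2) p(1,2)] by (simp add: power2_eq_square algebra_simps)
  next
    case greater then show ?thesis unfolding D'_def
      using expectation_incr_mult[OF c(2) p(1,2)[of j] q[OF greater] p(2)[of i]]
      by (simp add: mult.commute[of "incr c' (s + real j * h) _ _"])
  qed
  have ET: "expectation (?T i j) = (if i = j then h\<^sup>2 else 0)" for i j
    using indep_var_lebesgue_integral[OF ind int] E E' by (simp add: power2_eq_square)
  have eq: "(\<Sum>i<n. D i \<omega> * D' i \<omega>)\<^sup>2 = (\<Sum>i<n. \<Sum>j<n. ?T i j \<omega>)" for \<omega>
    by (simp add: power2_eq_square sum_product mult_ac)
  show "integrable M (\<lambda>\<omega>. (\<Sum>i<n. D i \<omega> * D' i \<omega>)\<^sup>2)"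
    unfolding eq using intT by (intro Bochner_Integration.integrable_sum)
  show "expectation (\<lambda>\<omega>. (\<Sum>i<n. D i \<omega> * D' i \<omega>)\<^sup>2) = real n * h\<^sup>2"
    unfolding eq using intT by (simp add: Bochner_Integration.integral_sum ET)
qed

text \<open>The product is spread over \<open>n\<close> equal subintervals; mixed terms vanish as
  increments over disjoint intervals, so \<eta> is integrated against the discrete covariation. The
  second moment of the latter is \<open>(t - s)\<^sup>2 / n\<close> by
  \<open>cross_variation_sq\<close> and tends to 0, while \<eta> is bounded. This replaces
  independence of \<eta> from the pair of motions.\<close>

lemma expectation_past_cross:
  assumes c: "c \<in> labels" "c' \<in> labels" "c \<noteq> c'" and st: "0 \<le> s" "s \<le> t"
    and \<eta>: "\<eta> \<in> borel_measurable (F s)" "\<And>\<omega>. \<omega> \<in> space M \<Longrightarrow> \<bar>\<eta> \<omega>\<bar> \<le> K"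
  shows "expectation (\<lambda>\<omega>. \<eta> \<omega> * (incr c s t \<omega> * incr c' s t \<omega>)) = 0"
proof -
  have \<eta>M: "\<eta> \<in> borel_measurable M" using borel_measurable_F_M[OF \<eta>(1) st(1)] .
  have split: "expectation (\<lambda>\<omega>. \<eta> \<omega> * (incr c s v \<omega> * incr c' s v \<omega>)) =
     expectation (\<lambda>\<omega>. \<eta> \<omega> * (incr c s u \<omega> * incr c' s u \<omega>)) +
     expectation (\<lambda>\<omega>. \<eta> \<omega> * (incr c u v \<omega> * incr c' u v \<omega>))" if uv: "s \<le> u" "u \<le> v" for u v
  proof -
    have \<eta>u: "\<eta> \<in> borel_measurable (F u)" using borel_measurable_mono_F[OF \<eta>(1) uv(1)] .
    have i: "integrable M (\<lambda>\<omega>. \<eta> \<omega> * (incr c a b \<omega> * incr c' a' b' \<omega>))"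
      if "0 \<le> a" "a \<le> b" "0 \<le> a'" "a' \<le> b'" for a b a' b'
      using that c \<eta>(2) by (intro integrable_bounded_mult[where K=K] \<eta>M integrable_incr_mult) auto
    have z1: "expectation (\<lambda>\<omega>. \<eta> \<omega> * (incr c s u \<omega> * incr c' u v \<omega>)) = 0"
      using expectation_incr_disjoint[OF c(1,2) st(1) uv(1) order_refl uv(2) \<eta>u \<eta>(2)] .
    have z2: "expectation (\<lambda>\<omega>. \<eta> \<omega> * (incr c u v \<omega> * incr c' s u \<omega>)) = 0"
      using expectation_incr_disjoint[OF c(2,1) st(1) uv(1) order_refl uv(2) \<eta>u \<eta>(2)] by (simp add: mult_ac)
    have "(\<lambda>\<omega>. \<eta> \<omega> * (incr c s v \<omega> * incr c' s v \<omega>)) = (\<lambda>\<omega>.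
       \<eta> \<omega> * (incr c s u \<omega> * incr c' s u \<omega>) + \<eta> \<omega> * (incr c u v \<omega> * incr c' u v \<omega>)
      + (\<eta> \<omega> * (incr c s u \<omega> * incr c' u v \<omega>) + \<eta> \<omega> * (incr c u v \<omega> * incr c' s u \<omega>)))"
      by (auto simp: incr_def algebra_simps)
    then show ?thesis using i st uv z1 z2 by (simp add: Bochner_Integration.integral_add)
  qed
  have sum: "expectation (\<lambda>\<omega>. \<eta> \<omega> * (incr c s (s + real n * h) \<omega> * incr c' s (s + real n * h) \<omega>)) =
     (\<Sum>i<n. expectation (\<lambda>\<omega>. \<eta> \<omega> * (incr c (s + real i * h) (s + real (Suc i) * h) \<omega>
        * incr c' (s + real i * h) (s + real (Suc i) * h) \<omega>)))" if h: "0 \<le> h" for n h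
  proof (induction n)
    case (Suc n)
    show ?case
      using split[of "s + real n * h" "s + real (Suc n) * h"] Suc h by (simp add: algebra_simps)
  qed simp
  define e where "e = \<bar>expectation (\<lambda>\<omega>. \<eta> \<omega> * (incr c s t \<omega> * incr c' s t \<omega>))\<bar>"
  have K: "0 \<le> K" using \<eta>(2) not_empty by fastforce
  have bound: "e \<le> K * ((t - s)\<^sup>2 + 1) / 2 / real m" if m: "m > 0" for m
  proof -
    \<comment> \<open>With \<open>m\<^sup>2\<close> subintervals, the weight \<open>m\<close> in
      \<open>2 * \<bar>Q\<bar> \<le> m * Q\<^sup>2 + 1 / m\<close> turns the expectations of both
      terms into multiples of \<open>1 / m\<close>.\<close>
    define n where "n = m\<^sup>2"
    define h where "h = (t - s) / real n"
    have n: "0 < n" using m by (simp add: n_def)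
    have h: "0 \<le> h" "s + real n * h = t" using st n by (auto simp: h_def)
    let ?T = "\<lambda>i \<omega>. incr c (s + real i * h) (s + real (Suc i) * h) \<omega> * incr c' (s + real i * h) (s + real (Suc i) * h) \<omega>"
    let ?Q = "\<lambda>\<omega>. \<Sum>i<n. ?T i \<omega>"
    have a: "0 \<le> s + real i * h" "s + real i * h \<le> s + real (Suc i) * h" for i
      using st h by (auto simp: algebra_simps add_nonneg_nonneg)
    have iT: "integrable M (?T i)" for i by (rule integrable_incr_mult[OF c(1,2) a a])
    then have iQ: "integrable M ?Q" by (intro Bochner_Integration.integrable_sum)
    have i\<eta>T: "integrable M (\<lambda>\<omega>. \<eta> \<omega> * ?T i \<omega>)" for i
      using \<eta>(2) by (intro integrable_bounded_mult[where K=K] \<eta>M iT) auto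
    have i\<eta>Q: "integrable M (\<lambda>\<omega>. \<eta> \<omega> * ?Q \<omega>)"
      using \<eta>(2) by (intro integrable_bounded_mult[where K=K] \<eta>M iQ) auto
    have "expectation (\<lambda>\<omega>. \<eta> \<omega> * (incr c s t \<omega> * incr c' s t \<omega>)) = (\<Sum>i<n. expectation (\<lambda>\<omega>. \<eta> \<omega> * ?T i \<omega>))"
      using sum[OF h(1), of n] unfolding h(2) .
    also have "\<dots> = expectation (\<lambda>\<omega>. \<Sum>i<n. \<eta> \<omega> * ?T i \<omega>)"
      by (rule Bochner_Integration.integral_sum[symmetric]) (rule i\<eta>T)
    also have "\<dots> = expectation (\<lambda>\<omega>. \<eta> \<omega> * ?Q \<omega>)" by (simp add: sum_distrib_left)
    finally have "e = \<bar>expectation (\<lambda>\<omega>. \<eta> \<omega> * ?Q \<omega>)\<bar>" by (simp add: e_def)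
    also have "\<dots> \<le> expectation (\<lambda>\<omega>. \<bar>\<eta> \<omega> * ?Q \<omega>\<bar>)" by (rule integral_abs_bound)
    also have "\<dots> \<le> expectation (\<lambda>\<omega>. K * ((real m * (?Q \<omega>)\<^sup>2 + 1 / real m) / 2))"
    proof (rule integral_mono)
      show "integrable M (\<lambda>\<omega>. \<bar>\<eta> \<omega> * ?Q \<omega>\<bar>)" using i\<eta>Q by simp
      show "integrable M (\<lambda>\<omega>. K * ((real m * (?Q \<omega>)\<^sup>2 + 1 / real m) / 2))"
        using cross_variation_sq(1)[OF c st(1) h(1), of n] by simp
      fix \<omega> assume \<omega>: "\<omega> \<in> space M"
      have "0 \<le> (real m * \<bar>?Q \<omega>\<bar> - 1)\<^sup>2 / real m" by simp
      also have "\<dots> = real m * (?Q \<omega>)\<^sup>2 + 1 / real m - 2 * \<bar>?Q \<omega>\<bar>"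
        using m by (simp add: power2_diff power_mult_distrib field_simps power2_eq_square)
      finally have "\<bar>?Q \<omega>\<bar> \<le> (real m * (?Q \<omega>)\<^sup>2 + 1 / real m) / 2" by simp
      then show "\<bar>\<eta> \<omega> * ?Q \<omega>\<bar> \<le> K * ((real m * (?Q \<omega>)\<^sup>2 + 1 / real m) / 2)"
        unfolding abs_mult using \<eta>(2)[OF \<omega>] K by (intro mult_mono) auto
    qed
    also have "\<dots> = K * ((real m * (real n * h\<^sup>2) + 1 / real m) / 2)"
      using cross_variation_sq[OF c st(1) h(1), of n] by (simp add: prob_space)
    also have "real m * (real n * h\<^sup>2) = (t - s)\<^sup>2 / real m"
      using n m by (simp add: h_def n_def power2_eq_square field_simps)
    also have "K * (((t - s)\<^sup>2 / real m + 1 / real m) / 2) = K * ((t - s)\<^sup>2 + 1) / 2 / real m"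
      using m by (simp add: field_simps)
    finally show ?thesis .
  qed
  have "(\<lambda>m. K * ((t - s)\<^sup>2 + 1) / 2 / real m) \<longlonglongrightarrow> 0"
    by (rule lim_const_over_n)
  then have "e \<le> 0"
    using bound by (intro LIMSEQ_le_const[where a=e]) (auto intro!: exI[of _ 1])
  then show ?thesis by (simp add: e_def)
qed

end

section \<open>Simple integrals\<close>

text \<open>Clamping the nodes to \<open>[s,t]\<close> turns the increment of a simple integral over
  \<open>[s,t]\<close> into a sum over clipped intervals with the same coefficients, however the
  nodes lie relative to \<open>s\<close> and \<open>t\<close>.\<close>

definition clip_time :: "real \<Rightarrow> real \<Rightarrow> real \<Rightarrow> real" where
  "clip_time s t a = max s (min t a)"

text \<open>The intersection lies between \<open>{p<..q}\<close> and \<open>{p..q}\<close>, which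
  have equal measure. The length is written with clipped nodes because the covariance of clipped
  increments appears in exactly this form.\<close>

lemma overlap_integral:
  fixes s t a b a' b' :: real
  assumes "s \<le> t" "a \<le> b" "a' \<le> b'"
  shows "(LBINT r:{s..t}. indicator {a<..b} r * indicator {a'<..b'} r) =
    max 0 (min (clip_time s t b) (clip_time s t b') - max (clip_time s t a) (clip_time s t a'))"
    and "set_integrable lborel {s..t} (\<lambda>r. indicator {a<..b} r * indicator {a'<..b'} r :: real)"
proof -
  define p q where "p = max s (max a a')" and "q = min t (min b b')"
  have eq: "indicator {s..t} r *\<^sub>R (indicator {a<..b} r * indicator {a'<..b'} r) =
     (indicator ({s..t} \<inter> {a<..b} \<inter> {a'<..b'}) r :: real)" for r
    by (simp add: indicator_inter_arith)
  have sub: "{p<..q} \<subseteq> {s..t} \<inter> {a<..b} \<inter> {a'<..b'}" "{s..t} \<inter> {a<..b} \<inter> {a'<..b'} \<subseteq> {p..q}"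
    by (auto simp: p_def q_def)
  have fin: "emeasure lborel {p..q} < \<infinity>" by (simp add: emeasure_lborel_Icc_eq)
  have fin': "emeasure lborel ({s..t} \<inter> {a<..b} \<inter> {a'<..b'}) < \<infinity>"
    using emeasure_mono[OF sub(2), of lborel] fin by (auto intro: le_less_trans)
  have 1: "measure lborel {p<..q} \<le> measure lborel ({s..t} \<inter> {a<..b} \<inter> {a'<..b'})"
    by (rule measure_mono_fmeasurable[OF sub(1)]) (use fin' in \<open>auto simp: fmeasurable_def\<close>)
  have 2: "measure lborel ({s..t} \<inter> {a<..b} \<inter> {a'<..b'}) \<le> measure lborel {p..q}"
    by (rule measure_mono_fmeasurable[OF sub(2)]) (use fin in \<open>auto simp: fmeasurable_def\<close>)
  have 3: "measure lborel {p<..q} = max 0 (q - p)" "measure lborel {p..q} = max 0 (q - p)"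
    by (cases "p \<le> q"; auto simp: measure_def)+
  have "measure lborel ({s..t} \<inter> {a<..b} \<inter> {a'<..b'}) = max 0 (q - p)" using 1 2 3 by linarith
  also have "\<dots> = max 0 (min (clip_time s t b) (clip_time s t b') - max (clip_time s t a) (clip_time s t a'))"
    using assms by (auto simp: p_def q_def clip_time_def min_def max_def)
  finally show "(LBINT r:{s..t}. indicator {a<..b} r * indicator {a'<..b'} r) =
    max 0 (min (clip_time s t b) (clip_time s t b') - max (clip_time s t a) (clip_time s t a'))"
    unfolding set_lebesgue_integral_def eq by simp
  show "set_integrable lborel {s..t} (\<lambda>r. indicator {a<..b} r * indicator {a'<..b'} r :: real)"
    unfolding set_integrable_def eq using fin' by (intro integrable_real_indicator) auto
qed

lemma integral_sum_sum:
  fixes f :: "nat \<Rightarrow> nat \<Rightarrow> 'b \<Rightarrow> real"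
  assumes "\<And>i j. i < m \<Longrightarrow> j < n \<Longrightarrow> integrable N (f i j)"
  shows "(\<integral>x. (\<Sum>i<m. \<Sum>j<n. f i j x) \<partial>N) = (\<Sum>i<m. \<Sum>j<n. \<integral>x. f i j x \<partial>N)"
proof -
  have "(\<integral>x. (\<Sum>i<m. \<Sum>j<n. f i j x) \<partial>N) = (\<Sum>i<m. \<integral>x. (\<Sum>j<n. f i j x) \<partial>N)"
    by (rule Bochner_Integration.integral_sum) (auto intro!: Bochner_Integration.integrable_sum assms)
  also have "\<dots> = (\<Sum>i<m. \<Sum>j<n. \<integral>x. f i j x \<partial>N)"
    by (intro sum.cong refl Bochner_Integration.integral_sum) (auto intro: assms)
  finally show ?thesis .
qed

context driven_space begin

lemma integrable_past_incr_incr: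
  assumes c: "c \<in> labels" "c' \<in> labels" and ab: "0 \<le> a" "a \<le> b" "0 \<le> a'" "a' \<le> b'"
    and \<eta>: "\<eta> \<in> borel_measurable M" "\<And>\<omega>. \<omega> \<in> space M \<Longrightarrow> \<bar>\<eta> \<omega>\<bar> \<le> K"
  shows "integrable M (\<lambda>\<omega>. \<eta> \<omega> * (incr c a b \<omega> * incr c' a' b' \<omega>))"
  using assms by (intro integrable_bounded_mult[where K=K] integrable_incr_mult) auto

text \<open>On the overlap of the two intervals the identities for a common interval apply; off the
  overlap the later factor is orthogonal to everything before it. The factor \<eta> has to be known
  only at the start of the overlap, \<open>max a a'\<close>.\<close>

lemma expectation_past_incr_incr:
  assumes c: "c \<in> labels" "c' \<in> labels" and ab: "0 \<le> a" "a \<le> b" "0 \<le> a'" "a' \<le> b'"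
    and \<eta>: "\<eta> \<in> borel_measurable (F (max a a'))" "\<And>\<omega>. \<omega> \<in> space M \<Longrightarrow> \<bar>\<eta> \<omega>\<bar> \<le> K"
  shows "expectation (\<lambda>\<omega>. \<eta> \<omega> * (incr c a b \<omega> * incr c' a' b' \<omega>)) =
    (if c = c' then expectation \<eta> * max 0 (min b b' - max a a') else 0)"
proof -
  define p q where "p = max a a'" and "q = min b b'"
  have p0: "0 \<le> p" using ab by (simp add: p_def)
  note \<eta>p = \<eta>(1)[folded p_def]
  have \<eta>u: "\<eta> \<in> borel_measurable (F u)" if "p \<le> u" for u using borel_measurable_mono_F[OF \<eta>p that] .
  have \<eta>M: "\<eta> \<in> borel_measurable M" using borel_measurable_F_M[OF \<eta>p p0] .
  have comm: "expectation (\<lambda>\<omega>. \<eta> \<omega> * (x \<omega> * y \<omega>)) = expectation (\<lambda>\<omega>. \<eta> \<omega> * (y \<omega> * x \<omega>))" for x y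
    by (simp add: mult_ac)
  have i\<eta>: "integrable M \<eta>"
    using integrable_bounded_mult[OF \<eta>M, of "\<lambda>_. 1" K] \<eta>(2) by simp
  consider "p < q" | "q \<le> p" "b \<le> a'" | "q \<le> p" "b' \<le> a" | "a = b" | "a' = b'"
  proof -
    have "p < q \<or> q \<le> p \<and> b \<le> a' \<or> q \<le> p \<and> b' \<le> a \<or> a = b \<or> a' = b'"
      using ab unfolding p_def q_def max_def min_def by argo
    then show thesis using that by blast
  qed
  then show ?thesis
  proof cases
    case 1
    \<comment> \<open>Both intervals are cut at the ends \<open>p\<close> and \<open>q\<close> of
      the overlap. Of the nine products only the middle one can survive: pieces with different index
      are disjoint in time, and one of the two first pieces is empty, as is one of the two last,
      since \<open>p = max a a'\<close> and \<open>q = min b b'\<close>.\<close>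
    define P P' where "P = (\<lambda>i::nat. if i = 0 then a else if i = 1 then p else if i = 2 then q else b)"
      and "P' = (\<lambda>i::nat. if i = 0 then a' else if i = 1 then p else if i = 2 then q else b')"
    have P: "0 \<le> P i" "P i \<le> P (Suc i)" "0 \<le> P' i" "P' i \<le> P' (Suc i)" for i
      using ab 1 unfolding P_def P'_def p_def q_def by auto
    have lt3: "i = 0 \<or> i = 1 \<or> i = 2" if "i < 3" for i :: nat using that by auto
    have PP: "P (Suc i) \<le> P' j" "P' (Suc i) \<le> P j" "p \<le> P j" "p \<le> P' j" if "i < j" "j < 3" for i j
      using lt3[OF that(2)] that ab 1 unfolding P_def P'_def p_def q_def by auto
    let ?T = "\<lambda>i j \<omega>. \<eta> \<omega> * (incr c (P i) (P (Suc i)) \<omega> * incr c' (P' j) (P' (Suc j)) \<omega>)"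
    have iT: "integrable M (?T i j)" for i j
      by (rule integrable_past_incr_incr[OF c P \<eta>M \<eta>(2)])
    have off1: "expectation (?T i j) = 0" if "i < j" "j < 3" for i j
      using expectation_incr_disjoint[OF c P(1,2) PP(1)[OF that] P(4) \<eta>u[OF PP(4)[OF that]] \<eta>(2)] .
    have off2: "expectation (?T i j) = 0" if "j < i" "i < 3" for i j
      using expectation_incr_disjoint[OF c(2,1) P(3,4) PP(2)[OF that] P(2) \<eta>u[OF PP(3)[OF that]] \<eta>(2)]
      by (subst comm)
    have d0: "expectation (?T 0 0) = 0"
      unfolding P_def P'_def p_def by (cases "a \<le> a'") (auto simp: max_def)
    have d2: "expectation (?T 2 2) = 0"
      unfolding P_def P'_def q_def by (cases "b \<le> b'") (auto simp: min_def)
    have d1: "expectation (?T 1 1) = (if c = c' then expectation \<eta> * (q - p) else 0)"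
    proof (cases "c = c'")
      case True
      then show ?thesis
        using expectation_past_incr_sq[OF c(1) p0 _ \<eta>p i\<eta>, of q] 1
        by (simp add: P_def P'_def power2_eq_square)
    next
      case False
      then show ?thesis
        using expectation_past_cross[OF c False p0 _ \<eta>p \<eta>(2), of q] 1
        by (simp add: P_def P'_def)
    qed
    have "(\<lambda>\<omega>. \<eta> \<omega> * (incr c a b \<omega> * incr c' a' b' \<omega>)) = (\<lambda>\<omega>. \<Sum>i<3. \<Sum>j<3. ?T i j \<omega>)"
      by (auto simp: incr_def P_def P'_def eval_nat_numeral algebra_simps)
    then have "expectation (\<lambda>\<omega>. \<eta> \<omega> * (incr c a b \<omega> * incr c' a' b' \<omega>)) = (\<Sum>i<3. \<Sum>j<3. expectation (?T i j))"
      using iT by (simp add: Bochner_Integration.integral_sum)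
    also have "\<dots> = (\<Sum>i<3::nat. \<Sum>j<3::nat. if i = 1 \<and> j = 1 then expectation (?T 1 1) else 0)"
    proof (intro sum.cong refl)
      fix i j :: nat assume "i \<in> {..<3}" "j \<in> {..<3}"
      then show "expectation (?T i j) = (if i = 1 \<and> j = 1 then expectation (?T 1 1) else 0)"
        using off1[of i j] off2[of j i] d0 d2 lt3[of i] lt3[of j]
        by (cases i j rule: linorder_cases) auto
    qed
    also have "\<dots> = expectation (?T 1 1)" by (simp add: eval_nat_numeral)
    finally show ?thesis using d1 1 by (simp add: p_def q_def)
  next
    case 2
    have "expectation (\<lambda>\<omega>. \<eta> \<omega> * (incr c a b \<omega> * incr c' a' b' \<omega>)) = 0"
      using 2 ab by (intro expectation_incr_disjoint[OF c _ _ _ _ \<eta>u \<eta>(2)]) (auto simp: p_def)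
    then show ?thesis using 2 by (simp add: p_def q_def)
  next
    case 3
    have "expectation (\<lambda>\<omega>. \<eta> \<omega> * (incr c a b \<omega> * incr c' a' b' \<omega>)) = 0"
      unfolding comm[of "incr c a b"]
      using 3 ab by (intro expectation_incr_disjoint[OF c(2,1) _ _ _ _ \<eta>u \<eta>(2)]) (auto simp: p_def)
    then show ?thesis using 3 by (simp add: p_def q_def)
  next
    case 4 then show ?thesis using ab by simp
  next
    case 5 then show ?thesis using ab by simp
  qed
qed

section \<open>Martingale property and isometry for simple integrands\<close>

abbreviation SI :: "nat \<times> nat \<Rightarrow> 'a simple_proc \<Rightarrow> real \<Rightarrow> 'a \<Rightarrow> real" where
  "SI c \<equiv> simple_integral (V c)"

lemma simple_proc_bound:
  assumes "simple_proc M F (m, \<tau>, \<xi>)"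
  obtains K where "\<And>k \<omega>. k < m \<Longrightarrow> \<omega> \<in> space M \<Longrightarrow> \<bar>\<xi> k \<omega>\<bar> \<le> K" "0 \<le> K"
proof -
  have "\<forall>k<m. \<exists>K. \<forall>\<omega>\<in>space M. \<bar>\<xi> k \<omega>\<bar> \<le> K" using assms by (auto simp: simple_proc_def)
  then obtain b where b: "\<And>k \<omega>. k < m \<Longrightarrow> \<omega> \<in> space M \<Longrightarrow> \<bar>\<xi> k \<omega>\<bar> \<le> b k" by metis
  show ?thesis
  proof
    fix k \<omega> assume k: "k < m" "\<omega> \<in> space M"
    have "\<bar>\<xi> k \<omega>\<bar> \<le> \<bar>b k\<bar>" using b[OF k] by linarith
    also have "\<dots> \<le> (\<Sum>k<m. \<bar>b k\<bar>)" using k by (intro member_le_sum) auto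
    finally show "\<bar>\<xi> k \<omega>\<bar> \<le> (\<Sum>k<m. \<bar>b k\<bar>)" .
  qed (simp add: sum_nonneg)
qed

lemma simple_proc_times:
  assumes "simple_proc M F (m, \<tau>, \<xi>)"
  shows "k \<le> m \<Longrightarrow> 0 \<le> \<tau> k" "k < m \<Longrightarrow> \<tau> k < \<tau> (Suc k)" "k < m \<Longrightarrow> \<xi> k \<in> borel_measurable (F (\<tau> k))"
    "k < m \<Longrightarrow> \<xi> k \<in> borel_measurable M" "i \<le> k \<Longrightarrow> k \<le> m \<Longrightarrow> \<tau> i \<le> \<tau> k"
proof -
  have s: "0 \<le> \<tau> 0" "\<And>k. k < m \<Longrightarrow> \<tau> k < \<tau> (Suc k)" "\<And>k. k < m \<Longrightarrow> \<xi> k \<in> borel_measurable (F (\<tau> k))"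
    using assms by (auto simp: simple_proc_def)
  have mono: "\<tau> i \<le> \<tau> k" if "i \<le> k" "k \<le> m" for i k
    using that
  proof (induction k rule: dec_induct)
    case (step k) then show ?case using s(2)[of k] by simp
  qed simp
  have nn: "0 \<le> \<tau> k" if "k \<le> m" for k using mono[of 0 k] that s(1) by simp
  show "k \<le> m \<Longrightarrow> 0 \<le> \<tau> k" "k < m \<Longrightarrow> \<tau> k < \<tau> (Suc k)" "k < m \<Longrightarrow> \<xi> k \<in> borel_measurable (F (\<tau> k))"
    "i \<le> k \<Longrightarrow> k \<le> m \<Longrightarrow> \<tau> i \<le> \<tau> k" using s nn mono by auto
  show "k < m \<Longrightarrow> \<xi> k \<in> borel_measurable M" using borel_measurable_F_M[OF s(3) nn] by simp
qed

lemma simple_integral_diff: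
  assumes "s \<le> t"
  shows "SI c (m, \<tau>, \<xi>) t \<omega> - SI c (m, \<tau>, \<xi>) s \<omega> =
    (\<Sum>k<m. \<xi> k \<omega> * incr c (clip_time s t (\<tau> k)) (clip_time s t (\<tau> (Suc k))) \<omega>)"
proof -
  have "V c (min t b) \<omega> - V c (min s b) \<omega> = V c (clip_time s t b) \<omega> - V c s \<omega>" for b
    using assms by (auto simp: clip_time_def min_def max_def)
  then have "V c (min t b) \<omega> - V c (min t a) \<omega> - (V c (min s b) \<omega> - V c (min s a) \<omega>) = incr c (clip_time s t a) (clip_time s t b) \<omega>" for a b
    unfolding incr_def by (smt (verit))
  then show ?thesis
    by (simp add: simple_integral_def sum_subtractf[symmetric] right_diff_distrib[symmetric])
qed

text \<open>The last statement makes a coefficient count as past: if a clipped interval has positive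
  length, its left node was not moved backwards, so \<xi> is known at the clipped node.\<close>

lemma clip_time_simps:
  assumes "0 \<le> s" "s \<le> t"
  shows "0 \<le> clip_time s t a" "a \<le> b \<Longrightarrow> clip_time s t a \<le> clip_time s t b" "s \<le> clip_time s t a" "clip_time s t a \<le> t"
    "clip_time s t a < clip_time s t b \<Longrightarrow> a \<le> clip_time s t a"
  using assms by (auto simp: clip_time_def min_def max_def split: if_splits)

lemma simple_integral_measurable:
  assumes P: "simple_proc M F P" and c: "c \<in> labels" and t: "0 \<le> t"
  shows "SI c P t \<in> borel_measurable M"
proof -
  obtain m \<tau> \<xi> where [simp]: "P = (m, \<tau>, \<xi>)" by (cases P) auto
  note s = simple_proc_times[OF P[simplified]]
  show ?thesis unfolding simple_integral_def
    using s t by (auto intro!: borel_measurable_sum borel_measurable_times borel_measurable_diff V_measurable[OF c])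
qed

lemma simple_integral_increment_sq:
  assumes P: "simple_proc M F P" and c: "c \<in> labels" and st: "0 \<le> s" "s \<le> t"
  shows "integrable M (\<lambda>\<omega>. (SI c P t \<omega> - SI c P s \<omega>)\<^sup>2)"
proof -
  obtain m \<tau> \<xi> where [simp]: "P = (m, \<tau>, \<xi>)" by (cases P) auto
  note s = simple_proc_times[OF P[simplified]]
  obtain K where K: "\<And>k \<omega>. k < m \<Longrightarrow> \<omega> \<in> space M \<Longrightarrow> \<bar>\<xi> k \<omega>\<bar> \<le> K" "0 \<le> K"
    using simple_proc_bound P by force
  have "integrable M (\<lambda>\<omega>. \<Sum>k<m. \<Sum>j<m. (\<xi> k \<omega> * \<xi> j \<omega>) *
     (incr c (clip_time s t (\<tau> k)) (clip_time s t (\<tau> (Suc k))) \<omega> * incr c (clip_time s t (\<tau> j)) (clip_time s t (\<tau> (Suc j))) \<omega>))"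
  proof (intro Bochner_Integration.integrable_sum integrable_past_incr_incr[where K="K * K"] clip_time_simps[OF st] c)
    fix k j \<omega> assume kj: "k \<in> {..<m}" "j \<in> {..<m}"
    show "\<tau> k \<le> \<tau> (Suc k)" "\<tau> j \<le> \<tau> (Suc j)" using kj s(2) by (auto intro: less_imp_le)
    show "(\<lambda>\<omega>. \<xi> k \<omega> * \<xi> j \<omega>) \<in> borel_measurable M" using kj s(4) by auto
    show "\<bar>\<xi> k \<omega> * \<xi> j \<omega>\<bar> \<le> K * K" if "\<omega> \<in> space M"
      unfolding abs_mult using K kj that by (intro mult_mono) auto
  qed
  then show ?thesis
    by (simp add: simple_integral_diff[OF st(2)] power2_eq_square sum_product mult_ac)
qed

lemma simple_integral_increment_past:
  assumes P: "simple_proc M F P" and c: "c \<in> labels" and st: "0 \<le> s" "s \<le> t"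
    and \<eta>: "\<eta> \<in> borel_measurable (F s)" "\<And>\<omega>. \<omega> \<in> space M \<Longrightarrow> \<bar>\<eta> \<omega>\<bar> \<le> B"
  shows "expectation (\<lambda>\<omega>. \<eta> \<omega> * (SI c P t \<omega> - SI c P s \<omega>)) = 0"
proof -
  obtain m \<tau> \<xi> where [simp]: "P = (m, \<tau>, \<xi>)" by (cases P) auto
  note s = simple_proc_times[OF P[simplified]]
  obtain K where K: "\<And>k \<omega>. k < m \<Longrightarrow> \<omega> \<in> space M \<Longrightarrow> \<bar>\<xi> k \<omega>\<bar> \<le> K" "0 \<le> K"
    using simple_proc_bound P by force
  have B: "0 \<le> B" using \<eta>(2) not_empty by fastforce
  have \<eta>M: "\<eta> \<in> borel_measurable M" using borel_measurable_F_M[OF \<eta>(1) st(1)] .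
  let ?T = "\<lambda>k \<omega>. (\<eta> \<omega> * \<xi> k \<omega>) * incr c (clip_time s t (\<tau> k)) (clip_time s t (\<tau> (Suc k))) \<omega>"
  have bd: "\<bar>\<eta> \<omega> * \<xi> k \<omega>\<bar> \<le> B * K" if "k < m" "\<omega> \<in> space M" for k \<omega>
    unfolding abs_mult using K \<eta>(2) B that by (intro mult_mono) auto
  have m: "(\<lambda>\<omega>. \<eta> \<omega> * \<xi> k \<omega>) \<in> borel_measurable M" if "k < m" for k
    using \<eta>M s(4)[OF that] by simp
  have i: "integrable M (\<lambda>\<omega>. \<eta> \<omega> * \<xi> k \<omega>)" if "k < m" for k
    using integrable_bounded_mult[OF m[OF that], of "\<lambda>_. 1" "B*K"] bd that by simp
  have iT: "integrable M (?T k)" if "k < m" for k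
    using that bd m s(2)[of k] by (intro integrable_bounded_mult[where K="B*K"] integrable_incr[OF c] clip_time_simps[OF st]) auto
  have T0: "expectation (?T k) = 0" if k: "k < m" for k
  \<comment> \<open>A degenerate clipped interval may sit at \<open>t\<close>, before its own node,
    where \<xi> is not yet known; the increment is then 0.\<close>
  proof (cases "clip_time s t (\<tau> k) < clip_time s t (\<tau> (Suc k))")
    case True
    show ?thesis
    proof (rule expectation_past_incr[OF c clip_time_simps(1)[OF st] _ _ i[OF k]])
      show "(\<lambda>\<omega>. \<eta> \<omega> * \<xi> k \<omega>) \<in> borel_measurable (F (clip_time s t (\<tau> k)))"
        by (intro borel_measurable_times borel_measurable_mono_F[OF \<eta>(1)] borel_measurable_mono_F[OF s(3)[OF k]]
            clip_time_simps(3)[OF st] clip_time_simps(5)[OF st True])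
    qed (use True in simp)
  next
    case False
    then have "clip_time s t (\<tau> k) = clip_time s t (\<tau> (Suc k))"
      using clip_time_simps(2)[OF st, of "\<tau> k" "\<tau> (Suc k)"] s(2)[OF k] by simp
    then show ?thesis by simp
  qed
  have "expectation (\<lambda>\<omega>. \<eta> \<omega> * (SI c P t \<omega> - SI c P s \<omega>)) = expectation (\<lambda>\<omega>. \<Sum>k<m. ?T k \<omega>)"
    by (simp add: simple_integral_diff[OF st(2)] sum_distrib_left mult_ac)
  also have "\<dots> = (\<Sum>k<m. expectation (?T k))" using iT by (intro Bochner_Integration.integral_sum) auto
  finally show ?thesis using T0 by simp
qed

text \<open>The polarised form covers two integrands with different nodes and includes orthogonality
  for different motions. For equal labels both sides expand into the same double sum, weighted by
  the overlaps of the clipped intervals.\<close>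

lemma simple_isometry:
  assumes P: "simple_proc M F P" "simple_proc M F P'" and c: "c \<in> labels" "c' \<in> labels"
    and st: "0 \<le> s" "s \<le> t"
  shows "expectation (\<lambda>\<omega>. (SI c P t \<omega> - SI c P s \<omega>) * (SI c' P' t \<omega> - SI c' P' s \<omega>)) =
    (if c = c' then (\<integral>\<omega>. (LBINT r:{s..t}. simple_val P r \<omega> * simple_val P' r \<omega>) \<partial>M) else 0)"
proof -
  obtain m \<tau> \<xi> where P1: "P = (m, \<tau>, \<xi>)" by (cases P) auto
  obtain m' \<tau>' \<xi>' where P2: "P' = (m', \<tau>', \<xi>')" by (cases P') auto
  note s = simple_proc_times[OF P(1)[unfolded P1]] and s' = simple_proc_times[OF P(2)[unfolded P2]]
  obtain K where K: "\<And>k \<omega>. k < m \<Longrightarrow> \<omega> \<in> space M \<Longrightarrow> \<bar>\<xi> k \<omega>\<bar> \<le> K" "0 \<le> K"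
    using simple_proc_bound P(1)[unfolded P1] by force
  obtain K' where K': "\<And>k \<omega>. k < m' \<Longrightarrow> \<omega> \<in> space M \<Longrightarrow> \<bar>\<xi>' k \<omega>\<bar> \<le> K'" "0 \<le> K'"
    using simple_proc_bound P(2)[unfolded P2] by force
  let ?cl = "clip_time s t"
  let ?ov = "\<lambda>k j. max 0 (min (?cl (\<tau> (Suc k))) (?cl (\<tau>' (Suc j))) - max (?cl (\<tau> k)) (?cl (\<tau>' j)))"
  let ?T = "\<lambda>k j \<omega>. (\<xi> k \<omega> * \<xi>' j \<omega>) * (incr c (?cl (\<tau> k)) (?cl (\<tau> (Suc k))) \<omega> * incr c' (?cl (\<tau>' j)) (?cl (\<tau>' (Suc j))) \<omega>)"
  have bd: "\<bar>\<xi> k \<omega> * \<xi>' j \<omega>\<bar> \<le> K * K'" if "k < m" "j < m'" "\<omega> \<in> space M" for k j \<omega>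
    unfolding abs_mult using K K' that by (intro mult_mono) auto
  have ms: "(\<lambda>\<omega>. \<xi> k \<omega> * \<xi>' j \<omega>) \<in> borel_measurable M" if "k < m" "j < m'" for k j
    using s(4)[OF that(1)] s'(4)[OF that(2)] by simp
  have i: "integrable M (\<lambda>\<omega>. \<xi> k \<omega> * \<xi>' j \<omega>)" if "k < m" "j < m'" for k j
    using integrable_bounded_mult[OF ms[OF that], of "\<lambda>_. 1" "K*K'"] bd that by simp
  have le: "?cl (\<tau> k) \<le> ?cl (\<tau> (Suc k))" if "k < m" for k using s(2)[OF that] by (intro clip_time_simps[OF st]) simp
  have le': "?cl (\<tau>' k) \<le> ?cl (\<tau>' (Suc k))" if "k < m'" for k using s'(2)[OF that] by (intro clip_time_simps[OF st]) simp
  have iT: "integrable M (?T k j)" if "k < m" "j < m'" for k j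
    using integrable_past_incr_incr[OF c clip_time_simps(1)[OF st] le[OF that(1)] clip_time_simps(1)[OF st] le'[OF that(2)] ms[OF that] bd[OF that]] by simp
  have ET: "expectation (?T k j) = (if c = c' then expectation (\<lambda>\<omega>. \<xi> k \<omega> * \<xi>' j \<omega>) * ?ov k j else 0)"
    if kj: "k < m" "j < m'" for k j
  proof (cases "?cl (\<tau> k) < ?cl (\<tau> (Suc k)) \<and> ?cl (\<tau>' j) < ?cl (\<tau>' (Suc j))")
    case True
    show ?thesis
    proof (rule expectation_past_incr_incr[OF c clip_time_simps(1)[OF st] le[OF kj(1)] clip_time_simps(1)[OF st] le'[OF kj(2)] _ bd[OF kj]])
      have "\<tau> k \<le> max (?cl (\<tau> k)) (?cl (\<tau>' j))" "\<tau>' j \<le> max (?cl (\<tau> k)) (?cl (\<tau>' j))"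
        using True clip_time_simps(5)[OF st] by (auto simp: le_max_iff_disj)
      then show "(\<lambda>\<omega>. \<xi> k \<omega> * \<xi>' j \<omega>) \<in> borel_measurable (F (max (?cl (\<tau> k)) (?cl (\<tau>' j))))"
        by (intro borel_measurable_times borel_measurable_mono_F[OF s(3)[OF kj(1)]] borel_measurable_mono_F[OF s'(3)[OF kj(2)]])
    qed auto
  next
    case False
    then have d: "?cl (\<tau> k) = ?cl (\<tau> (Suc k)) \<or> ?cl (\<tau>' j) = ?cl (\<tau>' (Suc j))"
      using le[OF kj(1)] le'[OF kj(2)] by auto
    then have "?ov k j = 0" using le[OF kj(1)] le'[OF kj(2)] by auto
    moreover have "(\<lambda>\<omega>. ?T k j \<omega>) = (\<lambda>_. 0)" using d by auto
    ultimately show ?thesis by simp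
  qed
  have "expectation (\<lambda>\<omega>. (SI c P t \<omega> - SI c P s \<omega>) * (SI c' P' t \<omega> - SI c' P' s \<omega>))
     = expectation (\<lambda>\<omega>. \<Sum>k<m. \<Sum>j<m'. ?T k j \<omega>)"
    by (simp only: P1 P2 simple_integral_diff[OF st(2)] sum_product) (simp add: mult_ac)
  also have "\<dots> = (\<Sum>k<m. \<Sum>j<m'. expectation (?T k j))"
    by (rule integral_sum_sum) (rule iT)
  finally have L: "expectation (\<lambda>\<omega>. (SI c P t \<omega> - SI c P s \<omega>) * (SI c' P' t \<omega> - SI c' P' s \<omega>)) =
     (\<Sum>k<m. \<Sum>j<m'. (if c = c' then expectation (\<lambda>\<omega>. \<xi> k \<omega> * \<xi>' j \<omega>) * ?ov k j else 0))"
    using ET by simp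
  let ?I = "\<lambda>k j r. indicator {\<tau> k<..\<tau> (Suc k)} r * indicator {\<tau>' j<..\<tau>' (Suc j)} r :: real"
  have R: "(LBINT r:{s..t}. simple_val P r \<omega> * simple_val P' r \<omega>) = (\<Sum>k<m. \<Sum>j<m'. (\<xi> k \<omega> * \<xi>' j \<omega>) * ?ov k j)" for \<omega>
  proof -
    have "(LBINT r:{s..t}. simple_val P r \<omega> * simple_val P' r \<omega>) =
      (LBINT r:{s..t}. \<Sum>k<m. \<Sum>j<m'. (\<xi> k \<omega> * \<xi>' j \<omega>) * ?I k j r)"
      by (simp only: P1 P2 simple_val_def prod.case sum_product)
        (intro set_lebesgue_integral_cong, auto intro!: sum.cong simp: mult_ac simp del: sum.inter_filter)
    also have "\<dots> = (\<Sum>k<m. \<Sum>j<m'. (LBINT r:{s..t}. (\<xi> k \<omega> * \<xi>' j \<omega>) * ?I k j r))"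
    proof -
      have "set_integrable lborel {s..t} (\<lambda>r. (\<xi> k \<omega> * \<xi>' j \<omega>) * ?I k j r)" if "k < m" "j < m'" for k j
        using overlap_integral(2)[OF st(2), of "\<tau> k" "\<tau> (Suc k)" "\<tau>' j" "\<tau>' (Suc j)"] s(2) s'(2) that
        by (intro set_integrable_mult_right) (auto intro: less_imp_le)
      then show ?thesis unfolding set_lebesgue_integral_def set_integrable_def
        by (simp only: scaleR_sum_right) (rule integral_sum_sum)
    qed
    also have "\<dots> = (\<Sum>k<m. \<Sum>j<m'. (\<xi> k \<omega> * \<xi>' j \<omega>) * ?ov k j)"
      using overlap_integral(1)[OF st(2)] s(2) s'(2) by (intro sum.cong refl) (simp add: less_imp_le)
    finally show ?thesis .
  qed
  have "(\<integral>\<omega>. (\<Sum>k<m. \<Sum>j<m'. (\<xi> k \<omega> * \<xi>' j \<omega>) * ?ov k j) \<partial>M) = (\<Sum>k<m. \<Sum>j<m'. expectation (\<lambda>\<omega>. \<xi> k \<omega> * \<xi>' j \<omega>) * ?ov k j)"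
    by (subst integral_sum_sum) (auto intro: i)
  then show ?thesis unfolding L R by simp
qed

end

section \<open>Bounded processes and $L^2$ limits\<close>

text \<open>This stands in for the Cauchy-Schwarz inequality in passages to the limit: \<delta> is
  fixed first, small against \<open>a\<close>, and afterwards \<open>b k / \<delta>\<close> is made
  small by \<open>k\<close>.\<close>

lemma tendsto_zero_weighted_bound:
  fixes x b :: "nat \<Rightarrow> real"
  assumes a: "0 \<le> a" and le: "\<And>k \<delta>. 0 < \<delta> \<Longrightarrow> \<bar>x k\<bar> \<le> (\<delta> * a + b k / \<delta>) / 2" and lim: "b \<longlonglongrightarrow> 0"
  shows "x \<longlonglongrightarrow> 0"
proof (rule LIMSEQ_I)
  fix e :: real assume e: "0 < e"
  define \<delta> where "\<delta> = e / (a + 1)"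
  have \<delta>: "0 < \<delta>" unfolding \<delta>_def using e a by (intro divide_pos_pos) linarith+
  have \<delta>a: "\<delta> * a < e" using e a by (simp add: \<delta>_def divide_less_eq algebra_simps)
  obtain N where N: "\<And>k. k \<ge> N \<Longrightarrow> \<bar>b k\<bar> < \<delta> * e"
    using LIMSEQ_D[OF lim, of "\<delta> * e"] \<delta> e by auto
  have "\<bar>x k\<bar> < e" if "k \<ge> N" for k
  proof -
    have "b k / \<delta> < e" using N[OF that] \<delta> by (simp add: divide_less_eq mult.commute)
    then show ?thesis using le[OF \<delta>, of k] \<delta>a by argo
  qed
  then show "\<exists>N. \<forall>k\<ge>N. norm (x k - 0) < e" by auto
qed

section \<open>Calculus of bounded, jointly measurable processes\<close>

context prob_space begin

text \<open>Joint measurability and one bound for all real times and all points of the space make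
  Fubini's theorem and every moment available without side conditions, and the class is an algebra.
  Adaptedness is kept apart from it.\<close>

definition bounded_process :: "(real \<Rightarrow> 'a \<Rightarrow> real) \<Rightarrow> bool" where
  "bounded_process f \<longleftrightarrow> (\<lambda>(r, \<omega>). f r \<omega>) \<in> borel_measurable (borel \<Otimes>\<^sub>M M) \<and>
     (\<exists>B\<ge>0. \<forall>r. \<forall>\<omega>\<in>space M. \<bar>f r \<omega>\<bar> \<le> B)"

lemma bounded_processI:
  assumes "(\<lambda>(r, \<omega>). f r \<omega>) \<in> borel_measurable (borel \<Otimes>\<^sub>M M)"
    and "\<And>r \<omega>. \<omega> \<in> space M \<Longrightarrow> \<bar>f r \<omega>\<bar> \<le> B"
  shows "bounded_process f"
proof -
  have "0 \<le> max 0 B" "\<forall>r. \<forall>\<omega>\<in>space M. \<bar>f r \<omega>\<bar> \<le> max 0 B"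
    using assms(2) by (simp_all add: le_max_iff_disj)
  then show ?thesis unfolding bounded_process_def by (intro conjI assms(1) exI[of _ "max 0 B"])
qed

lemma bounded_processD:
  "bounded_process f \<Longrightarrow> case_prod f \<in> borel_measurable (borel \<Otimes>\<^sub>M M)"
  unfolding bounded_process_def by (rule conjunct1)

lemma bounded_process_bound:
  "bounded_process f \<Longrightarrow> \<exists>B. 0 \<le> B \<and> (\<forall>r. \<forall>\<omega>\<in>space M. \<bar>f r \<omega>\<bar> \<le> B)"
  unfolding bounded_process_def by (rule conjunct2)

lemma bounded_process_measurable:
  assumes "bounded_process f" "g \<in> borel_measurable N" "h \<in> measurable N M"
  shows "(\<lambda>x. f (g x) (h x)) \<in> borel_measurable N"
  by (rule measurable_Pair_compose_split[OF bounded_processD[OF assms(1)] assms(2,3)])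

lemma bounded_process_const: "bounded_process (\<lambda>r \<omega>. c)"
  by (rule bounded_processI[where B="\<bar>c\<bar>"]) auto

lemma bounded_process_add:
  assumes "bounded_process f" "bounded_process g" shows "bounded_process (\<lambda>r \<omega>. f r \<omega> + g r \<omega>)"
proof -
  obtain A where A: "0 \<le> A" "\<forall>r. \<forall>\<omega>\<in>space M. \<bar>f r \<omega>\<bar> \<le> A" using bounded_process_bound[OF assms(1)] by blast
  note A = A(1) A(2)[rule_format]
  obtain B where B: "0 \<le> B" "\<forall>r. \<forall>\<omega>\<in>space M. \<bar>g r \<omega>\<bar> \<le> B" using bounded_process_bound[OF assms(2)] by blast
  note B = B(1) B(2)[rule_format]
  note b = A(2) B(2)
  show ?thesis
  proof (rule bounded_processI[where B="A + B"])
    show "\<bar>f r \<omega> + g r \<omega>\<bar> \<le> A + B" if "\<omega> \<in> space M" for r \<omega> using b(1)[OF that, of r] b(2)[OF that, of r] by linarith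
    show "(\<lambda>(r, \<omega>). f r \<omega> + g r \<omega>) \<in> borel_measurable (borel \<Otimes>\<^sub>M M)"
      using bounded_processD[OF assms(1)] bounded_processD[OF assms(2)] by (simp add: case_prod_beta')
  qed
qed

lemma bounded_process_mult:
  assumes "bounded_process f" "bounded_process g" shows "bounded_process (\<lambda>r \<omega>. f r \<omega> * g r \<omega>)"
proof -
  obtain A where A: "0 \<le> A" "\<forall>r. \<forall>\<omega>\<in>space M. \<bar>f r \<omega>\<bar> \<le> A" using bounded_process_bound[OF assms(1)] by blast
  note A = A(1) A(2)[rule_format]
  obtain B where B: "0 \<le> B" "\<forall>r. \<forall>\<omega>\<in>space M. \<bar>g r \<omega>\<bar> \<le> B" using bounded_process_bound[OF assms(2)] by blast
  note B = B(1) B(2)[rule_format]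
  note b = A(2) B(2) A(1) B(1)
  show ?thesis
  proof (rule bounded_processI[where B="A * B"])
    show "\<bar>f r \<omega> * g r \<omega>\<bar> \<le> A * B" if "\<omega> \<in> space M" for r \<omega>
      unfolding abs_mult using b(1)[OF that] b(2)[OF that] b(3,4) by (intro mult_mono) auto
    show "(\<lambda>(r, \<omega>). f r \<omega> * g r \<omega>) \<in> borel_measurable (borel \<Otimes>\<^sub>M M)"
      using bounded_processD[OF assms(1)] bounded_processD[OF assms(2)] by (simp add: case_prod_beta')
  qed
qed

lemma bounded_process_cmult: "bounded_process f \<Longrightarrow> bounded_process (\<lambda>r \<omega>. c * f r \<omega>)"
  using bounded_process_mult[OF bounded_process_const] .

lemma bounded_process_uminus: "bounded_process f \<Longrightarrow> bounded_process (\<lambda>r \<omega>. - f r \<omega>)"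
  using bounded_process_cmult[of f "-1"] by simp

lemma bounded_process_diff:
  "bounded_process f \<Longrightarrow> bounded_process g \<Longrightarrow> bounded_process (\<lambda>r \<omega>. f r \<omega> - g r \<omega>)"
  using bounded_process_add[OF _ bounded_process_uminus] by simp

lemma bounded_process_power2:
  "bounded_process f \<Longrightarrow> bounded_process (\<lambda>r \<omega>. (f r \<omega>)\<^sup>2)"
  unfolding power2_eq_square by (rule bounded_process_mult)

lemma bounded_process_sum:
  "(\<And>i. i \<in> A \<Longrightarrow> bounded_process (f i)) \<Longrightarrow> bounded_process (\<lambda>r \<omega>. \<Sum>i\<in>A. f i r \<omega>)"
  by (induction A rule: infinite_finite_induct) (simp_all add: bounded_process_const bounded_process_add)

lemmas bounded_process_intros = bounded_process_const bounded_process_add bounded_process_diff bounded_process_uminus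
  bounded_process_power2 bounded_process_mult bounded_process_sum

lemma bounded_process_random_variable: "bounded_process f \<Longrightarrow> f r \<in> borel_measurable M"
  by (rule bounded_process_measurable[where g="\<lambda>_. r" and h="\<lambda>x. x"]) auto

lemma bounded_process_integrable:
  assumes f: "bounded_process f" shows "integrable M (f r)"
proof -
  obtain B where B: "0 \<le> B" "\<forall>r. \<forall>\<omega>\<in>space M. \<bar>f r \<omega>\<bar> \<le> B" using bounded_process_bound[OF f] by blast
  note B = B(1) B(2)[rule_format]
  show ?thesis
    by (rule integrable_const_bound[where B=B, OF _ bounded_process_random_variable[OF f]])
       (rule AE_I2, simp only: real_norm_def B(2))
qed

lemma bounded_process_set_integrable:
  assumes f: "bounded_process f" and \<omega>: "\<omega> \<in> space M"
  shows "set_integrable lborel {s..t} (\<lambda>r. f r \<omega>)"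
proof -
  obtain B where B: "0 \<le> B" "\<forall>r. \<forall>\<omega>\<in>space M. \<bar>f r \<omega>\<bar> \<le> B" using bounded_process_bound[OF f] by blast
  note B = B(1) B(2)[rule_format]
  have m: "(\<lambda>r. f r \<omega>) \<in> borel_measurable borel"
    using bounded_process_measurable[OF f, of "\<lambda>r. r" borel "\<lambda>_. \<omega>"] \<omega> by simp
  show ?thesis unfolding set_integrable_def
  proof (rule integrableI_bounded_set_indicator[where B=B])
    show "(\<lambda>r. f r \<omega>) \<in> borel_measurable lborel" using m by simp
    show "emeasure lborel {s..t} < \<infinity>" by (simp add: emeasure_lborel_Icc_eq)
    show "AE x in lborel. x \<in> {s..t} \<longrightarrow> norm (f x \<omega>) \<le> B"
      by (intro AE_I2 impI) (simp only: real_norm_def B(2)[OF \<omega>])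
  qed simp
qed

lemma bounded_process_integral_bound:
  assumes f: "bounded_process f" and \<omega>: "\<omega> \<in> space M" and st: "s \<le> t" and B: "\<And>r. \<bar>f r \<omega>\<bar> \<le> B"
  shows "\<bar>LBINT r:{s..t}. f r \<omega>\<bar> \<le> B * (t - s)"
proof -
  have "norm (LBINT r:{s..t}. f r \<omega>) \<le> (LBINT r:{s..t}. \<bar>f r \<omega>\<bar>)"
    using set_integral_norm_bound[OF bounded_process_set_integrable[OF f \<omega>]] by simp
  also have "\<dots> \<le> (LBINT r:{s..t}. B)"
  proof (rule set_integral_mono)
    show "set_integrable lborel {s..t} (\<lambda>r. \<bar>f r \<omega>\<bar>)"
      by (rule set_integrable_abs[OF bounded_process_set_integrable[OF f \<omega>]])
    show "set_integrable lborel {s..t} (\<lambda>r. B)"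
      using bounded_process_set_integrable[OF bounded_process_const \<omega>] .
  qed (rule B)
  also have "\<dots> = B * (t - s)" using st by (simp add: set_lebesgue_integral_def)
  finally show ?thesis by simp
qed

lemma bounded_process_integral_measurable:
  assumes f: "bounded_process f"
  shows "(\<lambda>\<omega>. LBINT r:{s..t}. f r \<omega>) \<in> borel_measurable M"
proof -
  have 1: "(\<lambda>x. f (snd x) (fst x)) \<in> borel_measurable (M \<Otimes>\<^sub>M lborel)"
    by (rule bounded_process_measurable[OF f]) measurable
  have 2: "(\<lambda>x. indicat_real {s..t} (snd x)) \<in> borel_measurable (M \<Otimes>\<^sub>M lborel)"
    by measurable
  have "(\<lambda>(\<omega>, r). indicat_real {s..t} r *\<^sub>R f r \<omega>) \<in> borel_measurable (M \<Otimes>\<^sub>M lborel)"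
    unfolding case_prod_beta' by (rule borel_measurable_scaleR[OF 2 1])
  then show ?thesis
    unfolding set_lebesgue_integral_def by (rule lborel.borel_measurable_lebesgue_integral)
qed

lemma bounded_process_integral_integrable:
  assumes f: "bounded_process f" and st: "s \<le> t"
  shows "integrable M (\<lambda>\<omega>. LBINT r:{s..t}. f r \<omega>)"
proof -
  obtain B where B: "0 \<le> B" "\<forall>r. \<forall>\<omega>\<in>space M. \<bar>f r \<omega>\<bar> \<le> B" using bounded_process_bound[OF f] by blast
  note B = B(1) B(2)[rule_format]
  show ?thesis
    by (rule integrable_const_bound[where B="B * (t - s)"])
       (intro AE_I2, simp only: real_norm_def bounded_process_integral_bound[OF f _ st B(2)], rule bounded_process_integral_measurable[OF f])
qed

section \<open>Expected time integrals and limits of products\<close>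

definition time_integral :: "real \<Rightarrow> real \<Rightarrow> (real \<Rightarrow> 'a \<Rightarrow> real) \<Rightarrow> real" where
  "time_integral s t f = (\<integral>\<omega>. (LBINT r:{s..t}. f r \<omega>) \<partial>M)"

lemma time_integral_fubini:
  assumes f: "bounded_process f"
  shows "time_integral s t f = (LBINT r:{s..t}. expectation (f r))"
    and "set_integrable lborel {s..t} (\<lambda>r. expectation (f r))"
proof -
  interpret P: pair_sigma_finite lborel M ..
  obtain B where B: "0 \<le> B" "\<forall>r. \<forall>\<omega>\<in>space M. \<bar>f r \<omega>\<bar> \<le> B" using bounded_process_bound[OF f] by blast
  note B = B(1) B(2)[rule_format]
  have fm: "(\<lambda>x. f (fst x) (snd x)) \<in> borel_measurable (lborel \<Otimes>\<^sub>M M)"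
    by (rule bounded_process_measurable[OF f]) measurable
  have im: "(\<lambda>x. indicat_real {s..t} (fst x)) \<in> borel_measurable (lborel \<Otimes>\<^sub>M M)"
    by measurable
  have i: "integrable (lborel \<Otimes>\<^sub>M M) (\<lambda>(r, \<omega>). indicator {s..t} r *\<^sub>R f r \<omega>)"
  proof (rule integrableI_bounded_set[where A="{s..t} \<times> space M" and B=B])
    show "{s..t} \<times> space M \<in> sets (lborel \<Otimes>\<^sub>M M)" by auto
    show "(\<lambda>(r, \<omega>). indicat_real {s..t} r *\<^sub>R f r \<omega>) \<in> borel_measurable (lborel \<Otimes>\<^sub>M M)"
      unfolding case_prod_beta' by (rule borel_measurable_scaleR[OF im fm])
    show "emeasure (lborel \<Otimes>\<^sub>M M) ({s..t} \<times> space M) < \<infinity>"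
      by (subst emeasure_pair_measure_Times) (auto simp: emeasure_lborel_Icc_eq emeasure_space_1)
    have "norm (case x of (r, \<omega>) \<Rightarrow> indicat_real {s..t} r *\<^sub>R f r \<omega>) \<le> B" if "x \<in> {s..t} \<times> space M" for x
    proof -
      have "\<bar>f (fst x) (snd x)\<bar> \<le> B" using B(2)[of "snd x" "fst x"] that by auto
      then show ?thesis using that by (cases x) simp
    qed
    then show "AE x in lborel \<Otimes>\<^sub>M M. x \<in> {s..t} \<times> space M \<longrightarrow> norm (case x of (r, \<omega>) \<Rightarrow> indicat_real {s..t} r *\<^sub>R f r \<omega>) \<le> B"
      by simp
    have "(case x of (r, \<omega>) \<Rightarrow> indicat_real {s..t} r *\<^sub>R f r \<omega>) = 0" if "x \<notin> {s..t} \<times> space M" "x \<in> space (lborel \<Otimes>\<^sub>M M)" for x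
      using that by (cases x) (auto simp: space_pair_measure)
    then show "AE x in lborel \<Otimes>\<^sub>M M. x \<notin> {s..t} \<times> space M \<longrightarrow> (case x of (r, \<omega>) \<Rightarrow> indicat_real {s..t} r *\<^sub>R f r \<omega>) = 0"
      by (intro AE_I2) auto
  qed
  show "time_integral s t f = (LBINT r:{s..t}. expectation (f r))"
    unfolding time_integral_def set_lebesgue_integral_def
    using P.Fubini_integral[OF i] by simp
  show "set_integrable lborel {s..t} (\<lambda>r. expectation (f r))"
    unfolding set_integrable_def using P.integrable_fst[OF i] by simp
qed

lemma time_integral_add:
  assumes "bounded_process f" "bounded_process g"
  shows "time_integral s t (\<lambda>r \<omega>. f r \<omega> + g r \<omega>) = time_integral s t f + time_integral s t g"
proof -
  have "time_integral s t (\<lambda>r \<omega>. f r \<omega> + g r \<omega>) = (LBINT r:{s..t}. expectation (f r) + expectation (g r))"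
    by (subst time_integral_fubini(1)[OF bounded_process_add[OF assms]])
       (simp add: Bochner_Integration.integral_add bounded_process_integrable[OF assms(1)] bounded_process_integrable[OF assms(2)])
  then show ?thesis
    by (simp add: set_integral_add time_integral_fubini[OF assms(1)] time_integral_fubini[OF assms(2)])
qed

lemma time_integral_cmult:
  assumes "bounded_process f"
  shows "time_integral s t (\<lambda>r \<omega>. c * f r \<omega>) = c * time_integral s t f"
  by (simp add: time_integral_fubini(1)[OF assms] time_integral_fubini(1)[OF bounded_process_cmult[OF assms]])

lemma time_integral_diff:
  assumes "bounded_process f" "bounded_process g"
  shows "time_integral s t (\<lambda>r \<omega>. f r \<omega> - g r \<omega>) = time_integral s t f - time_integral s t g"
  using time_integral_add[OF assms(1) bounded_process_cmult[OF assms(2), of "-1"], of s t]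
    time_integral_cmult[OF assms(2), of s t "-1"] by simp

lemma time_integral_mono:
  assumes "bounded_process f" "bounded_process g"
    and "\<And>r \<omega>. \<omega> \<in> space M \<Longrightarrow> r \<in> {s..t} \<Longrightarrow> f r \<omega> \<le> g r \<omega>"
  shows "time_integral s t f \<le> time_integral s t g"
  unfolding time_integral_fubini(1)[OF assms(1)] time_integral_fubini(1)[OF assms(2)]
  by (intro set_integral_mono time_integral_fubini(2) integral_mono bounded_process_integrable assms)

lemma time_integral_nonneg:
  assumes "bounded_process f" "\<And>r \<omega>. \<omega> \<in> space M \<Longrightarrow> r \<in> {s..t} \<Longrightarrow> 0 \<le> f r \<omega>"
  shows "0 \<le> time_integral s t f"
  using time_integral_mono[OF bounded_process_const[of 0] assms(1)] assms(2)
  by (simp add: time_integral_def set_lebesgue_integral_def)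

lemma time_integral_mono_interval:
  assumes f: "bounded_process f" "\<And>r \<omega>. \<omega> \<in> space M \<Longrightarrow> 0 \<le> f r \<omega>" and st: "s' \<le> s" "t \<le> t'"
  shows "time_integral s t f \<le> time_integral s' t' f"
  unfolding time_integral_fubini(1)[OF f(1)]
proof -
  have nn: "0 \<le> expectation (f r)" for r by (intro Bochner_Integration.integral_nonneg f(2))
  show "(LBINT r:{s..t}. expectation (f r)) \<le> (LBINT r:{s'..t'}. expectation (f r))"
    unfolding set_lebesgue_integral_def
    by (intro integral_mono time_integral_fubini(2)[OF f(1), unfolded set_integrable_def])
       (use st nn in \<open>auto simp: indicator_def\<close>)
qed

lemma time_integral_const: "s \<le> t \<Longrightarrow> time_integral s t (\<lambda>_ _. c) = c * (t - s)"
  by (simp add: time_integral_def set_lebesgue_integral_def prob_space)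

text \<open>Young's inequality under the expectation. The free weight \<delta> is later matched to
  the length of a time interval, where the two factors have different orders of magnitude.\<close>

lemma abs_expectation_mult_le:
  fixes X Y :: "'a \<Rightarrow> real"
  assumes [measurable]: "X \<in> borel_measurable M" "Y \<in> borel_measurable M"
    and i: "integrable M (\<lambda>\<omega>. (X \<omega>)\<^sup>2)" "integrable M (\<lambda>\<omega>. (Y \<omega>)\<^sup>2)"
    and \<delta>: "\<delta> > 0"
  shows "\<bar>expectation (\<lambda>\<omega>. X \<omega> * Y \<omega>)\<bar> \<le> (\<delta> * expectation (\<lambda>\<omega>. (X \<omega>)\<^sup>2) + expectation (\<lambda>\<omega>. (Y \<omega>)\<^sup>2) / \<delta>) / 2"
proof -
  have "\<bar>expectation (\<lambda>\<omega>. X \<omega> * Y \<omega>)\<bar> \<le> expectation (\<lambda>\<omega>. \<bar>X \<omega> * Y \<omega>\<bar>)" by (rule integral_abs_bound)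
  also have "\<dots> \<le> expectation (\<lambda>\<omega>. (\<delta> * (X \<omega>)\<^sup>2 + (Y \<omega>)\<^sup>2 / \<delta>) / 2)"
  proof (rule integral_mono)
    show "integrable M (\<lambda>\<omega>. \<bar>X \<omega> * Y \<omega>\<bar>)" using integrable_mult_squares[OF assms(1,2) i] by simp
    show "integrable M (\<lambda>\<omega>. (\<delta> * (X \<omega>)\<^sup>2 + (Y \<omega>)\<^sup>2 / \<delta>) / 2)" using i by simp
    fix \<omega>
    have "0 \<le> (\<delta> * \<bar>X \<omega>\<bar> - \<bar>Y \<omega>\<bar>)\<^sup>2 / \<delta>" using \<delta> by simp
    also have "\<dots> = \<delta> * (X \<omega>)\<^sup>2 + (Y \<omega>)\<^sup>2 / \<delta> - 2 * (\<bar>X \<omega>\<bar> * \<bar>Y \<omega>\<bar>)"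
      using \<delta> by (simp add: power2_diff power_mult_distrib field_simps power2_eq_square)
    finally show "\<bar>X \<omega> * Y \<omega>\<bar> \<le> (\<delta> * (X \<omega>)\<^sup>2 + (Y \<omega>)\<^sup>2 / \<delta>) / 2" by (simp add: abs_mult)
  qed
  also have "\<dots> = (\<delta> * expectation (\<lambda>\<omega>. (X \<omega>)\<^sup>2) + expectation (\<lambda>\<omega>. (Y \<omega>)\<^sup>2) / \<delta>) / 2" using i by simp
  finally show ?thesis .
qed

lemma tendsto_expectation_mult_left:
  fixes X :: "'a \<Rightarrow> real" and Y :: "nat \<Rightarrow> 'a \<Rightarrow> real"
  assumes m: "X \<in> borel_measurable M" "\<And>k. Y k \<in> borel_measurable M"
    and i: "integrable M (\<lambda>\<omega>. (X \<omega>)\<^sup>2)" "\<And>k. integrable M (\<lambda>\<omega>. (Y k \<omega>)\<^sup>2)"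
    and lim: "(\<lambda>k. expectation (\<lambda>\<omega>. (Y k \<omega>)\<^sup>2)) \<longlonglongrightarrow> 0"
  shows "(\<lambda>k. expectation (\<lambda>\<omega>. X \<omega> * Y k \<omega>)) \<longlonglongrightarrow> 0"
  by (rule tendsto_zero_weighted_bound[OF _ abs_expectation_mult_le[OF m i] lim]) simp

lemma abs_time_integral_mult_le:
  assumes f: "bounded_process f" and g: "bounded_process g" and \<delta>: "0 < \<delta>"
  shows "\<bar>time_integral s t (\<lambda>r \<omega>. f r \<omega> * g r \<omega>)\<bar> \<le>
    (\<delta> * time_integral s t (\<lambda>r \<omega>. (f r \<omega>)\<^sup>2) + time_integral s t (\<lambda>r \<omega>. (g r \<omega>)\<^sup>2) / \<delta>) / 2"
proof -
  let ?h = "\<lambda>r \<omega>. \<delta>/2 * (f r \<omega>)\<^sup>2 + 1/(2*\<delta>) * (g r \<omega>)\<^sup>2"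
  have h: "bounded_process ?h" by (intro bounded_process_intros f g)
  have fg: "bounded_process (\<lambda>r \<omega>. f r \<omega> * g r \<omega>)" by (intro bounded_process_intros f g)
  have eq: "time_integral s t ?h = (\<delta> * time_integral s t (\<lambda>r \<omega>. (f r \<omega>)\<^sup>2) + time_integral s t (\<lambda>r \<omega>. (g r \<omega>)\<^sup>2) / \<delta>) / 2"
    using \<delta> by (simp only: time_integral_add time_integral_cmult bounded_process_intros f g) (simp add: field_simps)
  have le: "\<bar>x * y\<bar> \<le> \<delta>/2 * x\<^sup>2 + 1/(2*\<delta>) * y\<^sup>2" for x y :: real
  proof -
    have "0 \<le> (\<delta> * \<bar>x\<bar> - \<bar>y\<bar>)\<^sup>2 / (2*\<delta>)" using \<delta> by simp
    also have "\<dots> = \<delta>/2 * x\<^sup>2 + 1/(2*\<delta>) * y\<^sup>2 - \<bar>x\<bar> * \<bar>y\<bar>"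
      using \<delta> by (simp add: power2_diff power_mult_distrib field_simps power2_eq_square)
    finally show ?thesis by (simp add: abs_mult)
  qed
  have "time_integral s t (\<lambda>r \<omega>. f r \<omega> * g r \<omega>) \<le> time_integral s t ?h"
    by (rule time_integral_mono[OF fg h]) (rule order_trans[OF abs_ge_self le])
  moreover have "time_integral s t (\<lambda>r \<omega>. - (f r \<omega> * g r \<omega>)) \<le> time_integral s t ?h"
    by (rule time_integral_mono[OF bounded_process_uminus[OF fg] h]) (rule order_trans[OF abs_ge_minus_self le])
  moreover have "time_integral s t (\<lambda>r \<omega>. - (f r \<omega> * g r \<omega>)) = - time_integral s t (\<lambda>r \<omega>. f r \<omega> * g r \<omega>)"
    using time_integral_cmult[OF fg, of s t "-1"] by simp
  ultimately show ?thesis unfolding eq by linarith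
qed

text \<open>The product is expanded about the limit, \<open>A * B - f * g = (A - f) * (B - g) + f *
  (B - g) + g * (A - f)\<close>; each term contains a factor that vanishes in mean square.\<close>

lemma tendsto_time_integral_mult:
  assumes A: "\<And>k. bounded_process (A k)" and B: "\<And>k. bounded_process (B k)" and f: "bounded_process f" and g: "bounded_process g"
    and lim: "(\<lambda>k. time_integral s t (\<lambda>r \<omega>. (A k r \<omega> - f r \<omega>)\<^sup>2)) \<longlonglongrightarrow> 0"
      "(\<lambda>k. time_integral s t (\<lambda>r \<omega>. (B k r \<omega> - g r \<omega>)\<^sup>2)) \<longlonglongrightarrow> 0"
  shows "(\<lambda>k. time_integral s t (\<lambda>r \<omega>. A k r \<omega> * B k r \<omega>)) \<longlonglongrightarrow> time_integral s t (\<lambda>r \<omega>. f r \<omega> * g r \<omega>)"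
proof -
  have a: "bounded_process (\<lambda>r \<omega>. A k r \<omega> - f r \<omega>)" and b: "bounded_process (\<lambda>r \<omega>. B k r \<omega> - g r \<omega>)" for k
    by (intro bounded_process_intros A B f g)+
  have nn: "0 \<le> time_integral s t (\<lambda>r \<omega>. (h r \<omega>)\<^sup>2)" if "bounded_process h" for h
    by (rule time_integral_nonneg) (intro bounded_process_intros that, simp)
  have 1: "(\<lambda>k. time_integral s t (\<lambda>r \<omega>. f r \<omega> * (B k r \<omega> - g r \<omega>))) \<longlonglongrightarrow> 0"
    by (rule tendsto_zero_weighted_bound[OF nn[OF f] abs_time_integral_mult_le[OF f b] lim(2)])
  have 2: "(\<lambda>k. time_integral s t (\<lambda>r \<omega>. g r \<omega> * (A k r \<omega> - f r \<omega>))) \<longlonglongrightarrow> 0"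
    by (rule tendsto_zero_weighted_bound[OF nn[OF g] abs_time_integral_mult_le[OF g a] lim(1)])
  have 3: "(\<lambda>k. time_integral s t (\<lambda>r \<omega>. (A k r \<omega> - f r \<omega>) * (B k r \<omega> - g r \<omega>))) \<longlonglongrightarrow> 0"
  proof (rule Lim_null_comparison)
    show "(\<lambda>k. (time_integral s t (\<lambda>r \<omega>. (A k r \<omega> - f r \<omega>)\<^sup>2) + time_integral s t (\<lambda>r \<omega>. (B k r \<omega> - g r \<omega>)\<^sup>2)) / 2) \<longlonglongrightarrow> 0"
      using tendsto_divide[OF tendsto_add[OF lim] tendsto_const[of 2]] by simp
    show "\<forall>\<^sub>F k in sequentially. norm (time_integral s t (\<lambda>r \<omega>. (A k r \<omega> - f r \<omega>) * (B k r \<omega> - g r \<omega>)))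
      \<le> (time_integral s t (\<lambda>r \<omega>. (A k r \<omega> - f r \<omega>)\<^sup>2) + time_integral s t (\<lambda>r \<omega>. (B k r \<omega> - g r \<omega>)\<^sup>2)) / 2"
      using abs_time_integral_mult_le[OF a b, of 1 s t] by simp
  qed
  have "time_integral s t (\<lambda>r \<omega>. A k r \<omega> * B k r \<omega>) = time_integral s t (\<lambda>r \<omega>. (A k r \<omega> - f r \<omega>) * (B k r \<omega> - g r \<omega>)) +
     time_integral s t (\<lambda>r \<omega>. f r \<omega> * (B k r \<omega> - g r \<omega>)) + time_integral s t (\<lambda>r \<omega>. g r \<omega> * (A k r \<omega> - f r \<omega>)) +
     time_integral s t (\<lambda>r \<omega>. f r \<omega> * g r \<omega>)" for k
  proof -
    have "A k r \<omega> * B k r \<omega> = (A k r \<omega> - f r \<omega>) * (B k r \<omega> - g r \<omega>) + f r \<omega> * (B k r \<omega> - g r \<omega>) +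
       g r \<omega> * (A k r \<omega> - f r \<omega>) + f r \<omega> * g r \<omega>" for r \<omega> by algebra
    then show ?thesis by (simp only: time_integral_add bounded_process_intros a b f g)
  qed
  then show ?thesis using tendsto_add[OF tendsto_add[OF tendsto_add[OF 3 1] 2] tendsto_const] by simp
qed

lemma integrable_power2_add:
  fixes X Y :: "'a \<Rightarrow> real"
  assumes "X \<in> borel_measurable M" "Y \<in> borel_measurable M"
    and "integrable M (\<lambda>\<omega>. (X \<omega>)\<^sup>2)" "integrable M (\<lambda>\<omega>. (Y \<omega>)\<^sup>2)"
  shows "integrable M (\<lambda>\<omega>. (X \<omega> + Y \<omega>)\<^sup>2)"
  using integrable_mult_squares[OF assms] assms by (simp add: power2_sum mult.assoc)

lemma integrable_power2_diff:
  fixes X Y :: "'a \<Rightarrow> real"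
  assumes "X \<in> borel_measurable M" "Y \<in> borel_measurable M"
    and "integrable M (\<lambda>\<omega>. (X \<omega>)\<^sup>2)" "integrable M (\<lambda>\<omega>. (Y \<omega>)\<^sup>2)"
  shows "integrable M (\<lambda>\<omega>. (X \<omega> - Y \<omega>)\<^sup>2)"
  using integrable_power2_add[of X "\<lambda>\<omega>. - Y \<omega>"] assms by simp

lemma tendsto_expectation_mult:
  fixes X Y :: "'a \<Rightarrow> real" and A B :: "nat \<Rightarrow> 'a \<Rightarrow> real"
  assumes m: "X \<in> borel_measurable M" "Y \<in> borel_measurable M" "\<And>k. A k \<in> borel_measurable M" "\<And>k. B k \<in> borel_measurable M"
    and i: "integrable M (\<lambda>\<omega>. (X \<omega>)\<^sup>2)" "integrable M (\<lambda>\<omega>. (Y \<omega>)\<^sup>2)"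
      "\<And>k. integrable M (\<lambda>\<omega>. (A k \<omega> - X \<omega>)\<^sup>2)" "\<And>k. integrable M (\<lambda>\<omega>. (B k \<omega> - Y \<omega>)\<^sup>2)"
    and lim: "(\<lambda>k. expectation (\<lambda>\<omega>. (A k \<omega> - X \<omega>)\<^sup>2)) \<longlonglongrightarrow> 0" "(\<lambda>k. expectation (\<lambda>\<omega>. (B k \<omega> - Y \<omega>)\<^sup>2)) \<longlonglongrightarrow> 0"
  shows "(\<lambda>k. expectation (\<lambda>\<omega>. A k \<omega> * B k \<omega>)) \<longlonglongrightarrow> expectation (\<lambda>\<omega>. X \<omega> * Y \<omega>)"
proof -
  have mA: "(\<lambda>\<omega>. A k \<omega> - X \<omega>) \<in> borel_measurable M" and mB: "(\<lambda>\<omega>. B k \<omega> - Y \<omega>) \<in> borel_measurable M" for k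
    using m by measurable
  note iAB = integrable_mult_squares[OF mA mB i(3,4)] integrable_mult_squares[OF m(1) mB i(1,4)]
    integrable_mult_squares[OF m(2) mA i(2,3)] integrable_mult_squares[OF m(1,2) i(1,2)]
  have 1: "(\<lambda>k. expectation (\<lambda>\<omega>. X \<omega> * (B k \<omega> - Y \<omega>))) \<longlonglongrightarrow> 0"
    by (rule tendsto_expectation_mult_left[OF m(1) mB i(1,4) lim(2)])
  have 2: "(\<lambda>k. expectation (\<lambda>\<omega>. Y \<omega> * (A k \<omega> - X \<omega>))) \<longlonglongrightarrow> 0"
    by (rule tendsto_expectation_mult_left[OF m(2) mA i(2,3) lim(1)])
  have 3: "(\<lambda>k. expectation (\<lambda>\<omega>. (A k \<omega> - X \<omega>) * (B k \<omega> - Y \<omega>))) \<longlonglongrightarrow> 0"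
  proof (rule Lim_null_comparison)
    show "(\<lambda>k. (expectation (\<lambda>\<omega>. (A k \<omega> - X \<omega>)\<^sup>2) + expectation (\<lambda>\<omega>. (B k \<omega> - Y \<omega>)\<^sup>2)) / 2) \<longlonglongrightarrow> 0"
      using tendsto_divide[OF tendsto_add[OF lim] tendsto_const[of 2]] by simp
    show "\<forall>\<^sub>F k in sequentially. norm (expectation (\<lambda>\<omega>. (A k \<omega> - X \<omega>) * (B k \<omega> - Y \<omega>))) \<le>
       (expectation (\<lambda>\<omega>. (A k \<omega> - X \<omega>)\<^sup>2) + expectation (\<lambda>\<omega>. (B k \<omega> - Y \<omega>)\<^sup>2)) / 2"
      using abs_expectation_mult_le[OF mA mB i(3,4), of 1] by simp
  qed
  have "expectation (\<lambda>\<omega>. A k \<omega> * B k \<omega>) = expectation (\<lambda>\<omega>. (A k \<omega> - X \<omega>) * (B k \<omega> - Y \<omega>)) +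
     expectation (\<lambda>\<omega>. X \<omega> * (B k \<omega> - Y \<omega>)) + expectation (\<lambda>\<omega>. Y \<omega> * (A k \<omega> - X \<omega>)) + expectation (\<lambda>\<omega>. X \<omega> * Y \<omega>)" for k
  proof -
    have "A k \<omega> * B k \<omega> = (A k \<omega> - X \<omega>) * (B k \<omega> - Y \<omega>) + X \<omega> * (B k \<omega> - Y \<omega>) + Y \<omega> * (A k \<omega> - X \<omega>) + X \<omega> * Y \<omega>" for \<omega>
      by algebra
    then show ?thesis by (simp only: Bochner_Integration.integral_add Bochner_Integration.integrable_add iAB)
  qed
  then show ?thesis using tendsto_add[OF tendsto_add[OF tendsto_add[OF 3 1] 2] tendsto_const] by simp
qed

text \<open>
  Truncate $|Y_k - Z|^2$ at level \<open>A\<close>, compare with $Y_l$ for large \<open>l\<close>, and let \<open>A\<close> tend to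
  infinity.
\<close>

lemma L2_limit_of_limit_in_prob:
  fixes Y :: "nat \<Rightarrow> 'a \<Rightarrow> real"
  assumes m [measurable]: "Z \<in> borel_measurable M" "\<And>k. Y k \<in> borel_measurable M"
    and i: "\<And>k l. integrable M (\<lambda>\<omega>. (Y k \<omega> - Y l \<omega>)\<^sup>2)"
    and cauchy: "\<And>k l. expectation (\<lambda>\<omega>. (Y k \<omega> - Y l \<omega>)\<^sup>2) \<le> a k + a l" and a: "a \<longlonglongrightarrow> 0"
    and conv: "tendsto_in_prob M Y Z"
  shows "integrable M (\<lambda>\<omega>. (Y k \<omega> - Z \<omega>)\<^sup>2)" "(\<lambda>k. expectation (\<lambda>\<omega>. (Y k \<omega> - Z \<omega>)\<^sup>2)) \<longlonglongrightarrow> 0"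
proof -
  have trunc: "expectation (\<lambda>\<omega>. min A ((Y k \<omega> - Z \<omega>)\<^sup>2)) \<le> 2 * a k" if A: "A \<ge> 0" for A k
  proof (rule field_le_epsilon)
    fix e :: real assume e: "0 < e"
    \<comment> \<open>The tolerance \<open>e\<close> is divided among three errors:
      \<open>2 * a l\<close>, the part \<open>2 * \<epsilon>\<^sup>2\<close> from points where
      \<open>Y l\<close> is close to \<open>Z\<close>, and the cost \<open>A * \<delta>\<close> of
      the exceptional set.\<close>
    define \<epsilon> where "\<epsilon> = sqrt (e / 6)"
    have \<epsilon>: "\<epsilon> > 0" "2 * \<epsilon>\<^sup>2 = e / 3" using e by (auto simp: \<epsilon>_def)
    define \<delta> where "\<delta> = e / (3 * (A + 1))"
    have \<delta>: "\<delta> > 0" "A * \<delta> \<le> e / 3" using e A by (auto simp: \<delta>_def field_simps)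
    have "\<forall>\<^sub>F l in sequentially. \<exists>E\<in>sets M. measure M E < \<delta> \<and> {\<omega> \<in> space M. ennreal \<epsilon> \<le> ennreal \<bar>Y l \<omega> - Z \<omega>\<bar>} \<subseteq> E"
      using conv \<epsilon>(1) \<delta>(1) unfolding tendsto_in_prob_def vanishes_in_prob_def by blast
    moreover have "\<forall>\<^sub>F l in sequentially. a l < e / 6"
      using order_tendstoD(2)[OF a, of "e / 6"] e by simp
    ultimately have "\<forall>\<^sub>F l in sequentially. (\<exists>E\<in>sets M. measure M E < \<delta> \<and> {\<omega> \<in> space M. ennreal \<epsilon> \<le> ennreal \<bar>Y l \<omega> - Z \<omega>\<bar>} \<subseteq> E) \<and> a l < e / 6"
      by (rule eventually_conj)
    then obtain l E where E: "E \<in> sets M" "measure M E < \<delta>" "{\<omega> \<in> space M. ennreal \<epsilon> \<le> ennreal \<bar>Y l \<omega> - Z \<omega>\<bar>} \<subseteq> E" and al: "a l < e / 6"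
      by (auto dest!: eventually_happens)
    have "expectation (\<lambda>\<omega>. min A ((Y k \<omega> - Z \<omega>)\<^sup>2)) \<le> expectation (\<lambda>\<omega>. 2 * (Y k \<omega> - Y l \<omega>)\<^sup>2 + 2 * \<epsilon>\<^sup>2 + A * indicator E \<omega>)"
    proof (rule integral_mono)
      show "integrable M (\<lambda>\<omega>. min A ((Y k \<omega> - Z \<omega>)\<^sup>2))"
        by (rule integrable_const_bound[where B=A]) (use A in auto)
      show "integrable M (\<lambda>\<omega>. 2 * (Y k \<omega> - Y l \<omega>)\<^sup>2 + 2 * \<epsilon>\<^sup>2 + A * indicator E \<omega>)"
        using i E by (auto intro!: Bochner_Integration.integrable_add integrable_real_indicator simp: emeasure_eq_measure)
      fix \<omega> assume \<omega>: "\<omega> \<in> space M"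
      show "min A ((Y k \<omega> - Z \<omega>)\<^sup>2) \<le> 2 * (Y k \<omega> - Y l \<omega>)\<^sup>2 + 2 * \<epsilon>\<^sup>2 + A * indicator E \<omega>"
      proof (cases "\<omega> \<in> E")
        case True then show ?thesis by (simp add: add_nonneg_nonneg min.coboundedI1)
      next
        case False
        then have "\<not> ennreal \<epsilon> \<le> ennreal \<bar>Y l \<omega> - Z \<omega>\<bar>" using E(3) \<omega> by auto
        then have "\<bar>Y l \<omega> - Z \<omega>\<bar> < \<epsilon>" by (metis ennreal_leI not_le)
        then have "(Y l \<omega> - Z \<omega>)\<^sup>2 \<le> \<epsilon>\<^sup>2" by (metis abs_ge_zero less_imp_le power2_abs power_mono)
        moreover have "(Y k \<omega> - Z \<omega>)\<^sup>2 \<le> 2 * (Y k \<omega> - Y l \<omega>)\<^sup>2 + 2 * (Y l \<omega> - Z \<omega>)\<^sup>2"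
        proof -
          have "0 \<le> ((Y k \<omega> - Y l \<omega>) - (Y l \<omega> - Z \<omega>))\<^sup>2" by simp
          then show ?thesis by (simp add: power2_eq_square algebra_simps)
        qed
        ultimately show ?thesis using False by simp
      qed
    qed
    also have "\<dots> = 2 * expectation (\<lambda>\<omega>. (Y k \<omega> - Y l \<omega>)\<^sup>2) + 2 * \<epsilon>\<^sup>2 + A * measure M E"
      using i[of k l] E(1) by (simp add: prob_space emeasure_eq_measure)
    also have "\<dots> \<le> 2 * (a k + a l) + e / 3 + e / 3"
      using mult_left_mono[OF cauchy[of k l], of 2] \<epsilon>(2) \<delta>(2) mult_left_mono[OF less_imp_le[OF E(2)] A]
      by (intro add_mono) auto
    also have "\<dots> \<le> 2 * a k + e" using al by simp
    finally show "expectation (\<lambda>\<omega>. min A ((Y k \<omega> - Z \<omega>)\<^sup>2)) \<le> 2 * a k + e" .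
  qed
  \<comment> \<open>At truncation level 0 the left-hand side is 0, which yields the sign of
    \<open>a k\<close>.\<close>
  have a0: "0 \<le> a k" for k
    using trunc[of 0 k] by simp
  \<comment> \<open>The truncation is removed by monotone convergence in the nonnegative integral,
    since integrability of the square is only a consequence of this bound.\<close>
  have nn: "(\<integral>\<^sup>+\<omega>. ennreal ((Y k \<omega> - Z \<omega>)\<^sup>2) \<partial>M) \<le> ennreal (2 * a k)" for k
  proof -
    have "(\<integral>\<^sup>+\<omega>. ennreal ((Y k \<omega> - Z \<omega>)\<^sup>2) \<partial>M) = (\<integral>\<^sup>+\<omega>. (SUP n. ennreal (min (real n) ((Y k \<omega> - Z \<omega>)\<^sup>2))) \<partial>M)"
    proof (rule nn_integral_cong)
      fix \<omega>
      show "ennreal ((Y k \<omega> - Z \<omega>)\<^sup>2) = (SUP n. ennreal (min (real n) ((Y k \<omega> - Z \<omega>)\<^sup>2)))"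
      proof (rule antisym)
        obtain n where "(Y k \<omega> - Z \<omega>)\<^sup>2 \<le> real n" using real_arch_simple by blast
        then show "ennreal ((Y k \<omega> - Z \<omega>)\<^sup>2) \<le> (SUP n. ennreal (min (real n) ((Y k \<omega> - Z \<omega>)\<^sup>2)))"
          by (intro SUP_upper2[of n]) auto
      qed (auto intro!: SUP_least ennreal_leI)
    qed
    also have "\<dots> = (SUP n. \<integral>\<^sup>+\<omega>. ennreal (min (real n) ((Y k \<omega> - Z \<omega>)\<^sup>2)) \<partial>M)"
      by (rule nn_integral_monotone_convergence_SUP) (auto simp: incseq_def le_fun_def intro!: ennreal_leI)
    also have "\<dots> \<le> ennreal (2 * a k)"
    proof (rule SUP_least)
      fix n
      have "(\<integral>\<^sup>+\<omega>. ennreal (min (real n) ((Y k \<omega> - Z \<omega>)\<^sup>2)) \<partial>M) = ennreal (expectation (\<lambda>\<omega>. min (real n) ((Y k \<omega> - Z \<omega>)\<^sup>2)))"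
        by (rule nn_integral_eq_integral) (auto intro!: integrable_const_bound[where B="real n"])
      then show "(\<integral>\<^sup>+\<omega>. ennreal (min (real n) ((Y k \<omega> - Z \<omega>)\<^sup>2)) \<partial>M) \<le> ennreal (2 * a k)"
        using trunc[of "real n" k] by (simp add: ennreal_leI)
    qed
    finally show ?thesis .
  qed
  have int: "integrable M (\<lambda>\<omega>. (Y k \<omega> - Z \<omega>)\<^sup>2)" for k
    using nn[of k] by (intro integrableI_nonneg) (auto simp: order_le_less_trans)
  then show "integrable M (\<lambda>\<omega>. (Y k \<omega> - Z \<omega>)\<^sup>2)" .
  have le: "expectation (\<lambda>\<omega>. (Y k \<omega> - Z \<omega>)\<^sup>2) \<le> 2 * a k" for k
    using nn[of k] nn_integral_eq_integral[OF int[of k]] a0[of k] by (simp add: ennreal_le_iff)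
  show "(\<lambda>k. expectation (\<lambda>\<omega>. (Y k \<omega> - Z \<omega>)\<^sup>2)) \<longlonglongrightarrow> 0"
  proof (rule Lim_null_comparison)
    show "\<forall>\<^sub>F k in sequentially. norm (expectation (\<lambda>\<omega>. (Y k \<omega> - Z \<omega>)\<^sup>2)) \<le> 2 * a k" using le by simp
    show "(\<lambda>k. 2 * a k) \<longlonglongrightarrow> 0" using tendsto_mult_right_zero[OF a] .
  qed
qed

end

section \<open>Ito integrals of bounded integrands\<close>

context driven_space begin

text \<open>The intervals are disjoint, so at most one coefficient is active. The conclusion
  quantifies over all coefficients \<xi>' on the same nodes, because the truncated processes keep
  the nodes.\<close>

lemma simple_val_cases:
  assumes "simple_proc M F (m, \<tau>, \<xi>)"
  obtains "\<And>\<xi>' \<omega>::'a. simple_val (m, \<tau>, \<xi>') r \<omega> = 0" "\<And>k. k < m \<Longrightarrow> r \<notin> {\<tau> k<..\<tau> (Suc k)}"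
    | k where "k < m" "r \<in> {\<tau> k<..\<tau> (Suc k)}" "\<And>\<xi>' \<omega>::'a. simple_val (m, \<tau>, \<xi>') r \<omega> = \<xi>' k \<omega>"
        "\<And>j. j < m \<Longrightarrow> j \<noteq> k \<Longrightarrow> r \<notin> {\<tau> j<..\<tau> (Suc j)}"
proof (cases "\<exists>k<m. r \<in> {\<tau> k<..\<tau> (Suc k)}")
  case True
  then obtain k where k: "k < m" "r \<in> {\<tau> k<..\<tau> (Suc k)}" by blast
  have disj: "r \<notin> {\<tau> j<..\<tau> (Suc j)}" if "j < m" "j \<noteq> k" for j
  proof (cases "j < k")
    case True
    then have "\<tau> (Suc j) \<le> \<tau> k" using simple_proc_times(5)[OF assms, of "Suc j" k] k by simp
    then show ?thesis using k by auto
  next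
    case False
    then have "\<tau> (Suc k) \<le> \<tau> j" using simple_proc_times(5)[OF assms, of "Suc k" j] that by simp
    then show ?thesis using k by auto
  qed
  have "simple_val (m, \<tau>, \<xi>') r \<omega> = \<xi>' k \<omega>" for \<xi>' \<omega>
  proof -
    have "simple_val (m, \<tau>, \<xi>') r \<omega> = (\<Sum>j<m. if j = k then \<xi>' k \<omega> else 0)"
      unfolding simple_val_def prod.case by (rule sum.cong) (use disj k in auto)
    then show ?thesis using k(1) by simp
  qed
  then show ?thesis using that(2)[OF k] disj by blast
next
  case False
  then have "simple_val (m, \<tau>, \<xi>') r \<omega> = 0" for \<xi>' \<omega>
    unfolding simple_val_def prod.case by (intro sum.neutral) auto
  then show ?thesis using that(1) False by blast
qed

lemma simple_val_bounded_process:
  assumes P: "simple_proc M F P" shows "bounded_process (simple_val P)"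
proof -
  obtain m \<tau> \<xi> where P1: "P = (m, \<tau>, \<xi>)" by (cases P) auto
  note s = simple_proc_times[OF P[unfolded P1]]
  have "bounded_process (\<lambda>r \<omega>. \<xi> k \<omega> * indicator {\<tau> k<..\<tau> (Suc k)} r)" if k: "k < m" for k
  proof (rule bounded_process_mult)
    have "\<exists>K. \<forall>\<omega>\<in>space M. \<bar>\<xi> k \<omega>\<bar> \<le> K" using P k unfolding P1 simple_proc_def by blast
    then obtain K where K: "\<forall>\<omega>\<in>space M. \<bar>\<xi> k \<omega>\<bar> \<le> K" by blast
    show "bounded_process (\<lambda>r. \<xi> k)"
    proof (rule bounded_processI)
      show "(\<lambda>(r, \<omega>). \<xi> k \<omega>) \<in> borel_measurable (borel \<Otimes>\<^sub>M M)"
        unfolding case_prod_beta' by (rule measurable_compose[OF measurable_snd s(4)[OF k]])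
      show "\<bar>\<xi> k \<omega>\<bar> \<le> K" if "\<omega> \<in> space M" for r \<omega> using K that by blast
    qed
    show "bounded_process (\<lambda>r \<omega>. indicat_real {\<tau> k<..\<tau> (Suc k)} r)"
    proof (rule bounded_processI[where B=1])
      show "(\<lambda>(r, \<omega>). indicat_real {\<tau> k<..\<tau> (Suc k)} r) \<in> borel_measurable (borel \<Otimes>\<^sub>M M)"
        unfolding case_prod_beta' by measurable
    qed (simp add: indicator_def)
  qed
  then have "bounded_process (\<lambda>r \<omega>. \<Sum>k\<in>{..<m}. \<xi> k \<omega> * indicator {\<tau> k<..\<tau> (Suc k)} r)"
    by (intro bounded_process_sum) simp
  moreover have "simple_val P = (\<lambda>r \<omega>. \<Sum>k\<in>{..<m}. \<xi> k \<omega> * indicator {\<tau> k<..\<tau> (Suc k)} r)"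
    unfolding P1 simple_val_def by simp
  ultimately show ?thesis by simp
qed

lemma simple_integral_0:
  assumes "simple_proc M F P" shows "SI c P 0 \<omega> = 0"
proof -
  obtain m \<tau> \<xi> where P1: "P = (m, \<tau>, \<xi>)" by (cases P) auto
  have "min 0 (\<tau> (Suc k)) = 0 \<and> min 0 (\<tau> k) = 0" if "k < m" for k
    using simple_proc_times(1)[OF assms[unfolded P1]] that by (simp add: min_absorb1)
  then show ?thesis unfolding P1 simple_integral_def by simp
qed

lemma integral_simple_val_sq:
  fixes \<xi>' :: "nat \<Rightarrow> 'a \<Rightarrow> real"
  assumes P: "simple_proc M F (m, \<tau>, \<xi>)" and t: "0 \<le> t"
  shows "(LBINT r:{0..t}. (simple_val (m, \<tau>, \<xi>') r \<omega>)\<^sup>2) = (\<Sum>k<m. (\<xi>' k \<omega>)\<^sup>2 * (min t (\<tau> (Suc k)) - min t (\<tau> k)))"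
proof -
  note s = simple_proc_times[OF P]
  have sq: "(simple_val (m, \<tau>, \<xi>') r \<omega>)\<^sup>2 =
    (\<Sum>k<m. (\<xi>' k \<omega>)\<^sup>2 * (indicator {\<tau> k<..\<tau> (Suc k)} r * indicator {\<tau> k<..\<tau> (Suc k)} r))" for r
  proof (rule simple_val_cases[OF P, of r])
    assume a: "\<And>\<xi>' \<omega>::'a. simple_val (m, \<tau>, \<xi>') r \<omega> = 0" "\<And>k. k < m \<Longrightarrow> r \<notin> {\<tau> k<..\<tau> (Suc k)}"
    have z: "simple_val (m, \<tau>, \<xi>') r \<omega> = 0" by (rule a(1))
    have "(\<Sum>k<m. (\<xi>' k \<omega>)\<^sup>2 * (indicator {\<tau> k<..\<tau> (Suc k)} r * indicator {\<tau> k<..\<tau> (Suc k)} r)) = 0"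
      by (intro sum.neutral) (use a(2) in auto)
    then show ?thesis unfolding z by simp
  next
    fix k assume k: "k < m" "r \<in> {\<tau> k<..\<tau> (Suc k)}" "\<And>\<xi>' \<omega>::'a. simple_val (m, \<tau>, \<xi>') r \<omega> = \<xi>' k \<omega>"
        "\<And>j. j < m \<Longrightarrow> j \<noteq> k \<Longrightarrow> r \<notin> {\<tau> j<..\<tau> (Suc j)}"
    have "(\<Sum>j<m. (\<xi>' j \<omega>)\<^sup>2 * (indicator {\<tau> j<..\<tau> (Suc j)} r * indicator {\<tau> j<..\<tau> (Suc j)} r)) =
      (\<Sum>j<m. if j = k then (\<xi>' k \<omega>)\<^sup>2 else 0)"
      by (rule sum.cong) (use k in auto)
    then show ?thesis using k(1) unfolding k(3) by simp
  qed
  have i: "set_integrable lborel {0..t} (\<lambda>r. (\<xi>' k \<omega>)\<^sup>2 * (indicator {\<tau> k<..\<tau> (Suc k)} r * indicator {\<tau> k<..\<tau> (Suc k)} r))" if "k < m" for k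
    using s(2)[OF that] by (intro set_integrable_mult_right overlap_integral(2) t) auto
  have "(LBINT r:{0..t}. (simple_val (m, \<tau>, \<xi>') r \<omega>)\<^sup>2) =
     (\<Sum>k<m. (LBINT r:{0..t}. (\<xi>' k \<omega>)\<^sup>2 * (indicator {\<tau> k<..\<tau> (Suc k)} r * indicator {\<tau> k<..\<tau> (Suc k)} r)))"
    unfolding sq using i unfolding set_lebesgue_integral_def set_integrable_def scaleR_sum_right
    by (intro Bochner_Integration.integral_sum) simp
  also have "\<dots> = (\<Sum>k<m. (\<xi>' k \<omega>)\<^sup>2 * (min t (\<tau> (Suc k)) - min t (\<tau> k)))"
  proof (rule sum.cong[OF refl])
    fix k assume "k \<in> {..<m}"
    then have k: "k < m" by simp
    have ov: "(LBINT r:{0..t}. indicator {\<tau> k<..\<tau> (Suc k)} r * indicator {\<tau> k<..\<tau> (Suc k)} r :: real) = min t (\<tau> (Suc k)) - min t (\<tau> k)"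
      using s(1)[of k] s(2)[OF k] k t
      by (subst overlap_integral(1)) (auto simp: clip_time_def)
    show "(LBINT r:{0..t}. (\<xi>' k \<omega>)\<^sup>2 * (indicator {\<tau> k<..\<tau> (Suc k)} r * indicator {\<tau> k<..\<tau> (Suc k)} r)) =
       (\<xi>' k \<omega>)\<^sup>2 * (min t (\<tau> (Suc k)) - min t (\<tau> k))"
      by (simp only: set_integral_mult_right ov)
  qed
  finally show ?thesis .
qed

lemma expectation_simple_integral_sq:
  assumes P: "simple_proc M F P" and c: "c \<in> labels" and t: "0 \<le> t"
  shows "integrable M (\<lambda>\<omega>. (SI c P t \<omega>)\<^sup>2)"
    and "expectation (\<lambda>\<omega>. (SI c P t \<omega>)\<^sup>2) = (\<integral>\<omega>. (LBINT r:{0..t}. (simple_val P r \<omega>)\<^sup>2) \<partial>M)"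
  using simple_integral_increment_sq[OF P c order_refl t] simple_isometry[OF P P c c order_refl t]
  by (simp_all add: simple_integral_0[OF P] power2_eq_square)

text \<open>
  The integrand is switched off, in an adapted way, once its energy exceeds \<open>\<delta>\<close>.
\<close>

lemma simple_integral_tail:
  assumes P: "simple_proc M F P" and c: "c \<in> labels" and t: "0 \<le> t" and pos: "0 < \<delta>" "0 < \<epsilon>"
  shows "\<exists>A\<in>sets M. measure M A \<le> \<delta> / \<epsilon>\<^sup>2 \<and>
    {\<omega> \<in> space M. \<epsilon> \<le> \<bar>SI c P t \<omega>\<bar>} \<subseteq> A \<union> {\<omega> \<in> space M. \<delta> < (LBINT r:{0..t}. (simple_val P r \<omega>)\<^sup>2)}"
proof -
  obtain m \<tau> \<xi> where P1: "P = (m, \<tau>, \<xi>)" by (cases P) auto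
  note P' = P[unfolded P1]
  note s = simple_proc_times[OF P']
  define d where "d k = min t (\<tau> (Suc k)) - min t (\<tau> k)" for k
  have d: "0 \<le> d k" if "k < m" for k using s(2)[OF that] unfolding d_def by simp
  define S where "S j \<omega> = (\<Sum>i<j. (\<xi> i \<omega>)\<^sup>2 * d i)" for j \<omega>
  have Smono: "S i \<omega> \<le> S j \<omega>" if "i \<le> j" "j \<le> m" for i j \<omega>
    unfolding S_def by (rule sum_mono2) (use that d in auto)
  \<comment> \<open>The test at index \<open>j\<close> already counts interval \<open>j\<close>
    itself: \<open>S (Suc j)\<close> involves \<xi> up to index \<open>j\<close> and deterministic
    lengths, hence is known at \<open>\<tau> j\<close>. So the energy of \<phi> never overshoots
    \<delta>.\<close>
  define \<phi> where "\<phi> j \<omega> = (if S (Suc j) \<omega> \<le> \<delta> then \<xi> j \<omega> else 0)" for j \<omega>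
  have Sm: "S (Suc j) \<in> borel_measurable (F (\<tau> j))" if "j < m" for j
    unfolding S_def[abs_def]
    by (intro borel_measurable_sum borel_measurable_times borel_measurable_power borel_measurable_const
        borel_measurable_mono_F[OF s(3)] s(5)) (use that in auto)
  have Q: "simple_proc M F (m, \<tau>, \<phi>)"
    unfolding simple_proc_def prod.case
  proof (intro conjI allI impI)
    show "0 \<le> \<tau> 0" using s(1)[of 0] by simp
    fix k assume k: "k < m"
    show "\<tau> k < \<tau> (Suc k)" using s(2)[OF k] .
    show "\<phi> k \<in> borel_measurable (F (\<tau> k))"
      unfolding \<phi>_def[abs_def] using Sm[OF k] s(3)[OF k] by (intro measurable_If borel_measurable_const) (auto intro: measurable_sets_Collect[of _ _ borel])
    have "\<exists>K. \<forall>\<omega>\<in>space M. \<bar>\<xi> k \<omega>\<bar> \<le> K" using P' k unfolding simple_proc_def by blast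
    then obtain K where "\<forall>\<omega>\<in>space M. \<bar>\<xi> k \<omega>\<bar> \<le> K" by blast
    then have "\<forall>\<omega>\<in>space M. \<bar>\<phi> k \<omega>\<bar> \<le> \<bar>K\<bar>" unfolding \<phi>_def by fastforce
    then show "\<exists>K. \<forall>\<omega>\<in>space M. \<bar>\<phi> k \<omega>\<bar> \<le> K" by blast
  qed
  have bound: "(\<Sum>k<j. (\<phi> k \<omega>)\<^sup>2 * d k) \<le> min \<delta> (S j \<omega>)" if "j \<le> m" for j \<omega>
    using that
  proof (induction j)
    case 0 then show ?case using pos by (simp add: S_def)
  next
    case (Suc j)
    then have IH: "(\<Sum>k<j. (\<phi> k \<omega>)\<^sup>2 * d k) \<le> min \<delta> (S j \<omega>)" and j: "j < m" by simp_all
    have step: "S (Suc j) \<omega> = S j \<omega> + (\<xi> j \<omega>)\<^sup>2 * d j" by (simp add: S_def)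
    have "0 \<le> (\<xi> j \<omega>)\<^sup>2 * d j" using d[OF j] by simp
    then show ?case using IH step by (cases "S (Suc j) \<omega> \<le> \<delta>") (auto simp: \<phi>_def)
  qed
  have E: "expectation (\<lambda>\<omega>. (SI c (m, \<tau>, \<phi>) t \<omega>)\<^sup>2) \<le> \<delta>"
  proof -
    have "expectation (\<lambda>\<omega>. (SI c (m, \<tau>, \<phi>) t \<omega>)\<^sup>2) = (\<integral>\<omega>. (\<Sum>k<m. (\<phi> k \<omega>)\<^sup>2 * d k) \<partial>M)"
      unfolding expectation_simple_integral_sq(2)[OF Q c t] integral_simple_val_sq[OF Q t] d_def ..
    also have "\<dots> \<le> (\<integral>\<omega>. \<delta> \<partial>M)"
    proof (rule integral_mono')
      show "integrable M (\<lambda>_. \<delta>)" by simp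
      show "(\<Sum>k<m. (\<phi> k \<omega>)\<^sup>2 * d k) \<le> \<delta>" for \<omega> using bound[of m \<omega>] by simp
    qed (use pos in simp)
    finally show ?thesis by (simp add: prob_space)
  qed
  define A where "A = {\<omega> \<in> space M. \<epsilon>\<^sup>2 \<le> (SI c (m, \<tau>, \<phi>) t \<omega>)\<^sup>2}"
  have mS: "(\<lambda>\<omega>. (SI c (m, \<tau>, \<phi>) t \<omega>)\<^sup>2) \<in> borel_measurable M"
    using expectation_simple_integral_sq(1)[OF Q c t] by (rule borel_measurable_integrable)
  show ?thesis
  proof (intro bexI conjI)
    show "A \<in> sets M" unfolding A_def using mS by measurable
    have "measure M A \<le> expectation (\<lambda>\<omega>. (SI c (m, \<tau>, \<phi>) t \<omega>)\<^sup>2) / \<epsilon>\<^sup>2"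
      unfolding A_def by (rule integral_Markov_inequality_measure[OF expectation_simple_integral_sq(1)[OF Q c t], of "{}"])
        (use pos in auto)
    also have "\<dots> \<le> \<delta> / \<epsilon>\<^sup>2" using E by (simp add: divide_right_mono)
    finally show "measure M A \<le> \<delta> / \<epsilon>\<^sup>2" .
    show "{\<omega> \<in> space M. \<epsilon> \<le> \<bar>SI c P t \<omega>\<bar>} \<subseteq> A \<union> {\<omega> \<in> space M. \<delta> < (LBINT r:{0..t}. (simple_val P r \<omega>)\<^sup>2)}"
    proof
      fix \<omega> assume "\<omega> \<in> {\<omega> \<in> space M. \<epsilon> \<le> \<bar>SI c P t \<omega>\<bar>}"
      then have \<omega>: "\<omega> \<in> space M" "\<epsilon> \<le> \<bar>SI c P t \<omega>\<bar>" by auto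
      show "\<omega> \<in> A \<union> {\<omega> \<in> space M. \<delta> < (LBINT r:{0..t}. (simple_val P r \<omega>)\<^sup>2)}"
      proof (cases "\<delta> < (LBINT r:{0..t}. (simple_val P r \<omega>)\<^sup>2)")
        case False
        then have "S m \<omega> \<le> \<delta>" unfolding P1 integral_simple_val_sq[OF P' t] S_def d_def by simp
        \<comment> \<open>Partial energies increase, so total energy at most \<delta> means that no
          coefficient was switched off, and the two integrals agree at this point.\<close>
        then have "\<phi> k \<omega> = \<xi> k \<omega>" if "k < m" for k
          using Smono[of "Suc k" m \<omega>] that unfolding \<phi>_def by simp
        then have "SI c (m, \<tau>, \<phi>) t \<omega> = SI c P t \<omega>"
          unfolding P1 simple_integral_def prod.case by (intro sum.cong) auto
        then have "\<epsilon>\<^sup>2 \<le> (SI c (m, \<tau>, \<phi>) t \<omega>)\<^sup>2" using \<omega>(2) pos by (metis abs_le_square_iff abs_of_pos)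
        then show ?thesis using \<omega>(1) by (simp add: A_def)
      qed (use \<omega> in simp)
    qed
  qed
qed

section \<open>Truncation of integrands and the mean-square form of the integral\<close>

definition cut :: "real \<Rightarrow> real \<Rightarrow> real" where "cut K x = max (- K) (min K x)"

lemma cut_bound: "0 \<le> K \<Longrightarrow> \<bar>cut K x\<bar> \<le> K"
  by (auto simp: cut_def)

lemma cut_measurable: "f \<in> borel_measurable N \<Longrightarrow> (\<lambda>\<omega>. cut K (f \<omega>)) \<in> borel_measurable N"
  unfolding cut_def by (intro borel_measurable_max borel_measurable_min borel_measurable_const)

text \<open>\<open>cut K\<close> is the projection onto \<open>[-K,K]\<close>: it moves no point
  away from an element \<open>h\<close> of the interval, and it displaces \<open>x\<close> by the
  distance to the interval, which is at most the distance to \<open>h\<close>.\<close>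

lemma cut_distance:
  assumes "\<bar>h\<bar> \<le> K"
  shows "(cut K x - h)\<^sup>2 \<le> (x - h)\<^sup>2" "(x - cut K x)\<^sup>2 \<le> (x - h)\<^sup>2"
proof -
  have h: "- K \<le> h" "h \<le> K" using assms by auto
  then have "\<bar>cut K x - h\<bar> \<le> \<bar>x - h\<bar>" "\<bar>x - cut K x\<bar> \<le> \<bar>x - h\<bar>"
    unfolding cut_def by linarith+
  then show "(cut K x - h)\<^sup>2 \<le> (x - h)\<^sup>2" "(x - cut K x)\<^sup>2 \<le> (x - h)\<^sup>2"
    by (simp_all add: abs_le_square_iff)
qed

definition cut_proc :: "real \<Rightarrow> 'a simple_proc \<Rightarrow> 'a simple_proc" where
  "cut_proc K = (\<lambda>(m, \<tau>, \<xi>). (m, \<tau>, \<lambda>k \<omega>. cut K (\<xi> k \<omega>)))"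

text \<open>The part removed by truncation is again simple, so its integral can be controlled by
  \<open>simple_integral_tail\<close> although its energy is small only in probability.\<close>

definition rest_proc :: "real \<Rightarrow> 'a simple_proc \<Rightarrow> 'a simple_proc" where
  "rest_proc K = (\<lambda>(m, \<tau>, \<xi>). (m, \<tau>, \<lambda>k \<omega>. \<xi> k \<omega> - cut K (\<xi> k \<omega>)))"

text \<open>Truncation commutes with evaluation since at most one coefficient is active at a time
  and \<open>cut K 0 = 0\<close> for \<open>0 \<le> K\<close>.\<close>

lemma cut_proc:
  assumes P: "simple_proc M F P" and K: "0 \<le> K"
  shows "simple_proc M F (cut_proc K P)" "simple_proc M F (rest_proc K P)"
    "simple_val (cut_proc K P) r \<omega> = cut K (simple_val P r \<omega>)"
    "simple_val (rest_proc K P) r \<omega> = simple_val P r \<omega> - cut K (simple_val P r \<omega>)"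
    "SI c (rest_proc K P) t \<omega> = SI c P t \<omega> - SI c (cut_proc K P) t \<omega>"
proof -
  obtain m \<tau> \<xi> where P1: "P = (m, \<tau>, \<xi>)" by (cases P) auto
  have s: "0 \<le> \<tau> 0" "\<And>k. k < m \<Longrightarrow> \<tau> k < \<tau> (Suc k)" "\<And>k. k < m \<Longrightarrow> \<xi> k \<in> borel_measurable (F (\<tau> k))"
     "\<And>k. k < m \<Longrightarrow> \<exists>B. \<forall>\<omega>\<in>space M. \<bar>\<xi> k \<omega>\<bar> \<le> B"
    using P unfolding P1 simple_proc_def by auto
  show 1: "simple_proc M F (cut_proc K P)"
    unfolding P1 simple_proc_def cut_proc_def prod.case using s cut_bound[OF K] cut_measurable by blast
  show "simple_proc M F (rest_proc K P)"
    unfolding P1 simple_proc_def rest_proc_def prod.case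
  proof (intro conjI allI impI s borel_measurable_diff cut_measurable)
    fix k assume "k < m"
    then obtain B where B: "\<forall>\<omega>\<in>space M. \<bar>\<xi> k \<omega>\<bar> \<le> B" using s(4) by blast
    have "\<bar>\<xi> k \<omega> - cut K (\<xi> k \<omega>)\<bar> \<le> B + K" if "\<omega> \<in> space M" for \<omega>
      using B[rule_format, OF that] cut_bound[OF K, of "\<xi> k \<omega>"] by linarith
    then show "\<exists>B. \<forall>\<omega>\<in>space M. \<bar>\<xi> k \<omega> - cut K (\<xi> k \<omega>)\<bar> \<le> B" by blast
  qed
  show "simple_val (cut_proc K P) r \<omega> = cut K (simple_val P r \<omega>)"
    unfolding P1 cut_proc_def prod.case using K
    by (rule_tac simple_val_cases[OF P[unfolded P1], of r]) (simp_all add: cut_def)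
  show "simple_val (rest_proc K P) r \<omega> = simple_val P r \<omega> - cut K (simple_val P r \<omega>)"
    unfolding P1 rest_proc_def prod.case using K
    by (rule_tac simple_val_cases[OF P[unfolded P1], of r]) (simp_all add: cut_def)
  show "SI c (rest_proc K P) t \<omega> = SI c P t \<omega> - SI c (cut_proc K P) t \<omega>"
    unfolding P1 rest_proc_def cut_proc_def simple_integral_def prod.case
    by (simp add: sum_subtractf[symmetric] left_diff_distrib)
qed

text \<open>One sequence of simple processes approximates at all times, with integrals and
  integrands both converging in mean square instead of in probability. In this form expectations and
  the isometry pass to the limit.\<close>

definition L2_integral :: "nat \<times> nat \<Rightarrow> (real \<Rightarrow> 'a \<Rightarrow> real) \<Rightarrow> (real \<Rightarrow> 'a \<Rightarrow> real) \<Rightarrow> bool" where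
  "L2_integral c H I \<longleftrightarrow> (\<forall>t\<ge>0. I t \<in> borel_measurable M) \<and>
     (\<exists>Q. (\<forall>k. simple_proc M F (Q k)) \<and>
       (\<forall>t\<ge>0. (\<forall>k. integrable M (\<lambda>\<omega>. (SI c (Q k) t \<omega> - I t \<omega>)\<^sup>2)) \<and>
          (\<lambda>k. expectation (\<lambda>\<omega>. (SI c (Q k) t \<omega> - I t \<omega>)\<^sup>2)) \<longlonglongrightarrow> 0 \<and>
          (\<lambda>k. time_integral 0 t (\<lambda>r \<omega>. (simple_val (Q k) r \<omega> - H r \<omega>)\<^sup>2)) \<longlonglongrightarrow> 0))"

text \<open>Expanding the square and using the polarised isometry avoids a common refinement of the
  two systems of nodes.\<close>

lemma expectation_simple_integral_diff_sq:
  assumes P: "simple_proc M F P" "simple_proc M F Q" and c: "c \<in> labels" and t: "0 \<le> t"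
  shows "integrable M (\<lambda>\<omega>. (SI c P t \<omega> - SI c Q t \<omega>)\<^sup>2)"
    and "expectation (\<lambda>\<omega>. (SI c P t \<omega> - SI c Q t \<omega>)\<^sup>2) =
      time_integral 0 t (\<lambda>r \<omega>. (simple_val P r \<omega> - simple_val Q r \<omega>)\<^sup>2)"
proof -
  note m = simple_integral_measurable[OF P(1) c t] simple_integral_measurable[OF P(2) c t]
  note i = expectation_simple_integral_sq(1)[OF P(1) c t] expectation_simple_integral_sq(1)[OF P(2) c t]
  show "integrable M (\<lambda>\<omega>. (SI c P t \<omega> - SI c Q t \<omega>)\<^sup>2)" by (rule integrable_power2_diff[OF m i])
  note b = simple_val_bounded_process[OF P(1)] simple_val_bounded_process[OF P(2)]
  have iso: "expectation (\<lambda>\<omega>. SI c P' t \<omega> * SI c Q' t \<omega>) = time_integral 0 t (\<lambda>r \<omega>. simple_val P' r \<omega> * simple_val Q' r \<omega>)"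
    if "simple_proc M F P'" "simple_proc M F Q'" for P' Q'
    using simple_isometry[OF that c c order_refl t]
    by (simp add: simple_integral_0[OF that(1)] simple_integral_0[OF that(2)] time_integral_def)
  have ip: "integrable M (\<lambda>\<omega>. SI c P t \<omega> * SI c Q t \<omega>)" by (rule integrable_mult_squares[OF m i])
  have "expectation (\<lambda>\<omega>. (SI c P t \<omega> - SI c Q t \<omega>)\<^sup>2) =
    expectation (\<lambda>\<omega>. (SI c P t \<omega>)\<^sup>2 + (SI c Q t \<omega>)\<^sup>2 - 2 * (SI c P t \<omega> * SI c Q t \<omega>))"
    by (simp add: power2_diff mult.assoc)
  also have "\<dots> = expectation (\<lambda>\<omega>. (SI c P t \<omega>)\<^sup>2) + expectation (\<lambda>\<omega>. (SI c Q t \<omega>)\<^sup>2) - 2 * expectation (\<lambda>\<omega>. SI c P t \<omega> * SI c Q t \<omega>)"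
    using i ip by simp
  also have "\<dots> = time_integral 0 t (\<lambda>r \<omega>. simple_val P r \<omega> * simple_val P r \<omega> + simple_val Q r \<omega> * simple_val Q r \<omega>
       - 2 * (simple_val P r \<omega> * simple_val Q r \<omega>))"
    using iso[OF P(1) P(1)] iso[OF P(2) P(2)] iso[OF P]
    by (simp only: time_integral_diff time_integral_add time_integral_cmult bounded_process_intros b power2_eq_square)
  also have "(\<lambda>r \<omega>. simple_val P r \<omega> * simple_val P r \<omega> + simple_val Q r \<omega> * simple_val Q r \<omega>
       - 2 * (simple_val P r \<omega> * simple_val Q r \<omega>)) = (\<lambda>r \<omega>. (simple_val P r \<omega> - simple_val Q r \<omega>)\<^sup>2)"
    by (intro ext) algebra
  finally show "expectation (\<lambda>\<omega>. (SI c P t \<omega> - SI c Q t \<omega>)\<^sup>2) =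
      time_integral 0 t (\<lambda>r \<omega>. (simple_val P r \<omega> - simple_val Q r \<omega>)\<^sup>2)" .
qed

end

lemma vanishes_in_probD:
  "vanishes_in_prob M Z \<Longrightarrow> 0 < \<epsilon> \<Longrightarrow> 0 < \<delta> \<Longrightarrow>
    \<forall>\<^sub>F m in sequentially. \<exists>E\<in>sets M. measure M E < \<delta> \<and> {\<omega> \<in> space M. ennreal \<epsilon> \<le> Z m \<omega>} \<subseteq> E"
  unfolding vanishes_in_prob_def by blast

context driven_space begin

text \<open>The given approximations are truncated at the bound \<open>K\<close> of the integrand.
  What is kept converges in mean square, being bounded and convergent in probability. What is
  removed has energy that vanishes in probability, so its integrals vanish in probability as well.
  Hence the truncated integrals still converge to \<open>I\<close> in probability, and being Cauchy
  in mean square they do so in mean square. In the application \<open>H0\<close> belongs to the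
  solution itself and \<open>H\<close> to a regular modification of it.\<close>

lemma ito_integral_L2:
  assumes c: "c \<in> labels" and H: "bounded_process H" and K: "0 \<le> K" "\<forall>r. \<forall>\<omega>\<in>space M. \<bar>H r \<omega>\<bar> \<le> K"
    and ito: "ito_integral M F (V c) H0 I" and eq: "AE \<omega> in M. \<forall>r\<ge>0. H0 r \<omega> = H r \<omega>"
  shows "L2_integral c H I"
proof -
  have Im: "I t \<in> borel_measurable M" if "0 \<le> t" for t using ito that unfolding ito_integral_def by blast
  have "\<exists>P. (\<forall>k. simple_proc M F (P k)) \<and>
        (\<forall>T>0. vanishes_in_prob M
           (\<lambda>k \<omega>. \<integral>\<^sup>+s\<in>{0..T}. ennreal ((simple_val (P k) s \<omega> - H0 s \<omega>)\<^sup>2) \<partial>lborel)) \<and>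
        (\<forall>t\<ge>0. tendsto_in_prob M (\<lambda>k. SI c (P k) t) (I t))"
    using ito unfolding ito_integral_def by blast
  then obtain P where P: "\<And>k. simple_proc M F (P k)"
    and van: "\<And>T. 0 < T \<Longrightarrow> vanishes_in_prob M (\<lambda>k \<omega>. \<integral>\<^sup>+s\<in>{0..T}. ennreal ((simple_val (P k) s \<omega> - H0 s \<omega>)\<^sup>2) \<partial>lborel)"
    and conv: "\<And>t. 0 \<le> t \<Longrightarrow> tendsto_in_prob M (\<lambda>k. SI c (P k) t) (I t)" by auto
  obtain N where N: "{\<omega> \<in> space M. \<not> (\<forall>r\<ge>0. H0 r \<omega> = H r \<omega>)} \<subseteq> N" "emeasure M N = 0" "N \<in> sets M"
    using AE_E[OF eq] by blast
  have mN: "measure M N = 0" using N(2) by (simp add: measure_def)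
  define Q where "Q k = cut_proc K (P k)" for k
  have Q: "simple_proc M F (Q k)" for k unfolding Q_def by (rule cut_proc(1)[OF P K(1)])
  note R = cut_proc(2)[OF P K(1)]
  note bQ = simple_val_bounded_process[OF Q] and bR = simple_val_bounded_process[OF R]
  \<comment> \<open>The horizon \<open>t + 1\<close> is positive also for \<open>t = 0\<close>,
    where the hypothesis says nothing about the interval \<open>[0,t]\<close>.\<close>
  let ?Z = "\<lambda>t k \<omega>. \<integral>\<^sup>+s\<in>{0..t+1}. ennreal ((simple_val (P k) s \<omega> - H0 s \<omega>)\<^sup>2) \<partial>lborel"
  have dom: "ennreal (LBINT r:{0..t}. g r \<omega>) \<le> ?Z t k \<omega>"
    if g: "bounded_process g" and \<omega>: "\<omega> \<in> space M" "\<omega> \<notin> N" and le: "\<And>r. 0 \<le> g r \<omega>" "\<And>r. g r \<omega> \<le> (simple_val (P k) r \<omega> - H r \<omega>)\<^sup>2"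
    for g \<omega> t k
  proof -
    have "ennreal (LBINT r:{0..t}. g r \<omega>) = (\<integral>\<^sup>+r. ennreal (indicator {0..t} r *\<^sub>R g r \<omega>) \<partial>lborel)"
      unfolding set_lebesgue_integral_def
      by (rule nn_integral_eq_integral[symmetric, OF bounded_process_set_integrable[OF g \<omega>(1), unfolded set_integrable_def]])
         (use le(1) in simp)
    also have "\<dots> \<le> ?Z t k \<omega>"
    proof (rule nn_integral_mono)
      fix r :: real
      show "ennreal (indicator {0..t} r *\<^sub>R g r \<omega>) \<le> ennreal ((simple_val (P k) r \<omega> - H0 r \<omega>)\<^sup>2) * indicator {0..t+1} r"
      proof (cases "r \<in> {0..t}")
        case True
        then have "H0 r \<omega> = H r \<omega>" using N(1) \<omega> by auto
        then show ?thesis using True le(2)[of r] by (simp add: ennreal_leI)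
      qed simp
    qed
    finally show ?thesis .
  qed
  define G where "G k r \<omega> = (simple_val (Q k) r \<omega> - H r \<omega>)\<^sup>2" for k r \<omega>
  have G: "bounded_process (G k)" for k unfolding G_def by (intro bounded_process_intros bQ H)
  have G0: "0 \<le> G k r \<omega>" for k r \<omega> by (simp add: G_def)
  have GK: "G k r \<omega> \<le> (2 * K)\<^sup>2" if "\<omega> \<in> space M" for k r \<omega>
  proof -
    have "\<bar>simple_val (Q k) r \<omega> - H r \<omega>\<bar> \<le> 2 * K"
      using cut_bound[OF K(1), of "simple_val (P k) r \<omega>"] K(2)[rule_format, OF that, of r]
      unfolding Q_def cut_proc(3)[OF P K(1)] by linarith
    then show ?thesis unfolding G_def by (metis abs_ge_zero power2_abs power_mono)
  qed
  have Gd: "G k r \<omega> \<le> (simple_val (P k) r \<omega> - H r \<omega>)\<^sup>2" if "\<omega> \<in> space M" for k r \<omega>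
    unfolding G_def Q_def cut_proc(3)[OF P K(1)] by (rule cut_distance(1)) (use K(2) that in blast)
  have lim: "(\<lambda>k. time_integral 0 t (G k)) \<longlonglongrightarrow> 0" if t: "0 \<le> t" for t
  proof (rule LIMSEQ_I)
    fix e :: real assume e: "0 < e"
    define A where "A = (2 * K)\<^sup>2 * t"
    have A: "0 \<le> A" unfolding A_def using t by simp
    define \<delta> where "\<delta> = e / (2 * (A + 1))"
    have \<delta>: "0 < \<delta>" "A * \<delta> < e / 2" using e A by (auto simp: \<delta>_def field_simps)
    have "\<forall>\<^sub>F k in sequentially. \<exists>E\<in>sets M. measure M E < \<delta> \<and> {\<omega> \<in> space M. ennreal (e/2) \<le> ?Z t k \<omega>} \<subseteq> E"
      using t by (intro vanishes_in_probD[OF van]) (use e \<delta> in auto)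
    then obtain k0 where k0: "\<And>k. k \<ge> k0 \<Longrightarrow> \<exists>E\<in>sets M. measure M E < \<delta> \<and> {\<omega> \<in> space M. ennreal (e/2) \<le> ?Z t k \<omega>} \<subseteq> E"
      unfolding eventually_sequentially by blast
    have "time_integral 0 t (G k) < e" if "k \<ge> k0" for k
    proof -
      obtain E where E: "E \<in> sets M" "measure M E < \<delta>" "{\<omega> \<in> space M. ennreal (e/2) \<le> ?Z t k \<omega>} \<subseteq> E"
        using k0[OF \<open>k \<ge> k0\<close>] by blast
      have EN: "E \<union> N \<in> sets M" "measure M (E \<union> N) \<le> measure M E" using E(1) N(3) measure_Un_le[OF E(1) N(3)] mN by auto
      have "time_integral 0 t (G k) \<le> expectation (\<lambda>\<omega>. e/2 + A * indicator (E \<union> N) \<omega>)"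
        unfolding time_integral_def
      proof (rule integral_mono)
        show "integrable M (\<lambda>\<omega>. LBINT r:{0..t}. G k r \<omega>)" by (rule bounded_process_integral_integrable[OF G t])
        show "integrable M (\<lambda>\<omega>. e/2 + A * indicator (E \<union> N) \<omega>)"
          using EN(1) by (intro Bochner_Integration.integrable_add integrable_mult_right integrable_real_indicator) (auto simp: emeasure_eq_measure)
        fix \<omega> assume \<omega>: "\<omega> \<in> space M"
        show "(LBINT r:{0..t}. G k r \<omega>) \<le> e/2 + A * indicator (E \<union> N) \<omega>"
        proof (cases "\<omega> \<in> E \<union> N")
          case True
          have "\<bar>LBINT r:{0..t}. G k r \<omega>\<bar> \<le> (2*K)\<^sup>2 * (t - 0)"
            by (rule bounded_process_integral_bound[OF G \<omega> t]) (simp only: abs_of_nonneg G0 GK[OF \<omega>])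
          then show ?thesis using True e unfolding A_def by simp
        next
          case False
          then have "\<not> ennreal (e/2) \<le> ?Z t k \<omega>" using E(3) \<omega> by blast
          then have "\<not> ennreal (e/2) \<le> ennreal (LBINT r:{0..t}. G k r \<omega>)"
            using dom[OF G \<omega> _ G0 Gd[OF \<omega>], of t k] False by (meson UnI2 order_trans)
          then have "(LBINT r:{0..t}. G k r \<omega>) < e / 2" by (metis ennreal_leI not_le)
          then show ?thesis using False by simp
        qed
      qed
      also have "\<dots> = e/2 + A * measure M (E \<union> N)"
        using EN(1) by (subst Bochner_Integration.integral_add) (auto simp: prob_space emeasure_eq_measure intro!: integrable_mult_right integrable_real_indicator)
      also have "\<dots> \<le> e / 2 + A * \<delta>" using EN(2) E(2) A by (intro add_left_mono mult_left_mono) auto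
      also have "\<dots> < e" using \<delta>(2) by simp
      finally show ?thesis .
    qed
    moreover have "0 \<le> time_integral 0 t (G k)" for k by (rule time_integral_nonneg[OF G G0])
    ultimately show "\<exists>k0. \<forall>k\<ge>k0. norm (time_integral 0 t (G k) - 0) < e" by auto
  qed
  have Qconv: "tendsto_in_prob M (\<lambda>k. SI c (Q k) t) (I t)" if t: "0 \<le> t" for t
    unfolding tendsto_in_prob_def vanishes_in_prob_def
  proof (intro allI impI)
    fix \<epsilon> \<eta> :: real assume pos: "0 < \<epsilon>" "0 < \<eta>"
    \<comment> \<open>Chosen so that the tail bound
      \<open>\<delta> / (\<epsilon> / 2)\<^sup>2\<close> equals \<open>\<eta> / 4\<close>: the
      exceptional sets of the energy, of the original integrals and of the tail estimate together
      cost less than \<eta>.\<close>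
    define \<delta> where "\<delta> = \<eta> / 4 * (\<epsilon> / 2)\<^sup>2"
    have \<delta>: "0 < \<delta>" "\<delta> / (\<epsilon> / 2)\<^sup>2 = \<eta> / 4" using pos by (auto simp: \<delta>_def)
    have "\<forall>\<^sub>F k in sequentially. \<exists>E\<in>sets M. measure M E < \<eta>/4 \<and> {\<omega> \<in> space M. ennreal \<delta> \<le> ?Z t k \<omega>} \<subseteq> E"
      using t by (intro vanishes_in_probD[OF van]) (use pos \<delta> in auto)
    moreover have "\<forall>\<^sub>F k in sequentially. \<exists>E\<in>sets M. measure M E < \<eta>/4 \<and> {\<omega> \<in> space M. ennreal (\<epsilon>/2) \<le> ennreal \<bar>SI c (P k) t \<omega> - I t \<omega>\<bar>} \<subseteq> E"
      by (rule vanishes_in_probD[OF conv[OF t, unfolded tendsto_in_prob_def]]) (use pos in auto)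
    ultimately show "\<forall>\<^sub>F k in sequentially. \<exists>E\<in>sets M. measure M E < \<eta> \<and> {\<omega> \<in> space M. ennreal \<epsilon> \<le> ennreal \<bar>SI c (Q k) t \<omega> - I t \<omega>\<bar>} \<subseteq> E"
    proof eventually_elim
      case (elim k)
      obtain E where E: "E \<in> sets M" "measure M E < \<eta>/4" "{\<omega> \<in> space M. ennreal \<delta> \<le> ?Z t k \<omega>} \<subseteq> E" using elim(1) by blast
      obtain E' where E': "E' \<in> sets M" "measure M E' < \<eta>/4" "{\<omega> \<in> space M. ennreal (\<epsilon>/2) \<le> ennreal \<bar>SI c (P k) t \<omega> - I t \<omega>\<bar>} \<subseteq> E'" using elim(2) by blast
      have "0 < \<epsilon> / 2" using pos by simp
      from simple_integral_tail[OF R c t \<delta>(1) this]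
      obtain A where A: "A \<in> sets M" "measure M A \<le> \<delta> / (\<epsilon>/2)\<^sup>2"
        "{\<omega> \<in> space M. \<epsilon>/2 \<le> \<bar>SI c (rest_proc K (P k)) t \<omega>\<bar>} \<subseteq> A \<union> {\<omega> \<in> space M. \<delta> < (LBINT r:{0..t}. (simple_val (rest_proc K (P k)) r \<omega>)\<^sup>2)}"
        by blast
      let ?U = "(A \<union> E') \<union> (E \<union> N)"
      have "measure M ?U \<le> measure M (A \<union> E') + measure M (E \<union> N)"
        by (intro measure_Un_le sets.Un A(1) E(1) E'(1) N(3))
      also have "\<dots> \<le> (measure M A + measure M E') + (measure M E + measure M N)"
        by (intro add_mono measure_Un_le A(1) E(1) E'(1) N(3))
      also have "\<dots> < \<eta>" using A(2) E(2) E'(2) mN pos unfolding \<delta>(2) by simp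
      finally have mU: "measure M ?U < \<eta>" .
      have "\<omega> \<in> ?U" if \<omega>: "\<omega> \<in> space M" "ennreal \<epsilon> \<le> ennreal \<bar>SI c (Q k) t \<omega> - I t \<omega>\<bar>" for \<omega>
      proof (rule ccontr)
        assume nU: "\<omega> \<notin> ?U"
        have "\<not> ennreal \<delta> \<le> ?Z t k \<omega>" using E(3) \<omega>(1) nU by blast
        moreover have "ennreal (LBINT r:{0..t}. (simple_val (rest_proc K (P k)) r \<omega>)\<^sup>2) \<le> ?Z t k \<omega>"
        proof (rule dom[OF bounded_process_power2[OF bR] \<omega>(1)])
          show "\<omega> \<notin> N" using nU by blast
          show "(simple_val (rest_proc K (P k)) r \<omega>)\<^sup>2 \<le> (simple_val (P k) r \<omega> - H r \<omega>)\<^sup>2" for r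
            unfolding cut_proc(4)[OF P K(1)] by (rule cut_distance(2)) (use K(2) \<omega>(1) in blast)
        qed simp
        ultimately have "\<not> ennreal \<delta> \<le> ennreal (LBINT r:{0..t}. (simple_val (rest_proc K (P k)) r \<omega>)\<^sup>2)"
          by (meson order_trans)
        then have "\<not> \<delta> < (LBINT r:{0..t}. (simple_val (rest_proc K (P k)) r \<omega>)\<^sup>2)" by (metis ennreal_leI less_imp_le)
        have 1: "\<bar>SI c (rest_proc K (P k)) t \<omega>\<bar> < \<epsilon> / 2" 
        proof (rule ccontr)
          assume "\<not> \<bar>SI c (rest_proc K (P k)) t \<omega>\<bar> < \<epsilon> / 2"
          then have "\<omega> \<in> {\<omega> \<in> space M. \<epsilon>/2 \<le> \<bar>SI c (rest_proc K (P k)) t \<omega>\<bar>}" using \<omega>(1) by simp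
          from subsetD[OF A(3) this] show False using nU by simp (use \<open>\<not> \<delta> < (LBINT r:{0..t}. (simple_val (rest_proc K (P k)) r \<omega>)\<^sup>2)\<close> in blast)
        qed
        have "\<not> ennreal (\<epsilon>/2) \<le> ennreal \<bar>SI c (P k) t \<omega> - I t \<omega>\<bar>" using E'(3) \<omega>(1) nU by blast
        then have 2: "\<bar>SI c (P k) t \<omega> - I t \<omega>\<bar> < \<epsilon>/2" by (metis ennreal_leI not_le)
        have "\<bar>SI c (Q k) t \<omega> - I t \<omega>\<bar> < \<epsilon>" using 1 2 unfolding cut_proc(5)[OF P K(1)] Q_def by linarith
        then have "ennreal \<bar>SI c (Q k) t \<omega> - I t \<omega>\<bar> < ennreal \<epsilon>" by (simp add: ennreal_lessI)
        with leD[OF \<omega>(2)] show False by (rule notE)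
      qed
      then have "{\<omega> \<in> space M. ennreal \<epsilon> \<le> ennreal \<bar>SI c (Q k) t \<omega> - I t \<omega>\<bar>} \<subseteq> ?U" by blast
      moreover have "?U \<in> sets M" by (intro sets.Un A(1) E(1) E'(1) N(3))
      ultimately show ?case using mU by blast
    qed
  qed
  have L2: "integrable M (\<lambda>\<omega>. (SI c (Q k) t \<omega> - I t \<omega>)\<^sup>2)" "(\<lambda>k. expectation (\<lambda>\<omega>. (SI c (Q k) t \<omega> - I t \<omega>)\<^sup>2)) \<longlonglongrightarrow> 0"
    if t: "0 \<le> t" for t k
  proof -
    have cauchy: "expectation (\<lambda>\<omega>. (SI c (Q k) t \<omega> - SI c (Q l) t \<omega>)\<^sup>2) \<le> 2 * time_integral 0 t (G k) + 2 * time_integral 0 t (G l)" for k l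
    proof -
      have "expectation (\<lambda>\<omega>. (SI c (Q k) t \<omega> - SI c (Q l) t \<omega>)\<^sup>2) = time_integral 0 t (\<lambda>r \<omega>. (simple_val (Q k) r \<omega> - simple_val (Q l) r \<omega>)\<^sup>2)"
        by (rule expectation_simple_integral_diff_sq(2)[OF Q Q c t])
      also have "\<dots> \<le> time_integral 0 t (\<lambda>r \<omega>. 2 * G k r \<omega> + 2 * G l r \<omega>)"
      proof (rule time_integral_mono)
        fix r \<omega>
        have "(x - y)\<^sup>2 \<le> 2 * (x - h)\<^sup>2 + 2 * (y - h)\<^sup>2" for x y h :: real
        proof -
          have "0 \<le> ((x - h) + (y - h))\<^sup>2" by simp
          then show ?thesis by (simp add: power2_eq_square algebra_simps)
        qed
        then show "(simple_val (Q k) r \<omega> - simple_val (Q l) r \<omega>)\<^sup>2 \<le> 2 * G k r \<omega> + 2 * G l r \<omega>" unfolding G_def .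
      qed (intro bounded_process_intros bQ G)+
      also have "\<dots> = 2 * time_integral 0 t (G k) + 2 * time_integral 0 t (G l)"
        by (simp only: time_integral_add time_integral_cmult bounded_process_intros G)
      finally show ?thesis .
    qed
    note L = L2_limit_of_limit_in_prob[OF Im[OF t] simple_integral_measurable[OF Q c t] expectation_simple_integral_diff_sq(1)[OF Q Q c t] cauchy _ Qconv[OF t]]
    show "integrable M (\<lambda>\<omega>. (SI c (Q k) t \<omega> - I t \<omega>)\<^sup>2)" "(\<lambda>k. expectation (\<lambda>\<omega>. (SI c (Q k) t \<omega> - I t \<omega>)\<^sup>2)) \<longlonglongrightarrow> 0"
      by (rule L; rule tendsto_mult_right_zero[OF lim[OF t]])+
  qed
  show ?thesis unfolding L2_integral_def
    using Im Q L2 lim unfolding G_def[abs_def] by blast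
qed

end

lemma set_integral_Icc_split:
  fixes f :: "real \<Rightarrow> real"
  assumes f: "set_integrable lborel {a..c} f" and ab: "a \<le> b" "b \<le> c"
  shows "(LBINT r:{a..c}. f r) = (LBINT r:{a..b}. f r) + (LBINT r:{b..c}. f r)"
proof -
  have 1: "set_integrable lborel {a..b} f" "set_integrable lborel {b..c} f"
    by (rule set_integrable_subset[OF f]; use ab in auto)+
  have "(LBINT r:{a..c}. f r) = (\<integral>r. indicator {a..b} r *\<^sub>R f r + indicator {b..c} r *\<^sub>R f r \<partial>lborel)"
    unfolding set_lebesgue_integral_def
  proof (rule integral_cong_AE)
    show "AE r in lborel. indicator {a..c} r *\<^sub>R f r = indicator {a..b} r *\<^sub>R f r + indicator {b..c} r *\<^sub>R f r"
      using AE_lborel_singleton[of b]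
    proof eventually_elim
      case (elim r)
      then show ?case using ab by (auto simp: indicator_def)
    qed
    show "(\<lambda>r. indicator {a..c} r *\<^sub>R f r) \<in> borel_measurable lborel"
      using f unfolding set_integrable_def by (rule borel_measurable_integrable)
    show "(\<lambda>r. indicator {a..b} r *\<^sub>R f r + indicator {b..c} r *\<^sub>R f r) \<in> borel_measurable lborel"
      using 1 unfolding set_integrable_def by (intro borel_measurable_add borel_measurable_integrable)
  qed
  also have "\<dots> = (LBINT r:{a..b}. f r) + (LBINT r:{b..c}. f r)"
    unfolding set_lebesgue_integral_def using 1 unfolding set_integrable_def by (rule Bochner_Integration.integral_add)
  finally show ?thesis .
qed

text \<open>Over \<open>n\<close> equal steps the increments add up to the order of
  \<open>1 / sqrt n\<close>, which tends to 0. The exponent 3/2 is what a product of a drift and a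
  noise increment leaves as error.\<close>

lemma constant_if_small_increments:
  fixes \<Psi> :: "real \<Rightarrow> real"
  assumes small: "\<And>s t. 0 \<le> s \<Longrightarrow> s \<le> t \<Longrightarrow> t \<le> s + 1 \<Longrightarrow> \<bar>\<Psi> t - \<Psi> s\<bar> \<le> c * ((t - s) * sqrt (t - s))"
    and st: "0 \<le> s" "s \<le> t"
  shows "\<Psi> t = \<Psi> s"
proof -
  define h where "h = t - s"
  have h: "0 \<le> h" using st by (simp add: h_def)
  have part: "\<bar>\<Psi> (s + real k * d) - \<Psi> s\<bar> \<le> real k * (c * (d * sqrt d))" if d: "0 \<le> d" "d \<le> 1" for k d
  proof (induction k)
    case (Suc k)
    have "\<bar>\<Psi> (s + real (Suc k) * d) - \<Psi> (s + real k * d)\<bar> \<le> c * (d * sqrt d)"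
      using small[of "s + real k * d" "s + real (Suc k) * d"] st d by (simp add: algebra_simps)
    then show ?case using Suc by (simp add: algebra_simps)
  qed simp
  \<comment> \<open>The hypothesis concerns steps of length at most 1, so more than \<open>h\<close>
    of them are taken.\<close>
  obtain n0 where n0: "h \<le> real n0" using real_arch_simple by blast
  have bound: "\<bar>\<Psi> t - \<Psi> s\<bar> \<le> c * h * sqrt (h / real n)" if n: "n \<ge> Suc n0" for n
  proof -
    have np: "0 < real n" using n by simp
    have "0 \<le> h / real n" "h / real n \<le> 1" using h n n0 np by auto
    from part[OF this, of n] show ?thesis using np by (simp add: h_def mult.assoc)
  qed
  have "(\<lambda>n. c * h * sqrt (h / real n)) \<longlonglongrightarrow> c * h * sqrt 0"
    by (intro tendsto_mult tendsto_const tendsto_real_sqrt lim_const_over_n)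
  then have "\<bar>\<Psi> t - \<Psi> s\<bar> \<le> c * h * sqrt 0"
    by (rule LIMSEQ_le_const) (use bound in blast)
  then show ?thesis by simp
qed

context prob_space begin

lemma time_integral_split:
  assumes f: "bounded_process f" and "a \<le> b" "b \<le> c"
  shows "time_integral a c f = time_integral a b f + time_integral b c f"
  unfolding time_integral_fubini(1)[OF f]
  by (rule set_integral_Icc_split[OF time_integral_fubini(2)[OF f] assms(2,3)])

lemma time_integral_abs_le:
  assumes f: "bounded_process f" and st: "s \<le> t" and B: "\<And>r. r \<in> {s..t} \<Longrightarrow> \<bar>expectation (f r)\<bar> \<le> B"
  shows "\<bar>time_integral s t f\<bar> \<le> B * (t - s)"
proof -
  have "\<bar>time_integral s t f\<bar> \<le> (LBINT r:{s..t}. \<bar>expectation (f r)\<bar>)"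
    unfolding time_integral_fubini(1)[OF f]
    using set_integral_norm_bound[OF time_integral_fubini(2)[OF f]] by simp
  also have "\<dots> \<le> (LBINT r:{s..t}. B)"
    using B by (intro set_integral_mono set_integrable_abs time_integral_fubini(2)[OF f])
      (auto simp: set_integrable_def emeasure_lborel_Icc_eq)
  also have "\<dots> = B * (t - s)" using st by (simp add: set_lebesgue_integral_def)
  finally show ?thesis .
qed

end

section \<open>Martingale property and isometry of the mean-square integral\<close>

context driven_space begin

lemma L2_integralE:
  assumes "L2_integral c H I"
  obtains Q :: "nat \<Rightarrow> 'a simple_proc" where "\<And>k. simple_proc M F (Q k)"
    "\<And>t k. 0 \<le> t \<Longrightarrow> integrable M (\<lambda>\<omega>. (SI c (Q k) t \<omega> - I t \<omega>)\<^sup>2)"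
    "\<And>t. 0 \<le> t \<Longrightarrow> (\<lambda>k. expectation (\<lambda>\<omega>. (SI c (Q k) t \<omega> - I t \<omega>)\<^sup>2)) \<longlonglongrightarrow> 0"
    "\<And>t. 0 \<le> t \<Longrightarrow> (\<lambda>k. time_integral 0 t (\<lambda>r \<omega>. (simple_val (Q k) r \<omega> - H r \<omega>)\<^sup>2)) \<longlonglongrightarrow> 0"
proof -
  obtain Q where Q: "\<forall>k. simple_proc M F (Q k)" and R: "\<forall>t\<ge>0. (\<forall>k. integrable M (\<lambda>\<omega>. (SI c (Q k) t \<omega> - I t \<omega>)\<^sup>2)) \<and>
          (\<lambda>k. expectation (\<lambda>\<omega>. (SI c (Q k) t \<omega> - I t \<omega>)\<^sup>2)) \<longlonglongrightarrow> 0 \<and>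
          (\<lambda>k. time_integral 0 t (\<lambda>r \<omega>. (simple_val (Q k) r \<omega> - H r \<omega>)\<^sup>2)) \<longlonglongrightarrow> 0"
    using assms unfolding L2_integral_def by blast
  show thesis
    by (rule that[of Q]) (use Q R in blast)+
qed

lemma L2_integral_increment:
  assumes L: "L2_integral c H I" and c: "c \<in> labels" and H: "bounded_process H" and st: "0 \<le> s" "s \<le> t"
  obtains Q :: "nat \<Rightarrow> 'a simple_proc" where "\<And>k. simple_proc M F (Q k)"
    "\<And>k. integrable M (\<lambda>\<omega>. ((SI c (Q k) t \<omega> - SI c (Q k) s \<omega>) - (I t \<omega> - I s \<omega>))\<^sup>2)"
    "(\<lambda>k. expectation (\<lambda>\<omega>. ((SI c (Q k) t \<omega> - SI c (Q k) s \<omega>) - (I t \<omega> - I s \<omega>))\<^sup>2)) \<longlonglongrightarrow> 0"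
    "(\<lambda>k. time_integral s t (\<lambda>r \<omega>. (simple_val (Q k) r \<omega> - H r \<omega>)\<^sup>2)) \<longlonglongrightarrow> 0"
proof -
  have t: "0 \<le> t" using st by simp
  obtain Q where Q: "\<And>k. simple_proc M F (Q k)"
    and i: "\<And>u k. 0 \<le> u \<Longrightarrow> integrable M (\<lambda>\<omega>. (SI c (Q k) u \<omega> - I u \<omega>)\<^sup>2)"
    and l: "\<And>u. 0 \<le> u \<Longrightarrow> (\<lambda>k. expectation (\<lambda>\<omega>. (SI c (Q k) u \<omega> - I u \<omega>)\<^sup>2)) \<longlonglongrightarrow> 0"
    and h: "\<And>u. 0 \<le> u \<Longrightarrow> (\<lambda>k. time_integral 0 u (\<lambda>r \<omega>. (simple_val (Q k) r \<omega> - H r \<omega>)\<^sup>2)) \<longlonglongrightarrow> 0"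
    by (rule L2_integralE[OF L]) blast
  have Im: "I u \<in> borel_measurable M" if "0 \<le> u" for u using L that unfolding L2_integral_def by blast
  have m: "(\<lambda>\<omega>. SI c (Q k) u \<omega> - I u \<omega>) \<in> borel_measurable M" if "0 \<le> u" for u k
    by (intro borel_measurable_diff simple_integral_measurable[OF Q c that] Im[OF that])
  have eq: "((SI c (Q k) t \<omega> - SI c (Q k) s \<omega>) - (I t \<omega> - I s \<omega>))\<^sup>2 = ((SI c (Q k) t \<omega> - I t \<omega>) - (SI c (Q k) s \<omega> - I s \<omega>))\<^sup>2" for k \<omega>
    by (simp add: algebra_simps)
  show ?thesis
  proof (rule that[of Q])
    show int: "integrable M (\<lambda>\<omega>. ((SI c (Q k) t \<omega> - SI c (Q k) s \<omega>) - (I t \<omega> - I s \<omega>))\<^sup>2)" for k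
      unfolding eq by (rule integrable_power2_diff[OF m[OF t] m[OF st(1)] i[OF t] i[OF st(1)]])
    show "(\<lambda>k. expectation (\<lambda>\<omega>. ((SI c (Q k) t \<omega> - SI c (Q k) s \<omega>) - (I t \<omega> - I s \<omega>))\<^sup>2)) \<longlonglongrightarrow> 0"
    proof (rule Lim_null_comparison)
      show "(\<lambda>k. 2 * expectation (\<lambda>\<omega>. (SI c (Q k) t \<omega> - I t \<omega>)\<^sup>2) + 2 * expectation (\<lambda>\<omega>. (SI c (Q k) s \<omega> - I s \<omega>)\<^sup>2)) \<longlonglongrightarrow> 0"
        using tendsto_add[OF tendsto_mult_right_zero[OF l[OF t]] tendsto_mult_right_zero[OF l[OF st(1)]]] by simp
      have "expectation (\<lambda>\<omega>. ((SI c (Q k) t \<omega> - SI c (Q k) s \<omega>) - (I t \<omega> - I s \<omega>))\<^sup>2) \<le>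
        expectation (\<lambda>\<omega>. 2 * (SI c (Q k) t \<omega> - I t \<omega>)\<^sup>2 + 2 * (SI c (Q k) s \<omega> - I s \<omega>)\<^sup>2)" for k
      proof (rule integral_mono[OF int])
        show "integrable M (\<lambda>\<omega>. 2 * (SI c (Q k) t \<omega> - I t \<omega>)\<^sup>2 + 2 * (SI c (Q k) s \<omega> - I s \<omega>)\<^sup>2)"
          using i[OF t] i[OF st(1)] by (intro Bochner_Integration.integrable_add integrable_mult_right)
        have "(x - y)\<^sup>2 \<le> 2 * x\<^sup>2 + 2 * y\<^sup>2" for x y :: real
        proof -
          have "0 \<le> (x + y)\<^sup>2" by simp
          then show ?thesis by (simp add: power2_eq_square algebra_simps)
        qed
        then show "((SI c (Q k) t \<omega> - SI c (Q k) s \<omega>) - (I t \<omega> - I s \<omega>))\<^sup>2 \<le> 2 * (SI c (Q k) t \<omega> - I t \<omega>)\<^sup>2 + 2 * (SI c (Q k) s \<omega> - I s \<omega>)\<^sup>2" for \<omega>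
          unfolding eq .
      qed
      then show "\<forall>\<^sub>F k in sequentially. norm (expectation (\<lambda>\<omega>. ((SI c (Q k) t \<omega> - SI c (Q k) s \<omega>) - (I t \<omega> - I s \<omega>))\<^sup>2))
         \<le> 2 * expectation (\<lambda>\<omega>. (SI c (Q k) t \<omega> - I t \<omega>)\<^sup>2) + 2 * expectation (\<lambda>\<omega>. (SI c (Q k) s \<omega> - I s \<omega>)\<^sup>2)"
        using i[OF t] i[OF st(1)] by simp
    qed
    have b: "bounded_process (\<lambda>r \<omega>. (simple_val (Q k) r \<omega> - H r \<omega>)\<^sup>2)" for k
      by (intro bounded_process_intros H simple_val_bounded_process Q)
    show "(\<lambda>k. time_integral s t (\<lambda>r \<omega>. (simple_val (Q k) r \<omega> - H r \<omega>)\<^sup>2)) \<longlonglongrightarrow> 0"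
    proof (rule Lim_null_comparison[OF _ h[OF t]])
      have "0 \<le> time_integral s t (\<lambda>r \<omega>. (simple_val (Q k) r \<omega> - H r \<omega>)\<^sup>2)" for k
        by (rule time_integral_nonneg[OF b]) simp
      moreover have "time_integral s t (\<lambda>r \<omega>. (simple_val (Q k) r \<omega> - H r \<omega>)\<^sup>2) \<le> time_integral 0 t (\<lambda>r \<omega>. (simple_val (Q k) r \<omega> - H r \<omega>)\<^sup>2)" for k
        by (rule time_integral_mono_interval[OF b _ st(1) order_refl]) simp
      ultimately show "\<forall>\<^sub>F k in sequentially. norm (time_integral s t (\<lambda>r \<omega>. (simple_val (Q k) r \<omega> - H r \<omega>)\<^sup>2)) \<le> time_integral 0 t (\<lambda>r \<omega>. (simple_val (Q k) r \<omega> - H r \<omega>)\<^sup>2)"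
        by simp
    qed
  qed (rule Q)
qed

lemma L2_integral_measurable: "L2_integral c H I \<Longrightarrow> 0 \<le> t \<Longrightarrow> I t \<in> borel_measurable M"
  unfolding L2_integral_def by blast

text \<open>The increment of \<open>I\<close> is the increment of a simple integral minus the
  approximation error, and both are square integrable; a single member of the sequence
  suffices.\<close>

lemma L2_integral_increment_sq:
  assumes L: "L2_integral c H I" and c: "c \<in> labels" and H: "bounded_process H" and st: "0 \<le> s" "s \<le> t"
  shows "integrable M (\<lambda>\<omega>. (I t \<omega> - I s \<omega>)\<^sup>2)"
proof (rule L2_integral_increment[OF assms])
  fix Q :: "nat \<Rightarrow> 'a simple_proc"
  assume Q: "\<And>k. simple_proc M F (Q k)"
    and i: "\<And>k. integrable M (\<lambda>\<omega>. ((SI c (Q k) t \<omega> - SI c (Q k) s \<omega>) - (I t \<omega> - I s \<omega>))\<^sup>2)"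
  have t: "0 \<le> t" using st by simp
  have m: "(\<lambda>\<omega>. SI c (Q 0) t \<omega> - SI c (Q 0) s \<omega>) \<in> borel_measurable M"
    by (intro borel_measurable_diff simple_integral_measurable[OF Q c] t st)
  have m': "(\<lambda>\<omega>. I t \<omega> - I s \<omega>) \<in> borel_measurable M"
    by (intro borel_measurable_diff L2_integral_measurable[OF L] t st)
  have "integrable M (\<lambda>\<omega>. ((SI c (Q 0) t \<omega> - SI c (Q 0) s \<omega>) - ((SI c (Q 0) t \<omega> - SI c (Q 0) s \<omega>) - (I t \<omega> - I s \<omega>)))\<^sup>2)"
    by (rule integrable_power2_diff[OF m borel_measurable_diff[OF m m'] simple_integral_increment_sq[OF Q c st] i])
  then show ?thesis by simp
qed

lemma L2_integral_increment_past:
  assumes L: "L2_integral c H I" and c: "c \<in> labels" and H: "bounded_process H" and st: "0 \<le> s" "s \<le> t"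
    and \<eta>: "\<eta> \<in> borel_measurable (F s)" "\<And>\<omega>. \<omega> \<in> space M \<Longrightarrow> \<bar>\<eta> \<omega>\<bar> \<le> B"
  shows "integrable M (\<lambda>\<omega>. \<eta> \<omega> * (I t \<omega> - I s \<omega>))" "expectation (\<lambda>\<omega>. \<eta> \<omega> * (I t \<omega> - I s \<omega>)) = 0"
proof -
  have t: "0 \<le> t" using st by simp
  have \<eta>m: "\<eta> \<in> borel_measurable M" using borel_measurable_F_M[OF \<eta>(1) st(1)] .
  have \<eta>2: "integrable M (\<lambda>\<omega>. (\<eta> \<omega>)\<^sup>2)"
  proof (rule integrable_const_bound[where B="B\<^sup>2"])
    have "norm ((\<eta> \<omega>)\<^sup>2) \<le> B\<^sup>2" if "\<omega> \<in> space M" for \<omega>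
      using power_mono[OF \<eta>(2)[OF that] abs_ge_zero, of 2] by simp
    then show "AE \<omega> in M. norm ((\<eta> \<omega>)\<^sup>2) \<le> B\<^sup>2" by (intro AE_I2)
    show "(\<lambda>\<omega>. (\<eta> \<omega>)\<^sup>2) \<in> borel_measurable M" by (rule borel_measurable_power[OF \<eta>m])
  qed
  have Dm: "(\<lambda>\<omega>. I t \<omega> - I s \<omega>) \<in> borel_measurable M"
    by (intro borel_measurable_diff L2_integral_measurable[OF L] t st)
  note D2 = L2_integral_increment_sq[OF L c H st]
  show iD: "integrable M (\<lambda>\<omega>. \<eta> \<omega> * (I t \<omega> - I s \<omega>))" by (rule integrable_mult_squares[OF \<eta>m Dm \<eta>2 D2])
  show "expectation (\<lambda>\<omega>. \<eta> \<omega> * (I t \<omega> - I s \<omega>)) = 0"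
  proof (rule L2_integral_increment[OF L c H st])
    fix Q :: "nat \<Rightarrow> 'a simple_proc"
    assume Q: "\<And>k. simple_proc M F (Q k)"
      and i: "\<And>k. integrable M (\<lambda>\<omega>. ((SI c (Q k) t \<omega> - SI c (Q k) s \<omega>) - (I t \<omega> - I s \<omega>))\<^sup>2)"
      and l: "(\<lambda>k. expectation (\<lambda>\<omega>. ((SI c (Q k) t \<omega> - SI c (Q k) s \<omega>) - (I t \<omega> - I s \<omega>))\<^sup>2)) \<longlonglongrightarrow> 0"
    have Qm: "(\<lambda>\<omega>. SI c (Q k) t \<omega> - SI c (Q k) s \<omega>) \<in> borel_measurable M" for k
      by (intro borel_measurable_diff simple_integral_measurable[OF Q c] t st)
    note iQ = integrable_mult_squares[OF \<eta>m Qm \<eta>2 simple_integral_increment_sq[OF Q c st]]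
    have "expectation (\<lambda>\<omega>. \<eta> \<omega> * ((SI c (Q k) t \<omega> - SI c (Q k) s \<omega>) - (I t \<omega> - I s \<omega>))) = - expectation (\<lambda>\<omega>. \<eta> \<omega> * (I t \<omega> - I s \<omega>))" for k
      unfolding right_diff_distrib[of "\<eta> _" "SI c (Q k) t _ - SI c (Q k) s _"]
      using Bochner_Integration.integral_diff[OF iQ iD] simple_integral_increment_past[OF Q c st \<eta>] by simp
    moreover have "(\<lambda>k. expectation (\<lambda>\<omega>. \<eta> \<omega> * ((SI c (Q k) t \<omega> - SI c (Q k) s \<omega>) - (I t \<omega> - I s \<omega>)))) \<longlonglongrightarrow> 0"
      by (rule tendsto_expectation_mult_left[OF \<eta>m borel_measurable_diff[OF Qm Dm] \<eta>2 i l])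
    ultimately have "(\<lambda>k::nat. - expectation (\<lambda>\<omega>. \<eta> \<omega> * (I t \<omega> - I s \<omega>))) \<longlonglongrightarrow> 0" by simp
    then show ?thesis by (simp add: tendsto_const_iff)
  qed
qed

text \<open>Both sides of \<open>simple_isometry\<close> pass to the limit: the left by mean-square
  convergence of the integrals, the right by that of the integrands.\<close>

lemma L2_integral_isometry:
  assumes L: "L2_integral c H I" "L2_integral c' H' I'" and c: "c \<in> labels" "c' \<in> labels"
    and H: "bounded_process H" "bounded_process H'" and st: "0 \<le> s" "s \<le> t"
  shows "expectation (\<lambda>\<omega>. (I t \<omega> - I s \<omega>) * (I' t \<omega> - I' s \<omega>)) = (if c = c' then time_integral s t (\<lambda>r \<omega>. H r \<omega> * H' r \<omega>) else 0)"
proof (rule L2_integral_increment[OF L(1) c(1) H(1) st], rule L2_integral_increment[OF L(2) c(2) H(2) st])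
  fix Q Q' :: "nat \<Rightarrow> 'a simple_proc"
  assume Q: "\<And>k. simple_proc M F (Q k)"
    and i: "\<And>k. integrable M (\<lambda>\<omega>. ((SI c (Q k) t \<omega> - SI c (Q k) s \<omega>) - (I t \<omega> - I s \<omega>))\<^sup>2)"
    and l: "(\<lambda>k. expectation (\<lambda>\<omega>. ((SI c (Q k) t \<omega> - SI c (Q k) s \<omega>) - (I t \<omega> - I s \<omega>))\<^sup>2)) \<longlonglongrightarrow> 0"
    and v: "(\<lambda>k. time_integral s t (\<lambda>r \<omega>. (simple_val (Q k) r \<omega> - H r \<omega>)\<^sup>2)) \<longlonglongrightarrow> 0"
    and Q': "\<And>k. simple_proc M F (Q' k)"
    and i': "\<And>k. integrable M (\<lambda>\<omega>. ((SI c' (Q' k) t \<omega> - SI c' (Q' k) s \<omega>) - (I' t \<omega> - I' s \<omega>))\<^sup>2)"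
    and l': "(\<lambda>k. expectation (\<lambda>\<omega>. ((SI c' (Q' k) t \<omega> - SI c' (Q' k) s \<omega>) - (I' t \<omega> - I' s \<omega>))\<^sup>2)) \<longlonglongrightarrow> 0"
    and v': "(\<lambda>k. time_integral s t (\<lambda>r \<omega>. (simple_val (Q' k) r \<omega> - H' r \<omega>)\<^sup>2)) \<longlonglongrightarrow> 0"
  have t: "0 \<le> t" using st by simp
  have "(\<lambda>k. expectation (\<lambda>\<omega>. (SI c (Q k) t \<omega> - SI c (Q k) s \<omega>) * (SI c' (Q' k) t \<omega> - SI c' (Q' k) s \<omega>)))
     \<longlonglongrightarrow> expectation (\<lambda>\<omega>. (I t \<omega> - I s \<omega>) * (I' t \<omega> - I' s \<omega>))"
    by (rule tendsto_expectation_mult[OF _ _ _ _ L2_integral_increment_sq[OF L(1) c(1) H(1) st] L2_integral_increment_sq[OF L(2) c(2) H(2) st] i i' l l'])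
       (intro borel_measurable_diff simple_integral_measurable[OF Q c(1)] simple_integral_measurable[OF Q' c(2)]
          L2_integral_measurable[OF L(1)] L2_integral_measurable[OF L(2)] t st)+
  moreover have "(\<lambda>k. time_integral s t (\<lambda>r \<omega>. simple_val (Q k) r \<omega> * simple_val (Q' k) r \<omega>)) \<longlonglongrightarrow> time_integral s t (\<lambda>r \<omega>. H r \<omega> * H' r \<omega>)"
    by (rule tendsto_time_integral_mult[OF simple_val_bounded_process[OF Q] simple_val_bounded_process[OF Q'] H v v'])
  then have "(\<lambda>k. expectation (\<lambda>\<omega>. (SI c (Q k) t \<omega> - SI c (Q k) s \<omega>) * (SI c' (Q' k) t \<omega> - SI c' (Q' k) s \<omega>)))
     \<longlonglongrightarrow> (if c = c' then time_integral s t (\<lambda>r \<omega>. H r \<omega> * H' r \<omega>) else 0)"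
    unfolding simple_isometry[OF Q Q' c st] time_integral_def by simp
  ultimately show ?thesis by (rule LIMSEQ_unique)
qed

text \<open>The value at time 0 is not prescribed by the definition; it is inherited from simple
  integrals, which vanish there.\<close>

lemma L2_integral_initial:
  assumes L: "L2_integral c H I" and c: "c \<in> labels"
  shows "AE \<omega> in M. I 0 \<omega> = 0"
proof -
  obtain Q where Q: "\<And>k. simple_proc M F (Q k)"
    and i': "\<And>t k. 0 \<le> t \<Longrightarrow> integrable M (\<lambda>\<omega>. (SI c (Q k) t \<omega> - I t \<omega>)\<^sup>2)"
    and l': "\<And>t. 0 \<le> t \<Longrightarrow> (\<lambda>k. expectation (\<lambda>\<omega>. (SI c (Q k) t \<omega> - I t \<omega>)\<^sup>2)) \<longlonglongrightarrow> 0"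
    by (rule L2_integralE[OF L]) blast
  note i = i'[OF order_refl] and l = l'[OF order_refl]
  have i0: "integrable M (\<lambda>\<omega>. (I 0 \<omega>)\<^sup>2)" using i[of 0] by (simp add: simple_integral_0[OF Q])
  have "(\<lambda>k::nat. expectation (\<lambda>\<omega>. (I 0 \<omega>)\<^sup>2)) \<longlonglongrightarrow> 0" using l by (simp add: simple_integral_0[OF Q])
  then have "expectation (\<lambda>\<omega>. (I 0 \<omega>)\<^sup>2) = 0" by (simp add: tendsto_const_iff)
  then have "AE \<omega> in M. (I 0 \<omega>)\<^sup>2 = 0" using integral_nonneg_eq_0_iff_AE[OF i0] by simp
  then show ?thesis by eventually_elim simp
qed

text \<open>It removes from the noise of mode \<open>n\<close> the motions with first index above
  \<open>n\<close>.\<close>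

lemma L2_integral_zero:
  assumes L: "L2_integral c (\<lambda>_ _. 0) I" and c: "c \<in> labels" and t: "0 \<le> t"
  shows "AE \<omega> in M. I t \<omega> = 0"
proof -
  have "expectation (\<lambda>\<omega>. (I t \<omega> - I 0 \<omega>) * (I t \<omega> - I 0 \<omega>)) = 0"
    using L2_integral_isometry[OF L L c c bounded_process_const bounded_process_const order_refl t]
    by (simp add: time_integral_def set_lebesgue_integral_def)
  then have "AE \<omega> in M. (I t \<omega> - I 0 \<omega>)\<^sup>2 = 0"
    using integral_nonneg_eq_0_iff_AE[OF L2_integral_increment_sq[OF L c bounded_process_const order_refl t]]
    by (simp add: power2_eq_square)
  with L2_integral_initial[OF L c] show ?thesis by eventually_elim simp
qed

end

section \<open>Expectations of products\<close>

context prob_space begin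

text \<open>A factor frozen at time \<open>s\<close> can be moved under the time integral and
  compared there with the running process.\<close>

lemma bounded_process_frozen:
  assumes f: "bounded_process f" shows "bounded_process (\<lambda>r \<omega>. f s \<omega>)"
proof -
  obtain B where B: "0 \<le> B" "\<forall>r. \<forall>\<omega>\<in>space M. \<bar>f r \<omega>\<bar> \<le> B" using bounded_process_bound[OF f] by blast
  show ?thesis
  proof (rule bounded_processI)
    show "(\<lambda>(r, \<omega>). f s \<omega>) \<in> borel_measurable (borel \<Otimes>\<^sub>M M)"
      unfolding case_prod_beta' by (rule measurable_compose[OF measurable_snd bounded_process_random_variable[OF f]])
    show "\<bar>f s \<omega>\<bar> \<le> B" if "\<omega> \<in> space M" for r \<omega> using B(2) that by blast
  qed
qed

lemma time_integral_sum:
  assumes "finite C" "\<And>c. c \<in> C \<Longrightarrow> bounded_process (f c)"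
  shows "time_integral s t (\<lambda>r \<omega>. \<Sum>c\<in>C. f c r \<omega>) = (\<Sum>c\<in>C. time_integral s t (f c))"
  using assms
proof (induction C rule: finite_induct)
  case empty then show ?case by (simp add: time_integral_def set_lebesgue_integral_def)
next
  case (insert x C)
  have "bounded_process (\<lambda>r \<omega>. \<Sum>c\<in>C. f c r \<omega>)" by (rule bounded_process_sum) (use insert in blast)
  then show ?case using insert by (simp add: time_integral_add)
qed

lemma bounded_process_sq_integrable: "bounded_process f \<Longrightarrow> integrable M (\<lambda>\<omega>. (f s \<omega>)\<^sup>2)"
  by (rule bounded_process_integrable[OF bounded_process_power2])

lemma bounded_process_integral_sq:
  assumes f: "bounded_process f" and B: "0 \<le> B" "\<forall>r. \<forall>\<omega>\<in>space M. \<bar>f r \<omega>\<bar> \<le> B" and st: "s \<le> t"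
  shows "integrable M (\<lambda>\<omega>. (LBINT r:{s..t}. f r \<omega>)\<^sup>2)"
    and "expectation (\<lambda>\<omega>. (LBINT r:{s..t}. f r \<omega>)\<^sup>2) \<le> B\<^sup>2 * (t - s)\<^sup>2"
proof -
  have le: "(LBINT r:{s..t}. f r \<omega>)\<^sup>2 \<le> B\<^sup>2 * (t - s)\<^sup>2" if "\<omega> \<in> space M" for \<omega>
    using power_mono[OF bounded_process_integral_bound[OF f that st, of B] abs_ge_zero, of 2] B(2) that
    by (simp add: power_mult_distrib)
  show i: "integrable M (\<lambda>\<omega>. (LBINT r:{s..t}. f r \<omega>)\<^sup>2)"
  proof (rule integrable_const_bound[where B="B\<^sup>2 * (t - s)\<^sup>2"])
    show "AE \<omega> in M. norm ((LBINT r:{s..t}. f r \<omega>)\<^sup>2) \<le> B\<^sup>2 * (t - s)\<^sup>2"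
      by (rule AE_I2) (use le in simp)
    show "(\<lambda>\<omega>. (LBINT r:{s..t}. f r \<omega>)\<^sup>2) \<in> borel_measurable M"
      by (rule borel_measurable_power[OF bounded_process_integral_measurable[OF f]])
  qed
  have "expectation (\<lambda>\<omega>. (LBINT r:{s..t}. f r \<omega>)\<^sup>2) \<le> expectation (\<lambda>\<omega>. B\<^sup>2 * (t - s)\<^sup>2)"
    by (rule integral_mono[OF i]) (use le in auto)
  then show "expectation (\<lambda>\<omega>. (LBINT r:{s..t}. f r \<omega>)\<^sup>2) \<le> B\<^sup>2 * (t - s)\<^sup>2" by (simp add: prob_space)
qed

end

section \<open>Noise over finitely many motions, and processes with drift and noise\<close>

context driven_space begin

definition noise :: "(nat \<times> nat) set \<Rightarrow> (nat \<times> nat \<Rightarrow> real) \<Rightarrow> (nat \<times> nat \<Rightarrow> real \<Rightarrow> 'a \<Rightarrow> real) \<Rightarrow> real \<Rightarrow> real \<Rightarrow> 'a \<Rightarrow> real" where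
  "noise C \<alpha> I s t \<omega> = (\<Sum>c\<in>C. \<alpha> c * (I c t \<omega> - I c s \<omega>))"

definition integrators :: "(nat \<times> nat) set \<Rightarrow> (nat \<times> nat \<Rightarrow> real \<Rightarrow> 'a \<Rightarrow> real) \<Rightarrow> (nat \<times> nat \<Rightarrow> real \<Rightarrow> 'a \<Rightarrow> real) \<Rightarrow> bool" where
  "integrators C H I \<longleftrightarrow> finite C \<and> C \<subseteq> labels \<and> (\<forall>c\<in>C. bounded_process (H c) \<and> L2_integral c (H c) (I c))"

lemma noise_measurable:
  assumes "integrators C H I" "0 \<le> s" "s \<le> t"
  shows "noise C \<alpha> I s t \<in> borel_measurable M"
proof -
  have "I c u \<in> borel_measurable M" if "c \<in> C" "0 \<le> u" for c u
    using assms(1) that L2_integral_measurable unfolding integrators_def by blast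
  then show ?thesis unfolding noise_def[abs_def] using assms(2,3)
    by (intro borel_measurable_sum borel_measurable_times borel_measurable_const borel_measurable_diff) auto
qed

lemma noise_sq_integrable:
  assumes I: "integrators C H I" and st: "0 \<le> s" "s \<le> t"
  shows "integrable M (\<lambda>\<omega>. (noise C \<alpha> I s t \<omega>)\<^sup>2)"
proof -
  have "finite C" using I by (simp add: integrators_def)
  moreover have "D \<subseteq> C \<longrightarrow> integrable M (\<lambda>\<omega>. (noise D \<alpha> I s t \<omega>)\<^sup>2)" if "finite D" for D
    using that
  proof (induction D rule: finite_induct)
    case empty then show ?case by (simp add: noise_def)
  next
    case (insert c D)
    show ?case
    proof
      assume sub: "insert c D \<subseteq> C"
      have ID: "integrators D H I" using I sub insert.hyps(1) unfolding integrators_def by blast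
      have c: "c \<in> labels" "bounded_process (H c)" "L2_integral c (H c) (I c)" using I sub unfolding integrators_def by auto
      have m: "(\<lambda>\<omega>. \<alpha> c * (I c t \<omega> - I c s \<omega>)) \<in> borel_measurable M"
        using st by (intro borel_measurable_times borel_measurable_const borel_measurable_diff L2_integral_measurable[OF c(3)]) auto
      have i: "integrable M (\<lambda>\<omega>. (\<alpha> c * (I c t \<omega> - I c s \<omega>))\<^sup>2)"
        using L2_integral_increment_sq[OF c(3,1,2) st] by (simp add: power_mult_distrib)
      have "integrable M (\<lambda>\<omega>. (\<alpha> c * (I c t \<omega> - I c s \<omega>) + noise D \<alpha> I s t \<omega>)\<^sup>2)"
        by (rule integrable_power2_add[OF m noise_measurable[OF ID st] i]) (use insert.IH sub in blast)
      then show "integrable M (\<lambda>\<omega>. (noise (insert c D) \<alpha> I s t \<omega>)\<^sup>2)"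
        using insert.hyps unfolding noise_def by simp
    qed
  qed
  ultimately show ?thesis by blast
qed

lemma noise_past:
  assumes I: "integrators C H I" and st: "0 \<le> s" "s \<le> t"
    and \<eta>: "\<eta> \<in> borel_measurable (F s)" "\<And>\<omega>. \<omega> \<in> space M \<Longrightarrow> \<bar>\<eta> \<omega>\<bar> \<le> B"
  shows "expectation (\<lambda>\<omega>. \<eta> \<omega> * noise C \<alpha> I s t \<omega>) = 0"
proof -
  have c: "c \<in> labels" "bounded_process (H c)" "L2_integral c (H c) (I c)" if "c \<in> C" for c using I that unfolding integrators_def by auto
  have E: "integrable M (\<lambda>\<omega>. \<alpha> c * (\<eta> \<omega> * (I c t \<omega> - I c s \<omega>)))" "expectation (\<lambda>\<omega>. \<alpha> c * (\<eta> \<omega> * (I c t \<omega> - I c s \<omega>))) = 0" if "c \<in> C" for c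
    using L2_integral_increment_past[OF c(3)[OF that] c(1)[OF that] c(2)[OF that] st \<eta>] by simp_all
  have "expectation (\<lambda>\<omega>. \<eta> \<omega> * noise C \<alpha> I s t \<omega>) = expectation (\<lambda>\<omega>. \<Sum>c\<in>C. \<alpha> c * (\<eta> \<omega> * (I c t \<omega> - I c s \<omega>)))"
    unfolding noise_def sum_distrib_left by (simp add: mult.left_commute)
  also have "\<dots> = (\<Sum>c\<in>C. expectation (\<lambda>\<omega>. \<alpha> c * (\<eta> \<omega> * (I c t \<omega> - I c s \<omega>))))"
    by (rule Bochner_Integration.integral_sum) (rule E(1))
  also have "\<dots> = 0" by (intro sum.neutral ballI E(2))
  finally show ?thesis .
qed

text \<open>Orthogonality of different motions leaves only the diagonal of the double sum. The
  coefficients \<alpha> are shared because they depend on the mode and its labels, not on the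
  solution.\<close>

lemma noise_isometry:
  assumes I: "integrators C H I" "integrators C H' I'" and st: "0 \<le> s" "s \<le> t"
  shows "expectation (\<lambda>\<omega>. noise C \<alpha> I s t \<omega> * noise C \<alpha> I' s t \<omega>) = time_integral s t (\<lambda>r \<omega>. \<Sum>c\<in>C. (\<alpha> c)\<^sup>2 * (H c r \<omega> * H' c r \<omega>))"
proof -
  have fin: "finite C" using I by (simp add: integrators_def)
  have c: "c \<in> labels" "bounded_process (H c)" "L2_integral c (H c) (I c)" "bounded_process (H' c)" "L2_integral c (H' c) (I' c)" if "c \<in> C" for c
    using I that unfolding integrators_def by auto
  let ?T = "\<lambda>c d \<omega>. \<alpha> c * \<alpha> d * ((I c t \<omega> - I c s \<omega>) * (I' d t \<omega> - I' d s \<omega>))"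
  have iT: "integrable M (?T c d)" if "c \<in> C" "d \<in> C" for c d
    using st by (intro integrable_mult_right integrable_mult_squares L2_integral_increment_sq[OF c(3,1,2)[OF that(1)]] L2_integral_increment_sq[OF c(5,1,4)[OF that(2)]]
      borel_measurable_diff L2_integral_measurable[OF c(3)[OF that(1)]] L2_integral_measurable[OF c(5)[OF that(2)]]) auto
  have ET: "expectation (?T c d) = (if c = d then (\<alpha> c)\<^sup>2 * time_integral s t (\<lambda>r \<omega>. H c r \<omega> * H' c r \<omega>) else 0)" if "c \<in> C" "d \<in> C" for c d
    using L2_integral_isometry[OF c(3)[OF that(1)] c(5)[OF that(2)] c(1)[OF that(1)] c(1)[OF that(2)] c(2)[OF that(1)] c(4)[OF that(2)] st]
    by (simp add: power2_eq_square)
  have "expectation (\<lambda>\<omega>. noise C \<alpha> I s t \<omega> * noise C \<alpha> I' s t \<omega>) = expectation (\<lambda>\<omega>. \<Sum>c\<in>C. \<Sum>d\<in>C. ?T c d \<omega>)"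
    unfolding noise_def sum_product by (simp add: mult_ac)
  also have "\<dots> = (\<Sum>c\<in>C. expectation (\<lambda>\<omega>. \<Sum>d\<in>C. ?T c d \<omega>))"
    by (rule Bochner_Integration.integral_sum) (rule Bochner_Integration.integrable_sum, rule iT)
  also have "\<dots> = (\<Sum>c\<in>C. \<Sum>d\<in>C. expectation (?T c d))"
    by (intro sum.cong refl Bochner_Integration.integral_sum iT)
  also have "\<dots> = (\<Sum>c\<in>C. \<Sum>d\<in>C. if c = d then (\<alpha> c)\<^sup>2 * time_integral s t (\<lambda>r \<omega>. H c r \<omega> * H' c r \<omega>) else 0)"
    by (intro sum.cong refl ET)
  also have "\<dots> = (\<Sum>c\<in>C. (\<alpha> c)\<^sup>2 * time_integral s t (\<lambda>r \<omega>. H c r \<omega> * H' c r \<omega>))"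
    using fin by simp
  also have "\<dots> = (\<Sum>c\<in>C. time_integral s t (\<lambda>r \<omega>. (\<alpha> c)\<^sup>2 * (H c r \<omega> * H' c r \<omega>)))"
    by (intro sum.cong refl time_integral_cmult[symmetric] bounded_process_mult c)
  also have "\<dots> = time_integral s t (\<lambda>r \<omega>. \<Sum>c\<in>C. (\<alpha> c)\<^sup>2 * (H c r \<omega> * H' c r \<omega>))"
    by (rule time_integral_sum[symmetric, OF fin]) (intro bounded_process_cmult bounded_process_mult c)
  finally show ?thesis .
qed

text \<open>The integrated form of a stochastic differential with drift \<open>b\<close> and noise
  coefficients \<open>\<alpha> c * H c\<close>. Adaptedness is demanded up to a null set, because a
  regular modification changes paths on a null set that need not belong to \<open>F t\<close>. The
  equation is asked for at each fixed time almost surely, since only expectations are formed from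
  it.\<close>

definition evolves :: "(real \<Rightarrow> 'a \<Rightarrow> real) \<Rightarrow> (real \<Rightarrow> 'a \<Rightarrow> real) \<Rightarrow> (nat \<times> nat) set \<Rightarrow>
    (nat \<times> nat \<Rightarrow> real) \<Rightarrow> (nat \<times> nat \<Rightarrow> real \<Rightarrow> 'a \<Rightarrow> real) \<Rightarrow> (nat \<times> nat \<Rightarrow> real \<Rightarrow> 'a \<Rightarrow> real) \<Rightarrow> bool" where
  "evolves X b C \<alpha> H I \<longleftrightarrow> bounded_process X \<and> bounded_process b \<and> integrators C H I \<and>
     (\<forall>t\<ge>0. \<exists>\<eta>\<in>borel_measurable (F t). AE \<omega> in M. X t \<omega> = \<eta> \<omega>) \<and>
     (\<forall>t\<ge>0. AE \<omega> in M. X t \<omega> = X 0 \<omega> + (LBINT r:{0..t}. b r \<omega>) + (\<Sum>c\<in>C. \<alpha> c * I c t \<omega>))"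

lemma evolves_increment:
  assumes X: "evolves X b C \<alpha> H I" and st: "0 \<le> s" "s \<le> t"
  shows "AE \<omega> in M. X t \<omega> = X s \<omega> + (LBINT r:{s..t}. b r \<omega>) + noise C \<alpha> I s t \<omega>"
proof -
  have b: "bounded_process b" using X unfolding evolves_def by blast
  have 1: "AE \<omega> in M. X t \<omega> = X 0 \<omega> + (LBINT r:{0..t}. b r \<omega>) + (\<Sum>c\<in>C. \<alpha> c * I c t \<omega>)"
    and 2: "AE \<omega> in M. X s \<omega> = X 0 \<omega> + (LBINT r:{0..s}. b r \<omega>) + (\<Sum>c\<in>C. \<alpha> c * I c s \<omega>)"
    using X st unfolding evolves_def by auto
  have 3: "AE \<omega> in M. (LBINT r:{0..t}. b r \<omega>) = (LBINT r:{0..s}. b r \<omega>) + (LBINT r:{s..t}. b r \<omega>)"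
    by (rule AE_I2) (rule set_integral_Icc_split[OF bounded_process_set_integrable[OF b] st])
  show ?thesis using 1 2 3
    by eventually_elim (simp add: noise_def right_diff_distrib sum_subtractf)
qed

lemma evolves_past_noise:
  assumes X: "evolves X b C \<alpha> H I" and Y: "integrators C' H' I'" and st: "0 \<le> s" "s \<le> t"
  shows "expectation (\<lambda>\<omega>. X s \<omega> * noise C' \<alpha>' I' s t \<omega>) = 0"
proof -
  have bX: "bounded_process X" using X unfolding evolves_def by blast
  obtain K where K: "0 \<le> K" "\<forall>r. \<forall>\<omega>\<in>space M. \<bar>X r \<omega>\<bar> \<le> K" using bounded_process_bound[OF bX] by blast
  obtain \<eta> where \<eta>: "\<eta> \<in> borel_measurable (F s)" "AE \<omega> in M. X s \<omega> = \<eta> \<omega>" using X st(1) unfolding evolves_def by blast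
  \<comment> \<open>The adapted representative \<eta> may be unbounded on the null set where it
    differs from \<open>X s\<close>; truncation at the bound of \<open>X\<close> makes it bounded
    and changes it on this null set only.\<close>
  have m: "(\<lambda>\<omega>. cut K (\<eta> \<omega>)) \<in> borel_measurable (F s)" by (rule cut_measurable[OF \<eta>(1)])
  have eq: "AE \<omega> in M. X s \<omega> * noise C' \<alpha>' I' s t \<omega> = cut K (\<eta> \<omega>) * noise C' \<alpha>' I' s t \<omega>"
    using \<eta>(2) AE_space
  proof eventually_elim
    case (elim \<omega>)
    have "\<bar>X s \<omega>\<bar> \<le> K" using K(2) elim(2) by blast
    then have "cut K (X s \<omega>) = X s \<omega>" unfolding cut_def by linarith
    then show ?case using elim(1) by simp
  qed
  have "expectation (\<lambda>\<omega>. X s \<omega> * noise C' \<alpha>' I' s t \<omega>) = expectation (\<lambda>\<omega>. cut K (\<eta> \<omega>) * noise C' \<alpha>' I' s t \<omega>)"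
    by (rule integral_cong_AE[OF _ _ eq])
       (intro borel_measurable_times bounded_process_random_variable[OF bX] noise_measurable[OF Y st] borel_measurable_F_M[OF m st(1)])+
  also have "\<dots> = 0" by (rule noise_past[OF Y st m]) (rule cut_bound[OF K(1)])
  finally show ?thesis .
qed

lemma noise_sq_bound:
  assumes I: "integrators C H I"
  shows "\<exists>D\<ge>0. \<forall>s t. 0 \<le> s \<and> s \<le> t \<longrightarrow> expectation (\<lambda>\<omega>. (noise C \<alpha> I s t \<omega>)\<^sup>2) \<le> D * (t - s)"
proof -
  have b: "bounded_process (\<lambda>r \<omega>. \<Sum>c\<in>C. (\<alpha> c)\<^sup>2 * (H c r \<omega> * H c r \<omega>))"
    using I unfolding integrators_def by (intro bounded_process_sum bounded_process_cmult bounded_process_mult) auto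
  obtain D where D: "0 \<le> D" "\<forall>r. \<forall>\<omega>\<in>space M. \<bar>\<Sum>c\<in>C. (\<alpha> c)\<^sup>2 * (H c r \<omega> * H c r \<omega>)\<bar> \<le> D"
    using bounded_process_bound[OF b] by blast
  have "expectation (\<lambda>\<omega>. (noise C \<alpha> I s t \<omega>)\<^sup>2) \<le> D * (t - s)" if "0 \<le> s" "s \<le> t" for s t
  proof -
    have "time_integral s t (\<lambda>r \<omega>. \<Sum>c\<in>C. (\<alpha> c)\<^sup>2 * (H c r \<omega> * H c r \<omega>)) \<le> time_integral s t (\<lambda>_ _. D)"
      by (rule time_integral_mono[OF b bounded_process_const]) (use D(2) abs_le_D1 in blast)
    then show ?thesis
      using noise_isometry[OF I I that] time_integral_const[OF that(2)] by (simp add: power2_eq_square)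
  qed
  then show ?thesis using D(1) by blast
qed

text \<open>The noise contributes order \<open>t - s\<close> by the isometry, the drift order
  \<open>(t - s)\<^sup>2\<close>, which is no larger as the interval has length at most 1.\<close>

lemma evolves_increment_sq_bound:
  assumes X: "evolves X b C \<alpha> H I"
  shows "\<exists>c\<ge>0. \<forall>s t. 0 \<le> s \<and> s \<le> t \<and> t \<le> s + 1 \<longrightarrow> expectation (\<lambda>\<omega>. (X t \<omega> - X s \<omega>)\<^sup>2) \<le> c * (t - s)"
proof -
  have bX: "bounded_process X" and b: "bounded_process b" and I: "integrators C H I" using X unfolding evolves_def by blast+
  obtain K where K: "0 \<le> K" "\<forall>r. \<forall>\<omega>\<in>space M. \<bar>b r \<omega>\<bar> \<le> K" using bounded_process_bound[OF b] by blast
  obtain D where D: "0 \<le> D" "\<forall>s t. 0 \<le> s \<and> s \<le> t \<longrightarrow> expectation (\<lambda>\<omega>. (noise C \<alpha> I s t \<omega>)\<^sup>2) \<le> D * (t - s)"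
    using noise_sq_bound[OF I] by blast
  have "expectation (\<lambda>\<omega>. (X t \<omega> - X s \<omega>)\<^sup>2) \<le> (2 * K\<^sup>2 + 2 * D) * (t - s)" if st: "0 \<le> s" "s \<le> t" "t \<le> s + 1" for s t
  proof -
    note bi = bounded_process_integral_sq[OF b K st(2)]
    note ni = noise_sq_integrable[OF I st(1,2), of \<alpha>]
    have "expectation (\<lambda>\<omega>. (X t \<omega> - X s \<omega>)\<^sup>2) \<le> expectation (\<lambda>\<omega>. 2 * (LBINT r:{s..t}. b r \<omega>)\<^sup>2 + 2 * (noise C \<alpha> I s t \<omega>)\<^sup>2)"
    proof (rule integral_mono_AE)
      show "integrable M (\<lambda>\<omega>. (X t \<omega> - X s \<omega>)\<^sup>2)"
        by (intro integrable_power2_diff bounded_process_random_variable bounded_process_sq_integrable bX)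
      show "integrable M (\<lambda>\<omega>. 2 * (LBINT r:{s..t}. b r \<omega>)\<^sup>2 + 2 * (noise C \<alpha> I s t \<omega>)\<^sup>2)"
        by (intro Bochner_Integration.integrable_add integrable_mult_right bi(1) ni)
      show "AE \<omega> in M. (X t \<omega> - X s \<omega>)\<^sup>2 \<le> 2 * (LBINT r:{s..t}. b r \<omega>)\<^sup>2 + 2 * (noise C \<alpha> I s t \<omega>)\<^sup>2"
        using evolves_increment[OF X st(1,2)]
      proof eventually_elim
        case (elim \<omega>)
        have "(x + y)\<^sup>2 \<le> 2 * x\<^sup>2 + 2 * y\<^sup>2" for x y :: real
        proof -
          have "0 \<le> (x - y)\<^sup>2" by simp
          then show ?thesis by (simp add: power2_eq_square algebra_simps)
        qed
        from this[of "LBINT r:{s..t}. b r \<omega>" "noise C \<alpha> I s t \<omega>"] show ?case unfolding elim by simp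
      qed
    qed
    also have "\<dots> = 2 * expectation (\<lambda>\<omega>. (LBINT r:{s..t}. b r \<omega>)\<^sup>2) + 2 * expectation (\<lambda>\<omega>. (noise C \<alpha> I s t \<omega>)\<^sup>2)"
      using bi(1) ni by simp
    also have "\<dots> \<le> 2 * (K\<^sup>2 * (t - s)\<^sup>2) + 2 * (D * (t - s))"
      using bi(2) D(2) st by (intro add_mono mult_left_mono) auto
    also have "\<dots> \<le> 2 * (K\<^sup>2 * (t - s)) + 2 * (D * (t - s))"
      using st by (intro add_mono mult_left_mono order_refl) (auto simp: power2_eq_square mult_left_le_one_le)
    finally show ?thesis by (simp add: algebra_simps)
  qed
  moreover have "0 \<le> 2 * K\<^sup>2 + 2 * D" using D(1) by simp
  ultimately show ?thesis by blast
qed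

text \<open>Freezing \<open>X\<close> at the left end costs order \<open>sqrt (t - s)\<close> in
  mean square at each time, and integration over the interval supplies the other factor
  \<open>t - s\<close>.\<close>

lemma evolves_drift_bound:
  assumes X: "evolves X b C \<alpha> H I" and g: "bounded_process g"
  shows "\<exists>c\<ge>0. \<forall>s t. 0 \<le> s \<and> s < t \<and> t \<le> s + 1 \<longrightarrow>
    \<bar>expectation (\<lambda>\<omega>. X s \<omega> * (LBINT r:{s..t}. g r \<omega>)) - time_integral s t (\<lambda>r \<omega>. X r \<omega> * g r \<omega>)\<bar> \<le> c * ((t - s) * sqrt (t - s))"
proof -
  have bX: "bounded_process X" using X unfolding evolves_def by blast+
  obtain K where K: "0 \<le> K" "\<forall>r. \<forall>\<omega>\<in>space M. \<bar>g r \<omega>\<bar> \<le> K" using bounded_process_bound[OF g] by blast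
  obtain c where c: "0 \<le> c" "\<forall>s t. 0 \<le> s \<and> s \<le> t \<and> t \<le> s + 1 \<longrightarrow> expectation (\<lambda>\<omega>. (X t \<omega> - X s \<omega>)\<^sup>2) \<le> c * (t - s)"
    using evolves_increment_sq_bound[OF X] by blast
  have "\<bar>expectation (\<lambda>\<omega>. X s \<omega> * (LBINT r:{s..t}. g r \<omega>)) - time_integral s t (\<lambda>r \<omega>. X r \<omega> * g r \<omega>)\<bar> \<le> ((c + K\<^sup>2) / 2) * ((t - s) * sqrt (t - s))"
    if st: "0 \<le> s" "s < t" "t \<le> s + 1" for s t
  proof -
    let ?d = "\<lambda>r \<omega>. (X s \<omega> - X r \<omega>) * g r \<omega>"
    have bd: "bounded_process (\<lambda>r \<omega>. X s \<omega> - X r \<omega>)" by (intro bounded_process_diff bounded_process_frozen bX)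
    have "expectation (\<lambda>\<omega>. X s \<omega> * (LBINT r:{s..t}. g r \<omega>)) = time_integral s t (\<lambda>r \<omega>. X s \<omega> * g r \<omega>)"
      unfolding time_integral_def by simp
    then have "expectation (\<lambda>\<omega>. X s \<omega> * (LBINT r:{s..t}. g r \<omega>)) - time_integral s t (\<lambda>r \<omega>. X r \<omega> * g r \<omega>) = time_integral s t ?d"
      unfolding left_diff_distrib
      by (simp only: time_integral_diff[OF bounded_process_mult[OF bounded_process_frozen[OF bX] g] bounded_process_mult[OF bX g]])
    moreover have "\<bar>time_integral s t ?d\<bar> \<le> ((c + K\<^sup>2) / 2 * sqrt (t - s)) * (t - s)"
    proof (rule time_integral_abs_le[OF bounded_process_mult[OF bd g] less_imp_le[OF st(2)]])
      fix r assume r: "r \<in> {s..t}"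
      let ?q = "sqrt (t - s)"
      have q: "0 < ?q" "0 < 1 / ?q" using st by auto
      have 1: "expectation (\<lambda>\<omega>. (X s \<omega> - X r \<omega>)\<^sup>2) \<le> c * (t - s)"
      proof -
        have "expectation (\<lambda>\<omega>. (X r \<omega> - X s \<omega>)\<^sup>2) \<le> c * (r - s)" using c(2) r st by auto
        also have "\<dots> \<le> c * (t - s)" using r c(1) by (intro mult_left_mono) auto
        finally show ?thesis by (simp add: power2_commute)
      qed
      have 2: "expectation (\<lambda>\<omega>. (g r \<omega>)\<^sup>2) \<le> K\<^sup>2"
      proof -
        have "expectation (\<lambda>\<omega>. (g r \<omega>)\<^sup>2) \<le> expectation (\<lambda>\<omega>. K\<^sup>2)"
        proof (rule integral_mono[OF bounded_process_sq_integrable[OF g]])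
          fix \<omega> assume "\<omega> \<in> space M"
          then have "\<bar>g r \<omega>\<bar> \<le> K" using K(2) by blast
          then show "(g r \<omega>)\<^sup>2 \<le> K\<^sup>2" by (metis abs_ge_zero power2_abs power_mono)
        qed simp
        then show ?thesis by (simp add: prob_space)
      qed
      \<comment> \<open>The weight \<open>1 / sqrt (t - s)\<close> balances a factor whose square
        has order \<open>t - s\<close> against one of order 1.\<close>
      have "\<bar>expectation (?d r)\<bar> \<le> (1 / ?q * expectation (\<lambda>\<omega>. (X s \<omega> - X r \<omega>)\<^sup>2) + expectation (\<lambda>\<omega>. (g r \<omega>)\<^sup>2) / (1 / ?q)) / 2"
        by (intro abs_expectation_mult_le q(2) bounded_process_random_variable[OF bd] bounded_process_random_variable[OF g]
            bounded_process_sq_integrable[OF bd] bounded_process_sq_integrable[OF g])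
      also have "\<dots> \<le> (1 / ?q * (c * (t - s)) + K\<^sup>2 / (1 / ?q)) / 2"
        using 1 2 q by (intro divide_right_mono add_mono mult_left_mono) auto
      also have "1 / ?q * (c * (t - s)) = c * ?q"
        using st by (simp add: field_simps)
      also have "(c * ?q + K\<^sup>2 / (1 / ?q)) / 2 = (c + K\<^sup>2) / 2 * ?q" by (simp add: field_simps)
      finally show "\<bar>expectation (?d r)\<bar> \<le> (c + K\<^sup>2) / 2 * ?q" .
    qed
    ultimately show ?thesis by (simp add: mult_ac)
  qed
  moreover have "0 \<le> (c + K\<^sup>2) / 2" using c(1) by simp
  ultimately show ?thesis by blast
qed

text \<open>In mean square the drift over the interval has order \<open>t - s\<close> and the noise
  order \<open>sqrt (t - s)\<close>; the weight \<open>1 / sqrt (t - s)\<close> in Young's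
  inequality yields the product of these orders.\<close>

lemma drift_noise_bound:
  assumes g: "bounded_process g" and I: "integrators C H I"
  shows "\<exists>c\<ge>0. \<forall>s t. 0 \<le> s \<and> s < t \<and> t \<le> s + 1 \<longrightarrow>
    \<bar>expectation (\<lambda>\<omega>. (LBINT r:{s..t}. g r \<omega>) * noise C \<alpha> I s t \<omega>)\<bar> \<le> c * ((t - s) * sqrt (t - s))"
proof -
  obtain K where K: "0 \<le> K" "\<forall>r. \<forall>\<omega>\<in>space M. \<bar>g r \<omega>\<bar> \<le> K" using bounded_process_bound[OF g] by blast
  obtain D where D: "0 \<le> D" "\<forall>s t. 0 \<le> s \<and> s \<le> t \<longrightarrow> expectation (\<lambda>\<omega>. (noise C \<alpha> I s t \<omega>)\<^sup>2) \<le> D * (t - s)"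
    using noise_sq_bound[OF I] by blast
  have "\<bar>expectation (\<lambda>\<omega>. (LBINT r:{s..t}. g r \<omega>) * noise C \<alpha> I s t \<omega>)\<bar> \<le> ((K\<^sup>2 + D) / 2) * ((t - s) * sqrt (t - s))"
    if st: "0 \<le> s" "s < t" "t \<le> s + 1" for s t
  proof -
    let ?q = "sqrt (t - s)"
    have st': "s \<le> t" using st by simp
    have q: "0 < ?q" "0 < 1 / ?q" using st by auto
    note bi = bounded_process_integral_sq[OF g K st']
    have "\<bar>expectation (\<lambda>\<omega>. (LBINT r:{s..t}. g r \<omega>) * noise C \<alpha> I s t \<omega>)\<bar> \<le>
      (1 / ?q * expectation (\<lambda>\<omega>. (LBINT r:{s..t}. g r \<omega>)\<^sup>2) + expectation (\<lambda>\<omega>. (noise C \<alpha> I s t \<omega>)\<^sup>2) / (1 / ?q)) / 2"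
      by (intro abs_expectation_mult_le q(2) bounded_process_integral_measurable[OF g] noise_measurable[OF I st(1) st'] bi(1) noise_sq_integrable[OF I st(1) st'])
    also have "\<dots> \<le> (1 / ?q * (K\<^sup>2 * (t - s)\<^sup>2) + D * (t - s) / (1 / ?q)) / 2"
      using bi(2) D(2) st q by (intro divide_right_mono add_mono mult_left_mono) auto
    also have "1 / ?q * (K\<^sup>2 * (t - s)\<^sup>2) = K\<^sup>2 * ((t - s) * ?q)"
      using st by (simp add: field_simps power2_eq_square)
    also have "(K\<^sup>2 * ((t - s) * ?q) + D * (t - s) / (1 / ?q)) / 2 = (K\<^sup>2 + D) / 2 * ((t - s) * ?q)" by (simp add: field_simps)
    finally show ?thesis .
  qed
  moreover have "0 \<le> (K\<^sup>2 + D) / 2" using D(1) by simp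
  ultimately show ?thesis by blast
qed

text \<open>
  The increment of $E[XY]$ over a short interval of length \<open>h\<close> agrees with that of the time
  integral up to $O(h^{3/2})$; no Ito formula is needed for expectations of products.
\<close>

lemma evolves_product:
  assumes X: "evolves X b C \<alpha> H I" and Y: "evolves Y b' C \<alpha> H' I'" and st: "0 \<le> s" "s \<le> t"
  shows "expectation (\<lambda>\<omega>. X t \<omega> * Y t \<omega>) - expectation (\<lambda>\<omega>. X s \<omega> * Y s \<omega>) =
    time_integral s t (\<lambda>r \<omega>. X r \<omega> * b' r \<omega> + Y r \<omega> * b r \<omega> + (\<Sum>c\<in>C. (\<alpha> c)\<^sup>2 * (H c r \<omega> * H' c r \<omega>)))"
proof -
  have bX: "bounded_process X" and b: "bounded_process b" and I: "integrators C H I" using X unfolding evolves_def by blast+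
  have bY: "bounded_process Y" and b': "bounded_process b'" and I': "integrators C H' I'" using Y unfolding evolves_def by blast+
  let ?n = "\<lambda>r \<omega>. \<Sum>c\<in>C. (\<alpha> c)\<^sup>2 * (H c r \<omega> * H' c r \<omega>)"
  have bn: "bounded_process ?n"
    using I I' unfolding integrators_def by (intro bounded_process_sum bounded_process_cmult bounded_process_mult) auto
  have bXb': "bounded_process (\<lambda>r \<omega>. X r \<omega> * b' r \<omega>)" and bYb: "bounded_process (\<lambda>r \<omega>. Y r \<omega> * b r \<omega>)"
    by (intro bounded_process_mult bX bY b b')+
  let ?g = "\<lambda>r \<omega>. X r \<omega> * b' r \<omega> + Y r \<omega> * b r \<omega> + ?n r \<omega>"
  have bg: "bounded_process ?g" by (intro bounded_process_add bXb' bYb bn)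
  \<comment> \<open>The defect of the claimed identity; it suffices that it is constant in
    time.\<close>
  define \<Psi> where "\<Psi> u = expectation (\<lambda>\<omega>. X u \<omega> * Y u \<omega>) - time_integral 0 u ?g" for u
  obtain c1 where c1: "0 \<le> c1" "\<forall>s t. 0 \<le> s \<and> s < t \<and> t \<le> s + 1 \<longrightarrow>
    \<bar>expectation (\<lambda>\<omega>. X s \<omega> * (LBINT r:{s..t}. b' r \<omega>)) - time_integral s t (\<lambda>r \<omega>. X r \<omega> * b' r \<omega>)\<bar> \<le> c1 * ((t - s) * sqrt (t - s))"
    using evolves_drift_bound[OF X b'] by blast
  obtain c2 where c2: "0 \<le> c2" "\<forall>s t. 0 \<le> s \<and> s < t \<and> t \<le> s + 1 \<longrightarrow>
    \<bar>expectation (\<lambda>\<omega>. Y s \<omega> * (LBINT r:{s..t}. b r \<omega>)) - time_integral s t (\<lambda>r \<omega>. Y r \<omega> * b r \<omega>)\<bar> \<le> c2 * ((t - s) * sqrt (t - s))"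
    using evolves_drift_bound[OF Y b] by blast
  obtain c3 where c3: "0 \<le> c3" "\<forall>s t. 0 \<le> s \<and> s < t \<and> t \<le> s + 1 \<longrightarrow>
    \<bar>expectation (\<lambda>\<omega>. (LBINT r:{s..t}. b r \<omega>) * noise C \<alpha> I' s t \<omega>)\<bar> \<le> c3 * ((t - s) * sqrt (t - s))"
    using drift_noise_bound[OF b I'] by blast
  obtain c4 where c4: "0 \<le> c4" "\<forall>s t. 0 \<le> s \<and> s < t \<and> t \<le> s + 1 \<longrightarrow>
    \<bar>expectation (\<lambda>\<omega>. (LBINT r:{s..t}. b' r \<omega>) * noise C \<alpha> I s t \<omega>)\<bar> \<le> c4 * ((t - s) * sqrt (t - s))"
    using drift_noise_bound[OF b' I] by blast
  obtain K where K: "0 \<le> K" "\<forall>r. \<forall>\<omega>\<in>space M. \<bar>b r \<omega>\<bar> \<le> K" using bounded_process_bound[OF b] by blast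
  obtain K' where K': "0 \<le> K'" "\<forall>r. \<forall>\<omega>\<in>space M. \<bar>b' r \<omega>\<bar> \<le> K'" using bounded_process_bound[OF b'] by blast
  define c5 where "c5 = (K\<^sup>2 + K'\<^sup>2) / 2"
  have c5: "0 \<le> c5" by (simp add: c5_def)
  have "\<bar>\<Psi> t - \<Psi> s\<bar> \<le> (c1 + c2 + c3 + c4 + c5) * ((t - s) * sqrt (t - s))" if st: "0 \<le> s" "s \<le> t" "t \<le> s + 1" for s t
  proof (cases "s = t")
    case False
    then have lt: "s < t" using st by simp
    have t: "0 \<le> t" using st by simp
    define h where "h = (t - s) * sqrt (t - s)"
    let ?\<beta> = "\<lambda>\<omega>. LBINT r:{s..t}. b r \<omega>" and ?\<beta>' = "\<lambda>\<omega>. LBINT r:{s..t}. b' r \<omega>"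
    let ?a = "noise C \<alpha> I s t" and ?a' = "noise C \<alpha> I' s t"
    note m = bounded_process_random_variable[OF bX] bounded_process_random_variable[OF bY]
      bounded_process_integral_measurable[OF b] bounded_process_integral_measurable[OF b']
      noise_measurable[OF I st(1,2)] noise_measurable[OF I' st(1,2)]
    note i = bounded_process_sq_integrable[OF bX] bounded_process_sq_integrable[OF bY]
      bounded_process_integral_sq(1)[OF b K st(2)] bounded_process_integral_sq(1)[OF b' K' st(2)]
      noise_sq_integrable[OF I st(1,2)] noise_sq_integrable[OF I' st(1,2)]
    have p: "integrable M (\<lambda>\<omega>. X s \<omega> * ?\<beta>' \<omega>)" "integrable M (\<lambda>\<omega>. X s \<omega> * ?a' \<omega>)"
       "integrable M (\<lambda>\<omega>. Y s \<omega> * ?\<beta> \<omega>)" "integrable M (\<lambda>\<omega>. Y s \<omega> * ?a \<omega>)"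
       "integrable M (\<lambda>\<omega>. ?\<beta> \<omega> * ?\<beta>' \<omega>)" "integrable M (\<lambda>\<omega>. ?\<beta> \<omega> * ?a' \<omega>)"
       "integrable M (\<lambda>\<omega>. ?\<beta>' \<omega> * ?a \<omega>)" "integrable M (\<lambda>\<omega>. ?a \<omega> * ?a' \<omega>)"
       "integrable M (\<lambda>\<omega>. X s \<omega> * Y s \<omega>)"
      by (rule integrable_mult_squares; rule m i)+
    \<comment> \<open>Of the nine products, past times noise has mean 0, noise times noise is given
      by the isometry, and past times drift gives the time integrals up to an admissible error.
      Drift times drift and drift times noise are errors altogether.\<close>
    have "AE \<omega> in M. X t \<omega> * Y t \<omega> = X s \<omega> * Y s \<omega> + X s \<omega> * ?\<beta>' \<omega> + X s \<omega> * ?a' \<omega> + Y s \<omega> * ?\<beta> \<omega> + Y s \<omega> * ?a \<omega>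
       + ?\<beta> \<omega> * ?\<beta>' \<omega> + ?\<beta> \<omega> * ?a' \<omega> + ?\<beta>' \<omega> * ?a \<omega> + ?a \<omega> * ?a' \<omega>"
      using evolves_increment[OF X st(1,2)] evolves_increment[OF Y st(1,2)]
    proof eventually_elim
      case (elim \<omega>)
      show ?case unfolding elim by algebra
    qed
    then have "expectation (\<lambda>\<omega>. X t \<omega> * Y t \<omega>) = expectation (\<lambda>\<omega>. X s \<omega> * Y s \<omega> + X s \<omega> * ?\<beta>' \<omega> + X s \<omega> * ?a' \<omega> + Y s \<omega> * ?\<beta> \<omega> + Y s \<omega> * ?a \<omega>
       + ?\<beta> \<omega> * ?\<beta>' \<omega> + ?\<beta> \<omega> * ?a' \<omega> + ?\<beta>' \<omega> * ?a \<omega> + ?a \<omega> * ?a' \<omega>)"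
      by (intro integral_cong_AE borel_measurable_add borel_measurable_times m)
    also have "\<dots> = expectation (\<lambda>\<omega>. X s \<omega> * Y s \<omega>) + expectation (\<lambda>\<omega>. X s \<omega> * ?\<beta>' \<omega>) + expectation (\<lambda>\<omega>. X s \<omega> * ?a' \<omega>)
       + expectation (\<lambda>\<omega>. Y s \<omega> * ?\<beta> \<omega>) + expectation (\<lambda>\<omega>. Y s \<omega> * ?a \<omega>)
       + expectation (\<lambda>\<omega>. ?\<beta> \<omega> * ?\<beta>' \<omega>) + expectation (\<lambda>\<omega>. ?\<beta> \<omega> * ?a' \<omega>) + expectation (\<lambda>\<omega>. ?\<beta>' \<omega> * ?a \<omega>) + expectation (\<lambda>\<omega>. ?a \<omega> * ?a' \<omega>)"
      by (simp only: Bochner_Integration.integral_add Bochner_Integration.integrable_add p)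
    also have "expectation (\<lambda>\<omega>. X s \<omega> * ?a' \<omega>) = 0" by (rule evolves_past_noise[OF X I' st(1,2)])
    also have "expectation (\<lambda>\<omega>. Y s \<omega> * ?a \<omega>) = 0" by (rule evolves_past_noise[OF Y I st(1,2)])
    also have "expectation (\<lambda>\<omega>. ?a \<omega> * ?a' \<omega>) = time_integral s t ?n" by (rule noise_isometry[OF I I' st(1,2)])
    finally have E: "expectation (\<lambda>\<omega>. X t \<omega> * Y t \<omega>) = expectation (\<lambda>\<omega>. X s \<omega> * Y s \<omega>) + expectation (\<lambda>\<omega>. X s \<omega> * ?\<beta>' \<omega>)
       + expectation (\<lambda>\<omega>. Y s \<omega> * ?\<beta> \<omega>) + expectation (\<lambda>\<omega>. ?\<beta> \<omega> * ?\<beta>' \<omega>) + expectation (\<lambda>\<omega>. ?\<beta> \<omega> * ?a' \<omega>)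
       + expectation (\<lambda>\<omega>. ?\<beta>' \<omega> * ?a \<omega>) + time_integral s t ?n" by simp
    have T: "time_integral 0 t ?g = time_integral 0 s ?g + (time_integral s t (\<lambda>r \<omega>. X r \<omega> * b' r \<omega>) + time_integral s t (\<lambda>r \<omega>. Y r \<omega> * b r \<omega>) + time_integral s t ?n)"
      unfolding time_integral_split[OF bg st(1,2)]
      by (simp only: time_integral_add bounded_process_add bXb' bYb bn)
    have B5: "\<bar>expectation (\<lambda>\<omega>. ?\<beta> \<omega> * ?\<beta>' \<omega>)\<bar> \<le> c5 * h"
    proof -
      have "\<bar>expectation (\<lambda>\<omega>. ?\<beta> \<omega> * ?\<beta>' \<omega>)\<bar> \<le> (1 * expectation (\<lambda>\<omega>. (?\<beta> \<omega>)\<^sup>2) + expectation (\<lambda>\<omega>. (?\<beta>' \<omega>)\<^sup>2) / 1) / 2"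
        by (rule abs_expectation_mult_le[OF m(3,4) i(3,4)]) simp
      also have "\<dots> \<le> (1 * (K\<^sup>2 * (t - s)\<^sup>2) + K'\<^sup>2 * (t - s)\<^sup>2 / 1) / 2"
        using bounded_process_integral_sq(2)[OF b K st(2)] bounded_process_integral_sq(2)[OF b' K' st(2)]
        by (intro divide_right_mono add_mono mult_left_mono) auto
      also have "\<dots> = c5 * ((t - s) * (t - s))" by (simp add: c5_def power2_eq_square field_simps)
      also have "\<dots> \<le> c5 * h"
      proof -
        have "t - s \<le> sqrt (t - s)"
          using st lt by (intro real_le_rsqrt) (auto simp: power2_eq_square mult_left_le_one_le)
        then show ?thesis unfolding h_def using c5 lt by (intro mult_left_mono) auto
      qed
      finally show ?thesis .
    qed
    have B: "\<bar>expectation (\<lambda>\<omega>. X s \<omega> * ?\<beta>' \<omega>) - time_integral s t (\<lambda>r \<omega>. X r \<omega> * b' r \<omega>)\<bar> \<le> c1 * h"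
      "\<bar>expectation (\<lambda>\<omega>. Y s \<omega> * ?\<beta> \<omega>) - time_integral s t (\<lambda>r \<omega>. Y r \<omega> * b r \<omega>)\<bar> \<le> c2 * h"
      "\<bar>expectation (\<lambda>\<omega>. ?\<beta> \<omega> * ?a' \<omega>)\<bar> \<le> c3 * h" "\<bar>expectation (\<lambda>\<omega>. ?\<beta>' \<omega> * ?a \<omega>)\<bar> \<le> c4 * h"
      unfolding h_def using c1(2) c2(2) c3(2) c4(2) lt st by blast+
    have "(c1 + c2 + c3 + c4 + c5) * h = c1 * h + c2 * h + c3 * h + c4 * h + c5 * h" by (simp add: distrib_right)
    then show ?thesis unfolding \<Psi>_def h_def[symmetric] E T using B B5 by argo
  qed simp
  from constant_if_small_increments[OF this st] have "\<Psi> t = \<Psi> s" by simp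
  then show ?thesis unfolding \<Psi>_def using time_integral_split[OF bg st] by simp
qed

end

section \<open>Regular versions of solutions\<close>

definition theta :: "nat \<Rightarrow> nat \<Rightarrow> real" where
  "theta N j = (if j \<in> {1..N} then 1 / sqrt (real N) else 0)"

lemma theta_sq: "(theta N j)\<^sup>2 = (if j \<in> {1..N} then 1 / real N else 0)"
  by (simp add: theta_def power_divide)

lemma theta_ell2:
  assumes "1 \<le> N" shows "theta N \<in> ell2" "ell2_norm (theta N) = 1"
proof -
  have "(\<lambda>j. (theta N j)\<^sup>2) sums (\<Sum>j\<in>{1..N}. (theta N j)\<^sup>2)"
    by (rule sums_finite) (auto simp: theta_sq)
  moreover have "(\<Sum>j\<in>{1..N}. (theta N j)\<^sup>2) = 1" using assms by (simp add: theta_sq)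
  ultimately have "(\<lambda>j. (theta N j)\<^sup>2) sums 1" by simp
  then show "theta N \<in> ell2" "ell2_norm (theta N) = 1"
    by (auto simp: ell2_def ell2_norm_def theta_def sums_iff)
qed

definition drift :: "real \<Rightarrow> real \<Rightarrow> real \<Rightarrow> (nat \<Rightarrow> real) \<Rightarrow> (nat \<Rightarrow> real) \<Rightarrow> nat \<Rightarrow> real" where
  "drift lam \<kappa> \<nu> \<theta> x n = B_op lam x x n + \<kappa> * S_op lam x n + \<nu> * S_theta lam \<theta> x n"

lemma mat_app_A_mat:
  assumes "1 \<le> j"
  shows "mat_app (A_mat i (i + j)) x n = (if n = i then - x (i + j) else if n = i + j then x i else 0)"
proof -
  have "(\<lambda>l. A_mat i (i + j) n l * x l) sums (\<Sum>l\<in>{i, i + j}. A_mat i (i + j) n l * x l)"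
    by (rule sums_finite) (auto simp: A_mat_def)
  then show ?thesis using assms unfolding mat_app_def by (auto simp: sums_iff A_mat_def)
qed

lemma ell2_norm_sq: "x \<in> ell2 \<Longrightarrow> (ell2_norm x)\<^sup>2 = (\<Sum>n. (x n)\<^sup>2)"
  unfolding ell2_norm_def by (simp add: ell2_def suminf_nonneg)

lemma ell2_norm_nonneg: "0 \<le> ell2_norm x" if "x \<in> ell2"
  using that unfolding ell2_norm_def by (simp add: ell2_def suminf_nonneg)

lemma ell2_sum_le: "x \<in> ell2 \<Longrightarrow> finite A \<Longrightarrow> (\<Sum>n\<in>A. (x n)\<^sup>2) \<le> (ell2_norm x)\<^sup>2"
  unfolding ell2_norm_sq by (rule sum_le_suminf) (auto simp: ell2_def)

lemma ell2_component_le: assumes "x \<in> ell2" shows "\<bar>x n\<bar> \<le> ell2_norm x"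
proof -
  have "(x n)\<^sup>2 \<le> (ell2_norm x)\<^sup>2" using ell2_sum_le[OF assms, of "{n}"] by simp
  then show ?thesis using ell2_norm_nonneg[OF assms] by (metis abs_le_square_iff abs_of_nonneg)
qed

text \<open>Beyond mode \<open>m\<close> all weights are at least
  \<open>lam ^ (2 * (m + 1))\<close>, and the finitely many smaller ones are corrected explicitly.
  Unlike \<open>h1_norm\<close>, the lower bound is bounded on balls of \<open>ell2\<close>, so it
  fits the calculus of bounded processes.\<close>

lemma h1_norm_lower:
  assumes x: "x \<in> h1 lam" "x \<in> ell2" and lam: "lam > 1"
  shows "lam ^ (2 * (m + 1)) * (ell2_norm x)\<^sup>2 - (\<Sum>n=1..m. (lam ^ (2 * (m + 1)) - lam ^ (2 * n)) * (x n)\<^sup>2) \<le> (h1_norm lam x)\<^sup>2"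
proof -
  let ?L = "lam ^ (2 * (m + 1))"
  have s: "summable (\<lambda>n. (x n)\<^sup>2)" "summable (\<lambda>n. lam ^ (2 * n) * (x n)\<^sup>2)" "x 0 = 0" using x by (auto simp: h1_def ell2_def)
  have h: "(h1_norm lam x)\<^sup>2 = (\<Sum>n. lam ^ (2 * n) * (x n)\<^sup>2)"
    unfolding h1_norm_def using lam by (intro real_sqrt_pow2 suminf_nonneg s) auto
  have "(\<Sum>n=1..m. lam ^ (2 * n) * (x n)\<^sup>2 - ?L * (x n)\<^sup>2) \<le> (\<Sum>n. lam ^ (2 * n) * (x n)\<^sup>2 - ?L * (x n)\<^sup>2)"
  proof (rule sum_le_suminf)
    show "summable (\<lambda>n. lam ^ (2 * n) * (x n)\<^sup>2 - ?L * (x n)\<^sup>2)" by (intro summable_diff summable_mult s)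
    fix n assume n: "n \<in> - {1..m}"
    show "0 \<le> lam ^ (2 * n) * (x n)\<^sup>2 - ?L * (x n)\<^sup>2"
    proof (cases "n = 0")
      case False
      then have "?L \<le> lam ^ (2 * n)" using n lam by (intro power_increasing) auto
      then show ?thesis by (simp add: mult_right_mono)
    qed (simp add: s)
  qed simp
  also have "\<dots> = (h1_norm lam x)\<^sup>2 - ?L * (ell2_norm x)\<^sup>2"
    unfolding h ell2_norm_sq[OF x(2)] using s by (simp add: suminf_diff[symmetric] suminf_mult summable_mult)
  finally show ?thesis by (simp add: sum_subtractf left_diff_distrib)
qed

lemma drift_bounded: "\<exists>B. \<forall>x. (\<forall>k. \<bar>x k\<bar> \<le> L) \<longrightarrow> \<bar>drift lam \<kappa> \<nu> \<theta> x n\<bar> \<le> B"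
proof -
  define a where "a = lam ^ (n - 1)"
  define b where "b = lam ^ n"
  define d where "d = lam ^ (2 * n)"
  define e where "e = lam ^ (2 * n) + (\<Sum>j = 1..<n. (\<theta> j)\<^sup>2 * lam ^ (2 * (n - j)))"
  have "\<bar>drift lam \<kappa> \<nu> \<theta> x n\<bar> \<le> \<bar>a\<bar> * (L * L) + \<bar>b\<bar> * (L * L) + \<bar>\<kappa>\<bar> * (\<bar>d\<bar> * L) + \<bar>\<nu>\<bar> * (\<bar>e\<bar> * L)"
    if x: "\<forall>k. \<bar>x k\<bar> \<le> L" for x
  proof -
    have L: "0 \<le> L" by (rule order_trans[OF abs_ge_zero x[rule_format, of 0]])
    have p: "\<bar>u * x k * x l\<bar> \<le> \<bar>u\<bar> * (L * L)" for u k l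
      unfolding abs_mult mult.assoc by (intro mult_left_mono mult_mono x[rule_format] L abs_ge_zero)
    have q: "\<bar>u * (w * x k)\<bar> \<le> \<bar>u\<bar> * (\<bar>w\<bar> * L)" for u w k
      unfolding abs_mult by (intro mult_left_mono x[rule_format] L abs_ge_zero)
    have "drift lam \<kappa> \<nu> \<theta> x n = a * x (n - 1) * x (n - 1) - b * x n * x (n + 1) + (- (\<kappa> * (d * x n))) + (- (\<nu> * (e * x n)))"
      unfolding drift_def B_op_def S_op_def S_theta_def a_def b_def d_def e_def by (simp only: mult_minus_left mult_minus_right)
    moreover have "\<bar>u - v + (- w) + (- z)\<bar> \<le> U + V + W + Z"
      if "\<bar>u\<bar> \<le> U" "\<bar>v\<bar> \<le> V" "\<bar>w\<bar> \<le> W" "\<bar>z\<bar> \<le> Z" for u v w z U V W Z :: real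
      using that by linarith
    ultimately show ?thesis by (simp only: p q)
  qed
  then show ?thesis by (intro exI allI impI)
qed

lemma drift_path_integrable:
  assumes m: "path_measurable T x" and L: "\<And>r k. 0 \<le> r \<Longrightarrow> \<bar>x r k\<bar> \<le> L"
  shows "set_integrable lborel {0..T} (\<lambda>r. drift lam \<kappa> \<nu> \<theta> (x r) n)"
proof -
  \<comment> \<open>\<open>path_measurable\<close> speaks of components multiplied by the indicator
    of \<open>{0..T}\<close>, so the drift is rewritten in terms of these products.\<close>
  define y where "y k r = indicator {0..T} r * x r k" for k r
  have y: "y k \<in> borel_measurable lborel" for k
    using m unfolding path_measurable_def set_borel_measurable_def y_def[abs_def] real_scaleR_def by (rule spec)
  obtain B where B: "\<forall>x. (\<forall>k. \<bar>x k\<bar> \<le> L) \<longrightarrow> \<bar>drift lam \<kappa> \<nu> \<theta> x n\<bar> \<le> B" using drift_bounded by blast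
  have eq: "indicator {0..T} r *\<^sub>R drift lam \<kappa> \<nu> \<theta> (x r) n =
     lam ^ (n - 1) * y (n - 1) r * y (n - 1) r - lam ^ n * y n r * y (n + 1) r + \<kappa> * (- (lam ^ (2 * n)) * y n r) +
     \<nu> * (- (lam ^ (2 * n) + (\<Sum>j = 1..<n. (\<theta> j)\<^sup>2 * lam ^ (2 * (n - j)))) * y n r)" for r
    unfolding y_def drift_def B_op_def S_op_def S_theta_def by (cases "r \<in> {0..T}") simp_all
  have meas: "(\<lambda>r. indicator {0..T} r *\<^sub>R drift lam \<kappa> \<nu> \<theta> (x r) n) \<in> borel_measurable lborel"
    unfolding eq by (intro borel_measurable_add borel_measurable_diff borel_measurable_times borel_measurable_const y)
  show ?thesis unfolding set_integrable_def
  proof (rule integrableI_bounded_set[where A="{0..T}" and B=B])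
    show "emeasure lborel {0..T} < \<infinity>" by (simp add: emeasure_lborel_Icc_eq)
    show "AE r in lborel. r \<in> {0..T} \<longrightarrow> norm (indicator {0..T} r *\<^sub>R drift lam \<kappa> \<nu> \<theta> (x r) n) \<le> B"
    proof (intro AE_I2 impI)
      fix r :: real assume r: "r \<in> {0..T}"
      have "0 \<le> r" using r by simp
      then have "\<bar>drift lam \<kappa> \<nu> \<theta> (x r) n\<bar> \<le> B" by (intro B[rule_format] L)
      then show "norm (indicator {0..T} r *\<^sub>R drift lam \<kappa> \<nu> \<theta> (x r) n) \<le> B" using r by simp
    qed
    show "AE r in lborel. r \<notin> {0..T} \<longrightarrow> indicator {0..T} r *\<^sub>R drift lam \<kappa> \<nu> \<theta> (x r) n = 0"
      by (intro AE_I2 impI) simp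
    show "{0..T} \<in> sets lborel" by simp
  qed (rule meas)
qed

text \<open>The integral of the bounded drift and the noise version are continuous in time. From
  this continuity comes the joint measurability in time and chance, which the definition of a
  solution does not contain.\<close>

lemma component_path_continuous:
  assumes m: "path_measurable T x" and L: "\<And>r k. 0 \<le> r \<Longrightarrow> \<bar>x r k\<bar> \<le> L"
    and eq: "\<And>t. 0 \<le> t \<Longrightarrow> x t n = x 0 n + (LBINT r:{0..t}. drift lam \<kappa> \<nu> \<theta> (x r) n) + c * Z t"
    and Z: "continuous_on {0..} Z"
  shows "continuous_on {0..T} (\<lambda>t. x t n)"
proof -
  let ?f = "\<lambda>r. drift lam \<kappa> \<nu> \<theta> (x r) n"
  note i = drift_path_integrable[OF m L, where lam=lam and \<kappa>=\<kappa> and \<nu>=\<nu> and \<theta>=\<theta> and n=n]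
  have "(LBINT r:{0..t}. ?f r) = integral {0..t} ?f" if "t \<in> {0..T}" for t
    by (rule set_borel_integral_eq_integral(2)[OF set_integrable_subset[OF i]]) (use that in auto)
  moreover have "continuous_on {0..T} (\<lambda>t. integral {0..t} ?f)"
    by (rule indefinite_integral_continuous_1[OF set_borel_integral_eq_integral(1)[OF i]])
  ultimately have "continuous_on {0..T} (\<lambda>t. LBINT r:{0..t}. ?f r)"
    using continuous_on_cong[of "{0..T}" "{0..T}" "\<lambda>t. LBINT r:{0..t}. ?f r" "\<lambda>t. integral {0..t} ?f"] by blast
  then have "continuous_on {0..T} (\<lambda>t. x 0 n + (LBINT r:{0..t}. ?f r) + c * Z t)"
    by (intro continuous_intros continuous_on_subset[OF Z]) auto
  moreover have "x t n = x 0 n + (LBINT r:{0..t}. ?f r) + c * Z t" if "t \<in> {0..T}" for t using eq[of t] that by simp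
  ultimately show ?thesis
    using continuous_on_cong[of "{0..T}" "{0..T}" "\<lambda>t. x t n" "\<lambda>t. x 0 n + (LBINT r:{0..t}. ?f r) + c * Z t"] by blast
qed

text \<open>Time is rounded down to multiples of \<open>1 / (k + 1)\<close>, which leaves countably
  many random variables, and continuity identifies the limit. Negative times are mapped to 0 to
  obtain a process on the whole line.\<close>

lemma caratheodory_measurable:
  fixes g :: "real \<Rightarrow> 'a \<Rightarrow> real"
  assumes m: "\<And>t. 0 \<le> t \<Longrightarrow> g t \<in> borel_measurable M"
    and cont: "\<And>\<omega> T. \<omega> \<in> space M \<Longrightarrow> 0 < T \<Longrightarrow> continuous_on {0..T} (\<lambda>t. g t \<omega>)"
  shows "(\<lambda>(r, \<omega>). g (max 0 r) \<omega>) \<in> borel_measurable (borel \<Otimes>\<^sub>M M)"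
proof -
  define s where "s k r = real (nat \<lfloor>max 0 r * real (Suc k)\<rfloor>) / real (Suc k)" for k r
  have "(\<lambda>x. g (max 0 (fst x)) (snd x)) \<in> borel_measurable (borel \<Otimes>\<^sub>M M)"
  proof (rule borel_measurable_LIMSEQ_real)
    fix x :: "real \<times> 'a" assume x: "x \<in> space (borel \<Otimes>\<^sub>M M)"
    define t where "t = max 0 (fst x)"
    have t: "0 \<le> t" by (simp add: t_def)
    have up: "s k (fst x) \<le> t" for k
      unfolding s_def t_def[symmetric] using t by (simp add: divide_le_eq of_nat_nat)
    have low: "t - 1 / real (Suc k) \<le> s k (fst x)" for k
    proof -
      have "t * real (Suc k) - 1 \<le> real (nat \<lfloor>t * real (Suc k)\<rfloor>)" using t by linarith
      then have "(t * real (Suc k) - 1) / real (Suc k) \<le> s k (fst x)"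
        unfolding s_def t_def[symmetric] by (intro divide_right_mono) simp_all
      then show ?thesis by (simp add: diff_divide_distrib del: of_nat_Suc)
    qed
    have lim: "(\<lambda>k. s k (fst x)) \<longlonglongrightarrow> t"
    proof (rule tendsto_sandwich)
      show "(\<lambda>k. t - 1 / real (Suc k)) \<longlonglongrightarrow> t"
        using tendsto_diff[OF tendsto_const[of t] LIMSEQ_inverse_real_of_nat] by (simp add: inverse_eq_divide)
    qed (use up low in auto)
    have "continuous_on {0..t+1} (\<lambda>t. g t (snd x))"
      using x t by (intro cont) (auto simp: space_pair_measure)
    then have "(\<lambda>k. g (s k (fst x)) (snd x)) \<longlonglongrightarrow> g t (snd x)"
    proof (rule continuous_on_tendsto_compose[OF _ lim])
      show "t \<in> {0..t+1}" using t by simp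
      have "0 \<le> s k (fst x)" for k by (simp add: s_def)
      moreover have "s k (fst x) \<le> t + 1" for k using up[of k] by simp
      ultimately show "\<forall>\<^sub>F k in sequentially. s k (fst x) \<in> {0..t+1}" by simp
    qed
    then show "(\<lambda>k. g (s k (fst x)) (snd x)) \<longlonglongrightarrow> g (max 0 (fst x)) (snd x)" by (simp add: t_def)
  next
    fix k
    have 1: "(\<lambda>x. g (real i / real (Suc k)) (snd x)) \<in> borel_measurable (borel \<Otimes>\<^sub>M M)" for i :: nat
      by (rule measurable_compose[OF measurable_snd m]) simp
    have 2: "(\<lambda>x. nat \<lfloor>max 0 (fst x) * real (Suc k)\<rfloor>) \<in> measurable (borel \<Otimes>\<^sub>M M) (count_space UNIV)"
      by measurable
    show "(\<lambda>x. g (s k (fst x)) (snd x)) \<in> borel_measurable (borel \<Otimes>\<^sub>M M)"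
      unfolding s_def by (rule measurable_compose_countable[OF 1 2])
  qed
  then show ?thesis by (simp only: case_prod_beta')
qed

text \<open>It evaluates the noise series, whose partial sums become constant up to null sets. As
  \<open>g\<close> and \<open>S\<close> carry no measurability, the set where they differ by
  \<epsilon> is enclosed in measurable sets of arbitrarily small measure, and the intersection of
  these is a null set.\<close>

lemma (in prob_space) tendsto_in_prob_AE_unique:
  assumes conv: "tendsto_in_prob M f g" and f: "\<And>m. m \<ge> m0 \<Longrightarrow> AE \<omega> in M. f m \<omega> = S \<omega>"
  shows "AE \<omega> in M. g \<omega> = S \<omega>"
proof -
  have "AE \<omega> in M. \<bar>S \<omega> - g \<omega>\<bar> < \<epsilon>" if \<epsilon>: "0 < \<epsilon>" for \<epsilon>
  proof -
    have ex: "\<exists>E\<in>sets M. measure M E < 1 / real (Suc l) \<and> {\<omega> \<in> space M. \<epsilon> \<le> \<bar>S \<omega> - g \<omega>\<bar>} \<subseteq> E" for l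
    proof -
      have "\<forall>\<^sub>F m in sequentially. \<exists>E\<in>sets M. measure M E < 1 / real (Suc l) \<and> {\<omega> \<in> space M. ennreal \<epsilon> \<le> ennreal \<bar>f m \<omega> - g \<omega>\<bar>} \<subseteq> E"
        by (rule vanishes_in_probD[OF conv[unfolded tendsto_in_prob_def] \<epsilon>]) simp
      then obtain m1 where m1: "\<And>m. m \<ge> m1 \<Longrightarrow> \<exists>E\<in>sets M. measure M E < 1 / real (Suc l) \<and> {\<omega> \<in> space M. ennreal \<epsilon> \<le> ennreal \<bar>f m \<omega> - g \<omega>\<bar>} \<subseteq> E"
        unfolding eventually_sequentially by blast
      define m where "m = max m0 m1"
      obtain E where E: "E \<in> sets M" "measure M E < 1 / real (Suc l)" "{\<omega> \<in> space M. ennreal \<epsilon> \<le> ennreal \<bar>f m \<omega> - g \<omega>\<bar>} \<subseteq> E"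
        using m1[of m] unfolding m_def by auto
      have "AE \<omega> in M. f m \<omega> = S \<omega>" by (rule f) (simp add: m_def)
      then obtain N where N: "{\<omega> \<in> space M. f m \<omega> \<noteq> S \<omega>} \<subseteq> N" "emeasure M N = 0" "N \<in> sets M" by (rule AE_E)
      have "measure M (E \<union> N) \<le> measure M E + measure M N" by (rule measure_Un_le[OF E(1) N(3)])
      also have "measure M N = 0" using N(2) by (simp add: measure_def)
      finally have "measure M (E \<union> N) < 1 / real (Suc l)" using E(2) by simp
      moreover have "{\<omega> \<in> space M. \<epsilon> \<le> \<bar>S \<omega> - g \<omega>\<bar>} \<subseteq> E \<union> N"
      proof
        fix \<omega> assume "\<omega> \<in> {\<omega> \<in> space M. \<epsilon> \<le> \<bar>S \<omega> - g \<omega>\<bar>}"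
        then have \<omega>: "\<omega> \<in> space M" "\<epsilon> \<le> \<bar>S \<omega> - g \<omega>\<bar>" by auto
        show "\<omega> \<in> E \<union> N"
        proof (cases "\<omega> \<in> N")
          case False
          then have "f m \<omega> = S \<omega>" using N(1) \<omega>(1) by blast
          then have "ennreal \<epsilon> \<le> ennreal \<bar>f m \<omega> - g \<omega>\<bar>" using \<omega>(2) by (simp add: ennreal_leI)
          then show ?thesis using E(3) \<omega>(1) by blast
        qed simp
      qed
      ultimately show ?thesis using E(1) N(3) by blast
    qed
    then obtain E where E: "\<And>l. E l \<in> sets M" "\<And>l. measure M (E l) < 1 / real (Suc l)" "\<And>l. {\<omega> \<in> space M. \<epsilon> \<le> \<bar>S \<omega> - g \<omega>\<bar>} \<subseteq> E l"
      by metis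
    have E': "(\<Inter>l. E l) \<in> sets M" using E(1) by blast
    have "measure M (\<Inter>l. E l) \<le> 1 / real (Suc l)" for l
      using finite_measure_mono[of "\<Inter>l. E l" "E l"] E(1)[of l] E(2)[of l] by fastforce
    moreover have "(\<lambda>l. 1 / real (Suc l)) \<longlonglongrightarrow> 0"
      using LIMSEQ_inverse_real_of_nat by (simp add: inverse_eq_divide)
    ultimately have "measure M (\<Inter>l. E l) \<le> 0" by (intro LIMSEQ_le_const[of "\<lambda>l. 1 / real (Suc l)" 0]) auto
    then have "emeasure M (\<Inter>l. E l) = 0" by (simp add: emeasure_eq_measure measure_le_0_iff)
    then show ?thesis
      by (intro AE_I[of _ _ "\<Inter>l. E l"] E') (use E(3) not_less in blast)
  qed
  then have "AE \<omega> in M. \<forall>l. \<bar>S \<omega> - g \<omega>\<bar> < 1 / real (Suc l)" unfolding AE_all_countable by simp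
  then show ?thesis
  proof eventually_elim
    case (elim \<omega>)
    show ?case
    proof (rule ccontr)
      assume "g \<omega> \<noteq> S \<omega>"
      then obtain l where "1 / real (Suc l) < \<bar>S \<omega> - g \<omega>\<bar>"
        using reals_Archimedean[of "\<bar>S \<omega> - g \<omega>\<bar>"] by (auto simp: inverse_eq_divide)
      then show False using elim[rule_format, of l] by simp
    qed
  qed
qed

section \<open>Pathwise consequences of the energy equality\<close>

lemma energy_decreasing:
  fixes x :: "real \<Rightarrow> nat \<Rightarrow> real"
  assumes x: "\<And>t. 0 \<le> t \<Longrightarrow> x t \<in> ell2" and \<kappa>: "\<kappa> > 0"
    and energy: "\<forall>s t. 0 \<le> s \<and> s < t \<longrightarrow> (ell2_norm (x t))\<^sup>2 + 2 * \<kappa> * (LBINT r:{s..t}. (h1_norm lam (x r))\<^sup>2) = (ell2_norm (x s))\<^sup>2"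
    and st: "0 \<le> s" "s \<le> t"
  shows "(ell2_norm (x t))\<^sup>2 \<le> (ell2_norm (x s))\<^sup>2" "ell2_norm (x t) \<le> ell2_norm (x s)"
proof -
  show le: "(ell2_norm (x t))\<^sup>2 \<le> (ell2_norm (x s))\<^sup>2"
  proof (cases "s = t")
    case False
    have "0 \<le> (LBINT r:{s..t}. (h1_norm lam (x r))\<^sup>2)"
      unfolding set_lebesgue_integral_def by (intro Bochner_Integration.integral_nonneg) simp
    then have "0 \<le> 2 * \<kappa> * (LBINT r:{s..t}. (h1_norm lam (x r))\<^sup>2)" using \<kappa> by simp
    moreover have "s < t" using False st by simp
    then have "(ell2_norm (x t))\<^sup>2 + 2 * \<kappa> * (LBINT r:{s..t}. (h1_norm lam (x r))\<^sup>2) = (ell2_norm (x s))\<^sup>2"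
      using energy st by blast
    ultimately show ?thesis by linarith
  qed simp
  show "ell2_norm (x t) \<le> ell2_norm (x s)"
    using le ell2_norm_nonneg[OF x[OF st(1)]] by (rule power2_le_imp_le)
qed

text \<open>The unbounded dissipation is replaced by its bounded lower bound, the form in which
  expectations are taken later.\<close>

lemma energy_inequality:
  fixes x :: "real \<Rightarrow> nat \<Rightarrow> real"
  assumes x: "\<And>t. 0 \<le> t \<Longrightarrow> x t \<in> ell2" and \<kappa>: "\<kappa> > 0" and lam: "lam > 1"
    and energy: "\<forall>s t. 0 \<le> s \<and> s < t \<longrightarrow> (ell2_norm (x t))\<^sup>2 + 2 * \<kappa> * (LBINT r:{s..t}. (h1_norm lam (x r))\<^sup>2) = (ell2_norm (x s))\<^sup>2"
    and L2: "\<forall>T>0. x \<in> L2_H1 lam T" and st: "0 \<le> s" "s \<le> t"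
  shows "(ell2_norm (x t))\<^sup>2 - (ell2_norm (x s))\<^sup>2 \<le> - (2 * \<kappa>) * (LBINT r:{s..t}.
     lam ^ (2 * (m + 1)) * (ell2_norm (x r))\<^sup>2 - (\<Sum>n=1..m. (lam ^ (2 * (m + 1)) - lam ^ (2 * n)) * (x r n)\<^sup>2))"
proof (cases "s = t")
  case True
  \<comment> \<open>The energy equality is stated for \<open>s < t\<close>; for \<open>s = t\<close>
    the integral runs over a null set.\<close>
  have "(LBINT r:{t..t}. f r) = 0" for f :: "real \<Rightarrow> real"
  proof -
    have "AE r in lborel. indicator {t..t} r *\<^sub>R f r = 0" using AE_lborel_singleton[of t] by eventually_elim simp
    then show ?thesis unfolding set_lebesgue_integral_def by (rule integral_eq_zero_AE)
  qed
  then show ?thesis using True by simp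
next
  case False
  then have lt: "s < t" using st by simp
  let ?g = "\<lambda>r. lam ^ (2 * (m + 1)) * (ell2_norm (x r))\<^sup>2 - (\<Sum>n=1..m. (lam ^ (2 * (m + 1)) - lam ^ (2 * n)) * (x r n)\<^sup>2)"
  show ?thesis
  proof (cases "set_integrable lborel {s..t} ?g")
    case True
    have t: "0 < t" using lt st by simp
    have h: "set_integrable lborel {0..t} (\<lambda>r. (h1_norm lam (x r))\<^sup>2)" "AE r in lborel. r \<in> {0..t} \<longrightarrow> x r \<in> h1 lam"
      using L2 t unfolding L2_H1_def by auto
    have "(LBINT r:{s..t}. ?g r) \<le> (LBINT r:{s..t}. (h1_norm lam (x r))\<^sup>2)"
    proof (rule set_integral_mono_AE[OF True])
      show "set_integrable lborel {s..t} (\<lambda>r. (h1_norm lam (x r))\<^sup>2)"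
        by (rule set_integrable_subset[OF h(1)]) (use st in auto)
      have "AE r in lborel. r \<in> {s..t} \<longrightarrow> ?g r \<le> (h1_norm lam (x r))\<^sup>2"
        using h(2)
      proof eventually_elim
        case (elim r)
        show ?case
        proof
          assume r: "r \<in> {s..t}"
          then have "x r \<in> h1 lam" "x r \<in> ell2" using elim st x[of r] by auto
          then show "?g r \<le> (h1_norm lam (x r))\<^sup>2" by (rule h1_norm_lower[OF _ _ lam])
        qed
      qed
      then show "AE r\<in>{s..t} in lborel. ?g r \<le> (h1_norm lam (x r))\<^sup>2" .
    qed
    then have "2 * \<kappa> * (LBINT r:{s..t}. ?g r) \<le> 2 * \<kappa> * (LBINT r:{s..t}. (h1_norm lam (x r))\<^sup>2)"
      using \<kappa> by (intro mult_left_mono) auto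
    then show ?thesis using energy[rule_format, of s t] lt st by simp
  next
    case False
    \<comment> \<open>The integral of a non-integrable function has the value 0 by convention, and
      then the inequality reduces to the decrease of the norm.\<close>
    then have "(LBINT r:{s..t}. ?g r) = 0"
      unfolding set_integrable_def set_lebesgue_integral_def by (rule not_integrable_integral_eq)
    then show ?thesis using energy_decreasing(1)[OF x \<kappa> energy st] by simp
  qed
qed

section \<open>Reduction of the noise to finitely many motions, and bounded modifications of
  solutions\<close>

context driven_space begin

text \<open>Mode \<open>n\<close> is touched only if \<open>i = n\<close> or
  \<open>i + j = n\<close>, whence \<open>i \<le> n\<close>, and \<open>theta N\<close> vanishes
  beyond \<open>N\<close>. The rectangle also contains labels with zero integrand, in exchange for
  its simple shape.\<close>

definition grid :: "nat \<Rightarrow> nat \<Rightarrow> (nat \<times> nat) set" where "grid n N = {1..n} \<times> {1..N}"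

definition coef :: "real \<Rightarrow> real \<Rightarrow> nat \<Rightarrow> nat \<times> nat \<Rightarrow> real" where
  "coef lam \<nu> N c = sqrt (2 * \<nu>) * (lam ^ fst c * theta N (snd c))"

definition noise_integrand :: "nat \<Rightarrow> nat \<times> nat \<Rightarrow> (nat \<Rightarrow> real) \<Rightarrow> real" where
  "noise_integrand n c x = mat_app (A_mat (fst c) (fst c + snd c)) x n"

lemma noise_integrand_bounded_process:
  assumes "\<And>n. bounded_process (\<lambda>r \<omega>. X r \<omega> n)" "c \<in> labels"
  shows "bounded_process (\<lambda>r \<omega>. noise_integrand n c (X r \<omega>))"
proof -
  have c: "1 \<le> snd c" using assms(2) by (auto simp: labels_def)
  consider "n = fst c" | "n \<noteq> fst c" "n = fst c + snd c" | "n \<noteq> fst c" "n \<noteq> fst c + snd c" by blast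
  then show ?thesis
  proof cases
    case 1
    then show ?thesis unfolding noise_integrand_def mat_app_A_mat[OF c] using bounded_process_uminus[OF assms(1)] by simp
  next
    case 2
    then show ?thesis unfolding noise_integrand_def mat_app_A_mat[OF c] using assms(1) c by simp
  next
    case 3
    then show ?thesis unfolding noise_integrand_def mat_app_A_mat[OF c] by (simp add: bounded_process_const)
  qed
qed

text \<open>Both series are constant from some index on, up to null sets: the inner one because
  \<open>theta N\<close> vanishes beyond \<open>N\<close>, the outer one because the integrand of
  mode \<open>n\<close> is zero for \<open>i > n\<close>. The limits in probability are then
  determined almost surely.\<close>

lemma noise_component_finite:
  assumes noise: "noise_component lam (theta N) M F W X n Z"
    and X': "\<And>n. bounded_process (\<lambda>r \<omega>. X' r \<omega> n)" and eq: "AE \<omega> in M. \<forall>t\<ge>0. X' t \<omega> = X t \<omega>"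
  shows "\<exists>I. (\<forall>c\<in>labels. L2_integral c (\<lambda>r \<omega>. noise_integrand n c (X' r \<omega>)) (I c)) \<and>
     (\<forall>t\<ge>0. AE \<omega> in M. Z t \<omega> = (\<Sum>c\<in>grid n N. lam ^ fst c * theta N (snd c) * I c t \<omega>))"
proof -
  obtain I J where I: "\<And>i j. 1 \<le> i \<Longrightarrow> 1 \<le> j \<Longrightarrow> ito_integral M F (W i j) (\<lambda>t \<omega>. mat_app (A_mat i (i + j)) (X t \<omega>) n) (I i j)"
    and J: "\<And>i t. 1 \<le> i \<Longrightarrow> 0 \<le> t \<Longrightarrow> sums_in_prob M (\<lambda>j \<omega>. theta N j * I i j t \<omega>) (J i t)"
    and Z: "\<And>t. 0 \<le> t \<Longrightarrow> sums_in_prob M (\<lambda>i \<omega>. lam ^ i * J i t \<omega>) (Z t)"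
  proof -
    obtain I J where "\<forall>i\<ge>1. \<forall>j\<ge>1. ito_integral M F (W i j) (\<lambda>t \<omega>. mat_app (A_mat i (i + j)) (X t \<omega>) n) (I i j)"
      "\<forall>i\<ge>1. \<forall>t\<ge>0. sums_in_prob M (\<lambda>j \<omega>. theta N j * I i j t \<omega>) (J i t)"
      "\<forall>t\<ge>0. sums_in_prob M (\<lambda>i \<omega>. lam ^ i * J i t \<omega>) (Z t)"
      using noise unfolding noise_component_def by blast
    then show thesis by (intro that[of I J]) blast+
  qed
  define I' where "I' c = I (fst c) (snd c)" for c
  have L2: "L2_integral c (\<lambda>r \<omega>. noise_integrand n c (X' r \<omega>)) (I' c)" if c: "c \<in> labels" for c
  proof -
    have b: "bounded_process (\<lambda>r \<omega>. noise_integrand n c (X' r \<omega>))" by (rule noise_integrand_bounded_process[OF X' c])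
    obtain K where K: "0 \<le> K" "\<forall>r. \<forall>\<omega>\<in>space M. \<bar>noise_integrand n c (X' r \<omega>)\<bar> \<le> K" using bounded_process_bound[OF b] by blast
    have ito: "ito_integral M F (V c) (\<lambda>t \<omega>. noise_integrand n c (X t \<omega>)) (I' c)"
      using I[of "fst c" "snd c"] c unfolding noise_integrand_def I'_def by (auto simp: labels_def)
    have "AE \<omega> in M. \<forall>r\<ge>0. noise_integrand n c (X r \<omega>) = noise_integrand n c (X' r \<omega>)" using eq by eventually_elim simp
    then show ?thesis by (rule ito_integral_L2[OF c b K ito])
  qed
  have Jeq: "AE \<omega> in M. J i t \<omega> = (\<Sum>j=1..N. theta N j * I i j t \<omega>)" if "1 \<le> i" "0 \<le> t" for i t
  proof (rule tendsto_in_prob_AE_unique[OF J[OF that, unfolded sums_in_prob_def], of N])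
    fix m assume m: "N \<le> m"
    have "(\<Sum>k=1..m. theta N k * I i k t \<omega>) = (\<Sum>j=1..N. theta N j * I i j t \<omega>)" for \<omega>
      by (rule sum.mono_neutral_right) (use m in \<open>auto simp: theta_def\<close>)
    then show "AE \<omega> in M. (\<Sum>k=1..m. theta N k * I i k t \<omega>) = (\<Sum>j=1..N. theta N j * I i j t \<omega>)" by simp
  qed
  have I0: "AE \<omega> in M. I i j t \<omega> = 0" if "n < i" "1 \<le> j" "0 \<le> t" for i j t
  proof -
    have c: "(i, j) \<in> labels" using that by (auto simp: labels_def)
    have "(\<lambda>r \<omega>. noise_integrand n (i, j) (X' r \<omega>)) = (\<lambda>_ _. 0)"
      using that unfolding noise_integrand_def by (simp add: mat_app_A_mat)
    then show ?thesis using L2_integral_zero[of "(i, j)" "I i j", OF _ c that(3)] L2[OF c] by (simp add: I'_def)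
  qed
  have J0: "AE \<omega> in M. J i t \<omega> = 0" if "n < i" "0 \<le> t" for i t
  proof -
    have i: "1 \<le> i" using that by simp
    have "AE \<omega> in M. \<forall>j\<in>{1..N}. I i j t \<omega> = 0" by (rule AE_finite_allI) (use I0 that in auto)
    with Jeq[OF i that(2)] show ?thesis by eventually_elim simp
  qed
  have Zeq: "AE \<omega> in M. Z t \<omega> = (\<Sum>i=1..n. lam ^ i * (\<Sum>j=1..N. theta N j * I i j t \<omega>))" if t: "0 \<le> t" for t
  proof (rule tendsto_in_prob_AE_unique[OF Z[OF t, unfolded sums_in_prob_def], of n])
    fix m assume m: "n \<le> m"
    have "AE \<omega> in M. \<forall>i\<in>{1..m}. J i t \<omega> = (if i \<le> n then (\<Sum>j=1..N. theta N j * I i j t \<omega>) else 0)"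
    proof (rule AE_finite_allI)
      fix i assume "i \<in> {1..m}"
      then show "AE \<omega> in M. J i t \<omega> = (if i \<le> n then (\<Sum>j=1..N. theta N j * I i j t \<omega>) else 0)"
        using Jeq[of i t] J0[of i t] t by (cases "i \<le> n") auto
    qed simp
    then show "AE \<omega> in M. (\<Sum>k=1..m. lam ^ k * J k t \<omega>) = (\<Sum>i=1..n. lam ^ i * (\<Sum>j=1..N. theta N j * I i j t \<omega>))"
    proof eventually_elim
      case (elim \<omega>)
      have "(\<Sum>k=1..m. lam ^ k * J k t \<omega>) = (\<Sum>k=1..m. if k \<le> n then lam ^ k * (\<Sum>j=1..N. theta N j * I k j t \<omega>) else 0)"
        by (rule sum.cong) (use elim in auto)
      also have "\<dots> = (\<Sum>k=1..n. if k \<le> n then lam ^ k * (\<Sum>j=1..N. theta N j * I k j t \<omega>) else 0)"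
        by (rule sum.mono_neutral_right) (use m in auto)
      also have "\<dots> = (\<Sum>i=1..n. lam ^ i * (\<Sum>j=1..N. theta N j * I i j t \<omega>))" by (rule sum.cong) auto
      finally show ?case .
    qed
  qed
  have "(\<Sum>i=1..n. lam ^ i * (\<Sum>j=1..N. theta N j * I i j t \<omega>)) = (\<Sum>c\<in>grid n N. lam ^ fst c * theta N (snd c) * I' c t \<omega>)" for t \<omega>
    unfolding grid_def I'_def sum_distrib_left sum.cartesian_product by (simp add: case_prod_beta mult.assoc)
  then show ?thesis using L2 Zeq by (intro exI[of _ I']) auto
qed

text \<open>Membership in \<open>ell2\<close>, the bound \<open>L\<close> and the energy inequality
  hold at every point of the space, so that all quantities involved are bounded processes; the
  equation and the initial value hold almost surely. The energy equality is kept through its bounded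
  consequence for every \<open>m\<close>.\<close>

definition regular_version :: "real \<Rightarrow> real \<Rightarrow> real \<Rightarrow> nat \<Rightarrow> real \<Rightarrow> (nat \<Rightarrow> real) \<Rightarrow> (real \<Rightarrow> 'a \<Rightarrow> nat \<Rightarrow> real) \<Rightarrow> bool" where
  "regular_version lam \<kappa> \<nu> N L x0 X \<longleftrightarrow>
     (\<forall>r. \<forall>\<omega>\<in>space M. X r \<omega> \<in> ell2 \<and> ell2_norm (X r \<omega>) \<le> L) \<and>
     (\<forall>n. bounded_process (\<lambda>r \<omega>. X r \<omega> n)) \<and>
     bounded_process (\<lambda>r \<omega>. (ell2_norm (X r \<omega>))\<^sup>2) \<and>
     (AE \<omega> in M. X 0 \<omega> = x0) \<and>
     (\<forall>n\<ge>1. \<exists>I. evolves (\<lambda>r \<omega>. X r \<omega> n) (\<lambda>r \<omega>. drift lam \<kappa> \<nu> (theta N) (X r \<omega>) n)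
        (grid n N) (coef lam \<nu> N) (\<lambda>c r \<omega>. noise_integrand n c (X r \<omega>)) I) \<and>
     (\<forall>m s t. \<forall>\<omega>\<in>space M. 0 \<le> s \<and> s \<le> t \<longrightarrow>
        (ell2_norm (X t \<omega>))\<^sup>2 - (ell2_norm (X s \<omega>))\<^sup>2 \<le> - (2 * \<kappa>) * (LBINT r:{s..t}.
           lam ^ (2 * (m + 1)) * (ell2_norm (X r \<omega>))\<^sup>2 - (\<Sum>n=1..m. (lam ^ (2 * (m + 1)) - lam ^ (2 * n)) * (X r \<omega> n)\<^sup>2)))"

lemma drift_bounded_process:
  assumes "\<And>n. bounded_process (\<lambda>r \<omega>. X r \<omega> n)"
  shows "bounded_process (\<lambda>r \<omega>. drift lam \<kappa> \<nu> \<theta> (X r \<omega>) n)"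
  unfolding drift_def B_op_def S_op_def S_theta_def
  by (intro bounded_process_diff bounded_process_add bounded_process_mult bounded_process_const assms)

lemma zero_ell2: "(\<lambda>_. 0) \<in> ell2" "ell2_norm (\<lambda>_. 0) = 0"
  by (simp_all add: ell2_def ell2_norm_def)

lemma regular_version_exists:
  assumes sol: "leray_hopf_solution lam \<kappa> \<nu> (theta N) M F W x0 X" and L: "ell2_norm x0 \<le> L" "0 \<le> L"
    and par: "lam > 1" "\<kappa> > 0" "\<nu> > 0"
  shows "\<exists>X'. regular_version lam \<kappa> \<nu> N L x0 X' \<and> (AE \<omega> in M. \<forall>t\<ge>0. X' t \<omega> = X t \<omega>)"
proof -
  have Xl: "X t \<omega> \<in> ell2" if "0 \<le> t" "\<omega> \<in> space M" for t \<omega> using sol that unfolding leray_hopf_solution_def by blast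
  have XF: "(\<lambda>\<omega>. X t \<omega> n) \<in> borel_measurable (F t)" if "0 \<le> t" for t n using sol that unfolding leray_hopf_solution_def by blast
  let ?eq = "\<lambda>n Z \<omega>. \<forall>t\<ge>0. X t \<omega> n = X 0 \<omega> n + (LBINT r:{0..t}. drift lam \<kappa> \<nu> (theta N) (X r \<omega>) n) + sqrt (2 * \<nu>) * Z t \<omega>"
  have "\<forall>n. \<exists>Z. 1 \<le> n \<longrightarrow> noise_component lam (theta N) M F W X n Z \<and> (AE \<omega> in M. ?eq n Z \<omega>)"
    using sol unfolding leray_hopf_solution_def drift_def by blast
  then obtain Z where Z: "\<forall>n. 1 \<le> n \<longrightarrow> noise_component lam (theta N) M F W X n (Z n) \<and> (AE \<omega> in M. ?eq n (Z n) \<omega>)"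
    by (rule choice[THEN exE])
  let ?en = "\<lambda>\<omega>. \<forall>s t. 0 \<le> s \<and> s < t \<longrightarrow>
        (ell2_norm (X t \<omega>))\<^sup>2 + 2 * \<kappa> * (LBINT r:{s..t}. (h1_norm lam (X r \<omega>))\<^sup>2) = (ell2_norm (X s \<omega>))\<^sup>2"
  \<comment> \<open>The properties of the path for all modes and all times are collected, so that a
    single null set has to be removed.\<close>
  define good where "good \<omega> \<longleftrightarrow> X 0 \<omega> = x0 \<and> (\<forall>T>0. (\<lambda>t. X t \<omega>) \<in> Linf_ell2 T \<inter> L2_H1 lam T) \<and>
    (\<forall>n. 1 \<le> n \<longrightarrow> continuous_on {0..} (\<lambda>t. Z n t \<omega>) \<and> ?eq n (Z n) \<omega>) \<and> ?en \<omega>" for \<omega>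
  have "AE \<omega> in M. \<forall>n. 1 \<le> n \<longrightarrow> continuous_on {0..} (\<lambda>t. Z n t \<omega>) \<and> ?eq n (Z n) \<omega>"
    unfolding AE_all_countable
  proof
    fix n
    show "AE \<omega> in M. 1 \<le> n \<longrightarrow> continuous_on {0..} (\<lambda>t. Z n t \<omega>) \<and> ?eq n (Z n) \<omega>"
    proof (cases "1 \<le> n")
      case True
      have a: "AE \<omega> in M. continuous_on {0..} (\<lambda>t. Z n t \<omega>)" using Z[rule_format, OF True] unfolding noise_component_def by blast
      have b: "AE \<omega> in M. ?eq n (Z n) \<omega>" using Z[rule_format, OF True] by (rule conjunct2)
      from a b show ?thesis by eventually_elim blast
    qed simp
  qed
  moreover have "AE \<omega> in M. X 0 \<omega> = x0" "AE \<omega> in M. \<forall>T>0. (\<lambda>t. X t \<omega>) \<in> Linf_ell2 T \<inter> L2_H1 lam T" "AE \<omega> in M. ?en \<omega>"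
    using sol unfolding leray_hopf_solution_def by blast+
  ultimately have "AE \<omega> in M. good \<omega>" unfolding good_def by eventually_elim blast
  then obtain N0 where N0: "{\<omega> \<in> space M. \<not> good \<omega>} \<subseteq> N0" "emeasure M N0 = 0" "N0 \<in> sets M" by (rule AE_E)
  have AEN0: "AE \<omega> in M. \<omega> \<notin> N0" using N0(2,3) by (intro AE_not_in) (simp add: null_sets_def)
  \<comment> \<open>The zero path on the exceptional set obeys the bound and the energy inequality;
    off this set, negative times repeat the value at 0.\<close>
  define X' where "X' t \<omega> = (if \<omega> \<in> N0 then (\<lambda>_. 0) else X (max 0 t) \<omega>)" for t \<omega>
  have g: "good \<omega>" if "\<omega> \<in> space M" "\<omega> \<notin> N0" for \<omega> using N0(1) that by blast
  have eqX: "AE \<omega> in M. \<forall>t\<ge>0. X' t \<omega> = X t \<omega>" using AEN0 by eventually_elim (simp add: X'_def)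
  have nrm: "ell2_norm (X t \<omega>) \<le> L" if \<omega>: "\<omega> \<in> space M" "\<omega> \<notin> N0" and t: "0 \<le> t" for t \<omega>
  proof -
    have "ell2_norm (X t \<omega>) \<le> ell2_norm (X 0 \<omega>)"
      by (rule energy_decreasing(2)[OF _ par(2) _ order_refl t]) (use g[OF \<omega>] Xl \<omega> in \<open>auto simp: good_def\<close>)
    then show ?thesis using g[OF \<omega>] L unfolding good_def by simp
  qed
  have X'l: "X' r \<omega> \<in> ell2 \<and> ell2_norm (X' r \<omega>) \<le> L" if "\<omega> \<in> space M" for r \<omega>
    using Xl[of "max 0 r" \<omega>] nrm[of \<omega> "max 0 r"] zero_ell2 L(2) that by (simp add: X'_def)
  have cont: "continuous_on {0..T} (\<lambda>t. X t \<omega> n)" if \<omega>: "\<omega> \<in> space M" "\<omega> \<notin> N0" and T: "0 < T" for \<omega> T n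
  proof (cases "1 \<le> n")
    case True
    show ?thesis
    proof (rule component_path_continuous)
      show "path_measurable T (\<lambda>t. X t \<omega>)" using g[OF \<omega>] T unfolding good_def L2_H1_def by auto
      show "\<bar>X r \<omega> k\<bar> \<le> L" if "0 \<le> r" for r k
        by (rule order_trans[OF ell2_component_le[OF Xl[OF that \<omega>(1)]] nrm[OF \<omega> that]])
      show "X t \<omega> n = X 0 \<omega> n + (LBINT r:{0..t}. drift lam \<kappa> \<nu> (theta N) (X r \<omega>) n) + sqrt (2 * \<nu>) * Z n t \<omega>" if "0 \<le> t" for t
        using g[OF \<omega>] True that unfolding good_def by blast
      show "continuous_on {0..} (\<lambda>t. Z n t \<omega>)" using g[OF \<omega>] True unfolding good_def by blast
    qed
  next
    case False
    then have "n = 0" by simp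
    then have "X t \<omega> n = 0" if "t \<in> {0..T}" for t using Xl[of t \<omega>] \<omega> that by (simp add: ell2_def)
    then show ?thesis using continuous_on_cong[of "{0..T}" "{0..T}" "\<lambda>t. X t \<omega> n" "\<lambda>_. 0"] by simp
  qed
  have meas: "(\<lambda>(r, \<omega>). X' r \<omega> n) \<in> borel_measurable (borel \<Otimes>\<^sub>M M)" for n
  proof -
    have "(\<lambda>(r, \<omega>). if \<omega> \<in> N0 then 0 else X (max 0 r) \<omega> n) \<in> borel_measurable (borel \<Otimes>\<^sub>M M)"
    proof (rule caratheodory_measurable[where g="\<lambda>r \<omega>. if \<omega> \<in> N0 then 0 else X r \<omega> n"])
      fix t :: real assume "0 \<le> t"
      then have "(\<lambda>\<omega>. X t \<omega> n) \<in> borel_measurable M" using borel_measurable_F_M[OF XF] by blast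
      then show "(\<lambda>\<omega>. if \<omega> \<in> N0 then 0 else X t \<omega> n) \<in> borel_measurable M"
        using N0(3) by (intro measurable_If_set borel_measurable_const) auto
    next
      fix \<omega> and T :: real assume "\<omega> \<in> space M" "0 < T"
      then show "continuous_on {0..T} (\<lambda>t. if \<omega> \<in> N0 then 0 else X t \<omega> n)"
        using cont[of \<omega> T n] by (cases "\<omega> \<in> N0") auto
    qed
    moreover have "(\<lambda>(r, \<omega>). if \<omega> \<in> N0 then 0 else X (max 0 r) \<omega> n) = (\<lambda>(r, \<omega>). X' r \<omega> n)" by (auto simp: X'_def fun_eq_iff)
    ultimately show ?thesis by simp
  qed
  have bX: "bounded_process (\<lambda>r \<omega>. X' r \<omega> n)" for n
  proof (rule bounded_processI[where B=L])
    show "(\<lambda>(r, \<omega>). X' r \<omega> n) \<in> borel_measurable (borel \<Otimes>\<^sub>M M)" by (rule meas)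
    fix r \<omega> assume "\<omega> \<in> space M"
    then have l: "X' r \<omega> \<in> ell2" "ell2_norm (X' r \<omega>) \<le> L" using X'l by simp_all
    show "\<bar>X' r \<omega> n\<bar> \<le> L" using ell2_component_le[OF l(1), of n] l(2) by linarith
  qed
  have bU: "bounded_process (\<lambda>r \<omega>. (ell2_norm (X' r \<omega>))\<^sup>2)"
  proof (rule bounded_processI[where B="L\<^sup>2"])
    have m: "(\<lambda>x. \<Sum>n. (X' (fst x) (snd x) n)\<^sup>2) \<in> borel_measurable (borel \<Otimes>\<^sub>M M)"
      by (intro borel_measurable_suminf borel_measurable_power meas[unfolded case_prod_beta'])
    have eq: "(ell2_norm (X' (fst x) (snd x)))\<^sup>2 = (\<Sum>n. (X' (fst x) (snd x) n)\<^sup>2)" if "x \<in> space (borel \<Otimes>\<^sub>M M)" for x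
    proof -
      have "snd x \<in> space M" using that by (auto simp: space_pair_measure)
      then show ?thesis using X'l[of "snd x" "fst x"] by (intro ell2_norm_sq) blast
    qed
    show "(\<lambda>(r, \<omega>). (ell2_norm (X' r \<omega>))\<^sup>2) \<in> borel_measurable (borel \<Otimes>\<^sub>M M)"
      unfolding case_prod_beta' by (rule measurable_cong[THEN iffD2, OF eq m])
    show "\<bar>(ell2_norm (X' r \<omega>))\<^sup>2\<bar> \<le> L\<^sup>2" if "\<omega> \<in> space M" for r \<omega>
    proof -
      have "(ell2_norm (X' r \<omega>))\<^sup>2 \<le> L\<^sup>2"
        by (rule power_mono[OF X'l[OF that, THEN conjunct2] ell2_norm_nonneg[OF X'l[OF that, THEN conjunct1]]])
      then show ?thesis by simp
    qed
  qed
  have ev: "\<exists>I. evolves (\<lambda>r \<omega>. X' r \<omega> n) (\<lambda>r \<omega>. drift lam \<kappa> \<nu> (theta N) (X' r \<omega>) n)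
        (grid n N) (coef lam \<nu> N) (\<lambda>c r \<omega>. noise_integrand n c (X' r \<omega>)) I" if n: "1 \<le> n" for n
  proof -
    have Zn: "noise_component lam (theta N) M F W X n (Z n)" "AE \<omega> in M. ?eq n (Z n) \<omega>" using Z[rule_format, OF n] by blast+
    obtain I where I: "\<forall>c\<in>labels. L2_integral c (\<lambda>r \<omega>. noise_integrand n c (X' r \<omega>)) (I c)"
      and ZI: "\<forall>t\<ge>0. AE \<omega> in M. Z n t \<omega> = (\<Sum>c\<in>grid n N. lam ^ fst c * theta N (snd c) * I c t \<omega>)"
      using noise_component_finite[OF Zn(1) bX eqX] by blast
    have sub: "grid n N \<subseteq> labels" by (auto simp: grid_def labels_def)
    have integ: "integrators (grid n N) (\<lambda>c r \<omega>. noise_integrand n c (X' r \<omega>)) I"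
      unfolding integrators_def 
    proof (intro conjI ballI)
      show "finite (grid n N)" by (simp add: grid_def)
      fix c assume "c \<in> grid n N"
      then have c: "c \<in> labels" using sub by blast
      show "bounded_process (\<lambda>r \<omega>. noise_integrand n c (X' r \<omega>))" by (rule noise_integrand_bounded_process[OF bX c])
      show "L2_integral c (\<lambda>r \<omega>. noise_integrand n c (X' r \<omega>)) (I c)" by (rule I[rule_format, OF c])
    qed (rule sub)
    have adapt: "\<exists>\<eta>\<in>borel_measurable (F t). AE \<omega> in M. X' t \<omega> n = \<eta> \<omega>" if "0 \<le> t" for t
    proof (rule bexI[OF _ XF[OF that]])
      show "AE \<omega> in M. X' t \<omega> n = X t \<omega> n" using eqX by eventually_elim (use that in simp)
    qed
    have eqn: "AE \<omega> in M. X' t \<omega> n = X' 0 \<omega> n + (LBINT r:{0..t}. drift lam \<kappa> \<nu> (theta N) (X' r \<omega>) n) + (\<Sum>c\<in>grid n N. coef lam \<nu> N c * I c t \<omega>)"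
      if t: "0 \<le> t" for t
      using eqX Zn(2) ZI[rule_format, OF t]
    proof eventually_elim
      case (elim \<omega>)
      have "(LBINT r:{0..t}. drift lam \<kappa> \<nu> (theta N) (X' r \<omega>) n) = (LBINT r:{0..t}. drift lam \<kappa> \<nu> (theta N) (X r \<omega>) n)"
        by (rule set_lebesgue_integral_cong) (use elim(1) in auto)
      moreover have "sqrt (2 * \<nu>) * Z n t \<omega> = (\<Sum>c\<in>grid n N. coef lam \<nu> N c * I c t \<omega>)"
        unfolding elim(3) coef_def sum_distrib_left by (simp add: mult.assoc)
      moreover have "X' t \<omega> = X t \<omega>" "X' 0 \<omega> = X 0 \<omega>" using elim(1) t by simp_all
      ultimately show ?case using elim(2)[rule_format, OF t] by simp
    qed
    have "evolves (\<lambda>r \<omega>. X' r \<omega> n) (\<lambda>r \<omega>. drift lam \<kappa> \<nu> (theta N) (X' r \<omega>) n)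
        (grid n N) (coef lam \<nu> N) (\<lambda>c r \<omega>. noise_integrand n c (X' r \<omega>)) I"
      unfolding evolves_def
      by (rule conjI[OF bX conjI[OF drift_bounded_process[OF bX] conjI[OF integ conjI]]])
         (intro allI impI, rule adapt, assumption, intro allI impI, rule eqn, assumption)
    then show ?thesis by blast
  qed
  have en: "(ell2_norm (X' t \<omega>))\<^sup>2 - (ell2_norm (X' s \<omega>))\<^sup>2 \<le> - (2 * \<kappa>) * (LBINT r:{s..t}.
           lam ^ (2 * (m + 1)) * (ell2_norm (X' r \<omega>))\<^sup>2 - (\<Sum>n=1..m. (lam ^ (2 * (m + 1)) - lam ^ (2 * n)) * (X' r \<omega> n)\<^sup>2))"
    if \<omega>: "\<omega> \<in> space M" and st: "0 \<le> s" "s \<le> t" for m s t \<omega>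
  proof (cases "\<omega> \<in> N0")
    case True then show ?thesis by (simp add: X'_def zero_ell2 set_lebesgue_integral_def)
  next
    case False
    note G = g[OF \<omega> False, unfolded good_def]
    have "(ell2_norm (X t \<omega>))\<^sup>2 - (ell2_norm (X s \<omega>))\<^sup>2 \<le> - (2 * \<kappa>) * (LBINT r:{s..t}.
           lam ^ (2 * (m + 1)) * (ell2_norm (X r \<omega>))\<^sup>2 - (\<Sum>n=1..m. (lam ^ (2 * (m + 1)) - lam ^ (2 * n)) * (X r \<omega> n)\<^sup>2))"
      by (rule energy_inequality[OF _ par(2,1) _ _ st]) (use G Xl \<omega> in auto)
    also have "(LBINT r:{s..t}. lam ^ (2 * (m + 1)) * (ell2_norm (X r \<omega>))\<^sup>2 - (\<Sum>n=1..m. (lam ^ (2 * (m + 1)) - lam ^ (2 * n)) * (X r \<omega> n)\<^sup>2)) =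
       (LBINT r:{s..t}. lam ^ (2 * (m + 1)) * (ell2_norm (X' r \<omega>))\<^sup>2 - (\<Sum>n=1..m. (lam ^ (2 * (m + 1)) - lam ^ (2 * n)) * (X' r \<omega> n)\<^sup>2))"
      by (rule set_lebesgue_integral_cong) (use st False in \<open>auto simp: X'_def max_absorb2\<close>)
    finally show ?thesis using st False by (simp add: X'_def max_absorb2)
  qed
  have "AE \<omega> in M. X' 0 \<omega> = x0" using AEN0 AE_space by eventually_elim (use g in \<open>simp add: X'_def good_def\<close>)
  then have "regular_version lam \<kappa> \<nu> N L x0 X'"
    unfolding regular_version_def
  proof (intro conjI)
    show "\<forall>r. \<forall>\<omega>\<in>space M. X' r \<omega> \<in> ell2 \<and> ell2_norm (X' r \<omega>) \<le> L" by (intro allI ballI) (rule X'l)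
    show "\<forall>n. bounded_process (\<lambda>r \<omega>. X' r \<omega> n)" by (intro allI) (rule bX)
    show "\<forall>n\<ge>1. \<exists>I. evolves (\<lambda>r \<omega>. X' r \<omega> n) (\<lambda>r \<omega>. drift lam \<kappa> \<nu> (theta N) (X' r \<omega>) n)
        (grid n N) (coef lam \<nu> N) (\<lambda>c r \<omega>. noise_integrand n c (X' r \<omega>)) I" by (intro allI impI) (rule ev)
    show "\<forall>m s t. \<forall>\<omega>\<in>space M. 0 \<le> s \<and> s \<le> t \<longrightarrow>
        (ell2_norm (X' t \<omega>))\<^sup>2 - (ell2_norm (X' s \<omega>))\<^sup>2 \<le> - (2 * \<kappa>) * (LBINT r:{s..t}.
           lam ^ (2 * (m + 1)) * (ell2_norm (X' r \<omega>))\<^sup>2 - (\<Sum>n=1..m. (lam ^ (2 * (m + 1)) - lam ^ (2 * n)) * (X' r \<omega> n)\<^sup>2))"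
      by (intro allI ballI impI) (elim conjE, rule en)
  qed (rule bU, assumption)
  then show ?thesis using eqX by (intro exI conjI)
qed

end

section \<open>Energy inequalities\<close>

context driven_space begin

lemma noise_integrand_eq:
  "c \<in> labels \<Longrightarrow> noise_integrand n c x = (if n = fst c then - x (n + snd c) else if n = fst c + snd c then x (fst c) else 0)"
  unfolding noise_integrand_def by (subst mat_app_A_mat) (auto simp: labels_def)

lemma coef_sq:
  assumes "c \<in> grid n N" "0 \<le> \<nu>"
  shows "(coef lam \<nu> N c)\<^sup>2 = 2 * \<nu> / real N * lam ^ (2 * fst c)"
proof -
  have "snd c \<in> {1..N}" using assms(1) by (auto simp: grid_def)
  then have "(coef lam \<nu> N c)\<^sup>2 = 2 * \<nu> * ((lam ^ fst c)\<^sup>2 * (1 / real N))"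
    unfolding coef_def power_mult_distrib theta_sq using assms(2) by simp
  then show ?thesis by (simp add: power_mult[symmetric] mult.commute)
qed

text \<open>Labels \<open>(n, j)\<close> bring in energy from the modes \<open>n + j\<close>, labels
  \<open>(i, n - i)\<close> from the lower modes \<open>i\<close>; all other labels of the grid
  contribute 0. It is an inequality because \<open>n - i\<close> may exceed
  \<open>N\<close>.\<close>

lemma noise_energy_le:
  assumes n: "1 \<le> n" and \<nu>: "0 \<le> \<nu>" and lam: "0 \<le> lam"
  shows "(\<Sum>c\<in>grid n N. (coef lam \<nu> N c)\<^sup>2 * (noise_integrand n c x)\<^sup>2) \<le>
    2 * \<nu> / real N * (lam ^ (2 * n) * (\<Sum>j=1..N. (x (n + j))\<^sup>2) + (\<Sum>i=1..<n. lam ^ (2 * i) * (x i)\<^sup>2))"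
proof -
  have sub: "grid n N \<subseteq> labels" by (auto simp: grid_def labels_def)
  let ?f = "\<lambda>i j. if n = i then (x (n + j))\<^sup>2 else if n = i + j then (x i)\<^sup>2 else 0"
  have "(\<Sum>c\<in>grid n N. (coef lam \<nu> N c)\<^sup>2 * (noise_integrand n c x)\<^sup>2) = (\<Sum>c\<in>grid n N. 2 * \<nu> / real N * (lam ^ (2 * fst c) * ?f (fst c) (snd c)))"
  proof (rule sum.cong[OF refl])
    fix c assume c: "c \<in> grid n N"
    then have "c \<in> labels" using sub by blast
    from noise_integrand_eq[OF this, of n x] show "(coef lam \<nu> N c)\<^sup>2 * (noise_integrand n c x)\<^sup>2 = 2 * \<nu> / real N * (lam ^ (2 * fst c) * ?f (fst c) (snd c))"
      unfolding coef_sq[OF c \<nu>] by simp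
  qed
  also have "\<dots> = 2 * \<nu> / real N * (\<Sum>i=1..n. \<Sum>j=1..N. lam ^ (2 * i) * ?f i j)"
    unfolding grid_def sum_distrib_left sum.cartesian_product by (simp add: case_prod_beta)
  also have "(\<Sum>i=1..n. \<Sum>j=1..N. lam ^ (2 * i) * ?f i j) = (\<Sum>j=1..N. lam ^ (2 * n) * ?f n j) + (\<Sum>i=1..<n. \<Sum>j=1..N. lam ^ (2 * i) * ?f i j)"
  proof -
    have "{1..n} = insert n {1..<n}" using n by auto
    then show ?thesis by simp
  qed
  also have "(\<Sum>j=1..N. lam ^ (2 * n) * ?f n j) = lam ^ (2 * n) * (\<Sum>j=1..N. (x (n + j))\<^sup>2)"
    by (simp add: sum_distrib_left)
  also have "2 * \<nu> / real N * (lam ^ (2 * n) * (\<Sum>j=1..N. (x (n + j))\<^sup>2) + (\<Sum>i=1..<n. \<Sum>j=1..N. lam ^ (2 * i) * ?f i j))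
    \<le> 2 * \<nu> / real N * (lam ^ (2 * n) * (\<Sum>j=1..N. (x (n + j))\<^sup>2) + (\<Sum>i=1..<n. lam ^ (2 * i) * (x i)\<^sup>2))"
  proof (intro mult_left_mono add_left_mono sum_mono)
    fix i assume i: "i \<in> {1..<n}"
    have "(\<Sum>j=1..N. lam ^ (2 * i) * ?f i j) = (\<Sum>j=1..N. if j = n - i then lam ^ (2 * i) * (x i)\<^sup>2 else 0)"
      by (rule sum.cong) (use i in auto)
    also have "\<dots> \<le> lam ^ (2 * i) * (x i)\<^sup>2" using lam by simp
    finally show "(\<Sum>j=1..N. lam ^ (2 * i) * ?f i j) \<le> lam ^ (2 * i) * (x i)\<^sup>2" .
  qed (use \<nu> in simp)
  finally show ?thesis .
qed

lemma sum_shift_le: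
  fixes f :: "nat \<Rightarrow> real"
  assumes "\<And>k. 0 \<le> f k" "j \<le> N"
  shows "(\<Sum>n=1..m. f (n + j)) \<le> (\<Sum>k=1..m+N. f k)"
proof -
  have "(\<Sum>n=1..m. f (n + j)) = (\<Sum>k\<in>(\<lambda>n. n + j) ` {1..m}. f k)"
    by (subst sum.reindex) (simp_all add: inj_on_def del: image_add_atLeastAtMost')
  also have "\<dots> \<le> (\<Sum>k=1..m+N. f k)" by (rule sum_mono2) (use assms in auto)
  finally show ?thesis .
qed

lemma sum_pred_le:
  fixes f :: "nat \<Rightarrow> real"
  assumes "\<And>k. 0 \<le> f k" "f 0 = 0"
  shows "(\<Sum>n=1..m. f (n - 1)) \<le> (\<Sum>n=1..m. f n)"
proof -
  have "(\<Sum>n=1..m. f (n - 1)) + f m = f 0 + (\<Sum>n=1..m. f n)"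
    by (induction m) simp_all
  then show ?thesis using assms(1)[of m] assms(2) by simp
qed

text \<open>The drift of the square of mode \<open>n\<close> in Ito's formula, quadratic variation
  included.\<close>

definition gain :: "real \<Rightarrow> real \<Rightarrow> real \<Rightarrow> nat \<Rightarrow> nat \<Rightarrow> (nat \<Rightarrow> real) \<Rightarrow> real" where
  "gain lam \<kappa> \<nu> N n x = 2 * (x n * drift lam \<kappa> \<nu> (theta N) x n) + (\<Sum>c\<in>grid n N. (coef lam \<nu> N c)\<^sup>2 * (noise_integrand n c x)\<^sup>2)"

text \<open>
  Modes up to \<open>m\<close> carry weight 2 and the others weight 1: the noise moves energy out of the low
  modes at rate about \<open>\<nu>\<close>, spread over so many modes (\<open>N\<close> large) that little of it comes back,
  and the high modes are dissipated by the viscosity.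
\<close>

lemma decay_inequality:
  assumes x: "x \<in> ell2" "ell2_norm x \<le> L" and lam: "lam > 1" and \<kappa>: "\<kappa> > 0" and \<nu>: "\<nu> > 0" and N: "1 \<le> N"
    and c1: "K + 1 \<le> 2 * \<kappa> * lam ^ (2 * (m + 1))"
    and c2: "4 * lam ^ m * L + 1 + 2 * K \<le> 2 * \<nu> * lam\<^sup>2"
    and c3: "4 * \<nu> * real m * lam ^ (2 * m) \<le> real N"
  shows "- (2 * \<kappa>) * (lam ^ (2 * (m + 1)) * (ell2_norm x)\<^sup>2 - (\<Sum>n=1..m. (lam ^ (2 * (m + 1)) - lam ^ (2 * n)) * (x n)\<^sup>2))
     + (\<Sum>n=1..m. gain lam \<kappa> \<nu> N n x) \<le> - K * ((ell2_norm x)\<^sup>2 + (\<Sum>n=1..m. (x n)\<^sup>2))"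
proof -
  define U where "U = (ell2_norm x)\<^sup>2"
  define P where "P = (\<Sum>n=1..m. (x n)\<^sup>2)"
  define \<Lambda> where "\<Lambda> = lam ^ (2 * (m + 1))"
  have xL: "\<bar>x k\<bar> \<le> L" for k using ell2_component_le[OF x(1), of k] x(2) by linarith
  have x0: "x 0 = 0" using x(1) by (simp add: ell2_def)
  have sumU: "(\<Sum>n\<in>A. (x n)\<^sup>2) \<le> U" if "finite A" for A unfolding U_def by (rule ell2_sum_le[OF x(1) that])
  have U0: "0 \<le> U" unfolding U_def by simp
  have PU: "P \<le> U" unfolding P_def by (rule sumU) simp
  have P0: "0 \<le> P" unfolding P_def by (simp add: sum_nonneg)
  have pw: "lam ^ a \<le> lam ^ b" if "a \<le> b" for a b using lam that by (intro power_increasing) auto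
  have pos: "0 \<le> lam ^ a" for a using lam by simp
  have g: "gain lam \<kappa> \<nu> N n x \<le> 2 * lam ^ m * L * ((x (n - 1))\<^sup>2 + (x n)\<^sup>2) - 2 * \<nu> * lam\<^sup>2 * (x n)\<^sup>2 + 2 * \<nu> / real N * (lam ^ (2 * m) * (2 * U))"
    if n: "n \<in> {1..m}" for n
  proof -
    have B1: "x n * (lam ^ (n - 1) * x (n - 1) * x (n - 1)) \<le> lam ^ m * L * (x (n - 1))\<^sup>2"
    proof -
      have "x n * (lam ^ (n - 1) * x (n - 1) * x (n - 1)) = lam ^ (n - 1) * (x n * (x (n - 1))\<^sup>2)" by (simp add: power2_eq_square)
      also have "\<dots> \<le> lam ^ m * (L * (x (n - 1))\<^sup>2)"
      proof (cases "0 \<le> x n")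
        case True
        then show ?thesis using xL[of n] n pos by (intro mult_mono pw mult_right_mono) auto
      next
        case False
        have "0 \<le> L" using xL[of n] by linarith
        then have "0 \<le> lam ^ m * (L * (x (n - 1))\<^sup>2)" using pos by simp
        moreover have "lam ^ (n - 1) * (x n * (x (n - 1))\<^sup>2) \<le> 0" using False pos by (simp add: mult_nonneg_nonpos mult_nonpos_nonneg)
        ultimately show ?thesis by linarith
      qed
      finally show ?thesis by (simp add: mult.assoc)
    qed
    have B2: "- (x n * (lam ^ n * x n * x (n + 1))) \<le> lam ^ m * L * (x n)\<^sup>2"
    proof -
      have "- (x n * (lam ^ n * x n * x (n + 1))) = lam ^ n * ((- x (n + 1)) * (x n)\<^sup>2)" by (simp add: power2_eq_square)
      also have "\<dots> \<le> lam ^ n * (L * (x n)\<^sup>2)" using xL[of "n + 1"] pos by (intro mult_left_mono mult_right_mono) auto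
      also have "\<dots> \<le> lam ^ m * (L * (x n)\<^sup>2)"
        using n xL[of n] by (intro mult_right_mono pw mult_nonneg_nonneg) auto
      finally show ?thesis by (simp add: mult.assoc)
    qed
    have B: "x n * B_op lam x x n \<le> lam ^ m * L * ((x (n - 1))\<^sup>2 + (x n)\<^sup>2)"
      using B1 B2 unfolding B_op_def by (simp add: right_diff_distrib distrib_left)
    have S: "x n * (\<kappa> * S_op lam x n) \<le> 0"
    proof -
      have "x n * (\<kappa> * S_op lam x n) = - (\<kappa> * (lam ^ (2 * n) * (x n)\<^sup>2))" by (simp add: S_op_def power2_eq_square)
      then show ?thesis using \<kappa> pos by simp
    qed
    \<comment> \<open>In the low modes the viscosity has been discarded, and from the Ito correction
      only the weight \<open>lam\<^sup>2\<close> is kept, a lower bound for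
      \<open>lam ^ (2 * n)\<close> that is uniform in \<open>n \<ge> 1\<close>.\<close>
    have T: "x n * (\<nu> * S_theta lam (theta N) x n) \<le> - (\<nu> * lam\<^sup>2 * (x n)\<^sup>2)"
    proof -
      let ?s = "\<Sum>j = 1..<n. (theta N j)\<^sup>2 * lam ^ (2 * (n - j))"
      have "0 \<le> ?s" using pos by (intro sum_nonneg) simp
      then have "lam\<^sup>2 \<le> lam ^ (2 * n) + ?s" using pw[of 2 "2 * n"] n by simp
      then have "\<nu> * (lam\<^sup>2 * (x n)\<^sup>2) \<le> \<nu> * ((lam ^ (2 * n) + ?s) * (x n)\<^sup>2)"
        using \<nu> by (intro mult_left_mono mult_right_mono) auto
      moreover have "x n * (\<nu> * S_theta lam (theta N) x n) = - (\<nu> * ((lam ^ (2 * n) + ?s) * (x n)\<^sup>2))"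
        unfolding S_theta_def power2_eq_square[of "x n"] by (simp only: mult_minus_left mult_minus_right mult_ac)
      ultimately show ?thesis by (simp only: mult.assoc)
    qed
    have Nn: "(\<Sum>c\<in>grid n N. (coef lam \<nu> N c)\<^sup>2 * (noise_integrand n c x)\<^sup>2) \<le> 2 * \<nu> / real N * (lam ^ (2 * m) * (2 * U))"
    proof -
      have "(\<Sum>c\<in>grid n N. (coef lam \<nu> N c)\<^sup>2 * (noise_integrand n c x)\<^sup>2) \<le>
        2 * \<nu> / real N * (lam ^ (2 * n) * (\<Sum>j=1..N. (x (n + j))\<^sup>2) + (\<Sum>i=1..<n. lam ^ (2 * i) * (x i)\<^sup>2))"
        by (rule noise_energy_le) (use n \<nu> lam in auto)
      also have "\<dots> \<le> 2 * \<nu> / real N * (lam ^ (2 * m) * U + lam ^ (2 * m) * U)"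
      proof (intro mult_left_mono add_mono)
        have "(\<Sum>j=1..N. (x (n + j))\<^sup>2) = (\<Sum>k\<in>(+) n ` {1..N}. (x k)\<^sup>2)"
          by (subst sum.reindex) (simp_all add: inj_on_def)
        also have "\<dots> \<le> U" by (rule sumU) simp
        finally show "lam ^ (2 * n) * (\<Sum>j=1..N. (x (n + j))\<^sup>2) \<le> lam ^ (2 * m) * U"
          using n pos by (intro mult_mono pw) (auto intro: sum_nonneg)
        have "(\<Sum>i=1..<n. lam ^ (2 * i) * (x i)\<^sup>2) \<le> (\<Sum>i=1..<n. lam ^ (2 * m) * (x i)\<^sup>2)"
          using n by (intro sum_mono mult_right_mono pw) auto
        also have "\<dots> = lam ^ (2 * m) * (\<Sum>i=1..<n. (x i)\<^sup>2)" by (simp add: sum_distrib_left)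
        also have "\<dots> \<le> lam ^ (2 * m) * U" using pos by (intro mult_left_mono sumU) auto
        finally show "(\<Sum>i=1..<n. lam ^ (2 * i) * (x i)\<^sup>2) \<le> lam ^ (2 * m) * U" .
      qed (use \<nu> in simp)
      also have "lam ^ (2 * m) * U + lam ^ (2 * m) * U = lam ^ (2 * m) * (2 * U)" by simp
      finally show ?thesis .
    qed
    have "x n * drift lam \<kappa> \<nu> (theta N) x n = x n * B_op lam x x n + x n * (\<kappa> * S_op lam x n) + x n * (\<nu> * S_theta lam (theta N) x n)"
      by (simp add: drift_def distrib_left)
    then show ?thesis using B S T Nn unfolding gain_def by linarith
  qed
  have "(\<Sum>n=1..m. gain lam \<kappa> \<nu> N n x) \<le> (\<Sum>n=1..m. 2 * lam ^ m * L * ((x (n - 1))\<^sup>2 + (x n)\<^sup>2) - 2 * \<nu> * lam\<^sup>2 * (x n)\<^sup>2 + 2 * \<nu> / real N * (lam ^ (2 * m) * (2 * U)))"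
    by (rule sum_mono) (rule g)
  also have "\<dots> = 2 * lam ^ m * L * ((\<Sum>n=1..m. (x (n - 1))\<^sup>2) + P) - 2 * \<nu> * lam\<^sup>2 * P + real m * (2 * \<nu> / real N * (lam ^ (2 * m) * (2 * U)))"
    by (simp add: P_def sum.distrib sum_subtractf sum_distrib_left distrib_left)
  also have "\<dots> \<le> 2 * lam ^ m * L * (P + P) - 2 * \<nu> * lam\<^sup>2 * P + U"
  proof (intro add_mono diff_right_mono mult_left_mono)
    show "(\<Sum>n=1..m. (x (n - 1))\<^sup>2) \<le> P" unfolding P_def by (rule sum_pred_le) (use x0 in auto)
    show "0 \<le> 2 * lam ^ m * L" using pos[of m] xL[of 0] by simp
    \<comment> \<open>By \<open>c3\<close> the return of energy to all \<open>m\<close> low modes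
      together is at most \<open>U\<close>.\<close>
    have "real m * (2 * \<nu> / real N * (lam ^ (2 * m) * (2 * U))) = (4 * \<nu> * real m * lam ^ (2 * m)) / real N * U" by simp
    also have "\<dots> \<le> 1 * U" using c3 N U0 by (intro mult_right_mono) auto
    finally show "real m * (2 * \<nu> / real N * (lam ^ (2 * m) * (2 * U))) \<le> U" by simp
  qed simp
  also have "\<dots> = (4 * lam ^ m * L - 2 * \<nu> * lam\<^sup>2) * P + U" by (simp add: algebra_simps)
  \<comment> \<open>By \<open>c2\<close> the loss exceeds the nonlinear exchange by
    \<open>1 + 2 * K\<close>. Of this, \<open>K + 1\<close> compensates the low modes missing from
    the viscous estimate below, and \<open>K\<close> remains.\<close>
  also have "\<dots> \<le> (- (1 + 2 * K)) * P + U" using c2 P0 by (intro add_right_mono mult_right_mono) linarith+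
  finally have G: "(\<Sum>n=1..m. gain lam \<kappa> \<nu> N n x) \<le> (- (1 + 2 * K)) * P + U" .
  have "(\<Sum>n=1..m. (\<Lambda> - lam ^ (2 * n)) * (x n)\<^sup>2) \<le> (\<Sum>n=1..m. \<Lambda> * (x n)\<^sup>2)"
    using pos by (intro sum_mono mult_right_mono) auto
  also have "\<dots> = \<Lambda> * P" by (simp add: P_def sum_distrib_left)
  finally have "2 * \<kappa> * (\<Lambda> * (U - P)) \<le> 2 * \<kappa> * (\<Lambda> * U - (\<Sum>n=1..m. (\<Lambda> - lam ^ (2 * n)) * (x n)\<^sup>2))"
    using \<kappa> by (intro mult_left_mono) (auto simp: right_diff_distrib)
  \<comment> \<open>By \<open>c1\<close> the coefficient of \<open>U\<close> becomes
    \<open>K + 1\<close>, one unit of which absorbs the returned energy \<open>U\<close>.\<close>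
  moreover have "(K + 1) * (U - P) \<le> 2 * \<kappa> * \<Lambda> * (U - P)" using c1 PU unfolding \<Lambda>_def by (intro mult_right_mono) auto
  ultimately have "- (2 * \<kappa>) * (\<Lambda> * U - (\<Sum>n=1..m. (\<Lambda> - lam ^ (2 * n)) * (x n)\<^sup>2)) \<le> - ((K + 1) * (U - P))"
    by (simp add: mult.assoc)
  with G have "- (2 * \<kappa>) * (\<Lambda> * U - (\<Sum>n=1..m. (\<Lambda> - lam ^ (2 * n)) * (x n)\<^sup>2)) + (\<Sum>n=1..m. gain lam \<kappa> \<nu> N n x) \<le> - ((K + 1) * (U - P)) + ((- (1 + 2 * K)) * P + U)"
    by (rule add_mono[rotated])
  also have "\<dots> = - K * (U + P)" by (simp add: algebra_simps)
  finally show ?thesis unfolding U_def P_def \<Lambda>_def .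
qed

text \<open>The analogue for the square of the difference of two solutions driven by the same
  motions; the noise is linear, so its integrands subtract.\<close>

definition gain_diff :: "real \<Rightarrow> real \<Rightarrow> real \<Rightarrow> nat \<Rightarrow> nat \<Rightarrow> (nat \<Rightarrow> real) \<Rightarrow> (nat \<Rightarrow> real) \<Rightarrow> real" where
  "gain_diff lam \<kappa> \<nu> N n x y = 2 * ((x n - y n) * (drift lam \<kappa> \<nu> (theta N) x n - drift lam \<kappa> \<nu> (theta N) y n))
     + (\<Sum>c\<in>grid n N. (coef lam \<nu> N c)\<^sup>2 * (noise_integrand n c x - noise_integrand n c y)\<^sup>2)"

text \<open>Exchanging the sums gives geometric series with full sum
  \<open>1 / (lam\<^sup>2 - 1)\<close>, truncated at \<open>m\<close>. The remainder is added on the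
  left so that an exact identity can be proved by induction.\<close>

lemma weighted_prefix_sum:
  fixes f :: "nat \<Rightarrow> real" and lam :: real
  assumes lam: "lam > 1"
  defines "g \<equiv> 1 / (lam\<^sup>2 - 1)"
  shows "(\<Sum>n=1..m. (\<Sum>i=1..<n. lam ^ (2 * i) * f i) / lam ^ (2 * n)) + g * ((\<Sum>i=1..m. lam ^ (2 * i) * f i) / lam ^ (2 * m)) = g * (\<Sum>i=1..m. f i)"
proof (induction m)
  case (Suc m)
  define s where "s = (\<Sum>i=1..m. lam ^ (2 * i) * f i)"
  have l2: "lam\<^sup>2 - 1 > 0" using lam by (simp add: one_less_power)
  have p: "lam ^ (2 * Suc m) = lam\<^sup>2 * lam ^ (2 * m)" by (simp add: power2_eq_square)
  have pos: "lam ^ (2 * m) > 0" using lam by simp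
  have 1: "(1 + g) / lam\<^sup>2 = g"
  proof -
    define a where "a = lam\<^sup>2 - 1"
    have "(1 + 1 / a) / (1 + a) = 1 / a" 
    proof -
      have "a \<noteq> 0" "1 + a \<noteq> 0" using l2 unfolding a_def[symmetric] by auto
      then have "(1 + 1 / a) = (1 + a) / a" by (simp add: field_simps)
      then show ?thesis using \<open>1 + a \<noteq> 0\<close> by simp
    qed
    then show ?thesis by (simp add: g_def a_def)
  qed
  have "(\<Sum>n=1..Suc m. (\<Sum>i=1..<n. lam ^ (2 * i) * f i) / lam ^ (2 * n)) + g * ((\<Sum>i=1..Suc m. lam ^ (2 * i) * f i) / lam ^ (2 * Suc m))
    = (\<Sum>n=1..m. (\<Sum>i=1..<n. lam ^ (2 * i) * f i) / lam ^ (2 * n)) + s / lam ^ (2 * Suc m) + g * ((s + lam ^ (2 * Suc m) * f (Suc m)) / lam ^ (2 * Suc m))"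
    by (simp add: s_def atLeastLessThanSuc_atLeastAtMost)
  also have "s / lam ^ (2 * Suc m) + g * ((s + lam ^ (2 * Suc m) * f (Suc m)) / lam ^ (2 * Suc m)) = (1 + g) / lam\<^sup>2 * (s / lam ^ (2 * m)) + g * f (Suc m)"
    using pos lam unfolding p by (simp add: field_simps)
  then have "(\<Sum>n=1..m. (\<Sum>i=1..<n. lam ^ (2 * i) * f i) / lam ^ (2 * n)) + s / lam ^ (2 * Suc m) + g * ((s + lam ^ (2 * Suc m) * f (Suc m)) / lam ^ (2 * Suc m))
    = (\<Sum>n=1..m. (\<Sum>i=1..<n. lam ^ (2 * i) * f i) / lam ^ (2 * n)) + g * (s / lam ^ (2 * m)) + g * f (Suc m)"
    unfolding 1 by simp
  also have "\<dots> = g * (\<Sum>i=1..m. f i) + g * f (Suc m)" using Suc unfolding s_def by simp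
  finally show ?case by (simp add: distrib_left)
qed simp

text \<open>
  In the weights $\lambda^{-2n}$ the viscosity and the noise act on the differences like the
  unweighted norm, which absorbs the nonlinearity.
\<close>

lemma difference_inequality:
  assumes x: "x \<in> ell2" "ell2_norm x \<le> L" and y: "y \<in> ell2" "ell2_norm y \<le> L"
    and lam: "lam > 1" and \<kappa>: "\<kappa> > 0" and \<nu>: "\<nu> > 0" and N: "1 \<le> N" "2 * \<nu> / (lam\<^sup>2 - 1) \<le> \<kappa> * real N"
  shows "(\<Sum>n=1..m. gain_diff lam \<kappa> \<nu> N n x y / lam ^ (2 * n)) \<le>
     16 * L\<^sup>2 / \<kappa> * (\<Sum>n=1..m. (x n - y n)\<^sup>2 / lam ^ (2 * n)) + (2 * \<nu> + \<kappa>) * (\<Sum>n=m+1..m+N. (x n - y n)\<^sup>2)"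
proof -
  define r where "r n = x n - y n" for n
  define w where "w n = 1 / lam ^ (2 * n)" for n
  \<comment> \<open>The neighbouring squares from the nonlinearity cost
    \<open>4 * \<epsilon> = \<kappa>\<close>; of the viscous \<open>2 * \<kappa>\<close> the other
    \<kappa> is left for the noise coming from lower modes.\<close>
  define \<epsilon> where "\<epsilon> = \<kappa> / 4"
  define R where "R = (\<Sum>n=1..m. (r n)\<^sup>2)"
  \<comment> \<open>Modes between \<open>m + 1\<close> and \<open>m + N\<close> feed the truncated
    sum from outside; the expected time integral of this boundary term will vanish as
    \<open>m\<close> grows.\<close>
  define Q where "Q = (\<Sum>n=m+1..m+N. (r n)\<^sup>2)"
  have \<epsilon>: "\<epsilon> > 0" using \<kappa> by (simp add: \<epsilon>_def)
  have xL: "\<bar>x k\<bar> \<le> L" and yL: "\<bar>y k\<bar> \<le> L" for k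
    using ell2_component_le[OF x(1), of k] x(2) ell2_component_le[OF y(1), of k] y(2) by linarith+
  have L: "0 \<le> L" using xL[of 0] by linarith
  have r0: "r 0 = 0" using x(1) y(1) by (simp add: ell2_def r_def)
  have pos: "0 < lam ^ a" for a using lam by simp
  have l2: "lam\<^sup>2 - 1 > 0" using lam by (simp add: one_less_power)
  have amgm: "2 * L * (a * b) \<le> \<epsilon> * b\<^sup>2 + L\<^sup>2 / \<epsilon> * a\<^sup>2" for a b :: real
  proof -
    have "0 \<le> (\<epsilon> * b - L * a)\<^sup>2 / \<epsilon>" using \<epsilon> by simp
    also have "\<dots> = \<epsilon> * b\<^sup>2 + L\<^sup>2 / \<epsilon> * a\<^sup>2 - 2 * L * (a * b)"
      using \<epsilon> by (simp add: power2_diff power_mult_distrib field_simps power2_eq_square)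
    finally show ?thesis by simp
  qed
  have mode: "gain_diff lam \<kappa> \<nu> N n x y * w n \<le>
      \<epsilon> * (2 * (r (n - 1))\<^sup>2 + (r n)\<^sup>2 + (r (n + 1))\<^sup>2) + 4 * (L\<^sup>2 / \<epsilon>) * ((r n)\<^sup>2 * w n) - (2 * \<kappa> + 2 * \<nu>) * (r n)\<^sup>2
      + 2 * \<nu> / real N * ((\<Sum>j=1..N. (r (n + j))\<^sup>2) + (\<Sum>i=1..<n. lam ^ (2 * i) * (r i)\<^sup>2) / lam ^ (2 * n))" if n: "n \<in> {1..m}" for n
  proof -
    \<comment> \<open>The weight \<open>w n\<close> and the factor \<open>lam ^ n\<close> of the
      nonlinearity combine to \<open>1 / lam ^ n\<close>. Thus one factor lies in the weighted norm
      and the other in the unweighted one, which the viscosity controls.\<close>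
    define a where "a = \<bar>r n\<bar> / lam ^ n"
    have wn: "w n > 0" "w n * lam ^ (2 * n) = 1" using pos[of "2 * n"] lam by (simp_all add: w_def)
    have a2: "a\<^sup>2 = (r n)\<^sup>2 * w n" by (simp add: a_def w_def power_divide power_mult[symmetric] mult.commute)
    have n1: "lam ^ (n - 1) \<le> lam ^ n" using lam by (intro power_increasing) auto
    have Bd: "\<bar>B_op lam x x n - B_op lam y y n\<bar> \<le> lam ^ n * L * (2 * \<bar>r (n - 1)\<bar> + \<bar>r n\<bar> + \<bar>r (n + 1)\<bar>)"
    proof -
      have "B_op lam x x n - B_op lam y y n = lam ^ (n - 1) * (r (n - 1) * (x (n - 1) + y (n - 1))) - lam ^ n * (r n * x (n + 1) + y n * r (n + 1))"
        unfolding B_op_def r_def by (simp only: algebra_simps)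
      moreover have e1: "\<bar>lam ^ (n - 1) * (r (n - 1) * (x (n - 1) + y (n - 1)))\<bar> \<le> lam ^ n * (\<bar>r (n - 1)\<bar> * (2 * L))"
      proof -
        have "\<bar>x (n - 1) + y (n - 1)\<bar> \<le> 2 * L" using xL[of "n - 1"] yL[of "n - 1"] by linarith
        then have h: "\<bar>r (n - 1)\<bar> * \<bar>x (n - 1) + y (n - 1)\<bar> \<le> \<bar>r (n - 1)\<bar> * (2 * L)" by (rule mult_left_mono) (rule abs_ge_zero)
        show ?thesis unfolding abs_mult abs_of_pos[OF pos]
          by (rule mult_mono[OF n1 h less_imp_le[OF pos] mult_nonneg_nonneg[OF abs_ge_zero abs_ge_zero]])
      qed
      moreover have e2: "\<bar>lam ^ n * (r n * x (n + 1) + y n * r (n + 1))\<bar> \<le> lam ^ n * (\<bar>r n\<bar> * L + L * \<bar>r (n + 1)\<bar>)"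
      proof -
        have "\<bar>r n * x (n + 1)\<bar> \<le> \<bar>r n\<bar> * L" unfolding abs_mult by (rule mult_left_mono[OF xL abs_ge_zero])
        moreover have "\<bar>y n * r (n + 1)\<bar> \<le> L * \<bar>r (n + 1)\<bar>" unfolding abs_mult by (rule mult_right_mono[OF yL abs_ge_zero])
        ultimately have "\<bar>r n * x (n + 1) + y n * r (n + 1)\<bar> \<le> \<bar>r n\<bar> * L + L * \<bar>r (n + 1)\<bar>"
          by (rule order_trans[OF abs_triangle_ineq add_mono])
        then show ?thesis unfolding abs_mult abs_of_pos[OF pos] by (rule mult_left_mono) (rule less_imp_le[OF pos])
      qed
      moreover have "lam ^ n * (\<bar>r (n - 1)\<bar> * (2 * L)) + lam ^ n * (\<bar>r n\<bar> * L + L * \<bar>r (n + 1)\<bar>) = lam ^ n * L * (2 * \<bar>r (n - 1)\<bar> + \<bar>r n\<bar> + \<bar>r (n + 1)\<bar>)"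
        by (simp only: distrib_left mult_ac)
      ultimately show ?thesis using order_trans[OF abs_triangle_ineq4 add_mono[OF e1 e2]] by simp
    qed
    have B: "2 * (r n * (B_op lam x x n - B_op lam y y n)) * w n \<le> \<epsilon> * (2 * (r (n - 1))\<^sup>2 + (r n)\<^sup>2 + (r (n + 1))\<^sup>2) + 4 * (L\<^sup>2 / \<epsilon>) * ((r n)\<^sup>2 * w n)"
    proof -
      have "r n * (B_op lam x x n - B_op lam y y n) \<le> \<bar>r n\<bar> * (lam ^ n * L * (2 * \<bar>r (n - 1)\<bar> + \<bar>r n\<bar> + \<bar>r (n + 1)\<bar>))"
        by (rule order_trans[OF abs_ge_self]) (simp only: abs_mult mult_left_mono[OF Bd abs_ge_zero])
      then have "2 * (r n * (B_op lam x x n - B_op lam y y n)) * w n \<le> 2 * (\<bar>r n\<bar> * (lam ^ n * L * (2 * \<bar>r (n - 1)\<bar> + \<bar>r n\<bar> + \<bar>r (n + 1)\<bar>))) * w n"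
        using wn by (intro mult_right_mono mult_left_mono) auto
      also have "\<dots> = 2 * (2 * L * (a * \<bar>r (n - 1)\<bar>)) + 2 * L * (a * \<bar>r n\<bar>) + 2 * L * (a * \<bar>r (n + 1)\<bar>)"
      proof -
        have "lam ^ n * w n = 1 / lam ^ n" using pos[of n] by (simp add: w_def mult_2 power_add)
        then have "\<bar>r n\<bar> * (lam ^ n * w n) = a" by (simp add: a_def)
        moreover have "2 * (\<bar>r n\<bar> * (lam ^ n * L * (2 * \<bar>r (n - 1)\<bar> + \<bar>r n\<bar> + \<bar>r (n + 1)\<bar>))) * w n =
           2 * L * ((\<bar>r n\<bar> * (lam ^ n * w n)) * (2 * \<bar>r (n - 1)\<bar> + \<bar>r n\<bar> + \<bar>r (n + 1)\<bar>))" by simp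
        ultimately show ?thesis by (simp add: algebra_simps)
      qed
      also have "\<dots> \<le> 2 * (\<epsilon> * \<bar>r (n - 1)\<bar>\<^sup>2 + L\<^sup>2 / \<epsilon> * a\<^sup>2) + (\<epsilon> * \<bar>r n\<bar>\<^sup>2 + L\<^sup>2 / \<epsilon> * a\<^sup>2) + (\<epsilon> * \<bar>r (n + 1)\<bar>\<^sup>2 + L\<^sup>2 / \<epsilon> * a\<^sup>2)"
        by (intro add_mono mult_left_mono amgm) simp
      also have "\<dots> = \<epsilon> * (2 * (r (n - 1))\<^sup>2 + (r n)\<^sup>2 + (r (n + 1))\<^sup>2) + 4 * (L\<^sup>2 / \<epsilon>) * a\<^sup>2" by (simp add: algebra_simps)
      finally show ?thesis unfolding a2 .
    qed
    have S: "2 * (r n * (\<kappa> * (S_op lam x n - S_op lam y n))) * w n = - (2 * \<kappa> * (r n)\<^sup>2)"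
    proof -
      have "2 * (r n * (\<kappa> * (S_op lam x n - S_op lam y n))) * w n = - (2 * \<kappa> * (r n)\<^sup>2 * (w n * lam ^ (2 * n)))"
      proof -
        have "S_op lam x n - S_op lam y n = - (lam ^ (2 * n)) * r n" unfolding S_op_def r_def by (simp only: right_diff_distrib)
        moreover have "2 * (z * (\<kappa> * (- l * z))) * u = - (2 * \<kappa> * z\<^sup>2 * (u * l))" for z l u :: real by algebra
        ultimately show ?thesis by (simp only:)
      qed
      then show ?thesis by (simp only: wn(2) mult_1_right)
    qed
    have T: "2 * (r n * (\<nu> * (S_theta lam (theta N) x n - S_theta lam (theta N) y n))) * w n \<le> - (2 * \<nu> * (r n)\<^sup>2)"
    proof -
      define s where "s = (\<Sum>j = 1..<n. (theta N j)\<^sup>2 * lam ^ (2 * (n - j)))"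
      have s0: "0 \<le> s" unfolding s_def by (intro sum_nonneg mult_nonneg_nonneg zero_le_power2 less_imp_le[OF pos])
      have "2 * (r n * (\<nu> * (S_theta lam (theta N) x n - S_theta lam (theta N) y n))) * w n = - (2 * \<nu> * (r n)\<^sup>2 * (w n * lam ^ (2 * n))) - 2 * \<nu> * (r n)\<^sup>2 * (s * w n)"
      proof -
        have "S_theta lam (theta N) x n - S_theta lam (theta N) y n = - (lam ^ (2 * n) + s) * r n"
          unfolding S_theta_def r_def s_def by (simp only: right_diff_distrib)
        moreover have "2 * (z * (\<nu> * (- (l + v) * z))) * u = - (2 * \<nu> * z\<^sup>2 * (u * l)) - 2 * \<nu> * z\<^sup>2 * (v * u)" for z l u v :: real by algebra
        ultimately show ?thesis by (simp only:)
      qed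
      moreover have "0 \<le> 2 * \<nu> * (r n)\<^sup>2 * (s * w n)"
        by (intro mult_nonneg_nonneg zero_le_power2 s0 less_imp_le[OF \<nu>] less_imp_le[OF wn(1)]) simp
      moreover have "u \<le> - v" if "u = - v - z" "0 \<le> z" for u v z :: real using that by simp
      ultimately show ?thesis by (simp only: wn(2) mult_1_right)
    qed
    have Nn: "(\<Sum>c\<in>grid n N. (coef lam \<nu> N c)\<^sup>2 * (noise_integrand n c x - noise_integrand n c y)\<^sup>2) * w n \<le>
       2 * \<nu> / real N * ((\<Sum>j=1..N. (r (n + j))\<^sup>2) + (\<Sum>i=1..<n. lam ^ (2 * i) * (r i)\<^sup>2) / lam ^ (2 * n))"
    proof -
      have "noise_integrand n c x - noise_integrand n c y = noise_integrand n c r" if "c \<in> grid n N" for c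
      proof -
        have "c \<in> labels" using that by (auto simp: grid_def labels_def)
        then show ?thesis by (simp add: noise_integrand_eq r_def)
      qed
      then have "(\<Sum>c\<in>grid n N. (coef lam \<nu> N c)\<^sup>2 * (noise_integrand n c x - noise_integrand n c y)\<^sup>2) = (\<Sum>c\<in>grid n N. (coef lam \<nu> N c)\<^sup>2 * (noise_integrand n c r)\<^sup>2)"
        by (intro sum.cong refl) (simp only:)
      also have "\<dots> \<le> 2 * \<nu> / real N * (lam ^ (2 * n) * (\<Sum>j=1..N. (r (n + j))\<^sup>2) + (\<Sum>i=1..<n. lam ^ (2 * i) * (r i)\<^sup>2))"
        by (rule noise_energy_le) (use n \<nu> lam in auto)
      finally have "(\<Sum>c\<in>grid n N. (coef lam \<nu> N c)\<^sup>2 * (noise_integrand n c x - noise_integrand n c y)\<^sup>2) * w n \<le>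
         2 * \<nu> / real N * (lam ^ (2 * n) * (\<Sum>j=1..N. (r (n + j))\<^sup>2) + (\<Sum>i=1..<n. lam ^ (2 * i) * (r i)\<^sup>2)) * w n"
        by (rule mult_right_mono) (rule less_imp_le[OF wn(1)])
      also have "\<dots> = 2 * \<nu> / real N * ((w n * lam ^ (2 * n)) * (\<Sum>j=1..N. (r (n + j))\<^sup>2) + (\<Sum>i=1..<n. lam ^ (2 * i) * (r i)\<^sup>2) * w n)"
      proof -
        have "v * (l * A + B) * u = v * ((u * l) * A + B * u)" for v l A B u :: real by algebra
        then show ?thesis .
      qed
      also have "(w n * lam ^ (2 * n)) * (\<Sum>j=1..N. (r (n + j))\<^sup>2) = (\<Sum>j=1..N. (r (n + j))\<^sup>2)" unfolding wn(2) by simp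
      also have "(\<Sum>i=1..<n. lam ^ (2 * i) * (r i)\<^sup>2) * w n = (\<Sum>i=1..<n. lam ^ (2 * i) * (r i)\<^sup>2) / lam ^ (2 * n)" unfolding w_def by simp
      finally show ?thesis .
    qed
    have dr: "drift lam \<kappa> \<nu> (theta N) x n - drift lam \<kappa> \<nu> (theta N) y n = (B_op lam x x n - B_op lam y y n)
       + \<kappa> * (S_op lam x n - S_op lam y n) + \<nu> * (S_theta lam (theta N) x n - S_theta lam (theta N) y n)"
      by (simp add: drift_def right_diff_distrib)
    have "gain_diff lam \<kappa> \<nu> N n x y * w n = 2 * (r n * (B_op lam x x n - B_op lam y y n)) * w n + 2 * (r n * (\<kappa> * (S_op lam x n - S_op lam y n))) * w n
       + 2 * (r n * (\<nu> * (S_theta lam (theta N) x n - S_theta lam (theta N) y n))) * w n + (\<Sum>c\<in>grid n N. (coef lam \<nu> N c)\<^sup>2 * (noise_integrand n c x - noise_integrand n c y)\<^sup>2) * w n"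
      unfolding gain_diff_def dr r_def[symmetric] by (simp only: distrib_left distrib_right)
    moreover have "b + s + t + q \<le> u + v - (k + l) * z + p"
      if "b \<le> u + v" "s = - (k * z)" "t \<le> - (l * z)" "q \<le> p" for b s t q u v k l z p :: real
      using that by (simp add: distrib_right)
    note this[OF B S T Nn]
    ultimately show ?thesis by (simp only:)
  qed
  have tot: "(\<Sum>k=1..m+N. (r k)\<^sup>2) = R + Q"
  proof -
    have "{1..m+N} = {1..m} \<union> {m+1..m+N}" by auto
    then show ?thesis unfolding R_def Q_def by (simp add: sum.union_disjoint)
  qed
  have s1: "(\<Sum>n=1..m. (r (n - 1))\<^sup>2) \<le> R" unfolding R_def by (rule sum_pred_le) (use r0 in auto)
  have s2: "(\<Sum>n=1..m. (r (n + 1))\<^sup>2) \<le> R + Q"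
    unfolding tot[symmetric] by (rule sum_shift_le[where f="\<lambda>k. (r k)\<^sup>2"]) (use N in auto)
  \<comment> \<open>After exchanging the sums, each shift by \<open>j\<close> stays within
    \<open>m + N\<close>. The return is thus at most \<open>2 * \<nu> * (R + Q)\<close>, and its
    main part cancels against the loss \<open>2 * \<nu> * R\<close> from the Ito correction.\<close>
  have s3: "(\<Sum>n=1..m. \<Sum>j=1..N. (r (n + j))\<^sup>2) \<le> real N * (R + Q)"
  proof -
    have "(\<Sum>n=1..m. \<Sum>j=1..N. (r (n + j))\<^sup>2) = (\<Sum>j=1..N. \<Sum>n=1..m. (r (n + j))\<^sup>2)" by (rule sum.swap)
    also have "\<dots> \<le> (\<Sum>j=1..N. R + Q)"
      unfolding tot[symmetric] by (intro sum_mono sum_shift_le[where f="\<lambda>k. (r k)\<^sup>2"]) auto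
    finally show ?thesis by simp
  qed
  have s4: "(\<Sum>n=1..m. (\<Sum>i=1..<n. lam ^ (2 * i) * (r i)\<^sup>2) / lam ^ (2 * n)) \<le> 1 / (lam\<^sup>2 - 1) * R"
  proof -
    have "0 \<le> 1 / (lam\<^sup>2 - 1) * ((\<Sum>i=1..m. lam ^ (2 * i) * (r i)\<^sup>2) / lam ^ (2 * m))"
      using l2 pos by (intro mult_nonneg_nonneg divide_nonneg_nonneg sum_nonneg) (auto intro: less_imp_le)
    then show ?thesis using weighted_prefix_sum[OF lam, of "\<lambda>i. (r i)\<^sup>2" m] unfolding R_def by linarith
  qed
  have "(\<Sum>n=1..m. gain_diff lam \<kappa> \<nu> N n x y / lam ^ (2 * n)) = (\<Sum>n=1..m. gain_diff lam \<kappa> \<nu> N n x y * w n)"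
    by (simp add: w_def)
  also have "\<dots> \<le> (\<Sum>n=1..m. \<epsilon> * (2 * (r (n - 1))\<^sup>2 + (r n)\<^sup>2 + (r (n + 1))\<^sup>2) + 4 * (L\<^sup>2 / \<epsilon>) * ((r n)\<^sup>2 * w n) - (2 * \<kappa> + 2 * \<nu>) * (r n)\<^sup>2
      + 2 * \<nu> / real N * ((\<Sum>j=1..N. (r (n + j))\<^sup>2) + (\<Sum>i=1..<n. lam ^ (2 * i) * (r i)\<^sup>2) / lam ^ (2 * n)))"
    by (rule sum_mono) (rule mode)
  also have "\<dots> = \<epsilon> * (2 * (\<Sum>n=1..m. (r (n - 1))\<^sup>2) + R + (\<Sum>n=1..m. (r (n + 1))\<^sup>2)) + 4 * (L\<^sup>2 / \<epsilon>) * (\<Sum>n=1..m. (r n)\<^sup>2 * w n) - (2 * \<kappa> + 2 * \<nu>) * R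
      + 2 * \<nu> / real N * ((\<Sum>n=1..m. \<Sum>j=1..N. (r (n + j))\<^sup>2) + (\<Sum>n=1..m. (\<Sum>i=1..<n. lam ^ (2 * i) * (r i)\<^sup>2) / lam ^ (2 * n)))"
    unfolding R_def by (simp only: sum.distrib sum_subtractf sum_distrib_left[symmetric])
  also have "\<dots> \<le> \<epsilon> * (2 * R + R + (R + Q)) + 4 * (L\<^sup>2 / \<epsilon>) * (\<Sum>n=1..m. (r n)\<^sup>2 * w n) - (2 * \<kappa> + 2 * \<nu>) * R
      + 2 * \<nu> / real N * (real N * (R + Q) + 1 / (lam\<^sup>2 - 1) * R)"
    using s1 s2 s3 s4 \<epsilon> \<nu> by (intro add_mono diff_right_mono mult_left_mono order_refl) auto
  also have "\<dots> = 4 * (L\<^sup>2 / \<epsilon>) * (\<Sum>n=1..m. (r n)\<^sup>2 * w n) + (\<epsilon> + 2 * \<nu>) * Q + (4 * \<epsilon> - 2 * \<kappa> + 2 * \<nu> / real N * (1 / (lam\<^sup>2 - 1))) * R"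
  proof -
    have "2 * \<nu> / real N * (real N * (R + Q) + 1 / (lam\<^sup>2 - 1) * R) = 2 * \<nu> * (R + Q) + 2 * \<nu> / real N * (1 / (lam\<^sup>2 - 1)) * R"
      using N(1) by (simp add: distrib_left)
    then show ?thesis by (simp add: algebra_simps)
  qed
  also have "\<dots> \<le> 4 * (L\<^sup>2 / \<epsilon>) * (\<Sum>n=1..m. (r n)\<^sup>2 * w n) + (2 * \<nu> + \<kappa>) * Q + 0 * R"
  proof (rule add_mono[OF add_mono[OF order_refl mult_right_mono] mult_right_mono])
    show "0 \<le> R" "0 \<le> Q" by (simp_all add: R_def Q_def sum_nonneg)
    show "\<epsilon> + 2 * \<nu> \<le> 2 * \<nu> + \<kappa>" using \<kappa> by (simp add: \<epsilon>_def)
    have "2 * \<nu> / real N * (1 / (lam\<^sup>2 - 1)) = (2 * \<nu> / (lam\<^sup>2 - 1)) / real N" by simp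
    also have "\<dots> \<le> \<kappa> * real N / real N" using N(2) by (rule divide_right_mono) simp
    also have "\<dots> = \<kappa>" using N(1) by simp
    finally show "4 * \<epsilon> - 2 * \<kappa> + 2 * \<nu> / real N * (1 / (lam\<^sup>2 - 1)) \<le> 0" by (simp add: \<epsilon>_def)
  qed
  finally show ?thesis unfolding r_def w_def Q_def \<epsilon>_def by simp
qed

end

section \<open>Decay of the second moment and pathwise uniqueness\<close>

text \<open>The weighted supremum \<rho> of \<open>exp (- (2 * c * t)) * f t\<close> satisfies
  \<open>\<rho> \<le> b + \<rho> / 2\<close>, an argument that suits functions which are merely
  bounded and integrable. The bound \<open>B\<close> makes \<rho> finite without appearing in the
  conclusion, so it may grow with a truncation index.\<close>

lemma gronwall_bound:
  fixes f :: "real \<Rightarrow> real"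
  assumes T: "0 \<le> T" and i: "set_integrable lborel {0..T} f"
    and f: "\<And>t. t \<in> {0..T} \<Longrightarrow> 0 \<le> f t" "\<And>t. t \<in> {0..T} \<Longrightarrow> f t \<le> B"
    and c: "0 < c" and b: "0 \<le> b"
    and le: "\<And>t. t \<in> {0..T} \<Longrightarrow> f t \<le> b + c * (LBINT r:{0..t}. f r)"
    and t: "t \<in> {0..T}"
  shows "f t \<le> 2 * b * exp (2 * c * T)"
proof -
  define \<rho> where "\<rho> = (SUP t\<in>{0..T}. exp (- (2 * c * t)) * f t)"
  have bdd: "bdd_above ((\<lambda>t. exp (- (2 * c * t)) * f t) ` {0..T})"
  proof (rule bdd_aboveI2)
    fix t assume t: "t \<in> {0..T}"
    have "exp (- (2 * c * t)) \<le> 1" using t c by simp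
    then show "exp (- (2 * c * t)) * f t \<le> 1 * B" using f[OF t] by (intro mult_mono) auto
  qed
  have up: "exp (- (2 * c * t)) * f t \<le> \<rho>" if "t \<in> {0..T}" for t
    unfolding \<rho>_def by (rule cSUP_upper[OF that bdd])
  have fup: "f t \<le> \<rho> * exp (2 * c * t)" if "t \<in> {0..T}" for t
  proof -
    have "exp (2 * c * t) * (exp (- (2 * c * t)) * f t) \<le> exp (2 * c * t) * \<rho>" using up[OF that] by (intro mult_left_mono) auto
    moreover have "exp (2 * c * t) * (exp (- (2 * c * t)) * f t) = f t"
      by (simp only: mult.assoc[symmetric] exp_minus_inverse mult_1_left)
    ultimately show ?thesis by (simp only: mult.commute[of \<rho>])
  qed
  have \<rho>0: "0 \<le> \<rho>"
  proof -
    have "0 \<in> {0..T}" using T by simp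
    from up[OF this] f(1)[OF this] show ?thesis by simp
  qed
  have int: "(LBINT r:{0..t}. f r) \<le> \<rho> * (exp (2 * c * t) / (2 * c))" if t: "t \<in> {0..T}" for t
  proof -
    have h: "((\<lambda>r. \<rho> * exp (2 * c * r)) has_integral (\<rho> * exp (2 * c * t) / (2 * c) - \<rho> * exp (2 * c * 0) / (2 * c))) {0..t}"
      by (rule fundamental_theorem_of_calculus)
         (use t c in \<open>auto intro!: derivative_eq_intros simp: has_real_derivative_iff_has_vector_derivative[symmetric]\<close>)
    have ie: "set_integrable lborel {0..t} (\<lambda>r. \<rho> * exp (2 * c * r))"
      by (rule borel_integrable_atLeastAtMost') (intro continuous_intros)
    have "(LBINT r:{0..t}. f r) \<le> (LBINT r:{0..t}. \<rho> * exp (2 * c * r))"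
      by (rule set_integral_mono[OF set_integrable_subset[OF i] ie]) (use t fup in auto)
    also have "\<dots> = \<rho> * exp (2 * c * t) / (2 * c) - \<rho> * exp (2 * c * 0) / (2 * c)"
      by (rule trans[OF set_borel_integral_eq_integral(2)[OF ie] integral_unique[OF h]])
    also have "\<dots> \<le> \<rho> * (exp (2 * c * t) / (2 * c))" using \<rho>0 c by simp
    finally show ?thesis .
  qed
  have "\<rho> \<le> b + \<rho> / 2"
    unfolding \<rho>_def
  proof (rule cSUP_least, fold \<rho>_def)
    show "{0..T} \<noteq> {}" using T by simp
    fix t assume t: "t \<in> {0..T}"
    have "f t \<le> b + c * (\<rho> * (exp (2 * c * t) / (2 * c)))" using le[OF t] mult_left_mono[OF int[OF t], of c] c by simp
    also have "\<dots> = b + \<rho> / 2 * exp (2 * c * t)" using c by simp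
    finally have "exp (- (2 * c * t)) * f t \<le> exp (- (2 * c * t)) * (b + \<rho> / 2 * exp (2 * c * t))" by (intro mult_left_mono) auto
    also have "\<dots> = exp (- (2 * c * t)) * b + \<rho> / 2"
    proof -
      have "exp (- (2 * c * t)) * exp (2 * c * t) = 1" by (simp only: mult.commute[of "exp (- (2 * c * t))"] exp_minus_inverse)
      moreover have "u * (b + v * w) = u * b + v * (u * w)" for u v w :: real by algebra
      ultimately show ?thesis by (simp only: mult_1_right)
    qed
    also have "\<dots> \<le> 1 * b + \<rho> / 2" using t c b by (intro add_right_mono mult_right_mono) auto
    finally show "exp (- (2 * c * t)) * f t \<le> b + \<rho> / 2" by simp
  qed
  then have "\<rho> \<le> 2 * b" by simp
  then have "\<rho> * exp (2 * c * t) \<le> 2 * b * exp (2 * c * T)" using t c b by (intro mult_mono) auto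
  then show ?thesis using fup[OF t] by simp
qed

section \<open>Moment identities, decay and uniqueness for regular versions\<close>

context driven_space begin

lemma regular_versionD:
  assumes "regular_version lam \<kappa> \<nu> N L x0 X"
  shows "\<omega> \<in> space M \<Longrightarrow> X r \<omega> \<in> ell2" "\<omega> \<in> space M \<Longrightarrow> ell2_norm (X r \<omega>) \<le> L"
    "bounded_process (\<lambda>r \<omega>. X r \<omega> n)" "bounded_process (\<lambda>r \<omega>. (ell2_norm (X r \<omega>))\<^sup>2)"
    "AE \<omega> in M. X 0 \<omega> = x0"
    "1 \<le> n \<Longrightarrow> \<exists>I. evolves (\<lambda>r \<omega>. X r \<omega> n) (\<lambda>r \<omega>. drift lam \<kappa> \<nu> (theta N) (X r \<omega>) n)
        (grid n N) (coef lam \<nu> N) (\<lambda>c r \<omega>. noise_integrand n c (X r \<omega>)) I"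
    "\<omega> \<in> space M \<Longrightarrow> 0 \<le> s \<Longrightarrow> s \<le> t \<Longrightarrow> (ell2_norm (X t \<omega>))\<^sup>2 - (ell2_norm (X s \<omega>))\<^sup>2 \<le> - (2 * \<kappa>) * (LBINT r:{s..t}.
           lam ^ (2 * (m + 1)) * (ell2_norm (X r \<omega>))\<^sup>2 - (\<Sum>n=1..m. (lam ^ (2 * (m + 1)) - lam ^ (2 * n)) * (X r \<omega> n)\<^sup>2))"
proof -
  note R = assms[unfolded regular_version_def]
  show "\<omega> \<in> space M \<Longrightarrow> X r \<omega> \<in> ell2" "\<omega> \<in> space M \<Longrightarrow> ell2_norm (X r \<omega>) \<le> L"
    using R[THEN conjunct1, rule_format, of \<omega> r] by simp_all
  show "bounded_process (\<lambda>r \<omega>. X r \<omega> n)" by (rule R[THEN conjunct2, THEN conjunct1, rule_format])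
  show "bounded_process (\<lambda>r \<omega>. (ell2_norm (X r \<omega>))\<^sup>2)" by (rule R[THEN conjunct2, THEN conjunct2, THEN conjunct1])
  show "AE \<omega> in M. X 0 \<omega> = x0" by (rule R[THEN conjunct2, THEN conjunct2, THEN conjunct2, THEN conjunct1])
  show "1 \<le> n \<Longrightarrow> \<exists>I. evolves (\<lambda>r \<omega>. X r \<omega> n) (\<lambda>r \<omega>. drift lam \<kappa> \<nu> (theta N) (X r \<omega>) n)
        (grid n N) (coef lam \<nu> N) (\<lambda>c r \<omega>. noise_integrand n c (X r \<omega>)) I"
    by (rule R[THEN conjunct2, THEN conjunct2, THEN conjunct2, THEN conjunct2, THEN conjunct1, rule_format])
  show "\<omega> \<in> space M \<Longrightarrow> 0 \<le> s \<Longrightarrow> s \<le> t \<Longrightarrow> (ell2_norm (X t \<omega>))\<^sup>2 - (ell2_norm (X s \<omega>))\<^sup>2 \<le> - (2 * \<kappa>) * (LBINT r:{s..t}.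
           lam ^ (2 * (m + 1)) * (ell2_norm (X r \<omega>))\<^sup>2 - (\<Sum>n=1..m. (lam ^ (2 * (m + 1)) - lam ^ (2 * n)) * (X r \<omega> n)\<^sup>2))"
    by (rule R[THEN conjunct2, THEN conjunct2, THEN conjunct2, THEN conjunct2, THEN conjunct2, rule_format]) simp_all
qed

lemma gain_bounded_process:
  assumes X: "regular_version lam \<kappa> \<nu> N L x0 X"
  shows "bounded_process (\<lambda>r \<omega>. gain lam \<kappa> \<nu> N n (X r \<omega>))"
proof -
  have "bounded_process (\<lambda>r \<omega>. noise_integrand n c (X r \<omega>))" if "c \<in> grid n N" for c
    by (rule noise_integrand_bounded_process[OF regular_versionD(3)[OF X]]) (use that in \<open>auto simp: grid_def labels_def\<close>)
  then show ?thesis unfolding gain_def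
    by (intro bounded_process_add bounded_process_cmult bounded_process_mult bounded_process_sum bounded_process_power2
        drift_bounded_process regular_versionD(3)[OF X])
qed

lemma gain_diff_bounded_process:
  assumes X: "regular_version lam \<kappa> \<nu> N L x0 X" and Y: "regular_version lam \<kappa> \<nu> N L x0 Y"
  shows "bounded_process (\<lambda>r \<omega>. gain_diff lam \<kappa> \<nu> N n (X r \<omega>) (Y r \<omega>))"
proof -
  have "bounded_process (\<lambda>r \<omega>. noise_integrand n c (X r \<omega>))" "bounded_process (\<lambda>r \<omega>. noise_integrand n c (Y r \<omega>))" if "c \<in> grid n N" for c
    by (rule noise_integrand_bounded_process[OF regular_versionD(3)[OF X]] noise_integrand_bounded_process[OF regular_versionD(3)[OF Y]];
        use that in \<open>auto simp: grid_def labels_def\<close>)+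
  then show ?thesis unfolding gain_diff_def
    by (intro bounded_process_add bounded_process_cmult bounded_process_mult bounded_process_diff bounded_process_sum bounded_process_power2
        drift_bounded_process regular_versionD(3)[OF X] regular_versionD(3)[OF Y])
qed

lemma second_moment:
  assumes X: "regular_version lam \<kappa> \<nu> N L x0 X" and n: "1 \<le> n" and st: "0 \<le> s" "s \<le> t"
  shows "expectation (\<lambda>\<omega>. (X t \<omega> n)\<^sup>2) - expectation (\<lambda>\<omega>. (X s \<omega> n)\<^sup>2) = time_integral s t (\<lambda>r \<omega>. gain lam \<kappa> \<nu> N n (X r \<omega>))"
proof -
  obtain I where I: "evolves (\<lambda>r \<omega>. X r \<omega> n) (\<lambda>r \<omega>. drift lam \<kappa> \<nu> (theta N) (X r \<omega>) n)
        (grid n N) (coef lam \<nu> N) (\<lambda>c r \<omega>. noise_integrand n c (X r \<omega>)) I" using regular_versionD(6)[OF X n] by blast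
  show ?thesis using evolves_product[OF I I st] by (simp add: power2_eq_square gain_def)
qed

text \<open>The square is expanded and each of the three products evolves by
  \<open>evolves_product\<close>, for the two solutions share motions and coefficients. The common
  initial value removes the starting term.\<close>

lemma difference_moment:
  assumes X: "regular_version lam \<kappa> \<nu> N L x0 X" and Y: "regular_version lam \<kappa> \<nu> N L x0 Y" and n: "1 \<le> n" and t: "0 \<le> t"
  shows "expectation (\<lambda>\<omega>. (X t \<omega> n - Y t \<omega> n)\<^sup>2) = time_integral 0 t (\<lambda>r \<omega>. gain_diff lam \<kappa> \<nu> N n (X r \<omega>) (Y r \<omega>))"
proof -
  let ?b = "\<lambda>X r \<omega>. drift lam \<kappa> \<nu> (theta N) (X r \<omega>) n"
  let ?q = "\<lambda>X Y r \<omega>. \<Sum>c\<in>grid n N. (coef lam \<nu> N c)\<^sup>2 * (noise_integrand n c (X r \<omega>) * noise_integrand n c (Y r \<omega>))"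
  let ?g = "\<lambda>X Y r \<omega>. X r \<omega> n * ?b Y r \<omega> + Y r \<omega> n * ?b X r \<omega> + ?q X Y r \<omega>"
  obtain I where I: "evolves (\<lambda>r \<omega>. X r \<omega> n) (?b X) (grid n N) (coef lam \<nu> N) (\<lambda>c r \<omega>. noise_integrand n c (X r \<omega>)) I"
    using regular_versionD(6)[OF X n] by blast
  obtain J where J: "evolves (\<lambda>r \<omega>. Y r \<omega> n) (?b Y) (grid n N) (coef lam \<nu> N) (\<lambda>c r \<omega>. noise_integrand n c (Y r \<omega>)) J"
    using regular_versionD(6)[OF Y n] by blast
  note b = regular_versionD(3)[OF X] regular_versionD(3)[OF Y]
  have fb: "bounded_process (\<lambda>r \<omega>. noise_integrand n c (X r \<omega>))" "bounded_process (\<lambda>r \<omega>. noise_integrand n c (Y r \<omega>))" if "c \<in> grid n N" for c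
    by (rule noise_integrand_bounded_process[OF b(1)] noise_integrand_bounded_process[OF b(2)]; use that in \<open>auto simp: grid_def labels_def\<close>)+
  have g: "bounded_process (?g X X)" "bounded_process (?g X Y)" "bounded_process (?g Y Y)"
    by (intro bounded_process_add bounded_process_mult bounded_process_sum bounded_process_const drift_bounded_process b fb; assumption)+
  have i: "integrable M (\<lambda>\<omega>. X u \<omega> n * X u \<omega> n)" "integrable M (\<lambda>\<omega>. X u \<omega> n * Y u \<omega> n)" "integrable M (\<lambda>\<omega>. Y u \<omega> n * Y u \<omega> n)" for u
    by (rule bounded_process_integrable[OF bounded_process_mult]; rule b)+
  have ex: "expectation (\<lambda>\<omega>. (X u \<omega> n - Y u \<omega> n)\<^sup>2) = expectation (\<lambda>\<omega>. X u \<omega> n * X u \<omega> n) - 2 * expectation (\<lambda>\<omega>. X u \<omega> n * Y u \<omega> n) + expectation (\<lambda>\<omega>. Y u \<omega> n * Y u \<omega> n)" for u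
  proof -
    have "(\<lambda>\<omega>. (X u \<omega> n - Y u \<omega> n)\<^sup>2) = (\<lambda>\<omega>. X u \<omega> n * X u \<omega> n - 2 * (X u \<omega> n * Y u \<omega> n) + Y u \<omega> n * Y u \<omega> n)"
      by (intro ext) algebra
    then show ?thesis using i by simp
  qed
  have "AE \<omega> in M. (X 0 \<omega> n - Y 0 \<omega> n)\<^sup>2 = 0"
    using regular_versionD(5)[OF X] regular_versionD(5)[OF Y] by eventually_elim simp
  then have z: "expectation (\<lambda>\<omega>. (X 0 \<omega> n - Y 0 \<omega> n)\<^sup>2) = 0" by (rule integral_eq_zero_AE)
  have "expectation (\<lambda>\<omega>. (X t \<omega> n - Y t \<omega> n)\<^sup>2) = expectation (\<lambda>\<omega>. (X t \<omega> n - Y t \<omega> n)\<^sup>2) - expectation (\<lambda>\<omega>. (X 0 \<omega> n - Y 0 \<omega> n)\<^sup>2)"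
    using z by simp
  also have "\<dots> = time_integral 0 t (?g X X) - 2 * time_integral 0 t (?g X Y) + time_integral 0 t (?g Y Y)"
    unfolding ex using evolves_product[OF I I order_refl t] evolves_product[OF I J order_refl t] evolves_product[OF J J order_refl t]
    by linarith
  also have "\<dots> = time_integral 0 t (\<lambda>r \<omega>. ?g X X r \<omega> - 2 * ?g X Y r \<omega> + ?g Y Y r \<omega>)"
    by (simp only: time_integral_add time_integral_diff time_integral_cmult g bounded_process_add bounded_process_diff bounded_process_cmult)
  also have "(\<lambda>r \<omega>. ?g X X r \<omega> - 2 * ?g X Y r \<omega> + ?g Y Y r \<omega>) = (\<lambda>r \<omega>. gain_diff lam \<kappa> \<nu> N n (X r \<omega>) (Y r \<omega>))"
  proof (intro ext)
    fix r \<omega>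
    have "?q X X r \<omega> - 2 * ?q X Y r \<omega> + ?q Y Y r \<omega> = (\<Sum>c\<in>grid n N. (coef lam \<nu> N c)\<^sup>2 * (noise_integrand n c (X r \<omega>) - noise_integrand n c (Y r \<omega>))\<^sup>2)"
      unfolding sum_distrib_left sum_subtractf[symmetric] sum.distrib[symmetric]
      by (rule sum.cong[OF refl]) algebra
    moreover have "(x * bx + x * bx + qa) - 2 * (x * b' + y * bx + qb) + (y * b' + y * b' + qc) = 2 * ((x - y) * (bx - b')) + (qa - 2 * qb + qc)"
      for x y bx b' qa qb qc :: real by algebra
    ultimately show "?g X X r \<omega> - 2 * ?g X Y r \<omega> + ?g Y Y r \<omega> = gain_diff lam \<kappa> \<nu> N n (X r \<omega>) (Y r \<omega>)"
      unfolding gain_diff_def by (simp only:)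
  qed
  finally show ?thesis .
qed

text \<open>The energy inequality under the expectation and the second moments of the low modes
  combine into an integral inequality for \<open>G\<close>. It makes \<open>G\<close> decrease, so
  the integral over a unit interval is at least the final value, and each unit of time brings a
  factor \<open>1 / (1 + K)\<close>. The 2 accounts for the doubled weight of the low modes at time
  0.\<close>

lemma moment_decay:
  assumes X: "regular_version lam \<kappa> \<nu> N L x0 X" and x0: "x0 \<in> ell2"
    and lam: "lam > 1" and \<kappa>: "\<kappa> > 0" and \<nu>: "\<nu> > 0" and N: "1 \<le> N" and K: "0 \<le> K"
    and c1: "K + 1 \<le> 2 * \<kappa> * lam ^ (2 * (m + 1))"
    and c2: "4 * lam ^ m * L + 1 + 2 * K \<le> 2 * \<nu> * lam\<^sup>2"
    and c3: "4 * \<nu> * real m * lam ^ (2 * m) \<le> real N"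
  shows "expectation (\<lambda>\<omega>. (ell2_norm (X (real k) \<omega>))\<^sup>2) \<le> 2 * (ell2_norm x0)\<^sup>2 / (1 + K) ^ k"
proof -
  let ?U = "\<lambda>r \<omega>. (ell2_norm (X r \<omega>))\<^sup>2"
  let ?V = "\<lambda>r \<omega>. ?U r \<omega> + (\<Sum>n=1..m. (X r \<omega> n)\<^sup>2)"
  let ?D = "\<lambda>r \<omega>. lam ^ (2 * (m + 1)) * ?U r \<omega> - (\<Sum>n=1..m. (lam ^ (2 * (m + 1)) - lam ^ (2 * n)) * (X r \<omega> n)\<^sup>2)"
  let ?g = "\<lambda>r \<omega>. \<Sum>n=1..m. gain lam \<kappa> \<nu> N n (X r \<omega>)"
  note bX = regular_versionD(3)[OF X] and bU = regular_versionD(4)[OF X]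
  have bV: "bounded_process ?V" by (intro bounded_process_add bounded_process_sum bounded_process_power2 bX bU)
  have bD: "bounded_process ?D" by (intro bounded_process_diff bounded_process_cmult bounded_process_sum bounded_process_power2 bX bU)
  have bg: "bounded_process ?g" by (intro bounded_process_sum gain_bounded_process[OF X])
  define G where "G t = expectation (?V t)" for t
  have Gsum: "G t = expectation (?U t) + (\<Sum>n=1..m. expectation (\<lambda>\<omega>. (X t \<omega> n)\<^sup>2))" for t
    unfolding G_def using bounded_process_integrable[OF bU] bounded_process_sq_integrable[OF bX] by simp
  have G0: "0 \<le> G t" for t unfolding G_def by (intro Bochner_Integration.integral_nonneg add_nonneg_nonneg sum_nonneg zero_le_power2)
  have step: "G t \<le> G s - K * (LBINT r:{s..t}. G r)" if st: "0 \<le> s" "s \<le> t" for s t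
  proof -
    have "expectation (?U t) - expectation (?U s) = expectation (\<lambda>\<omega>. ?U t \<omega> - ?U s \<omega>)"
      by (simp add: Bochner_Integration.integral_diff bounded_process_integrable[OF bU])
    also have "\<dots> \<le> expectation (\<lambda>\<omega>. - (2 * \<kappa>) * (LBINT r:{s..t}. ?D r \<omega>))"
    proof (rule integral_mono)
      show "integrable M (\<lambda>\<omega>. ?U t \<omega> - ?U s \<omega>)" by (intro Bochner_Integration.integrable_diff bounded_process_integrable[OF bU])
      show "integrable M (\<lambda>\<omega>. - (2 * \<kappa>) * (LBINT r:{s..t}. ?D r \<omega>))"
        by (intro integrable_mult_right bounded_process_integral_integrable[OF bD st(2)])
    qed (rule regular_versionD(7)[OF X _ st])
    also have "\<dots> = - (2 * \<kappa>) * time_integral s t ?D" unfolding time_integral_def by (rule integral_mult_right_zero)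
    finally have U: "expectation (?U t) - expectation (?U s) \<le> - (2 * \<kappa>) * time_integral s t ?D" .
    have "(\<Sum>n=1..m. expectation (\<lambda>\<omega>. (X t \<omega> n)\<^sup>2)) - (\<Sum>n=1..m. expectation (\<lambda>\<omega>. (X s \<omega> n)\<^sup>2)) = (\<Sum>n=1..m. time_integral s t (\<lambda>r \<omega>. gain lam \<kappa> \<nu> N n (X r \<omega>)))"
      unfolding sum_subtractf[symmetric] by (rule sum.cong[OF refl]) (use second_moment[OF X _ st] in simp)
    also have "\<dots> = time_integral s t ?g" by (rule time_integral_sum[symmetric]) (auto intro: gain_bounded_process[OF X])
    finally have "G t - G s \<le> - (2 * \<kappa>) * time_integral s t ?D + time_integral s t ?g" using U unfolding Gsum by linarith
    also have "\<dots> = time_integral s t (\<lambda>r \<omega>. - (2 * \<kappa>) * ?D r \<omega> + ?g r \<omega>)"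
      by (simp only: time_integral_add time_integral_cmult bounded_process_cmult bD bg)
    also have "\<dots> \<le> time_integral s t (\<lambda>r \<omega>. - K * ?V r \<omega>)"
    proof (rule time_integral_mono)
      show "bounded_process (\<lambda>r \<omega>. - (2 * \<kappa>) * ?D r \<omega> + ?g r \<omega>)" by (intro bounded_process_add bounded_process_cmult bD bg)
      show "bounded_process (\<lambda>r \<omega>. - K * ?V r \<omega>)" by (intro bounded_process_cmult bV)
      fix r \<omega> assume \<omega>: "\<omega> \<in> space M"
      show "- (2 * \<kappa>) * ?D r \<omega> + ?g r \<omega> \<le> - K * ?V r \<omega>"
        by (rule decay_inequality[OF regular_versionD(1)[OF X \<omega>] regular_versionD(2)[OF X \<omega>] lam \<kappa> \<nu> N c1 c2 c3])
    qed
    also have "\<dots> = - K * time_integral s t ?V" by (rule time_integral_cmult[OF bV])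
    also have "time_integral s t ?V = (LBINT r:{s..t}. G r)" unfolding G_def by (rule time_integral_fubini(1)[OF bV])
    finally show ?thesis by simp
  qed
  have Gint: "set_integrable lborel {s..t} G" for s t unfolding G_def by (rule time_integral_fubini(2)[OF bV])
  have mono: "G t \<le> G s" if st: "0 \<le> s" "s \<le> t" for s t
  proof -
    have "0 \<le> (LBINT r:{s..t}. G r)"
      unfolding set_lebesgue_integral_def by (intro Bochner_Integration.integral_nonneg) (simp add: G0)
    then have "0 \<le> K * (LBINT r:{s..t}. G r)" using K by simp
    then show ?thesis using step[OF st] by linarith
  qed
  have unit: "G (s + 1) \<le> G s / (1 + K)" if s: "0 \<le> s" for s
  proof -
    have "(LBINT r:{s..s+1}. G (s + 1)) \<le> (LBINT r:{s..s+1}. G r)"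
      by (rule set_integral_mono[OF _ Gint]) (use mono s in \<open>auto simp: set_integrable_def emeasure_lborel_Icc_eq\<close>)
    then have "G (s + 1) \<le> (LBINT r:{s..s+1}. G r)" by (simp add: set_lebesgue_integral_def)
    then have "K * G (s + 1) \<le> K * (LBINT r:{s..s+1}. G r)" using K by (rule mult_left_mono)
    then have "(1 + K) * G (s + 1) \<le> G s" using step[of s "s + 1"] s by (simp add: distrib_right)
    then show ?thesis using K by (simp add: le_divide_eq mult.commute)
  qed
  have geo: "G (real k) \<le> G 0 / (1 + K) ^ k" for k
  proof (induction k)
    case (Suc k)
    have "G (real (Suc k)) \<le> G (real k) / (1 + K)" using unit[of "real k"] by (simp add: add.commute)
    also have "\<dots> \<le> G 0 / (1 + K) ^ k / (1 + K)" using Suc K by (intro divide_right_mono) auto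
    finally show ?case by (simp add: mult.commute)
  qed simp
  have "G 0 = expectation (\<lambda>_. (ell2_norm x0)\<^sup>2 + (\<Sum>n=1..m. (x0 n)\<^sup>2))"
    unfolding G_def
  proof (rule integral_cong_AE[OF bounded_process_random_variable[OF bV]])
    show "AE \<omega> in M. ?V 0 \<omega> = (ell2_norm x0)\<^sup>2 + (\<Sum>n=1..m. (x0 n)\<^sup>2)"
      using regular_versionD(5)[OF X] by eventually_elim simp
  qed simp
  also have "\<dots> \<le> 2 * (ell2_norm x0)\<^sup>2" using ell2_sum_le[OF x0, of "{1..m}"] by (simp add: prob_space)
  finally have G00: "G 0 \<le> 2 * (ell2_norm x0)\<^sup>2" .
  have "expectation (?U (real k)) \<le> G (real k)"
    unfolding Gsum by (simp add: sum_nonneg)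
  also have "\<dots> \<le> G 0 / (1 + K) ^ k" by (rule geo)
  also have "\<dots> \<le> 2 * (ell2_norm x0)\<^sup>2 / (1 + K) ^ k" using G00 K by (intro divide_right_mono) auto
  finally show ?thesis .
qed

text \<open>The weighted sums up to \<open>m\<close> satisfy a Gronwall inequality whose
  inhomogeneity is the boundary term from the modes \<open>m + 1\<close> to \<open>m + N\<close>.
  The expected time integrals of the squared differences are summable over the modes, so this term
  tends to 0 while the Gronwall constants stay fixed.\<close>

lemma regular_version_unique:
  assumes X: "regular_version lam \<kappa> \<nu> N L x0 X" and Y: "regular_version lam \<kappa> \<nu> N L x0 Y"
    and lam: "lam > 1" and \<kappa>: "\<kappa> > 0" and \<nu>: "\<nu> > 0" and L: "L > 0" and N: "1 \<le> N" "2 * \<nu> / (lam\<^sup>2 - 1) \<le> \<kappa> * real N"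
    and T: "0 \<le> T"
  shows "AE \<omega> in M. X T \<omega> = Y T \<omega>"
proof -
  define R where "R n r \<omega> = (X r \<omega> n - Y r \<omega> n)\<^sup>2" for n r \<omega>
  have bR: "bounded_process (R n)" for n
    unfolding R_def[abs_def] by (intro bounded_process_power2 bounded_process_diff regular_versionD(3)[OF X] regular_versionD(3)[OF Y])
  have R0: "0 \<le> R n r \<omega>" for n r \<omega> by (simp add: R_def)
  define c where "c = 16 * L\<^sup>2 / \<kappa>"
  have c: "0 < c" using L \<kappa> by (simp add: c_def)
  define a where "a n = time_integral 0 T (R n)" for n
  have a0: "0 \<le> a n" for n unfolding a_def by (rule time_integral_nonneg[OF bR R0])
  have Rsum: "(\<Sum>n\<in>A. R n r \<omega>) \<le> 4 * L\<^sup>2" if "finite A" "\<omega> \<in> space M" for A r \<omega>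
  proof -
    note x = regular_versionD(1,2)[OF X that(2), of r] and y = regular_versionD(1,2)[OF Y that(2), of r]
    have "(\<Sum>n\<in>A. R n r \<omega>) \<le> (\<Sum>n\<in>A. 2 * (X r \<omega> n)\<^sup>2 + 2 * (Y r \<omega> n)\<^sup>2)"
    proof (rule sum_mono)
      fix n
      have "0 \<le> (X r \<omega> n + Y r \<omega> n)\<^sup>2" by simp
      then show "R n r \<omega> \<le> 2 * (X r \<omega> n)\<^sup>2 + 2 * (Y r \<omega> n)\<^sup>2" unfolding R_def by (simp add: power2_eq_square algebra_simps)
    qed
    also have "\<dots> = 2 * (\<Sum>n\<in>A. (X r \<omega> n)\<^sup>2) + 2 * (\<Sum>n\<in>A. (Y r \<omega> n)\<^sup>2)" by (simp add: sum.distrib sum_distrib_left)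
    also have "\<dots> \<le> 2 * L\<^sup>2 + 2 * L\<^sup>2"
      using ell2_sum_le[OF x(1) that(1)] ell2_sum_le[OF y(1) that(1)]
        power_mono[OF x(2) ell2_norm_nonneg[OF x(1)], of 2] power_mono[OF y(2) ell2_norm_nonneg[OF y(1)], of 2] by linarith
    finally show ?thesis by simp
  qed
  have "summable a"
  proof (rule summableI_nonneg_bounded[OF a0])
    fix k
    have "(\<Sum>n<k. a n) = time_integral 0 T (\<lambda>r \<omega>. \<Sum>n<k. R n r \<omega>)"
      unfolding a_def by (rule time_integral_sum[symmetric]) (auto intro: bR)
    also have "\<dots> \<le> time_integral 0 T (\<lambda>_ _. 4 * L\<^sup>2)"
      by (intro time_integral_mono bounded_process_sum bounded_process_const bR Rsum) simp_all
    finally show "(\<Sum>n<k. a n) \<le> 4 * L\<^sup>2 * (T - 0)" by (simp add: time_integral_const[OF T])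
  qed
  then have alim: "a \<longlonglongrightarrow> 0" by (rule summable_LIMSEQ_zero)
  define b where "b m = (2 * \<nu> + \<kappa>) * (\<Sum>n=m+1..m+N. a n)" for m
  have b0: "0 \<le> b m" for m unfolding b_def using \<nu> \<kappa> a0 by (intro mult_nonneg_nonneg sum_nonneg) auto
  have blim: "b \<longlonglongrightarrow> 0"
  proof -
    have "(\<Sum>n=m+1..m+N. a n) = (\<Sum>j=1..N. a (j + m))" for m
      using sum.shift_bounds_cl_nat_ivl[of a 1 m N] by (simp add: add.commute)
    moreover have "(\<lambda>m. \<Sum>j=1..N. a (j + m)) \<longlonglongrightarrow> (\<Sum>j=1..N. 0)"
    proof (rule tendsto_sum)
      fix j
      show "(\<lambda>m. a (j + m)) \<longlonglongrightarrow> 0" using LIMSEQ_ignore_initial_segment[OF alim, of j] by (simp add: add.commute)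
    qed
    ultimately show ?thesis unfolding b_def[abs_def] using tendsto_mult_right_zero by fastforce
  qed
  let ?W = "\<lambda>m r \<omega>. \<Sum>n=1..m. 1 / lam ^ (2 * n) * R n r \<omega>"
  have bW: "bounded_process (?W m)" for m by (intro bounded_process_sum bounded_process_cmult bR)
  define f where "f m t = expectation (?W m t)" for m t
  have W0: "0 \<le> ?W m r \<omega>" for m r \<omega> using lam by (intro sum_nonneg mult_nonneg_nonneg R0) auto
  have fle: "f m t \<le> b m + c * (LBINT r:{0..t}. f m r)" if t: "t \<in> {0..T}" for m t
  proof -
    have t0: "0 \<le> t" using t by simp
    have "f m t = (\<Sum>n=1..m. 1 / lam ^ (2 * n) * expectation (R n t))"
      unfolding f_def using bounded_process_integrable[OF bR] by simp
    also have "\<dots> = (\<Sum>n=1..m. time_integral 0 t (\<lambda>r \<omega>. 1 / lam ^ (2 * n) * gain_diff lam \<kappa> \<nu> N n (X r \<omega>) (Y r \<omega>)))"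
    proof (rule sum.cong[OF refl])
      fix n assume "n \<in> {1..m}"
      then have n: "1 \<le> n" by simp
      show "1 / lam ^ (2 * n) * expectation (R n t) = time_integral 0 t (\<lambda>r \<omega>. 1 / lam ^ (2 * n) * gain_diff lam \<kappa> \<nu> N n (X r \<omega>) (Y r \<omega>))"
        unfolding time_integral_cmult[OF gain_diff_bounded_process[OF X Y]] difference_moment[OF X Y n t0, symmetric] R_def ..
    qed
    also have "\<dots> = time_integral 0 t (\<lambda>r \<omega>. \<Sum>n=1..m. 1 / lam ^ (2 * n) * gain_diff lam \<kappa> \<nu> N n (X r \<omega>) (Y r \<omega>))"
      by (rule time_integral_sum[symmetric]) (rule finite_atLeastAtMost, rule bounded_process_cmult[OF gain_diff_bounded_process[OF X Y]])
    also have "\<dots> \<le> time_integral 0 t (\<lambda>r \<omega>. c * ?W m r \<omega> + (2 * \<nu> + \<kappa>) * (\<Sum>n=m+1..m+N. R n r \<omega>))"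
    proof (rule time_integral_mono)
      fix r \<omega> assume \<omega>: "\<omega> \<in> space M"
      show "(\<Sum>n=1..m. 1 / lam ^ (2 * n) * gain_diff lam \<kappa> \<nu> N n (X r \<omega>) (Y r \<omega>)) \<le> c * ?W m r \<omega> + (2 * \<nu> + \<kappa>) * (\<Sum>n=m+1..m+N. R n r \<omega>)"
        using difference_inequality[OF regular_versionD(1,2)[OF X \<omega>, of r] regular_versionD(1,2)[OF Y \<omega>, of r] lam \<kappa> \<nu> N, of m]
        by (simp add: R_def c_def)
    qed (intro bounded_process_add bounded_process_cmult bounded_process_sum bR gain_diff_bounded_process[OF X Y])+
    also have "\<dots> = c * time_integral 0 t (?W m) + (2 * \<nu> + \<kappa>) * (\<Sum>n=m+1..m+N. time_integral 0 t (R n))"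
    proof -
      have s: "bounded_process (\<lambda>r \<omega>. \<Sum>n=m+1..m+N. R n r \<omega>)" by (intro bounded_process_sum bR)
      have "time_integral 0 t (\<lambda>r \<omega>. \<Sum>n=m+1..m+N. R n r \<omega>) = (\<Sum>n=m+1..m+N. time_integral 0 t (R n))"
        by (rule time_integral_sum) (auto intro: bR)
      then show ?thesis by (simp only: time_integral_add time_integral_cmult bounded_process_cmult bW s)
    qed
    also have "\<dots> \<le> c * time_integral 0 t (?W m) + b m"
      unfolding b_def a_def using t \<nu> \<kappa>
      by (intro add_left_mono mult_left_mono sum_mono time_integral_mono_interval bR R0) auto
    also have "time_integral 0 t (?W m) = (LBINT r:{0..t}. f m r)" unfolding f_def by (rule time_integral_fubini(1)[OF bW])
    finally show ?thesis by simp
  qed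
  have fb: "f m T \<le> 2 * b m * exp (2 * c * T)" for m
  proof -
    \<comment> \<open>This bound depends on \<open>m\<close>, which is harmless because it does not
      enter the conclusion of \<open>gronwall_bound\<close>.\<close>
    define B where "B = real m * (4 * L\<^sup>2)"
    have WB: "?W m t \<omega> \<le> B" if \<omega>: "\<omega> \<in> space M" for t \<omega>
    proof -
      have "?W m t \<omega> \<le> (\<Sum>n=1..m. 4 * L\<^sup>2)"
      proof (rule sum_mono)
        fix n assume "n \<in> {1..m}"
        have "1 / lam ^ (2 * n) \<le> 1" using one_le_power[of lam "2 * n"] lam by simp
        moreover have "R n t \<omega> \<le> 4 * L\<^sup>2" using Rsum[of "{n}", OF _ \<omega>] by simp
        ultimately have "1 / lam ^ (2 * n) * R n t \<omega> \<le> 1 * (4 * L\<^sup>2)" by (rule mult_mono) (simp_all add: R0)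
        then show "1 / lam ^ (2 * n) * R n t \<omega> \<le> 4 * L\<^sup>2" by simp
      qed
      then show ?thesis by (simp add: B_def)
    qed
    have fB: "f m t \<le> B" for t
    proof -
      have "f m t \<le> expectation (\<lambda>_. B)"
        unfolding f_def by (rule integral_mono[OF bounded_process_integrable[OF bW] _ WB]) simp_all
      then show ?thesis by (simp add: prob_space)
    qed
    have fi: "set_integrable lborel {0..T} (f m)" unfolding f_def by (rule time_integral_fubini(2)[OF bW])
    have f0: "0 \<le> f m t" for t unfolding f_def by (rule Bochner_Integration.integral_nonneg) (rule W0)
    have TT: "T \<in> {0..T}" using T by simp
    show ?thesis by (rule gronwall_bound[OF T fi f0 fB c b0 fle TT])
  qed
  have zero: "AE \<omega> in M. X T \<omega> n = Y T \<omega> n" if n: "1 \<le> n" for n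
  proof -
    have ub: "1 / lam ^ (2 * n) * expectation (R n T) \<le> 2 * b m * exp (2 * c * T)" if "m \<ge> n" for m
    proof -
      have "1 / lam ^ (2 * n) * expectation (R n T) = expectation (\<lambda>\<omega>. 1 / lam ^ (2 * n) * R n T \<omega>)" by simp
      also have "\<dots> \<le> f m T" unfolding f_def
      proof (rule integral_mono[OF bounded_process_integrable[OF bounded_process_cmult[OF bR]] bounded_process_integrable[OF bW]])
        fix \<omega>
        show "1 / lam ^ (2 * n) * R n T \<omega> \<le> ?W m T \<omega>"
          by (rule member_le_sum[of n "{1..m}" "\<lambda>n. 1 / lam ^ (2 * n) * R n T \<omega>"]) (use n that lam R0 in auto)
      qed
      finally show ?thesis using fb[of m] by linarith
    qed
    have lim: "(\<lambda>m. 2 * b m * exp (2 * c * T)) \<longlonglongrightarrow> 2 * 0 * exp (2 * c * T)"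
      by (intro tendsto_mult tendsto_const blim)
    have "1 / lam ^ (2 * n) * expectation (R n T) \<le> 2 * 0 * exp (2 * c * T)"
      by (rule LIMSEQ_le_const[OF lim]) (use ub in blast)
    moreover have "0 < 1 / lam ^ (2 * n)" using lam by simp
    ultimately have "expectation (R n T) \<le> 0" by (simp only: mult_zero_right mult_zero_left mult_le_0_iff) linarith
    moreover have "0 \<le> expectation (R n T)" by (rule Bochner_Integration.integral_nonneg) (rule R0)
    ultimately have "expectation (R n T) = 0" by simp
    then have "AE \<omega> in M. R n T \<omega> = 0"
      using integral_nonneg_eq_0_iff_AE[OF bounded_process_integrable[OF bR, of n T]] R0 by simp
    then show ?thesis by eventually_elim (simp add: R_def)
  qed
  have "AE \<omega> in M. \<forall>n. 1 \<le> n \<longrightarrow> X T \<omega> n = Y T \<omega> n"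
    unfolding AE_all_countable using zero by simp
  then show ?thesis using AE_space
  proof eventually_elim
    case (elim \<omega>)
    show ?case
    proof
      fix n
      show "X T \<omega> n = Y T \<omega> n"
        using elim(1) regular_versionD(1)[OF X elim(2), of T] regular_versionD(1)[OF Y elim(2), of T]
        by (cases "n = 0") (simp_all add: ell2_def)
    qed
  qed
qed

end

section \<open>The random constant\<close>

context driven_space begin

text \<open>The supremum over \<open>k\<close> is replaced by the sum \<open>D\<close> of 1 and the
  weighted squares, which is integrable, and \<open>C\<close> is its root of order \<open>q\<close>.
  Where \<open>y k \<le> 1\<close>, \<open>y k powr q\<close> is at most the square, so
  \<open>C\<close> dominates \<open>exp (chi * (k + 1)) * y k\<close>. Since
  \<open>D \<ge> 1\<close> and \<open>p \<le> q\<close>, \<open>C powr p\<close> is at most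
  \<open>D\<close>.\<close>

lemma geometric_supremum_moment:
  fixes y :: "nat \<Rightarrow> 'a \<Rightarrow> real"
  assumes y: "\<And>k. y k \<in> borel_measurable M" "\<And>k \<omega>. \<omega> \<in> space M \<Longrightarrow> 0 \<le> y k \<omega>" "\<And>k. integrable M (\<lambda>\<omega>. (y k \<omega>)\<^sup>2)"
    and q: "2 \<le> q" and chi: "0 < chi" and p: "1 \<le> p" "p \<le> q"
    and decay: "\<And>k. expectation (\<lambda>\<omega>. (y k \<omega>)\<^sup>2) \<le> 2 / (1 + 2 * exp (q * chi)) ^ k"
  shows "\<exists>C. C \<in> borel_measurable M \<and> (\<forall>\<omega>\<in>space M. C \<omega> > 0) \<and> integrable M (\<lambda>\<omega>. C \<omega> powr p) \<and>
    (AE \<omega> in M. \<forall>k. y k \<omega> \<le> 1 \<longrightarrow> y k \<omega> \<le> C \<omega> * exp (- chi * (real k + 1)))"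
proof -
  \<comment> \<open>The weight is taken at the right end \<open>k + 1\<close>, because the value at
    time \<open>k\<close> has to control the whole interval up to \<open>k + 1\<close>.\<close>
  define g where "g k \<omega> = exp (q * chi * (real k + 1)) * (y k \<omega>)\<^sup>2" for k \<omega>
  have gm: "g k \<in> borel_measurable M" for k
    unfolding g_def[abs_def] by (intro borel_measurable_times borel_measurable_const borel_measurable_power y(1))
  have g0: "0 \<le> g k \<omega>" for k \<omega> by (simp add: g_def)
  have gi: "integrable M (g k)" for k unfolding g_def[abs_def] by (intro integrable_mult_right y(3))
  have gE: "expectation (g k) \<le> 2 * exp (q * chi) * (1 / 2) ^ k" for k
  proof -
    have e: "exp (q * chi * (real k + 1)) = exp (q * chi) * exp (q * chi) ^ k"
      by (simp add: distrib_left exp_add exp_of_nat_mult[symmetric] mult_ac)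
    have "expectation (g k) = exp (q * chi * (real k + 1)) * expectation (\<lambda>\<omega>. (y k \<omega>)\<^sup>2)"
      unfolding g_def[abs_def] by (rule integral_mult_right_zero)
    also have "\<dots> \<le> exp (q * chi * (real k + 1)) * (2 / (1 + 2 * exp (q * chi)) ^ k)" by (intro mult_left_mono decay) simp
    also have "\<dots> = 2 * exp (q * chi) * (exp (q * chi) / (1 + 2 * exp (q * chi))) ^ k"
      unfolding e by (simp add: power_divide)
    also have "\<dots> \<le> 2 * exp (q * chi) * (1 / 2) ^ k"
    proof (intro mult_left_mono power_mono)
      have "0 < 1 + 2 * exp (q * chi)" by (simp add: add_pos_pos)
      then show "exp (q * chi) / (1 + 2 * exp (q * chi)) \<le> 1 / 2" "0 \<le> exp (q * chi) / (1 + 2 * exp (q * chi))"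
        by (simp_all add: divide_le_eq)
    qed simp
    finally show ?thesis .
  qed
  have sumE: "summable (\<lambda>k. expectation (g k))"
  proof (rule summable_comparison_test_ev)
    show "\<forall>\<^sub>F k in sequentially. norm (expectation (g k)) \<le> 2 * exp (q * chi) * (1 / 2) ^ k"
      using gE g0 by (simp add: Bochner_Integration.integral_nonneg)
    show "summable (\<lambda>k. 2 * exp (q * chi) * (1 / 2) ^ k)" by (intro summable_mult summable_geometric) simp
  qed
  have summ: "AE \<omega> in M. summable (\<lambda>k. g k \<omega>)"
  proof -
    have "(\<integral>\<^sup>+\<omega>. (\<Sum>k. ennreal (g k \<omega>)) \<partial>M) = (\<Sum>k. \<integral>\<^sup>+\<omega>. ennreal (g k \<omega>) \<partial>M)"
      by (rule nn_integral_suminf) (rule measurable_compose[OF gm measurable_ennreal])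
    also have "\<dots> = (\<Sum>k. ennreal (expectation (g k)))"
      by (rule arg_cong[where f=suminf], intro ext nn_integral_eq_integral gi) (simp add: g0)
    also have "\<dots> = ennreal (\<Sum>k. expectation (g k))"
      by (rule suminf_ennreal2[OF _ sumE]) (simp add: g0 Bochner_Integration.integral_nonneg)
    finally have fin: "(\<integral>\<^sup>+\<omega>. (\<Sum>k. ennreal (g k \<omega>)) \<partial>M) \<noteq> \<infinity>" by simp
    have "AE \<omega> in M. (\<Sum>k. ennreal (g k \<omega>)) \<noteq> \<infinity>"
      by (rule nn_integral_PInf_AE[OF _ fin]) (intro borel_measurable_suminf_order measurable_compose[OF gm measurable_ennreal])
    then show ?thesis by eventually_elim (rule summable_suminf_not_top, auto simp: g0)
  qed
  \<comment> \<open>The absolute value and the added 1 keep \<open>D \<ge> 1\<close> at every point,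
    also where the series diverges and its value is a default. Thus \<open>C\<close> is positive
    everywhere and powers of \<open>D\<close> increase with the exponent.\<close>
  define D where "D \<omega> = 1 + \<bar>\<Sum>k. g k \<omega>\<bar>" for \<omega>
  have "integrable M (\<lambda>\<omega>. \<Sum>k. g k \<omega>)"
  proof (rule integrable_suminf[OF gi])
    show "AE \<omega> in M. summable (\<lambda>k. norm (g k \<omega>))" using summ by (simp add: g0)
    show "summable (\<lambda>k. \<integral>\<omega>. norm (g k \<omega>) \<partial>M)" using sumE by (simp add: g0)
  qed
  then have Di: "integrable M D" unfolding D_def[abs_def] by simp
  have D1: "1 \<le> D \<omega>" for \<omega> by (simp add: D_def)
  have Dm: "D \<in> borel_measurable M" using Di by (rule borel_measurable_integrable)
  define C where "C \<omega> = D \<omega> powr (1 / q)" for \<omega>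
  have Cm: "C \<in> borel_measurable M" unfolding C_def[abs_def] by (rule powr_real_measurable[OF Dm borel_measurable_const])
  have Cp: "C \<omega> > 0" for \<omega> using D1[of \<omega>] by (simp add: C_def)
  have "integrable M (\<lambda>\<omega>. C \<omega> powr p)"
  proof (rule Bochner_Integration.integrable_bound[OF Di])
    show "(\<lambda>\<omega>. C \<omega> powr p) \<in> borel_measurable M" by (rule powr_real_measurable[OF Cm borel_measurable_const])
    have "C \<omega> powr p \<le> D \<omega>" for \<omega>
    proof -
      have "C \<omega> powr p = D \<omega> powr (1 / q * p)" by (simp add: C_def powr_powr)
      also have "\<dots> \<le> D \<omega> powr 1" by (rule powr_mono[OF _ D1]) (use p q in \<open>simp add: divide_le_eq\<close>)
      finally show ?thesis using D1[of \<omega>] by simp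
    qed
    then show "AE \<omega> in M. norm (C \<omega> powr p) \<le> norm (D \<omega>)"
      by (intro AE_I2) (simp add: order_trans[OF _ abs_ge_self])
  qed
  moreover have "AE \<omega> in M. \<forall>k. y k \<omega> \<le> 1 \<longrightarrow> y k \<omega> \<le> C \<omega> * exp (- chi * (real k + 1))"
    using summ AE_space
  proof eventually_elim
    case (elim \<omega>)
    show ?case
    proof (intro allI impI)
      fix k assume y1: "y k \<omega> \<le> 1"
      show "y k \<omega> \<le> C \<omega> * exp (- chi * (real k + 1))"
      proof (cases "y k \<omega> = 0")
        case True
        then show ?thesis using less_imp_le[OF Cp[of \<omega>]] by simp
      next
        case False
        then have yp: "0 < y k \<omega>" using y(2)[OF elim(2), of k] by simp
        have "(y k \<omega>) powr q \<le> (y k \<omega>) powr 2" by (rule powr_mono'[OF q]) (use yp y1 in auto)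
        then have "(y k \<omega>) powr q \<le> (y k \<omega>)\<^sup>2" using yp by simp
        then have "exp (q * chi * (real k + 1)) * (y k \<omega>) powr q \<le> g k \<omega>" unfolding g_def by (intro mult_left_mono) auto
        also have "g k \<omega> \<le> (\<Sum>k. g k \<omega>)" using sum_le_suminf[OF elim(1), of "{k}"] g0 by simp
        also have "\<dots> \<le> D \<omega>" by (simp add: D_def)
        finally have le: "exp (q * chi * (real k + 1)) * (y k \<omega>) powr q \<le> D \<omega>" .
        have eq: "exp (q * chi * (real k + 1)) * (y k \<omega>) powr q = (exp (chi * (real k + 1)) * y k \<omega>) powr q"
          using yp by (simp add: powr_mult exp_powr_real mult_ac)
        have "exp (chi * (real k + 1)) * y k \<omega> = ((exp (chi * (real k + 1)) * y k \<omega>) powr q) powr (1 / q)"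
          using yp q by (simp add: powr_powr)
        also have "\<dots> \<le> C \<omega>" unfolding C_def using le unfolding eq by (intro powr_mono2) (use q in auto)
        finally have "exp (- chi * (real k + 1)) * (exp (chi * (real k + 1)) * y k \<omega>) \<le> exp (- chi * (real k + 1)) * C \<omega>"
          by (intro mult_left_mono) auto
        moreover have "exp (- chi * (real k + 1)) * exp (chi * (real k + 1)) = 1" by (simp add: exp_add[symmetric])
        ultimately show ?thesis by (simp only: mult.assoc[symmetric] mult_1_left mult.commute[of "C \<omega>"])
      qed
    qed
  qed
  ultimately show ?thesis using Cm Cp by (intro exI[of _ C]) blast
qed

lemma solution_norm_decreasing:
  assumes sol: "leray_hopf_solution lam \<kappa> \<nu> \<theta> M F W x0 X" and \<kappa>: "\<kappa> > 0"
  shows "AE \<omega> in M. X 0 \<omega> = x0 \<and> (\<forall>s t. 0 \<le> s \<and> s \<le> t \<longrightarrow> ell2_norm (X t \<omega>) \<le> ell2_norm (X s \<omega>))"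
proof -
  have Xl: "X t \<omega> \<in> ell2" if "0 \<le> t" "\<omega> \<in> space M" for t \<omega> using sol that unfolding leray_hopf_solution_def by blast
  have "AE \<omega> in M. X 0 \<omega> = x0" "AE \<omega> in M. \<forall>s t. 0 \<le> s \<and> s < t \<longrightarrow>
        (ell2_norm (X t \<omega>))\<^sup>2 + 2 * \<kappa> * (LBINT r:{s..t}. (h1_norm lam (X r \<omega>))\<^sup>2) = (ell2_norm (X s \<omega>))\<^sup>2"
    using sol unfolding leray_hopf_solution_def by blast+
  then show ?thesis using AE_space
  proof eventually_elim
    case (elim \<omega>)
    have "ell2_norm (X t \<omega>) \<le> ell2_norm (X s \<omega>)" if "0 \<le> s" "s \<le> t" for s t
      by (rule energy_decreasing(2)[OF Xl[OF _ elim(3)] \<kappa> elim(2) that])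
    then show ?case using elim(1) by blast
  qed
qed

text \<open>Uniqueness is invoked at integer times, which yields a single null set; the times in
  between follow from the decrease of the norm.\<close>

lemma decay_constant_exists:
  assumes x0: "x0 \<in> ell2" "ell2_norm x0 \<le> L" and lam: "lam > 1" and \<kappa>: "\<kappa> > 0" and \<nu>: "\<nu> > 0" and L: "L > 0"
    and N: "1 \<le> N" "2 * \<nu> / (lam\<^sup>2 - 1) \<le> \<kappa> * real N"
    and q: "2 \<le> q" and chi: "0 < chi" and p: "1 \<le> p" "p \<le> q"
    and c1: "2 * exp (q * chi) + 1 \<le> 2 * \<kappa> * lam ^ (2 * (m + 1))"
    and c2: "4 * lam ^ m * L + 1 + 2 * (2 * exp (q * chi)) \<le> 2 * \<nu> * lam\<^sup>2"
    and c3: "4 * \<nu> * real m * lam ^ (2 * m) \<le> real N"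
  shows "\<exists>C. C \<in> borel_measurable M \<and> (\<forall>\<omega>\<in>space M. C \<omega> > 0) \<and> integrable M (\<lambda>\<omega>. C \<omega> powr p) \<and>
     (\<forall>X. leray_hopf_solution lam \<kappa> \<nu> (theta N) M F W x0 X \<longrightarrow>
        (AE \<omega> in M. \<forall>t\<ge>0. ell2_norm (X t \<omega>) \<le> C \<omega> * exp (- chi * t) * ell2_norm x0))"
proof (cases "(\<exists>X. leray_hopf_solution lam \<kappa> \<nu> (theta N) M F W x0 X) \<and> ell2_norm x0 \<noteq> 0")
  \<comment> \<open>If there is no solution the claim is empty; if \<open>x0\<close> has norm 0,
    every solution keeps norm 0. The constant 1 works in both cases.\<close>
  case False
  have "AE \<omega> in M. \<forall>t\<ge>0. ell2_norm (X t \<omega>) \<le> 1 * exp (- chi * t) * ell2_norm x0"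
    if sol: "leray_hopf_solution lam \<kappa> \<nu> (theta N) M F W x0 X" for X
    using solution_norm_decreasing[OF sol \<kappa>]
  proof eventually_elim
    case (elim \<omega>)
    have z: "ell2_norm x0 = 0" using False sol by blast
    have "ell2_norm (X t \<omega>) \<le> ell2_norm x0" if "0 \<le> t" for t
      using elim[THEN conjunct2, rule_format, of 0 t] elim[THEN conjunct1] that by simp
    then show ?case using z by simp
  qed
  then show ?thesis by (intro exI[of _ "\<lambda>_. 1"]) auto
next
  case True
  then obtain X0 where X0: "leray_hopf_solution lam \<kappa> \<nu> (theta N) M F W x0 X0" by blast
  define l where "l = ell2_norm x0"
  have l: "0 < l" using True ell2_norm_nonneg[OF x0(1)] unfolding l_def by simp
  have L0: "0 \<le> L" using L by simp
  obtain Z where Z: "regular_version lam \<kappa> \<nu> N L x0 Z"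
    using regular_version_exists[OF X0 x0(2) L0 lam \<kappa> \<nu>] by blast
  \<comment> \<open>Division by the initial norm makes the values at most 1 almost surely and yields
    a constant that multiplies \<open>ell2_norm x0\<close>.\<close>
  define y where "y k \<omega> = ell2_norm (Z (real k) \<omega>) / l" for k :: nat and \<omega>
  have Zsq: "(y k \<omega>)\<^sup>2 = (ell2_norm (Z (real k) \<omega>))\<^sup>2 / l\<^sup>2" for k \<omega> by (simp add: y_def power_divide)
  have y0: "0 \<le> y k \<omega>" if "\<omega> \<in> space M" for k \<omega>
    unfolding y_def using ell2_norm_nonneg[OF regular_versionD(1)[OF Z that]] l by simp
  have U: "integrable M (\<lambda>\<omega>. (ell2_norm (Z (real k) \<omega>))\<^sup>2)" for k
    by (rule bounded_process_integrable[OF regular_versionD(4)[OF Z]])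
  have ym: "y k \<in> borel_measurable M" for k
  proof (rule measurable_cong[THEN iffD2])
    show "y k \<omega> = sqrt ((ell2_norm (Z (real k) \<omega>))\<^sup>2) / l" if "\<omega> \<in> space M" for \<omega>
      unfolding y_def using ell2_norm_nonneg[OF regular_versionD(1)[OF Z that]] by simp
    show "(\<lambda>\<omega>. sqrt ((ell2_norm (Z (real k) \<omega>))\<^sup>2) / l) \<in> borel_measurable M"
      by (rule borel_measurable_divide[OF measurable_compose[OF borel_measurable_integrable[OF U] borel_measurable_sqrt] borel_measurable_const])
  qed
  have yi: "integrable M (\<lambda>\<omega>. (y k \<omega>)\<^sup>2)" for k unfolding Zsq by (intro integrable_divide_zero U)
  have dec: "expectation (\<lambda>\<omega>. (y k \<omega>)\<^sup>2) \<le> 2 / (1 + 2 * exp (q * chi)) ^ k" for k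
  proof -
    have "expectation (\<lambda>\<omega>. (ell2_norm (Z (real k) \<omega>))\<^sup>2) \<le> 2 * l\<^sup>2 / (1 + 2 * exp (q * chi)) ^ k"
      unfolding l_def by (rule moment_decay[OF Z x0(1) lam \<kappa> \<nu> N(1) _ c1 c2 c3]) simp
    then have "expectation (\<lambda>\<omega>. (ell2_norm (Z (real k) \<omega>))\<^sup>2) / l\<^sup>2 \<le> 2 * l\<^sup>2 / (1 + 2 * exp (q * chi)) ^ k / l\<^sup>2"
      by (rule divide_right_mono) simp
    then show ?thesis unfolding Zsq using l by simp
  qed
  obtain C where C: "C \<in> borel_measurable M" "\<forall>\<omega>\<in>space M. C \<omega> > 0" "integrable M (\<lambda>\<omega>. C \<omega> powr p)"
    and Cy: "AE \<omega> in M. \<forall>k. y k \<omega> \<le> 1 \<longrightarrow> y k \<omega> \<le> C \<omega> * exp (- chi * (real k + 1))"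
    using geometric_supremum_moment[OF ym y0 yi q chi p dec] by blast
  have "AE \<omega> in M. \<forall>t\<ge>0. ell2_norm (X t \<omega>) \<le> C \<omega> * exp (- chi * t) * ell2_norm x0"
    if sol: "leray_hopf_solution lam \<kappa> \<nu> (theta N) M F W x0 X" for X
  proof -
    obtain Y where Y: "regular_version lam \<kappa> \<nu> N L x0 Y" and XY: "AE \<omega> in M. \<forall>t\<ge>0. Y t \<omega> = X t \<omega>"
      using regular_version_exists[OF sol x0(2) L0 lam \<kappa> \<nu>] by blast
    have "AE \<omega> in M. \<forall>k::nat. Y (real k) \<omega> = Z (real k) \<omega>"
      unfolding AE_all_countable using regular_version_unique[OF Y Z lam \<kappa> \<nu> L N] by simp
    then show ?thesis
      using XY Cy solution_norm_decreasing[OF sol \<kappa>] AE_space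
    proof eventually_elim
      case (elim \<omega>)
      show ?case
      proof (intro allI impI)
        fix t :: real assume t: "0 \<le> t"
        define k where "k = nat \<lfloor>t\<rfloor>"
        have k: "real k \<le> t" "t \<le> real k + 1" using t unfolding k_def by linarith+
        have XZ: "X (real k) \<omega> = Z (real k) \<omega>" using elim(1)[rule_format, of k] elim(2)[rule_format, of "real k"] by simp
        have "ell2_norm (X (real k) \<omega>) \<le> l"
          using elim(4)[THEN conjunct2, rule_format, of 0 "real k"] elim(4)[THEN conjunct1] by (simp add: l_def)
        then have "y k \<omega> \<le> 1" unfolding y_def XZ using l by simp
        then have yC: "y k \<omega> \<le> C \<omega> * exp (- chi * (real k + 1))" using elim(3) by blast
        have Cp: "0 < C \<omega>" using C(2) elim(5) by blast
        have "ell2_norm (X t \<omega>) \<le> ell2_norm (X (real k) \<omega>)"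
          using elim(4)[THEN conjunct2, rule_format, of "real k" t] k by simp
        also have "\<dots> = y k \<omega> * l" unfolding y_def XZ using l by simp
        also have "\<dots> \<le> C \<omega> * exp (- chi * (real k + 1)) * l" using yC l by (intro mult_right_mono) auto
        also have "\<dots> \<le> C \<omega> * exp (- chi * t) * l"
          using k(2) chi Cp l by (intro mult_right_mono mult_left_mono) auto
        finally show "ell2_norm (X t \<omega>) \<le> C \<omega> * exp (- chi * t) * ell2_norm x0" unfolding l_def .
      qed
    qed
  qed
  then show ?thesis using C by (intro exI[of _ C] conjI allI impI)
qed

end

theorem theorem1p7:
  fixes lam \<kappa> p chi L :: real
    and M :: "'a measure" and F :: "real \<Rightarrow> 'a measure"
    and W :: "nat \<Rightarrow> nat \<Rightarrow> real \<Rightarrow> 'a \<Rightarrow> real"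
  assumes "lam > 1" and "\<kappa> > 0"
    and "filtered_prob_space M F"
    and "independent_brownian_motions M F W"
    and "p \<ge> 1" and "chi > 0" and "L > 0"
  shows "\<exists>\<nu> \<theta>. \<nu> > 0 \<and> \<theta> \<in> ell2 \<and> ell2_norm \<theta> = 1 \<and>
    (\<forall>x0 \<in> ell2. ell2_norm x0 \<le> L \<longrightarrow>
      (\<exists>C :: 'a \<Rightarrow> real. C \<in> borel_measurable M \<and> (\<forall>\<omega>\<in>space M. C \<omega> > 0) \<and>
         integrable M (\<lambda>\<omega>. C \<omega> powr p) \<and>
         (\<forall>X. leray_hopf_solution lam \<kappa> \<nu> \<theta> M F W x0 X \<longrightarrow>
           (AE \<omega> in M. \<forall>t\<ge>0.
              ell2_norm (X t \<omega>) \<le> C \<omega> * exp (- chi * t) * ell2_norm x0))))"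
proof -
  interpret driven_space M F W
    by (intro driven_space.intro assms driven_space_axioms.intro)
  \<comment> \<open>The root of order \<open>q\<close> needs \<open>q \<ge> 2\<close> for comparing
    powers with squares and \<open>q \<ge> p\<close> for the moment of order
    \<open>p\<close>.\<close>
  define q where "q = max p 2"
  define K where "K = 2 * exp (q * chi)"
  have K: "0 < K" by (simp add: K_def)
  \<comment> \<open>None of the choices from here on involves \<open>x0\<close>; the initial value
    is felt only through its bound \<open>L\<close>.\<close>
  obtain m where m: "(K + 1) / (2 * \<kappa>) < lam ^ m" using real_arch_pow[OF assms(1)] by blast
  have c1: "K + 1 \<le> 2 * \<kappa> * lam ^ (2 * (m + 1))"
  proof -
    have "lam ^ m \<le> lam ^ (2 * (m + 1))" using assms(1) by (intro power_increasing) auto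
    then have "(K + 1) / (2 * \<kappa>) \<le> lam ^ (2 * (m + 1))" using m by linarith
    then show ?thesis using assms(2) by (simp add: divide_le_eq mult.commute)
  qed
  \<comment> \<open>The value for which \<open>c2\<close> holds with equality.\<close>
  define \<nu> where "\<nu> = (4 * lam ^ m * L + 1 + 2 * K) / (2 * lam\<^sup>2)"
  have lam2: "0 < lam\<^sup>2" using assms(1) by simp
  have num: "0 < 4 * lam ^ m * L + 1 + 2 * K" using assms(1,7) K by (intro add_pos_pos) auto
  have \<nu>: "0 < \<nu>" unfolding \<nu>_def using num lam2 by simp
  have c2: "4 * lam ^ m * L + 1 + 2 * K \<le> 2 * \<nu> * lam\<^sup>2" unfolding \<nu>_def using lam2 by simp
  \<comment> \<open>The 1 makes \<open>theta N\<close> a unit vector, the next bound weakens the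
    return of energy, and the last one is the condition of the uniqueness estimate.\<close>
  obtain N where N: "max 1 (max (4 * \<nu> * real m * lam ^ (2 * m)) (2 * \<nu> / (lam\<^sup>2 - 1) / \<kappa>)) \<le> real N" using real_arch_simple by blast
  have N1: "1 \<le> N" using N by simp
  have c3: "4 * \<nu> * real m * lam ^ (2 * m) \<le> real N" using N by simp
  have N2: "2 * \<nu> / (lam\<^sup>2 - 1) \<le> \<kappa> * real N"
  proof -
    have "2 * \<nu> / (lam\<^sup>2 - 1) / \<kappa> \<le> real N" using N by simp
    then show ?thesis using assms(2) by (simp only: pos_divide_le_eq mult.commute)
  qed
  have q: "2 \<le> q" "p \<le> q" by (simp_all add: q_def)
  show ?thesis
    using \<nu> theta_ell2[OF N1] decay_constant_exists[OF _ _ assms(1,2) \<nu> assms(7) N1 N2 q(1) assms(6,5) q(2) c1[unfolded K_def] c2[unfolded K_def] c3]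
    by (intro exI[of _ \<nu>] exI[of _ "theta N"] conjI ballI impI)
qed

end
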